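(* Consider the setting described in the context: i.i.d. observations $X_1,X_2,\dots$ from a family of densities $(p_\theta)_{\theta\in\Theta}$, $\Theta\subseteq\mathbb{R}$, with true parameter value $\theta_0$, a real $\delta>0$ with $[\theta_0-\delta,\theta_0+\delta]\subseteq\Theta^\circ$, $\ell_x(\theta)=\ln p_\theta(x)$, and a maximum likelihood estimator $\hat\theta=\hat\theta_n$ for each $n\in\mathbb{N}$. Suppose that the following conditions hold. (I) The set $\mathcal{X}_{>0}:=\{x\in\mathcal{X}: p_\theta(x)>0\}$ is the same for all $\theta\in[\theta_0-\delta,\theta_0+\delta]$, and for each $x\in\mathcal{X}_{>0}$ the density $p_\theta(x)$ (and hence $\ell_x(\theta)$) is three times differentiable in $\theta$ at each point $\theta\in[\theta_0-\delta,\theta_0+\delta]$. (II) $\mathsf{E}\,\ell'_X(\theta_0)=0$ and $\mathsf{E}\,\ell'_X(\theta_0)^2=-\mathsf{E}\,\ell''_X(\theta_0)=I(\theta_0)\in(0,\infty)$. (III) $\mathsf{E}|\ell'_X(\theta_0)|^3+\mathsf{E}|\ell''_X(\theta_0)|^3<\infty$. (IV) $\mathsf{E}\sup_{\theta\in[\theta_0-\delta,\theta_0+\delta]}|\ell'''_X(\theta)|^3<\infty$. Suppose also that at least one of the following two alternatives holds: (i) the log-likelihood $\ell_x(\theta)$ is concave in $\theta\in\Theta$, for each $x\in\mathcal{X}$; or (ii) the following three conditions (B), (D$_0$), (D$_1$) all hold: (B) $\Theta$ is a (possibly infinite) interval, the Fisher information $I(\theta)$ is well defined for all $\theta\in\Theta$,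 and there are positive real constants $c_1,c_2,\alpha$ such that $I(\theta)\le c_1+c_2|\theta-\theta_0|^\alpha$ for all $\theta\in\Theta$; (D$_0$) for each bounded neighborhood $U$ of $\theta_0$ there is a real $c>0$ such that $H(\theta,\theta_0)\ge c\,(\theta-\theta_0)^2$ for all $\theta\in U\cap\Theta$; (D$_1$) there are a real $\gamma>0$, a bounded neighborhood $V$ of $\theta_0$, and a real $C>0$ such that $\int_{\mathcal{X}}\sqrt{p_\theta}\sqrt{p_{\theta_0}}\,d\mu\le C|\theta-\theta_0|^{-\gamma}$ for all $\theta\in\Theta\setminus V$. Then there is a finite positive constant $\mathfrak{C}$, not depending on $n$ or $z$, such that for all $n\in\mathbb{N}$ and all real $z$ $$\Big|\mathsf{P}\Big(\sqrt{nI(\theta_0)}\,(\hat\theta_n-\theta_0)\le z\Big)-\Phi(z)\Big|\le\frac{\mathfrak{C}}{\sqrt n}.$$ Moreover, for every $\omega\in(0,\infty)$ there is a finite positive constant $\mathfrak{C}_\omega$, not depending on $n$ or $z$, such that for all $n\in\mathbb{N}$ and all $z\in(0,\omega\sqrt n\,]$ $$\Big|\mathsf{P}\Big(\sqrt{nI(\theta_0)}\,(\hat\theta_n-\theta_0)\le z\Big)-\Phi(z)\Big|\le\frac{\mathfrak{C}_\omega}{z^3\sqrt n}.$$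
   Context: Setting. $X,X_1,X_2,\dots$ are measurable maps from a measurable space $(\Omega,\mathcal{A})$ to a measurable space $(\mathcal{X},\mathcal{B})$, and $(\mathsf{P}_\theta)_{\theta\in\Theta}$ is a family of probability measures on $(\Omega,\mathcal{A})$, with $\Theta\subseteq\mathbb{R}$, such that $X,X_1,X_2,\dots$ are i.i.d. under each $\mathsf{P}_\theta$. $\mathsf{E}_\theta$ is the expectation with respect to $\mathsf{P}_\theta$. For each $\theta\in\Theta$ the distribution of $X$ under $\mathsf{P}_\theta$ has a density $p_\theta$ with respect to a measure $\mu$ on $\mathcal{B}$. $\Theta^\circ$ is the interior of $\Theta$ in $\mathbb{R}$; $\theta_0\in\Theta$ is the true value of the parameter, and $\delta>0$ is a real number with $[\theta_0-\delta,\theta_0+\delta]\subseteq\Theta^\circ$. Write $\mathsf{P}:=\mathsf{P}_{\theta_0}$, $\mathsf{E}:=\mathsf{E}_{\theta_0}$. Log-likelihood: $\ell_x(\theta):=\ln p_\theta(x)$ (with $\ln 0=-\infty$); derivatives $\ell'_x,\ell''_x,\ell'''_x$ are in $\theta$. Expectations $\mathsf{E}$ of expressions in these derivatives are understood as integrals over $\mathcal{X}_{>0}$ against $p_{\theta_0}\,d\mu$. Maximum likelihood estimator (MLE): for $n\in\mathbb{N}$ and $\mathbf{x}=(x_1,\dots,x_n)\in\mathcal{X}^n$ let $L_{\mathbf{x}}(\theta):=\prod_{i=1}^n p_\theta(x_i)$. A generalized maximizer is a point $\hat\theta_n(\mathbf{x})$ of the closure of $\Theta$ in $[-\infty,\infty]$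 such that $\sup_{\theta\in\Theta}L_{\mathbf{x}}(\theta)=\limsup_{\theta\to\hat\theta_n(\mathbf{x})}L_{\mathbf{x}}(\theta)$ (limsup over $\theta\in\Theta$, the value $\theta=\hat\theta_n(\mathbf{x})$ being allowed if it lies in $\Theta$); at least one exists by compactness of $[-\infty,\infty]$. An MLE $\hat\theta=\hat\theta_n$ is any map $\omega\mapsto\hat\theta_n(X_1(\omega),\dots,X_n(\omega))$ obtained by choosing, for each $\mathbf{x}$, any one generalized maximizer. It need not be measurable; probabilities of events defined through $\hat\theta$ are to be understood as either one of the corresponding outer or inner measures (the result holds for either reading). Fisher information: $I(\theta):=\mathsf{E}_\theta\big[\ell'_X(\theta)^2\big]$. That it is well defined for all $\theta\in\Theta$ means that $p_\theta(x)$ is differentiable in $\theta$ throughout $\Theta$ for each $x$ (one-sided derivatives being used at endpoints of $\Theta$ belonging to $\Theta$), so that this expression makes sense. Squared Hellinger distance: $H(\theta,\theta_0):=\int_{\mathcal{X}}(\sqrt{p_\theta}-\sqrt{p_{\theta_0}})^2\,d\mu$, so $\int_{\mathcal X}\sqrt{p_\theta}\sqrt{p_{\theta_0}}\,d\mu=1-\tfrac12H(\theta,\theta_0)$. $\Phi$ is the standard normal distribution function. The constants $\mathfrak{C},\mathfrak{C}_\omega$ may depend on everything else in the setting (the family $(\mathsf{P}_\theta)$, $\theta_0$, $\delta$, the constants in the conditions, and, for $\mathfrak{C}_\omega$, on $\omega$). *)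

theory Defs
  imports "HOL-Probability.Probability"
begin

text \<open>
  A parametric family of densities is a function \<open>p :: real \<Rightarrow> 'x \<Rightarrow> real\<close>, where \<open>p \<theta> x\<close> is
  meaningful only for \<open>\<theta> \<in> \<Theta>\<close> and \<open>x \<in> space \<mu>\<close>. Derivatives in \<open>\<theta>\<close> are therefore taken
  relative to \<open>\<Theta>\<close>: they are the ordinary two-sided derivatives at interior points of \<open>\<Theta>\<close>, and
  one-sided ones at endpoints belonging to an interval \<open>\<Theta>\<close>.
\<close>

definition deriv_within :: "real set \<Rightarrow> (real \<Rightarrow> real) \<Rightarrow> real \<Rightarrow> real"
  where "deriv_within S f x = vector_derivative f (at x within S)"

text \<open>
  As usual, being \<open>k + 1\<close> times differentiable at a point requires the derivatives of order at
  most \<open>k\<close> to exist in a neighbourhood of that point, and the \<open>k\<close>-th derivative to be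
  differentiable at the point itself.
\<close>

fun times_differentiable_within :: "real set \<Rightarrow> nat \<Rightarrow> (real \<Rightarrow> real) \<Rightarrow> real \<Rightarrow> bool"
  where
    "times_differentiable_within S 0 f x \<longleftrightarrow> True"
  | "times_differentiable_within S (Suc 0) f x \<longleftrightarrow> f differentiable (at x within S)"
  | "times_differentiable_within S (Suc (Suc k)) f x \<longleftrightarrow>
       (\<forall>\<^sub>F y in nhds x. y \<in> S \<longrightarrow> f differentiable (at y within S)) \<and>
       times_differentiable_within S (Suc k) (deriv_within S f) x"

definition loglik :: "(real \<Rightarrow> 'x \<Rightarrow> real) \<Rightarrow> 'x \<Rightarrow> real \<Rightarrow> ereal"
  where "loglik p x \<theta> = (if p \<theta> x = 0 then - \<infinity> else ereal (ln (p \<theta> x)))"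

text \<open>
  The \<open>k\<close>-th derivative of the log-likelihood. It is only used at points \<open>\<theta>\<close> where
  \<open>p \<theta> x > 0\<close> and \<open>p\<close> is differentiable, hence positive, so that the log-likelihood is finite,
  near \<open>\<theta>\<close>.
\<close>

definition loglik_deriv ::
    "nat \<Rightarrow> real set \<Rightarrow> (real \<Rightarrow> 'x \<Rightarrow> real) \<Rightarrow> 'x \<Rightarrow> real \<Rightarrow> real"
  where "loglik_deriv k \<Theta> p x = (deriv_within \<Theta> ^^ k) (\<lambda>\<theta>. real_of_ereal (loglik p x \<theta>))"

text \<open>
  Concavity of an extended-real function with values in \<open>[-\<infinity>, \<infinity>)\<close>. The domain is not required
  to be convex; the inequality is demanded whenever the three points involved lie in the domain.
  In \<^typ>\<open>ereal\<close>, \<open>0 * (-\<infinity>) = 0\<close>, so the inequality is trivial for \<open>t \<in> {0, 1}\<close>.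
\<close>

definition ereal_concave_on :: "real set \<Rightarrow> (real \<Rightarrow> ereal) \<Rightarrow> bool"
  where "ereal_concave_on S f \<longleftrightarrow>
    (\<forall>a\<in>S. \<forall>b\<in>S. \<forall>t\<in>{0..1}. (1 - t) * a + t * b \<in> S \<longrightarrow>
       ereal (1 - t) * f a + ereal t * f b \<le> f ((1 - t) * a + t * b))"

definition positivity_set :: "'x measure \<Rightarrow> (real \<Rightarrow> 'x \<Rightarrow> real) \<Rightarrow> real \<Rightarrow> 'x set"
  where "positivity_set \<mu> p \<theta> = {x \<in> space \<mu>. p \<theta> x > 0}"

text \<open>
  The measure \<open>p \<theta> d\<mu>\<close> on the set where \<open>p \<theta>\<close> is positive, that is, the distribution of an
  observation under the parameter \<open>\<theta>\<close> up to a null set. Expectations of expressions in the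
  derivatives of the log-likelihood are integrals with respect to this measure.
\<close>

definition obs_law :: "'x measure \<Rightarrow> (real \<Rightarrow> 'x \<Rightarrow> real) \<Rightarrow> real \<Rightarrow> 'x measure"
  where "obs_law \<mu> p \<theta> =
    restrict_space (density \<mu> (\<lambda>x. ennreal (p \<theta> x))) (positivity_set \<mu> p \<theta>)"

definition fisher_info ::
    "'x measure \<Rightarrow> real set \<Rightarrow> (real \<Rightarrow> 'x \<Rightarrow> real) \<Rightarrow> real \<Rightarrow> ennreal"
  where "fisher_info \<mu> \<Theta> p \<theta> =
    (\<integral>\<^sup>+x. ennreal ((loglik_deriv 1 \<Theta> p x \<theta>)\<^sup>2) \<partial>obs_law \<mu> p \<theta>)"

definition fisher_info_well_defined ::
    "'x measure \<Rightarrow> real set \<Rightarrow> (real \<Rightarrow> 'x \<Rightarrow> real) \<Rightarrow> bool"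
  where "fisher_info_well_defined \<mu> \<Theta> p \<longleftrightarrow>
    (\<forall>x\<in>space \<mu>. \<forall>\<theta>\<in>\<Theta>. (\<lambda>t. p t x) differentiable (at \<theta> within \<Theta>))"

definition hellinger_sq :: "'x measure \<Rightarrow> (real \<Rightarrow> 'x \<Rightarrow> real) \<Rightarrow> real \<Rightarrow> real \<Rightarrow> real"
  where "hellinger_sq \<mu> p \<theta> \<theta>' = (\<integral>x. (sqrt (p \<theta> x) - sqrt (p \<theta>' x))\<^sup>2 \<partial>\<mu>)"

text \<open>
  The observations \<open>x\<^sub>1, \<dots>, x\<^sub>n\<close> form a function on \<open>{1..n}\<close>. The filter below consists of the
  traces on \<open>\<Theta>\<close> of the neighbourhoods of \<open>t\<close> in the extended reals; the point \<open>t\<close> itself is not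
  removed if it lies in \<open>\<Theta>\<close>.
\<close>

definition likelihood :: "(real \<Rightarrow> 'x \<Rightarrow> real) \<Rightarrow> nat \<Rightarrow> (nat \<Rightarrow> 'x) \<Rightarrow> real \<Rightarrow> real"
  where "likelihood p n x \<theta> = (\<Prod>i\<in>{1..n}. p \<theta> (x i))"

definition generalized_maximizer :: "real set \<Rightarrow> (real \<Rightarrow> real) \<Rightarrow> ereal \<Rightarrow> bool"
  where "generalized_maximizer \<Theta> L t \<longleftrightarrow>
    t \<in> closure (ereal ` \<Theta>) \<and>
    (SUP \<theta>\<in>\<Theta>. ereal (L \<theta>)) =
      Limsup (inf (filtercomap ereal (nhds t)) (principal \<Theta>)) (\<lambda>\<theta>. ereal (L \<theta>))"

definition is_MLE ::
    "'x measure \<Rightarrow> real set \<Rightarrow> (real \<Rightarrow> 'x \<Rightarrow> real) \<Rightarrow> nat \<Rightarrow> ((nat \<Rightarrow> 'x) \<Rightarrow> ereal) \<Rightarrow> bool"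
  where "is_MLE \<mu> \<Theta> p n T \<longleftrightarrow>
    (\<forall>x \<in> {1..n} \<rightarrow>\<^sub>E space \<mu>. generalized_maximizer \<Theta> (likelihood p n x) (T x))"

definition inner_measure_of :: "'w measure \<Rightarrow> 'w set \<Rightarrow> ennreal"
  where "inner_measure_of M A = (SUP B\<in>{B \<in> sets M. B \<subseteq> A}. emeasure M B)"

end

theory Submission
  imports Defs
begin

text \<open>
  Near \<theta>0 the score has derivative close to -n I outside an event of probability
  O(1/n^2), so there the event that the estimator is at most \<theta>0 + t is, as long as the
  estimator is near \<theta>0, the event that the score at \<theta>0 + t is at most 0.
  The latter is an event about a sum of i.i.d. variables with finite third moments, to which a
  nonuniform Berry--Esseen bound of order 1/((1 + |z|)^3 sqrt n) applies; no linearisation of the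
  estimator is needed. That bound comes from Bergstroem's convolution argument: telescope
  the smoothed difference of the n-fold convolutions, estimate it in the sup norm with weight
  (1 + |x| / sqrt n)^3, and desmooth.

  It remains to see that the estimator is near \<theta>0 outside an event of probability O(1/n^2).
  Under concavity this is immediate from the sign of the score at \<theta>0 - t and \<theta>0 + t. In the other
  case, cover the far part of \<Theta> by cells. On a cell, the supremum G of the square root of
  the likelihood ratio has mean at most the affinity at an endpoint plus the length of the cell
  times half the root of the Fisher information. If that mean is \<beta> < 1, then by Markov's
  inequality the likelihood ratio on the cell exceeds 1/4 with probability at most 2 \<beta>^n.
\<close>

section \<open>Smoothing a standardised law by a normal law\<close>

text \<open>The bound aimed at is C / (sqrt n (1 + |z|)^3) + C / n^2. The second term is admissible
  because z \<le> \<omega> sqrt n makes z^3 sqrt n at most \<omega>^3 n^2. Third moments give just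
  this order: at distance of order sqrt n, the nonuniform bound and the normal tail are both
  O(1/n^2). After smoothing with N(0, \<sigma>^2), replacing one summand by a normal one costs order
  \<sigma>^(-3), since the first two moments agree. The cost is multiplied by the error for fewer
  summands, so the unknown constant occurs on both sides; a large smoothing scale that does not
  depend on n makes its coefficient on the right less than one. The score at \<theta>0 + t is
  another variable for each t, hence the bound for sums has to be uniform over all variables with
  bounded third absolute moment and variance bounded below. The estimator need not be measurable.
  Its comparison with the score is therefore pointwise, outside a measurable set that does not
  depend on z, and both inner and outer measures are bracketed. For the same reason suprema over
  uncountable parameter sets are replaced by measurable majorants or by suprema over countable
  sets.\<close>

definition hermite_rem :: "real \<Rightarrow> real \<Rightarrow> real" where
  "hermite_rem v u = std_normal_density (v - u) - std_normal_density v
     - u * v * std_normal_density v - u\<^sup>2 / 2 * (v\<^sup>2 - 1) * std_normal_density v"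

lemma std_normal_density_deriv:
  "(std_normal_density has_real_derivative - x * std_normal_density x) (at x)"
  unfolding normal_density_def
  by (auto intro!: derivative_eq_intros simp: field_simps power2_eq_square)

lemma std_normal_density_shift_deriv:
  "((\<lambda>r. std_normal_density (v - r)) has_real_derivative (v - r) * std_normal_density (v - r)) (at r)"
proof -
  have "((\<lambda>r. std_normal_density (v - r)) has_real_derivative
      (- (v - r) * std_normal_density (v - r)) * (- 1)) (at r)"
    by (rule DERIV_chain2[OF std_normal_density_deriv]) (auto intro!: derivative_eq_intros)
  then show ?thesis by (simp add: algebra_simps)
qed

text \<open>Lagrange's form of the remainder: \<open>hermite_rem v u\<close> is the second-order
  Taylor remainder, in \<open>u\<close> at 0, of the normal density at \<open>v - u\<close>. The
  successive derivatives are the density times the Hermite polynomials 1, v, v^2 - 1, v^3 - 3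
  v.\<close>

lemma hermite_rem_taylor:
  "\<exists>t. \<bar>t\<bar> \<le> \<bar>u\<bar> \<and>
     hermite_rem v u = ((v - t) ^ 3 - 3 * (v - t)) * std_normal_density (v - t) / 6 * u ^ 3"
proof -
  define d :: "nat \<Rightarrow> real \<Rightarrow> real" where
    "d m r = (if m = 0 then 1 else if m = 1 then v - r else if m = 2 then (v - r)\<^sup>2 - 1
        else (v - r) ^ 3 - 3 * (v - r)) * std_normal_density (v - r)" for m r
  have D: "DERIV (d m) t :> d (Suc m) t" if "m < 3" for m t
  proof -
    have "m = 0 \<or> m = 1 \<or> m = 2" using that by auto
    then consider "m = 0" | "m = 1" | "m = 2" by blast
    then show ?thesis
    proof cases
      case 1
      then show ?thesis using std_normal_density_shift_deriv[of v t]
        by (simp add: d_def[abs_def])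
    next
      case 2
      show ?thesis unfolding d_def[abs_def] 2
        by (auto intro!: derivative_eq_intros std_normal_density_shift_deriv
            simp: field_simps power2_eq_square)
    next
      case 3
      show ?thesis unfolding d_def[abs_def] 3
        by (auto intro!: derivative_eq_intros std_normal_density_shift_deriv
            simp: field_simps power2_eq_square power3_eq_cube)
    qed
  qed
  obtain t where t: "\<bar>t\<bar> \<le> \<bar>u\<bar>"
    "d 0 u = (\<Sum>m<3. d m 0 / fact m * u ^ m) + d 3 t / fact 3 * u ^ 3"
    using Maclaurin_bi_le[of d "d 0" 3 u] D by blast
  have "(\<Sum>m<3. d m 0 / fact m * u ^ m) = d 0 0 + d 1 0 * u + d 2 0 / 2 * u\<^sup>2"
    by (simp add: eval_nat_numeral)
  with t(2) have "hermite_rem v u = d 3 t / fact 3 * u ^ 3"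
    by (simp add: hermite_rem_def d_def algebra_simps)
  with t(1) show ?thesis by (auto simp: d_def fact_numeral)
qed

lemma integrable_poly_normal_density:
  assumes "0 < \<sigma>"
  shows "integrable lborel (\<lambda>v. (1 + \<bar>v\<bar>) ^ k * normal_density 0 \<sigma> v)"
proof (rule Bochner_Integration.integrable_bound)
  show "integrable lborel (\<lambda>v. 2 ^ k * (normal_density 0 \<sigma> v + normal_density 0 \<sigma> v * \<bar>v - 0\<bar> ^ k))"
    using assms by (intro integrable_mult_right Bochner_Integration.integrable_add
        integrable_normal_moment_abs integrable_normal_density) auto
  show "AE v in lborel. norm ((1 + \<bar>v\<bar>) ^ k * normal_density 0 \<sigma> v)
      \<le> norm (2 ^ k * (normal_density 0 \<sigma> v + normal_density 0 \<sigma> v * \<bar>v - 0\<bar> ^ k))"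
  proof (rule AE_I2)
    fix v :: real
    have "(1 + \<bar>v\<bar>) ^ k \<le> (2 * max 1 \<bar>v\<bar>) ^ k" by (intro power_mono) auto
    also have "\<dots> \<le> 2 ^ k * (1 + \<bar>v\<bar> ^ k)"
      by (auto simp: max_def power_mult_distrib)
    finally have "(1 + \<bar>v\<bar>) ^ k * normal_density 0 \<sigma> v \<le> 2 ^ k * (1 + \<bar>v\<bar> ^ k) * normal_density 0 \<sigma> v"
      by (intro mult_right_mono) auto
    then show "norm ((1 + \<bar>v\<bar>) ^ k * normal_density 0 \<sigma> v)
      \<le> norm (2 ^ k * (normal_density 0 \<sigma> v + normal_density 0 \<sigma> v * \<bar>v - 0\<bar> ^ k))"
      by (simp add: abs_mult algebra_simps)
  qed
qed auto

lemma nn_integral_poly_normal_density: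
  assumes "0 < \<sigma>"
  obtains M where "0 \<le> M" "(\<integral>\<^sup>+v. ennreal ((1 + \<bar>v\<bar>) ^ k * normal_density 0 \<sigma> v) \<partial>lborel) = ennreal M"
  using nn_integral_eq_integral[OF integrable_poly_normal_density[OF assms, of k]]
  by (metis (no_types, lifting) AE_I2 integral_nonneg_AE mult_nonneg_nonneg normal_density_nonneg
      add_nonneg_nonneg abs_ge_zero zero_le_one zero_le_power)

text \<open>Removes the unknown intermediate point of the Taylor remainder: since v^2 \<le> 2 (v -
  t)^2 + 2 t^2, the wider law N(0, 2) dominates all shifts by at most 1. The constant 4 is 2 for exp
  (1/2) times 2 for the normalising factors.\<close>

lemma std_normal_density_near:
  assumes "\<bar>t\<bar> \<le> 1"
  shows "std_normal_density (v - t) \<le> 4 * normal_density 0 (sqrt 2) v"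
proof -
  have "v\<^sup>2 \<le> 2 * (v - t)\<^sup>2 + 2 * t\<^sup>2"
    using zero_le_power2[of "v - 2 * t"] by (simp add: power2_eq_square algebra_simps)
  moreover have "t\<^sup>2 \<le> 1" using assms by (simp add: abs_square_le_1)
  ultimately have "- ((v - t)\<^sup>2 / 2) \<le> 1 / 2 + - (v\<^sup>2 / 4)" by simp
  then have "exp (- ((v - t)\<^sup>2 / 2)) \<le> exp (1 / 2) * exp (- (v\<^sup>2 / 4))"
    by (simp add: mult_exp_exp)
  moreover have "exp (1 / 2 :: real) * exp (1/2) = exp 1" by (simp add: mult_exp_exp)
  then have "exp (1 / 2 :: real) ^ 2 \<le> 2 ^ 2"
    using exp_le by (simp add: power2_eq_square)
  then have "exp (1 / 2 :: real) \<le> 2" by (rule power2_le_imp_le) simp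
  ultimately have *: "exp (- ((v - t)\<^sup>2 / 2)) \<le> 2 * exp (- (v\<^sup>2 / 4))"
    by (meson mult_right_mono exp_ge_zero order_trans)
  have "sqrt (4 * pi) = sqrt 2 * sqrt (2 * pi)" by (simp add: real_sqrt_mult[symmetric])
  moreover have "sqrt 2 \<le> 2" by (rule real_le_lsqrt) auto
  ultimately have "sqrt (4 * pi) \<le> 2 * sqrt (2 * pi)" by simp
  then have "1 / sqrt (2 * pi) \<le> 2 / sqrt (4 * pi)"
    by (simp add: field_simps)
  then have "1 / sqrt (2 * pi) * exp (- ((v - t)\<^sup>2 / 2)) \<le> 2 / sqrt (4 * pi) * (2 * exp (- (v\<^sup>2 / 4)))"
    using * by (intro mult_mono) auto
  then show ?thesis unfolding normal_density_def by (simp add: field_simps)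
qed

lemma borel_measurable_hermite_rem[measurable]:
  "(\<lambda>x. hermite_rem (f x) (g x)) \<in> borel_measurable M"
  if [measurable]: "f \<in> borel_measurable M" "g \<in> borel_measurable M"
  unfolding hermite_rem_def by measurable

text \<open>For small \<open>u\<close> the factor |u|^3 comes from the Taylor remainder. Its cubic
  Hermite polynomial and the cubic weight together produce the sixth power.\<close>

lemma hermite_rem_small:
  assumes "\<bar>u\<bar> \<le> 1"
  shows "(1 + \<bar>v\<bar>) ^ 3 * \<bar>hermite_rem v u\<bar>
    \<le> 3 * \<bar>u\<bar> ^ 3 * ((1 + \<bar>v\<bar>) ^ 6 * normal_density 0 (sqrt 2) v)"
proof -
  obtain t where t: "\<bar>t\<bar> \<le> \<bar>u\<bar>"
     and e: "hermite_rem v u = ((v - t) ^ 3 - 3 * (v - t)) * std_normal_density (v - t) / 6 * u ^ 3"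
    using hermite_rem_taylor by blast
  define a where "a = 1 + \<bar>v\<bar>"
  have a: "1 \<le> a" "\<bar>v - t\<bar> \<le> a" using t assms by (auto simp: a_def)
  have "\<bar>(v - t) ^ 3 - 3 * (v - t)\<bar> \<le> \<bar>v - t\<bar> ^ 3 + 3 * \<bar>v - t\<bar>"
    by (metis abs_mult abs_numeral abs_triangle_ineq4 power_abs)
  also have "\<dots> \<le> a ^ 3 + 3 * a" using a by (intro add_mono power_mono mult_left_mono) auto
  also have "\<dots> \<le> 4 * a ^ 3" using self_le_power[of a 3] a by simp
  finally have "\<bar>(v - t) ^ 3 - 3 * (v - t)\<bar> * std_normal_density (v - t)
      \<le> 4 * a ^ 3 * (4 * normal_density 0 (sqrt 2) v)"
    using std_normal_density_near[of t v] t assms a by (intro mult_mono) auto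
  then have "\<bar>hermite_rem v u\<bar> \<le> 4 * a ^ 3 * (4 * normal_density 0 (sqrt 2) v) / 6 * \<bar>u\<bar> ^ 3"
  proof -
    have "\<bar>hermite_rem v u\<bar> = (\<bar>(v - t) ^ 3 - 3 * (v - t)\<bar> * std_normal_density (v - t)) / 6 * \<bar>u\<bar> ^ 3"
      unfolding e by (simp only: abs_mult abs_divide power_abs abs_of_nonneg[OF normal_density_nonneg])
    then show ?thesis
      using \<open>_ \<le> 4 * a ^ 3 * (4 * normal_density 0 (sqrt 2) v)\<close>
      by (metis (no_types, lifting) mult_right_mono divide_right_mono abs_ge_zero zero_le_power zero_le_numeral)
  qed
  also have "\<dots> \<le> 3 * \<bar>u\<bar> ^ 3 * (a ^ 3 * normal_density 0 (sqrt 2) v)"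
  proof -
    have "0 \<le> \<bar>u\<bar> ^ 3 * (a ^ 3 * normal_density 0 (sqrt 2) v)" using a by simp
    then show ?thesis by (simp add: algebra_simps)
  qed
  finally have "a ^ 3 * \<bar>hermite_rem v u\<bar> \<le> a ^ 3 * (3 * \<bar>u\<bar> ^ 3 * (a ^ 3 * normal_density 0 (sqrt 2) v))"
    using a by (intro mult_left_mono) auto
  also have "\<dots> = 3 * \<bar>u\<bar> ^ 3 * (a ^ 6 * normal_density 0 (sqrt 2) v)"
    by (simp add: power_add[symmetric] algebra_simps)
  finally show ?thesis by (simp add: a_def)
qed

lemma hermite_rem_large:
  assumes "1 \<le> \<bar>u\<bar>"
  shows "(1 + \<bar>v\<bar>) ^ 3 * \<bar>hermite_rem v u\<bar>
    \<le> 8 * \<bar>u\<bar> ^ 3 * ((1 + \<bar>v - u\<bar>) ^ 3 * std_normal_density (v - u))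
      + 4 * \<bar>u\<bar> ^ 3 * ((1 + \<bar>v\<bar>) ^ 5 * std_normal_density v)"
proof -
  have "(1 + \<bar>v\<bar>) ^ 3 \<le> ((2 * \<bar>u\<bar>) * (1 + \<bar>v - u\<bar>)) ^ 3"
  proof (rule power_mono)
    have "0 \<le> (\<bar>u\<bar> - 1) * \<bar>v - u\<bar>" using assms by simp
    then have "\<bar>v - u\<bar> \<le> \<bar>u\<bar> * \<bar>v - u\<bar>" by (simp add: algebra_simps)
    then show "1 + \<bar>v\<bar> \<le> (2 * \<bar>u\<bar>) * (1 + \<bar>v - u\<bar>)"
      using assms by (simp add: algebra_simps)
  qed auto
  then have 1: "(1 + \<bar>v\<bar>) ^ 3 * std_normal_density (v - u)
      \<le> 8 * \<bar>u\<bar> ^ 3 * ((1 + \<bar>v - u\<bar>) ^ 3 * std_normal_density (v - u))"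
    using mult_right_mono[of "(1 + \<bar>v\<bar>) ^ 3" "((2 * \<bar>u\<bar>) * (1 + \<bar>v - u\<bar>)) ^ 3" "std_normal_density (v - u)"]
    unfolding power_mult_distrib by (simp add: mult_ac)
  have u: "\<bar>u\<bar> \<le> \<bar>u\<bar> ^ 3" "1 \<le> \<bar>u\<bar> ^ 3" "\<bar>u\<bar>\<^sup>2 \<le> \<bar>u\<bar> ^ 3"
    using assms self_le_power[of "\<bar>u\<bar>" 3] power_increasing[of 2 3 "\<bar>u\<bar>"] by auto
  have v: "1 + \<bar>v\<bar> + (v\<^sup>2 + 1) / 2 \<le> 4 * (1 + \<bar>v\<bar>)\<^sup>2"
  proof -
    have "(1 + \<bar>v\<bar>)\<^sup>2 = 1 + 2 * \<bar>v\<bar> + v\<^sup>2" by (simp add: power2_sum)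
    then show ?thesis using zero_le_power2[of v] abs_ge_zero[of v] by (simp only:) argo
  qed
  have "\<bar>std_normal_density v + u * v * std_normal_density v + u\<^sup>2 / 2 * (v\<^sup>2 - 1) * std_normal_density v\<bar>
      = \<bar>1 + u * v + u\<^sup>2 / 2 * (v\<^sup>2 - 1)\<bar> * std_normal_density v"
  proof -
    have "std_normal_density v + u * v * std_normal_density v + u\<^sup>2 / 2 * (v\<^sup>2 - 1) * std_normal_density v
      = (1 + u * v + u\<^sup>2 / 2 * (v\<^sup>2 - 1)) * std_normal_density v" by (simp add: distrib_right)
    then show ?thesis by (simp only: abs_mult abs_of_nonneg[OF normal_density_nonneg])
  qed
  also have "\<dots> \<le> (\<bar>u\<bar> ^ 3 * (4 * (1 + \<bar>v\<bar>)\<^sup>2)) * std_normal_density v"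
  proof (rule mult_right_mono)
    have "\<bar>1 + u * v + u\<^sup>2 / 2 * (v\<^sup>2 - 1)\<bar> \<le> 1 + \<bar>u\<bar> * \<bar>v\<bar> + \<bar>u\<bar>\<^sup>2 * ((v\<^sup>2 + 1) / 2)"
    proof -
      have "\<bar>u\<^sup>2 / 2 * (v\<^sup>2 - 1)\<bar> \<le> \<bar>u\<bar>\<^sup>2 * ((v\<^sup>2 + 1) / 2)"
      proof -
        have "\<bar>v\<^sup>2 - 1\<bar> \<le> v\<^sup>2 + 1" by (simp add: abs_le_iff)
        then have "u\<^sup>2 * \<bar>v\<^sup>2 - 1\<bar> \<le> u\<^sup>2 * (v\<^sup>2 + 1)" by (intro mult_left_mono) auto
        then show ?thesis by (simp add: abs_mult)
      qed
      moreover have "\<bar>u * v\<bar> = \<bar>u\<bar> * \<bar>v\<bar>" by (simp add: abs_mult)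
      ultimately show ?thesis by linarith
    qed
    also have "\<dots> \<le> \<bar>u\<bar> ^ 3 * 1 + \<bar>u\<bar> ^ 3 * \<bar>v\<bar> + \<bar>u\<bar> ^ 3 * ((v\<^sup>2 + 1) / 2)"
      using u by (intro add_mono mult_right_mono) auto
    also have "\<dots> = \<bar>u\<bar> ^ 3 * (1 + \<bar>v\<bar> + (v\<^sup>2 + 1) / 2)" by (simp add: algebra_simps)
    also have "\<dots> \<le> \<bar>u\<bar> ^ 3 * (4 * (1 + \<bar>v\<bar>)\<^sup>2)" using v by (intro mult_left_mono) auto
    finally show "\<bar>1 + u * v + u\<^sup>2 / 2 * (v\<^sup>2 - 1)\<bar> \<le> \<bar>u\<bar> ^ 3 * (4 * (1 + \<bar>v\<bar>)\<^sup>2)" .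
  qed auto
  finally have 2: "(1 + \<bar>v\<bar>) ^ 3 * \<bar>std_normal_density v + u * v * std_normal_density v
      + u\<^sup>2 / 2 * (v\<^sup>2 - 1) * std_normal_density v\<bar>
      \<le> (1 + \<bar>v\<bar>) ^ 3 * (\<bar>u\<bar> ^ 3 * (4 * (1 + \<bar>v\<bar>)\<^sup>2) * std_normal_density v)"
    by (intro mult_left_mono) auto
  also have "\<dots> = 4 * \<bar>u\<bar> ^ 3 * ((1 + \<bar>v\<bar>) ^ (3 + 2) * std_normal_density v)"
    unfolding power_add by (simp add: mult_ac)
  finally have 2: "(1 + \<bar>v\<bar>) ^ 3 * \<bar>std_normal_density v + u * v * std_normal_density v
      + u\<^sup>2 / 2 * (v\<^sup>2 - 1) * std_normal_density v\<bar>
      \<le> 4 * \<bar>u\<bar> ^ 3 * ((1 + \<bar>v\<bar>) ^ 5 * std_normal_density v)" by simp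
  have "\<bar>hermite_rem v u\<bar> \<le> std_normal_density (v - u) +
     \<bar>std_normal_density v + u * v * std_normal_density v + u\<^sup>2 / 2 * (v\<^sup>2 - 1) * std_normal_density v\<bar>"
    unfolding hermite_rem_def using normal_density_nonneg[of 0 1 "v - u"] by linarith
  then have "(1 + \<bar>v\<bar>) ^ 3 * \<bar>hermite_rem v u\<bar> \<le> (1 + \<bar>v\<bar>) ^ 3 * (std_normal_density (v - u) +
     \<bar>std_normal_density v + u * v * std_normal_density v + u\<^sup>2 / 2 * (v\<^sup>2 - 1) * std_normal_density v\<bar>)"
    by (intro mult_left_mono) auto
  with 1 2 show ?thesis by (simp only: distrib_left)
qed

text \<open>One cubic bound for all \<open>u\<close>, so that after integration over the law of a
  summand only its third absolute moment enters.\<close>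

lemma nn_integral_hermite_rem_le:
  obtains C where "0 < C"
    "\<And>u. (\<integral>\<^sup>+v. ennreal ((1 + \<bar>v\<bar>) ^ 3 * \<bar>hermite_rem v u\<bar>) \<partial>lborel) \<le> ennreal (C * \<bar>u\<bar> ^ 3)"
proof -
  obtain M6 where M6: "0 \<le> M6"
    "(\<integral>\<^sup>+v. ennreal ((1 + \<bar>v\<bar>) ^ 6 * normal_density 0 (sqrt 2) v) \<partial>lborel) = ennreal M6"
    using nn_integral_poly_normal_density[of "sqrt 2" 6] by auto
  obtain M5 where M5: "0 \<le> M5"
    "(\<integral>\<^sup>+v. ennreal ((1 + \<bar>v\<bar>) ^ 5 * std_normal_density v) \<partial>lborel) = ennreal M5"
    using nn_integral_poly_normal_density[of 1 5] by auto
  obtain M3 where M3: "0 \<le> M3"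
    "(\<integral>\<^sup>+v. ennreal ((1 + \<bar>v\<bar>) ^ 3 * std_normal_density v) \<partial>lborel) = ennreal M3"
    using nn_integral_poly_normal_density[of 1 3] by auto
  define C where "C = 1 + 3 * M6 + 8 * M3 + 4 * M5"
  show thesis
  proof (rule that[of C])
    show "0 < C" using M6 M5 M3 by (simp add: C_def)
    fix u :: real
    show "(\<integral>\<^sup>+v. ennreal ((1 + \<bar>v\<bar>) ^ 3 * \<bar>hermite_rem v u\<bar>) \<partial>lborel) \<le> ennreal (C * \<bar>u\<bar> ^ 3)"
    proof (cases "\<bar>u\<bar> \<le> 1")
      case True
      have "(\<integral>\<^sup>+v. ennreal ((1 + \<bar>v\<bar>) ^ 3 * \<bar>hermite_rem v u\<bar>) \<partial>lborel)
          \<le> (\<integral>\<^sup>+v. ennreal (3 * \<bar>u\<bar> ^ 3) * ennreal ((1 + \<bar>v\<bar>) ^ 6 * normal_density 0 (sqrt 2) v) \<partial>lborel)"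
        using hermite_rem_small[OF True]
        by (intro nn_integral_mono) (simp flip: ennreal_mult)
      also have "\<dots> = ennreal (3 * \<bar>u\<bar> ^ 3 * M6)"
        using M6 by (simp add: nn_integral_cmult ennreal_mult)
      also have "\<dots> \<le> ennreal (C * \<bar>u\<bar> ^ 3)"
      proof (rule ennreal_leI)
        have "3 * M6 * \<bar>u\<bar> ^ 3 \<le> C * \<bar>u\<bar> ^ 3" using M5 M3 by (intro mult_right_mono) (auto simp: C_def)
        then show "3 * \<bar>u\<bar> ^ 3 * M6 \<le> C * \<bar>u\<bar> ^ 3" by (simp add: mult_ac)
      qed
      finally show ?thesis .
    next
      case False
      have shift: "(\<integral>\<^sup>+v. ennreal ((1 + \<bar>v - u\<bar>) ^ 3 * std_normal_density (v - u)) \<partial>lborel) = ennreal M3"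
        using M3(2) nn_integral_real_affine[of "\<lambda>v. ennreal ((1 + \<bar>v - u\<bar>) ^ 3 * std_normal_density (v - u))" 1 u]
        by simp
      have "(\<integral>\<^sup>+v. ennreal ((1 + \<bar>v\<bar>) ^ 3 * \<bar>hermite_rem v u\<bar>) \<partial>lborel)
          \<le> (\<integral>\<^sup>+v. (ennreal (8 * \<bar>u\<bar> ^ 3) * ennreal ((1 + \<bar>v - u\<bar>) ^ 3 * std_normal_density (v - u)) +
             ennreal (4 * \<bar>u\<bar> ^ 3) * ennreal ((1 + \<bar>v\<bar>) ^ 5 * std_normal_density v)) \<partial>lborel)"
        using hermite_rem_large[of u] False
        by (intro nn_integral_mono) (simp flip: ennreal_mult ennreal_plus)
      also have "\<dots> = ennreal (8 * \<bar>u\<bar> ^ 3) * ennreal M3 + ennreal (4 * \<bar>u\<bar> ^ 3) * ennreal M5"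
        by (subst nn_integral_add) (auto simp: nn_integral_cmult M5 shift)
      also have "\<dots> = ennreal (8 * \<bar>u\<bar> ^ 3 * M3 + 4 * \<bar>u\<bar> ^ 3 * M5)"
        using M3 M5 by (simp flip: ennreal_mult ennreal_plus)
      also have "\<dots> \<le> ennreal (C * \<bar>u\<bar> ^ 3)"
      proof (rule ennreal_leI)
        have "(8 * M3 + 4 * M5) * \<bar>u\<bar> ^ 3 \<le> C * \<bar>u\<bar> ^ 3" using M6 by (intro mult_right_mono) (auto simp: C_def)
        then show "8 * \<bar>u\<bar> ^ 3 * M3 + 4 * \<bar>u\<bar> ^ 3 * M5 \<le> C * \<bar>u\<bar> ^ 3" by (simp add: algebra_simps)
      qed
      finally show ?thesis .
    qed
  qed
qed

section \<open>The cubic weight and the error of replacing one summand\<close>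

definition tail_weight :: "real \<Rightarrow> real \<Rightarrow> real" where
  "tail_weight r v = (1 + \<bar>v\<bar> / r) ^ 3"

text \<open>The third absolute moment is merely bounded by \<rho>, so that later constants depend on
  \<rho> and not on the law itself.\<close>

definition standardised_law :: "real measure \<Rightarrow> real \<Rightarrow> bool" where
  "standardised_law \<nu> \<rho> \<longleftrightarrow> prob_space \<nu> \<and> sets \<nu> = sets borel \<and>
     integrable \<nu> (\<lambda>u. \<bar>u\<bar> ^ 3) \<and> (\<integral>u. u \<partial>\<nu>) = 0 \<and> (\<integral>u. u\<^sup>2 \<partial>\<nu>) = 1 \<and> (\<integral>u. \<bar>u\<bar> ^ 3 \<partial>\<nu>) \<le> \<rho>"

text \<open>The error made when one summand of law \<open>\<nu>\<close> is replaced by a standard normal one in the presence of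
  an independent \<open>N(0, \<sigma>\<^sup>2)\<close> variable.\<close>
definition smoothing_defect :: "real measure \<Rightarrow> real \<Rightarrow> real \<Rightarrow> real" where
  "smoothing_defect \<nu> \<sigma> v =
     (\<integral>u. normal_density 0 \<sigma> (v - u) \<partial>\<nu>) - normal_density 0 (sqrt (\<sigma>\<^sup>2 + 1)) v"

lemma tail_weight_ge_1: "0 < r \<Longrightarrow> 1 \<le> tail_weight r v"
  unfolding tail_weight_def by (intro one_le_power) auto

text \<open>Submultiplicativity makes the weighted sup norm compatible with convolution. With r =
  sqrt n the weight at y sqrt n is (1 + |y|)^3, so sums can be left unnormalised.\<close>

lemma tail_weight_submult:
  assumes "0 < r" shows "tail_weight r (v + w) \<le> tail_weight r v * tail_weight r w"
proof -
  have "\<bar>v + w\<bar> / r \<le> \<bar>v\<bar> / r + \<bar>w\<bar> / r"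
    using assms by (metis abs_triangle_ineq add_divide_distrib divide_right_mono less_imp_le)
  moreover have "0 \<le> \<bar>v\<bar> / r * (\<bar>w\<bar> / r)" using assms by simp
  moreover have "(1 + a) * (1 + b) = 1 + a + b + a * b" for a b :: real by (simp add: algebra_simps)
  ultimately have "1 + \<bar>v + w\<bar> / r \<le> (1 + \<bar>v\<bar> / r) * (1 + \<bar>w\<bar> / r)"
    by (simp only:)
  then show ?thesis unfolding tail_weight_def power_mult_distrib[symmetric]
    using assms by (intro power_mono) auto
qed

lemma borel_measurable_tail_weight[measurable]:
  assumes [measurable]: "f \<in> borel_measurable M"
  shows "(\<lambda>x. tail_weight r (f x)) \<in> borel_measurable M"
  unfolding tail_weight_def by measurable

lemma standardised_law_integrable:
  assumes "standardised_law \<nu> \<rho>"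
  shows "integrable \<nu> (\<lambda>u. u)" "integrable \<nu> (\<lambda>u. u\<^sup>2)"
proof -
  interpret prob_space \<nu> using assms by (simp add: standardised_law_def)
  have [measurable_cong]: "sets \<nu> = sets borel" using assms by (simp add: standardised_law_def)
  have i: "integrable \<nu> (\<lambda>u. 1 + \<bar>u\<bar> ^ 3)" using assms by (simp add: standardised_law_def)
  have le: "\<bar>u\<bar> \<le> 1 + \<bar>u\<bar> ^ 3 \<and> \<bar>u\<bar>\<^sup>2 \<le> 1 + \<bar>u\<bar> ^ 3" for u :: real
  proof (cases "\<bar>u\<bar> \<le> 1")
    case True
    then show ?thesis by (simp add: power_le_one add_increasing2 abs_square_le_1)
  next
    case False
    then show ?thesis using self_le_power[of "\<bar>u\<bar>" 3] power_increasing[of 2 3 "\<bar>u\<bar>"]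
      by simp
  qed
  show "integrable \<nu> (\<lambda>u. u)" "integrable \<nu> (\<lambda>u. u\<^sup>2)"
    using le by (auto intro!: Bochner_Integration.integrable_bound[OF i])
qed

lemma standardised_law_normal:
  "standardised_law std_normal_distribution (LINT x|std_normal_distribution. \<bar>x\<bar> ^ 3)"
  unfolding standardised_law_def
proof (intro conjI)
  show "prob_space std_normal_distribution" by (rule prob_space_normal_density) simp
  show "integrable std_normal_distribution (\<lambda>u. \<bar>u\<bar> ^ 3)"
    using integrable_std_normal_distribution_moment[of 3, THEN integrable_abs] by (simp add: power_abs)
  show "(LINT u|std_normal_distribution. u) = 0"
    using integral_std_normal_distribution_moment_odd[of 1] by simp
  show "(LINT u|std_normal_distribution. u\<^sup>2) = 1"
    using std_normal_distribution_even_moments(1)[of 1] by simp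
qed auto

lemma normal_density_bounded:
  assumes "0 < \<sigma>" shows "normal_density 0 \<sigma> v \<le> 1 / \<sigma>"
proof -
  have "1 \<le> sqrt (2 * pi)" using pi_gt3 by simp
  then have "\<sigma> * 1 \<le> \<sigma> * sqrt (2 * pi)" using assms by (intro mult_left_mono) auto
  then have "\<sigma> \<le> sqrt (2 * pi * \<sigma>\<^sup>2)" using assms by (simp add: real_sqrt_mult)
  then have "1 / sqrt (2 * pi * \<sigma>\<^sup>2) * exp (- (v - 0)\<^sup>2 / (2 * \<sigma>\<^sup>2)) \<le> 1 / \<sigma> * 1"
    using assms by (intro mult_mono) (auto simp: frac_le)
  then show ?thesis unfolding normal_density_def by simp
qed

lemma normal_density_scale:
  assumes "0 < \<sigma>" shows "normal_density 0 \<sigma> v = std_normal_density (v / \<sigma>) / \<sigma>"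
  using assms by (simp add: normal_density_def real_sqrt_mult power_divide)

lemma normal_density_convolution:
  assumes "0 < \<sigma>" "0 < \<tau>"
  shows "(\<integral>u. normal_density 0 \<sigma> (v - u) \<partial>density lborel (\<lambda>x. ennreal (normal_density 0 \<tau> x)))
    = normal_density 0 (sqrt (\<sigma>\<^sup>2 + \<tau>\<^sup>2)) v"
proof -
  have "(\<integral>u. normal_density 0 \<sigma> (v - u) \<partial>density lborel (\<lambda>x. ennreal (normal_density 0 \<tau> x)))
    = (\<integral>u. normal_density 0 \<sigma> (v - u) * normal_density 0 \<tau> u \<partial>lborel)"
    by (subst integral_real_density) (auto simp: mult.commute)
  also have "\<dots> = enn2real (\<integral>\<^sup>+u. ennreal (normal_density 0 \<sigma> (v - u) * normal_density 0 \<tau> u) \<partial>lborel)"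
    by (rule integral_eq_nn_integral) auto
  also have "\<dots> = normal_density 0 (sqrt (\<sigma>\<^sup>2 + \<tau>\<^sup>2)) v"
    using fun_cong[OF conv_normal_density_zero_mean[OF assms], of v] by simp
  finally show ?thesis .
qed

lemma smoothing_defect_normal: "0 < \<sigma> \<Longrightarrow> smoothing_defect std_normal_distribution \<sigma> v = 0"
  using normal_density_convolution[of \<sigma> 1 v] by (simp add: smoothing_defect_def)

text \<open>Mean 0 and variance 1 turn the integrated Taylor polynomial into an expression free of
  \<open>\<nu>\<close>. Hence only remainders survive in the difference of two standardised
  laws.\<close>

lemma integral_hermite_rem:
  assumes "standardised_law \<nu> \<rho>" "0 < \<sigma>"
  shows "integrable \<nu> (\<lambda>u. hermite_rem (v / \<sigma>) (u / \<sigma>) / \<sigma>)" (is ?I)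
    and "(\<integral>u. normal_density 0 \<sigma> (v - u) \<partial>\<nu>) = (\<integral>u. hermite_rem (v / \<sigma>) (u / \<sigma>) / \<sigma> \<partial>\<nu>)
      + std_normal_density (v / \<sigma>) / \<sigma> * (1 + (((v / \<sigma>)\<^sup>2 - 1) / (2 * \<sigma>\<^sup>2)))" (is ?E)
proof -
  interpret prob_space \<nu> using assms by (simp add: standardised_law_def)
  have [measurable_cong]: "sets \<nu> = sets borel" using assms by (simp add: standardised_law_def)
  note si = standardised_law_integrable[OF assms(1)]
  have m: "(\<integral>u. u \<partial>\<nu>) = 0" "(\<integral>u. u\<^sup>2 \<partial>\<nu>) = 1" using assms by (auto simp: standardised_law_def)
  define a where "a = std_normal_density (v / \<sigma>) / \<sigma>"
  have i1: "integrable \<nu> (\<lambda>u. normal_density 0 \<sigma> (v - u))"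
    using normal_density_bounded[OF assms(2)]
    by (intro integrable_const_bound[of _ "1 / \<sigma>"]) auto
  have eq: "hermite_rem (v / \<sigma>) (u / \<sigma>) / \<sigma> = normal_density 0 \<sigma> (v - u)
      - (a + (v / \<sigma>\<^sup>2 * a) * u + (((v / \<sigma>)\<^sup>2 - 1) / (2 * \<sigma>\<^sup>2) * a) * u\<^sup>2)" for u
    unfolding hermite_rem_def normal_density_scale[OF assms(2)] a_def
    using assms(2) by (simp add: diff_divide_distrib power_divide power2_eq_square add_divide_distrib)
      (simp add: field_simps)
  have i2: "integrable \<nu> (\<lambda>u. a + (v / \<sigma>\<^sup>2 * a) * u + (((v / \<sigma>)\<^sup>2 - 1) / (2 * \<sigma>\<^sup>2) * a) * u\<^sup>2)"
    using si by (intro Bochner_Integration.integrable_add integrable_mult_right) auto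
  show ?I unfolding eq using i1 i2 by (rule Bochner_Integration.integrable_diff)
  have "(\<integral>u. hermite_rem (v / \<sigma>) (u / \<sigma>) / \<sigma> \<partial>\<nu>) = (\<integral>u. normal_density 0 \<sigma> (v - u) \<partial>\<nu>)
     - (\<integral>u. a + (v / \<sigma>\<^sup>2 * a) * u + (((v / \<sigma>)\<^sup>2 - 1) / (2 * \<sigma>\<^sup>2) * a) * u\<^sup>2 \<partial>\<nu>)"
    unfolding eq using i1 i2 by (rule Bochner_Integration.integral_diff)
  also have "(\<integral>u. a + (v / \<sigma>\<^sup>2 * a) * u + (((v / \<sigma>)\<^sup>2 - 1) / (2 * \<sigma>\<^sup>2) * a) * u\<^sup>2 \<partial>\<nu>)
     = a + (((v / \<sigma>)\<^sup>2 - 1) / (2 * \<sigma>\<^sup>2) * a)"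
    using si m by (subst Bochner_Integration.integral_add; (subst Bochner_Integration.integral_add)?)
      (auto intro!: Bochner_Integration.integrable_add integrable_mult_right simp: prob_space)
  finally show ?E by (simp add: a_def algebra_simps)
qed

text \<open>Tonelli's theorem, then the substitution of \<sigma> v for v: the cubic bound in u /
  \<sigma> yields \<sigma>^(-3). The condition \<sigma> \<le> 2 r keeps the rescaled weight below 8
  (1 + |v|)^3; it leaves room for smoothing scales a little above r = sqrt n.\<close>

lemma nn_integral_weighted_hermite_rem:
  obtains C where "0 < C" "\<And>\<nu> \<rho> \<sigma> r. standardised_law \<nu> \<rho> \<Longrightarrow> 0 < \<sigma> \<Longrightarrow> \<sigma> \<le> 2 * r \<Longrightarrow>
    (\<integral>\<^sup>+v. \<integral>\<^sup>+u. ennreal (tail_weight r v * \<bar>hermite_rem (v / \<sigma>) (u / \<sigma>) / \<sigma>\<bar>) \<partial>\<nu> \<partial>lborel)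
      \<le> ennreal (C * \<rho> / \<sigma> ^ 3)"
proof -
  obtain C where C: "0 < C"
    "\<And>u. (\<integral>\<^sup>+v. ennreal ((1 + \<bar>v\<bar>) ^ 3 * \<bar>hermite_rem v u\<bar>) \<partial>lborel) \<le> ennreal (C * \<bar>u\<bar> ^ 3)"
    using nn_integral_hermite_rem_le by blast
  have "(\<integral>\<^sup>+v. \<integral>\<^sup>+u. ennreal (tail_weight r v * \<bar>hermite_rem (v / \<sigma>) (u / \<sigma>) / \<sigma>\<bar>) \<partial>\<nu> \<partial>lborel)
      \<le> ennreal (8 * C * \<rho> / \<sigma> ^ 3)" if law: "standardised_law \<nu> \<rho>" and \<sigma>: "0 < \<sigma>" "\<sigma> \<le> 2 * r" for \<nu> \<rho> \<sigma> r
  proof -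
    interpret prob_space \<nu> using law by (simp add: standardised_law_def)
    interpret pair_sigma_finite \<nu> lborel ..
    have [measurable_cong]: "sets \<nu> = sets borel" using law by (simp add: standardised_law_def)
    have r: "0 < r" using \<sigma> by simp
    have "(\<integral>\<^sup>+v. \<integral>\<^sup>+u. ennreal (tail_weight r v * \<bar>hermite_rem (v / \<sigma>) (u / \<sigma>) / \<sigma>\<bar>) \<partial>\<nu> \<partial>lborel)
       = (\<integral>\<^sup>+u. \<integral>\<^sup>+v. ennreal (tail_weight r v * \<bar>hermite_rem (v / \<sigma>) (u / \<sigma>) / \<sigma>\<bar>) \<partial>lborel \<partial>\<nu>)"
      by (rule Fubini') measurable
    also have "\<dots> \<le> (\<integral>\<^sup>+u. ennreal (8 * C * \<bar>u\<bar> ^ 3 / \<sigma> ^ 3) \<partial>\<nu>)"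
    proof (rule nn_integral_mono)
      fix u
      have "(\<integral>\<^sup>+v. ennreal (tail_weight r v * \<bar>hermite_rem (v / \<sigma>) (u / \<sigma>) / \<sigma>\<bar>) \<partial>lborel)
        = ennreal \<sigma> * (\<integral>\<^sup>+v. ennreal (tail_weight r (\<sigma> * v) * \<bar>hermite_rem v (u / \<sigma>) / \<sigma>\<bar>) \<partial>lborel)"
        using \<sigma> by (subst nn_integral_real_affine[where c = \<sigma> and t = 0]) auto
      also have "\<dots> = (\<integral>\<^sup>+v. ennreal \<sigma> * ennreal (tail_weight r (\<sigma> * v) * \<bar>hermite_rem v (u / \<sigma>) / \<sigma>\<bar>) \<partial>lborel)"
        by (subst nn_integral_cmult) auto
      also have "\<dots> \<le> (\<integral>\<^sup>+v. ennreal 8 * ennreal ((1 + \<bar>v\<bar>) ^ 3 * \<bar>hermite_rem v (u / \<sigma>)\<bar>) \<partial>lborel)"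
      proof (rule nn_integral_mono)
        fix v :: real
        have "\<sigma> / r \<le> 2" using \<sigma> r by (simp add: divide_le_eq)
        then have "\<bar>v\<bar> * (\<sigma> / r) \<le> \<bar>v\<bar> * 2" by (intro mult_left_mono) auto
        then have "1 + \<bar>\<sigma> * v\<bar> / r \<le> 2 * (1 + \<bar>v\<bar>)"
          using \<sigma> by (simp add: abs_mult mult.commute)
        then have "tail_weight r (\<sigma> * v) \<le> (2 * (1 + \<bar>v\<bar>)) ^ 3"
          unfolding tail_weight_def using r by (intro power_mono) auto
        then have "tail_weight r (\<sigma> * v) \<le> 8 * (1 + \<bar>v\<bar>) ^ 3" unfolding power_mult_distrib by simp
        then have "tail_weight r (\<sigma> * v) * \<bar>hermite_rem v (u / \<sigma>)\<bar> \<le> 8 * (1 + \<bar>v\<bar>) ^ 3 * \<bar>hermite_rem v (u / \<sigma>)\<bar>"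
          by (intro mult_right_mono) auto
        then show "ennreal \<sigma> * ennreal (tail_weight r (\<sigma> * v) * \<bar>hermite_rem v (u / \<sigma>) / \<sigma>\<bar>)
          \<le> ennreal 8 * ennreal ((1 + \<bar>v\<bar>) ^ 3 * \<bar>hermite_rem v (u / \<sigma>)\<bar>)"
          using \<sigma> r tail_weight_ge_1[OF r, of "\<sigma> * v"]
          by (subst (1 2) ennreal_mult[symmetric]) (auto simp: mult.assoc intro!: ennreal_leI)
      qed
      also have "\<dots> = ennreal 8 * (\<integral>\<^sup>+v. ennreal ((1 + \<bar>v\<bar>) ^ 3 * \<bar>hermite_rem v (u / \<sigma>)\<bar>) \<partial>lborel)"
        by (rule nn_integral_cmult) measurable
      also have "\<dots> \<le> ennreal 8 * ennreal (C * \<bar>u / \<sigma>\<bar> ^ 3)"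
        by (intro mult_left_mono C) auto
      also have "\<dots> = ennreal (8 * C * \<bar>u\<bar> ^ 3 / \<sigma> ^ 3)"
        using C(1) \<sigma> by (subst ennreal_mult[symmetric]) (auto simp: power_divide)
      finally show "(\<integral>\<^sup>+v. ennreal (tail_weight r v * \<bar>hermite_rem (v / \<sigma>) (u / \<sigma>) / \<sigma>\<bar>) \<partial>lborel)
        \<le> ennreal (8 * C * \<bar>u\<bar> ^ 3 / \<sigma> ^ 3)" .
    qed
    also have "\<dots> = ennreal (\<integral>u. 8 * C * \<bar>u\<bar> ^ 3 / \<sigma> ^ 3 \<partial>\<nu>)"
      using law C(1) \<sigma> by (intro nn_integral_eq_integral) (auto simp: standardised_law_def)
    also have "\<dots> = ennreal (8 * C * (\<integral>u. \<bar>u\<bar> ^ 3 \<partial>\<nu>) / \<sigma> ^ 3)" by simp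
    also have "\<dots> \<le> ennreal (8 * C * \<rho> / \<sigma> ^ 3)"
      using law C(1) \<sigma> by (intro ennreal_leI divide_right_mono mult_left_mono) (auto simp: standardised_law_def)
    finally show ?thesis .
  qed
  with C(1) show thesis by (intro that[of "8 * C"]) auto
qed

lemma borel_measurable_smoothing_defect[measurable]:
  assumes "standardised_law \<nu> \<rho>" and [measurable]: "f \<in> borel_measurable M"
  shows "(\<lambda>x. smoothing_defect \<nu> \<sigma> (f x)) \<in> borel_measurable M"
proof -
  interpret prob_space \<nu> using assms by (simp add: standardised_law_def)
  have [measurable_cong]: "sets \<nu> = sets borel" using assms by (simp add: standardised_law_def)
  show ?thesis unfolding smoothing_defect_def by measurable
qed

text \<open>The decay \<sigma>^(-3) is the heart of the convolution method: over \<sigma>^2 =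
  \<tau>^2 + j it is summable in j, with a sum of order 1 / \<tau>.\<close>

lemma smoothing_defect_bound:
  obtains C where "0 < C" "\<And>\<nu> \<rho> \<sigma> r. standardised_law \<nu> \<rho> \<Longrightarrow> 0 < \<sigma> \<Longrightarrow> \<sigma> \<le> 2 * r \<Longrightarrow>
    (\<integral>\<^sup>+v. ennreal (tail_weight r v * \<bar>smoothing_defect \<nu> \<sigma> v\<bar>) \<partial>lborel)
      \<le> ennreal (C * (1 + \<rho>) / \<sigma> ^ 3)"
proof -
  obtain C where C: "0 < C" "\<And>\<nu> \<rho> \<sigma> r. standardised_law \<nu> \<rho> \<Longrightarrow> 0 < \<sigma> \<Longrightarrow> \<sigma> \<le> 2 * r \<Longrightarrow>
    (\<integral>\<^sup>+v. \<integral>\<^sup>+u. ennreal (tail_weight r v * \<bar>hermite_rem (v / \<sigma>) (u / \<sigma>) / \<sigma>\<bar>) \<partial>\<nu> \<partial>lborel)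
      \<le> ennreal (C * \<rho> / \<sigma> ^ 3)" using nn_integral_weighted_hermite_rem by blast
  define \<rho>0 where "\<rho>0 = (LINT x|std_normal_distribution. \<bar>x\<bar> ^ 3)"
  have \<rho>0: "0 \<le> \<rho>0" by (simp add: \<rho>0_def)
  note n0 = standardised_law_normal[folded \<rho>0_def]
  let ?H = "\<lambda>\<nu> \<sigma> v. \<integral>u. hermite_rem (v / \<sigma>) (u / \<sigma>) / \<sigma> \<partial>\<nu>"
  have key: "(\<integral>\<^sup>+v. ennreal (tail_weight r v * \<bar>?H \<nu> \<sigma> v\<bar>) \<partial>lborel) \<le> ennreal (C * \<rho> / \<sigma> ^ 3)"
    if law: "standardised_law \<nu> \<rho>" and \<sigma>: "0 < \<sigma>" "\<sigma> \<le> 2 * r" for \<nu> \<rho> \<sigma> r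
  proof -
    have [measurable_cong]: "sets \<nu> = sets borel" using law by (simp add: standardised_law_def)
    have r: "0 < r" using \<sigma> by simp
    have "(\<integral>\<^sup>+v. ennreal (tail_weight r v * \<bar>?H \<nu> \<sigma> v\<bar>) \<partial>lborel)
      \<le> (\<integral>\<^sup>+v. \<integral>\<^sup>+u. ennreal (tail_weight r v * \<bar>hermite_rem (v / \<sigma>) (u / \<sigma>) / \<sigma>\<bar>) \<partial>\<nu> \<partial>lborel)"
    proof (rule nn_integral_mono)
      fix v
      have w: "0 \<le> tail_weight r v" using tail_weight_ge_1[OF r, of v] by simp
      have "ennreal (tail_weight r v * \<bar>?H \<nu> \<sigma> v\<bar>) = ennreal (tail_weight r v) * ennreal (norm (?H \<nu> \<sigma> v))"
        unfolding real_norm_def using w by (intro ennreal_mult) auto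
      also have "\<dots> \<le> ennreal (tail_weight r v) * (\<integral>\<^sup>+u. ennreal (norm (hermite_rem (v / \<sigma>) (u / \<sigma>) / \<sigma>)) \<partial>\<nu>)"
        by (intro mult_left_mono integral_norm_bound_ennreal integral_hermite_rem(1)[OF law \<sigma>(1)]) auto
      also have "\<dots> = (\<integral>\<^sup>+u. ennreal (tail_weight r v * \<bar>hermite_rem (v / \<sigma>) (u / \<sigma>) / \<sigma>\<bar>) \<partial>\<nu>)"
        unfolding real_norm_def using w by (subst nn_integral_cmult[symmetric])
          (auto simp del: abs_divide simp add: ennreal_mult)
      finally show "ennreal (tail_weight r v * \<bar>?H \<nu> \<sigma> v\<bar>)
         \<le> (\<integral>\<^sup>+u. ennreal (tail_weight r v * \<bar>hermite_rem (v / \<sigma>) (u / \<sigma>) / \<sigma>\<bar>) \<partial>\<nu>)" .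
    qed
    also have "\<dots> \<le> ennreal (C * \<rho> / \<sigma> ^ 3)" by (rule C(2)[OF law \<sigma>])
    finally show ?thesis .
  qed
  show thesis
  proof (rule that[of "C * (1 + \<rho>0)"])
    show "0 < C * (1 + \<rho>0)" using C(1) \<rho>0 by simp
    fix \<nu> \<rho> \<sigma> r assume law: "standardised_law \<nu> \<rho>" and \<sigma>: "0 < \<sigma>" "\<sigma> \<le> 2 * (r::real)"
    have \<nu>m[measurable_cong]: "sets \<nu> = sets borel" using law by (simp add: standardised_law_def)
    interpret prob_space \<nu> using law by (simp add: standardised_law_def)
    have \<rho>: "0 \<le> \<rho>" using law unfolding standardised_law_def
      by (metis (no_types, lifting) integral_nonneg_AE AE_I2 zero_le_power abs_ge_zero order_trans)
    have r: "0 < r" using \<sigma> by simp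
    \<comment> \<open>The standard normal law has defect 0. Subtracting its expansion removes the
      common second-order polynomial and leaves a difference of two remainder integrals.\<close>
    have d: "smoothing_defect \<nu> \<sigma> v = ?H \<nu> \<sigma> v - ?H std_normal_distribution \<sigma> v" for v
      using smoothing_defect_normal[OF \<sigma>(1), of v] integral_hermite_rem(2)[OF law \<sigma>(1), of v]
        integral_hermite_rem(2)[OF n0 \<sigma>(1), of v]
      unfolding smoothing_defect_def by simp
    have [measurable]: "(\<lambda>v. ?H \<nu> \<sigma> v) \<in> borel_measurable borel" by measurable
    interpret N: prob_space std_normal_distribution by (rule prob_space_normal_density) simp
    have [measurable]: "(\<lambda>v. ?H std_normal_distribution \<sigma> v) \<in> borel_measurable borel" by measurable
    have "(\<integral>\<^sup>+v. ennreal (tail_weight r v * \<bar>smoothing_defect \<nu> \<sigma> v\<bar>) \<partial>lborel)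
      \<le> (\<integral>\<^sup>+v. ennreal (tail_weight r v * \<bar>?H \<nu> \<sigma> v\<bar>) +
           ennreal (tail_weight r v * \<bar>?H std_normal_distribution \<sigma> v\<bar>) \<partial>lborel)"
    proof (rule nn_integral_mono)
      fix v
      have w: "0 \<le> tail_weight r v" using tail_weight_ge_1[OF r, of v] by simp
      have "tail_weight r v * \<bar>smoothing_defect \<nu> \<sigma> v\<bar> \<le> tail_weight r v * (\<bar>?H \<nu> \<sigma> v\<bar> + \<bar>?H std_normal_distribution \<sigma> v\<bar>)"
        unfolding d using w by (intro mult_left_mono abs_triangle_ineq4)
      then show "ennreal (tail_weight r v * \<bar>smoothing_defect \<nu> \<sigma> v\<bar>) \<le> ennreal (tail_weight r v * \<bar>?H \<nu> \<sigma> v\<bar>) +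
           ennreal (tail_weight r v * \<bar>?H std_normal_distribution \<sigma> v\<bar>)"
        using w by (subst ennreal_plus[symmetric])
          (auto simp only: distrib_left intro!: ennreal_leI mult_nonneg_nonneg abs_ge_zero)
    qed
    also have "\<dots> = (\<integral>\<^sup>+v. ennreal (tail_weight r v * \<bar>?H \<nu> \<sigma> v\<bar>) \<partial>lborel) +
         (\<integral>\<^sup>+v. ennreal (tail_weight r v * \<bar>?H std_normal_distribution \<sigma> v\<bar>) \<partial>lborel)"
      by (rule nn_integral_add) measurable
    also have "\<dots> \<le> ennreal (C * \<rho> / \<sigma> ^ 3) + ennreal (C * \<rho>0 / \<sigma> ^ 3)"
      by (intro add_mono key law n0 \<sigma>)
    also have "\<dots> = ennreal (C * (\<rho> + \<rho>0) / \<sigma> ^ 3)"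
      using C(1) \<rho> \<rho>0 \<sigma> by (subst ennreal_plus[symmetric]) (auto simp: distrib_left add_divide_distrib)
    also have "\<dots> \<le> ennreal (C * (1 + \<rho>0) * (1 + \<rho>) / \<sigma> ^ 3)"
    proof (intro ennreal_leI divide_right_mono)
      have "\<rho> + \<rho>0 \<le> (1 + \<rho>0) * (1 + \<rho>)" using \<rho> \<rho>0 by (simp add: algebra_simps)
      then show "C * (\<rho> + \<rho>0) \<le> C * (1 + \<rho>0) * (1 + \<rho>)" using C(1) by (simp add: mult.assoc)
    qed (use \<sigma> in auto)
    finally show "(\<integral>\<^sup>+v. ennreal (tail_weight r v * \<bar>smoothing_defect \<nu> \<sigma> v\<bar>) \<partial>lborel)
      \<le> ennreal (C * (1 + \<rho>0) * (1 + \<rho>) / \<sigma> ^ 3)" .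
  qed
qed

section \<open>Distribution functions of sums and desmoothing\<close>

text \<open>Distribution function of the n-fold convolution power, starting from the point mass at
  0. It is kept as a plain function so that the Fubini lemmas for kernels apply without any random
  variables.\<close>

primrec sumcdf :: "real measure \<Rightarrow> nat \<Rightarrow> real \<Rightarrow> real" where
  "sumcdf \<nu> 0 y = indicator {0..} y"
| "sumcdf \<nu> (Suc n) y = (\<integral>u. sumcdf \<nu> n (y - u) \<partial>\<nu>)"

lemma borel_measurable_sumcdf_borel:
  assumes "prob_space \<nu>" "sets \<nu> = sets borel"
  shows "sumcdf \<nu> n \<in> borel_measurable borel"
proof (induction n)
  case 0
  have "sumcdf \<nu> 0 = indicator {0..}" by (simp add: fun_eq_iff)
  then show ?case by simp
next
  case (Suc n)
  interpret prob_space \<nu> by fact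
  note [measurable_cong] = assms(2)
  note [measurable] = Suc
  have "sumcdf \<nu> (Suc n) = (\<lambda>y. \<integral>u. sumcdf \<nu> n (y - u) \<partial>\<nu>)" by (simp add: fun_eq_iff)
  then show ?case by simp
qed

lemma sumcdf_nonneg:
  assumes "prob_space \<nu>" shows "0 \<le> sumcdf \<nu> n y"
  by (induction n arbitrary: y) (auto intro!: integral_nonneg_AE)

lemma sumcdf_integrable:
  assumes "prob_space \<nu>" "sets \<nu> = sets borel" "\<And>y. sumcdf \<nu> n y \<le> 1"
  shows "integrable \<nu> (\<lambda>u. sumcdf \<nu> n (y - u))"
proof -
  interpret prob_space \<nu> by fact
  note [measurable_cong] = assms(2)
  note [measurable] = borel_measurable_sumcdf_borel[OF assms(1,2)]
  show ?thesis
    by (rule integrable_const_bound[of _ 1]) (auto simp: sumcdf_nonneg[OF assms(1)] assms(3))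
qed

lemma sumcdf_le_1:
  assumes "prob_space \<nu>" "sets \<nu> = sets borel"
  shows "sumcdf \<nu> n y \<le> 1"
proof (induction n arbitrary: y)
  case (Suc n)
  interpret prob_space \<nu> by fact
  have "(\<integral>u. sumcdf \<nu> n (y - u) \<partial>\<nu>) \<le> (\<integral>u. 1 \<partial>\<nu>)"
    using Suc by (intro integral_mono sumcdf_integrable assms) auto
  then show ?case by (simp add: prob_space)
qed (simp add: indicator_def)

lemma sumcdf_mono:
  assumes "prob_space \<nu>" "sets \<nu> = sets borel" "x \<le> y"
  shows "sumcdf \<nu> n x \<le> sumcdf \<nu> n y"
  using assms(3)
proof (induction n arbitrary: x y)
  case (Suc n)
  then show ?case
    by (auto intro!: integral_mono sumcdf_integrable assms sumcdf_le_1)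
qed (simp add: indicator_def)

lemma sumcdf_abs_le_1:
  assumes "prob_space \<nu>" "sets \<nu> = sets borel"
  shows "\<bar>sumcdf \<nu> n y\<bar> \<le> 1"
  using sumcdf_le_1[OF assms, of n y] sumcdf_nonneg[OF assms(1), of n y] by simp

section \<open>Fubini for bounded functions against integrable kernels\<close>

lemma integrable_lborel_reflect:
  fixes \<kappa> :: "real \<Rightarrow> real"
  assumes "integrable lborel \<kappa>" shows "integrable lborel (\<lambda>w. \<kappa> (x - w))"
  using lborel_integrable_real_affine[OF assms, of "-1" x] by simp

lemma integrable_bounded_mult_kernel:
  fixes \<kappa> :: "real \<Rightarrow> real"
  assumes "integrable lborel \<kappa>" "f \<in> borel_measurable borel" "\<And>w. \<bar>f w\<bar> \<le> B"
  shows "integrable lborel (\<lambda>w. f w * \<kappa> (x - w))"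
proof (rule Bochner_Integration.integrable_bound)
  show "integrable lborel (\<lambda>w. B * \<kappa> (x - w))"
    using integrable_lborel_reflect[OF assms(1)] by simp
  have [measurable]: "\<kappa> \<in> borel_measurable borel" using assms(1) by simp
  note [measurable] = assms(2)
  show "(\<lambda>w. f w * \<kappa> (x - w)) \<in> borel_measurable lborel" by measurable
  have "\<bar>f w\<bar> \<le> \<bar>B\<bar>" for w using assms(3)[of w] by linarith
  then show "AE w in lborel. norm (f w * \<kappa> (x - w)) \<le> norm (B * \<kappa> (x - w))"
    by (auto simp: abs_mult intro!: mult_right_mono)
qed

lemma integrable_pair_bound:
  fixes g :: "'a \<times> real \<Rightarrow> real"
  assumes "prob_space \<nu>" and g: "g \<in> borel_measurable (\<nu> \<Otimes>\<^sub>M lborel)"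
    and le: "\<And>u. (\<integral>\<^sup>+w. ennreal (norm (g (u, w))) \<partial>lborel) \<le> ennreal K"
  shows "integrable (\<nu> \<Otimes>\<^sub>M lborel) g"
proof (rule integrableI_bounded[OF g])
  interpret prob_space \<nu> by fact
  have "(\<integral>\<^sup>+z. ennreal (norm (g z)) \<partial>(\<nu> \<Otimes>\<^sub>M lborel)) = (\<integral>\<^sup>+u. \<integral>\<^sup>+w. ennreal (norm (g (u, w))) \<partial>lborel \<partial>\<nu>)"
    using g by (intro lborel.nn_integral_fst[symmetric]) auto
  also have "\<dots> \<le> (\<integral>\<^sup>+u. ennreal K \<partial>\<nu>)" by (intro nn_integral_mono le)
  also have "\<dots> = ennreal K" by (simp add: emeasure_space_1)
  finally show "(\<integral>\<^sup>+z. ennreal (norm (g z)) \<partial>(\<nu> \<Otimes>\<^sub>M lborel)) < \<infinity>" by (simp add: order_le_less_trans)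
qed

lemma nn_integral_kernel_shift:
  fixes \<kappa> :: "real \<Rightarrow> real"
  assumes [measurable]: "\<kappa> \<in> borel_measurable borel"
  shows "(\<integral>\<^sup>+w. ennreal (\<kappa> (x - w)) \<partial>lborel) = (\<integral>\<^sup>+w. ennreal (\<kappa> w) \<partial>lborel)"
  using nn_integral_real_affine[of "\<lambda>w. ennreal (\<kappa> w)" "-1" x] by simp

lemma integrable_pair_kernel:
  fixes \<kappa> :: "real \<Rightarrow> real"
  assumes "prob_space \<nu>" and "h \<in> borel_measurable (\<nu> \<Otimes>\<^sub>M lborel)"
    and \<kappa>: "integrable lborel \<kappa>" and le: "\<And>u w. \<bar>h (u, w)\<bar> \<le> B * \<bar>\<kappa> (c u - w)\<bar>" and B: "0 \<le> B"
  shows "integrable (\<nu> \<Otimes>\<^sub>M lborel) h"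
proof (rule integrable_pair_bound[OF assms(1,2)])
  fix u
  have [measurable]: "\<kappa> \<in> borel_measurable borel" using \<kappa> by simp
  have "(\<integral>\<^sup>+w. ennreal (norm (h (u, w))) \<partial>lborel) \<le> (\<integral>\<^sup>+w. ennreal (B * \<bar>\<kappa> (c u - w)\<bar>) \<partial>lborel)"
    using le by (intro nn_integral_mono ennreal_leI) auto
  also have "\<dots> = (\<integral>\<^sup>+w. ennreal (B * \<bar>\<kappa> w\<bar>) \<partial>lborel)"
    by (rule nn_integral_kernel_shift) measurable
  also have "\<dots> = ennreal (\<integral>w. B * \<bar>\<kappa> w\<bar> \<partial>lborel)"
    using \<kappa> B by (intro nn_integral_eq_integral) auto
  finally show "(\<integral>\<^sup>+w. ennreal (norm (h (u, w))) \<partial>lborel) \<le> ennreal (\<integral>w. B * \<bar>\<kappa> w\<bar> \<partial>lborel)" .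
qed

lemma fubini_kernel:
  fixes \<kappa> :: "real \<Rightarrow> real"
  assumes \<nu>: "prob_space \<nu>" "sets \<nu> = sets borel" and \<kappa>: "integrable lborel \<kappa>"
    and f[measurable]: "f \<in> borel_measurable borel" and B: "\<And>w. \<bar>f w\<bar> \<le> B"
  shows "(\<integral>u. (\<integral>w. f w * \<kappa> (x - w - u) \<partial>lborel) \<partial>\<nu>) = (\<integral>w. f w * (\<integral>u. \<kappa> (x - w - u) \<partial>\<nu>) \<partial>lborel)"
proof -
  interpret prob_space \<nu> by fact
  interpret pair_sigma_finite \<nu> lborel ..
  note [measurable_cong] = \<nu>(2)
  have [measurable]: "\<kappa> \<in> borel_measurable borel" using \<kappa> by simp
  have B0: "0 \<le> B" using B[of 0] by linarith
  have "integrable (\<nu> \<Otimes>\<^sub>M lborel) (case_prod (\<lambda>u w. f w * \<kappa> (x - w - u)))"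
    by (rule integrable_pair_kernel[OF \<nu>(1) _ \<kappa>, of _ B "\<lambda>u. x - u"])
      (auto simp: abs_mult B0 algebra_simps intro!: mult_left_mono mult_right_mono B)
  from Fubini_integral[OF this] show ?thesis by simp
qed

text \<open>Associativity of convolution: averaging \<open>f\<close> over \<open>\<nu>\<close> and
  then applying the kernel is the same as applying the averaged kernel to \<open>f\<close>. This is
  how the last summand is transferred from the distribution function to the smoothing
  kernel.\<close>

lemma fubini_shift:
  fixes \<kappa> :: "real \<Rightarrow> real"
  assumes \<nu>: "prob_space \<nu>" "sets \<nu> = sets borel" and \<kappa>: "integrable lborel \<kappa>"
    and f[measurable]: "f \<in> borel_measurable borel" and B: "\<And>w. \<bar>f w\<bar> \<le> B"
  shows "(\<integral>w. (\<integral>u. f (w - u) \<partial>\<nu>) * \<kappa> (x - w) \<partial>lborel) = (\<integral>w. f w * (\<integral>u. \<kappa> (x - w - u) \<partial>\<nu>) \<partial>lborel)"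
proof -
  interpret prob_space \<nu> by fact
  interpret pair_sigma_finite \<nu> lborel ..
  note [measurable_cong] = \<nu>(2)
  have [measurable]: "\<kappa> \<in> borel_measurable borel" using \<kappa> by simp
  have B0: "0 \<le> B" using B[of 0] by linarith
  have i: "integrable (\<nu> \<Otimes>\<^sub>M lborel) (case_prod (\<lambda>u w. f (w - u) * \<kappa> (x - w)))"
    by (rule integrable_pair_kernel[OF \<nu>(1) _ \<kappa>, of _ B "\<lambda>u. x"])
      (auto simp: abs_mult B0 intro!: mult_right_mono B)
  have "(\<integral>w. (\<integral>u. f (w - u) \<partial>\<nu>) * \<kappa> (x - w) \<partial>lborel) = (\<integral>w. (\<integral>u. f (w - u) * \<kappa> (x - w) \<partial>\<nu>) \<partial>lborel)"
    by simp
  also have "\<dots> = (\<integral>u. (\<integral>w. f (w - u) * \<kappa> (x - w) \<partial>lborel) \<partial>\<nu>)"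
    by (rule Fubini_integral[OF i])
  also have "\<dots> = (\<integral>u. (\<integral>w. f w * \<kappa> (x - w - u) \<partial>lborel) \<partial>\<nu>)"
  proof (rule Bochner_Integration.integral_cong[OF refl])
    fix u
    show "(\<integral>w. f (w - u) * \<kappa> (x - w) \<partial>lborel) = (\<integral>w. f w * \<kappa> (x - w - u) \<partial>lborel)"
      using lborel_integral_real_affine[of 1 "\<lambda>w. f (w - u) * \<kappa> (x - w)" u]
      by (simp add: algebra_simps)
  qed
  also have "\<dots> = (\<integral>w. f w * (\<integral>u. \<kappa> (x - w - u) \<partial>\<nu>) \<partial>lborel)"
    by (rule fubini_kernel[OF \<nu> \<kappa> f B])
  finally show ?thesis .
qed

lemma integral_kernel_reflect:
  fixes \<kappa> :: "real \<Rightarrow> real"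
  shows "(\<integral>w. \<kappa> (x - w) \<partial>lborel) = (\<integral>w. \<kappa> w \<partial>lborel)"
  using lborel_integral_real_affine[of "-1" \<kappa> x] by simp

section \<open>The smoothing defect as a convolution kernel\<close>

lemma sets_std_normal: "sets std_normal_distribution = sets borel" by simp

lemma prob_space_std_normal: "prob_space std_normal_distribution"
  by (rule prob_space_normal_density) simp

lemma integrable_smoothing_defect:
  assumes law: "standardised_law \<nu> \<rho>" and \<sigma>: "0 < \<sigma>"
  shows "integrable lborel (smoothing_defect \<nu> \<sigma>)"
proof (rule integrableI_bounded)
  show "smoothing_defect \<nu> \<sigma> \<in> borel_measurable lborel"
    using borel_measurable_smoothing_defect[OF law, of "\<lambda>x. x" borel \<sigma>] by simp
  obtain C where C: "(\<integral>\<^sup>+v. ennreal (tail_weight \<sigma> v * \<bar>smoothing_defect \<nu> \<sigma> v\<bar>) \<partial>lborel)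
      \<le> ennreal (C * (1 + \<rho>) / \<sigma> ^ 3)" using smoothing_defect_bound[of thesis] law \<sigma>
    by (metis less_eq_real_def mult_2 le_add_same_cancel1)
  have "(\<integral>\<^sup>+v. ennreal (norm (smoothing_defect \<nu> \<sigma> v)) \<partial>lborel)
    \<le> (\<integral>\<^sup>+v. ennreal (tail_weight \<sigma> v * \<bar>smoothing_defect \<nu> \<sigma> v\<bar>) \<partial>lborel)"
  proof (intro nn_integral_mono ennreal_leI)
    fix v show "norm (smoothing_defect \<nu> \<sigma> v) \<le> tail_weight \<sigma> v * \<bar>smoothing_defect \<nu> \<sigma> v\<bar>"
      using mult_right_mono[OF tail_weight_ge_1[OF \<sigma>, of v], of "\<bar>smoothing_defect \<nu> \<sigma> v\<bar>"] by simp
  qed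
  also note C
  finally show "(\<integral>\<^sup>+v. ennreal (norm (smoothing_defect \<nu> \<sigma> v)) \<partial>lborel) < \<infinity>"
    by (simp add: order_le_less_trans)
qed

text \<open>The defect is N(0, \<sigma>^2) convolved with the signed measure \<open>\<nu>\<close>
  minus N(0, 1); one more independent standard normal variable therefore only raises \<sigma>^2 by
  1.\<close>

lemma smoothing_defect_normal_conv:
  assumes law: "standardised_law \<nu> \<rho>" and \<sigma>: "0 < \<sigma>"
  shows "(\<integral>u. smoothing_defect \<nu> \<sigma> (v - u) \<partial>std_normal_distribution)
     = smoothing_defect \<nu> (sqrt (\<sigma>\<^sup>2 + 1)) v"
proof -
  interpret prob_space \<nu> using law by (simp add: standardised_law_def)
  interpret N: prob_space std_normal_distribution by (rule prob_space_std_normal)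
  interpret pair_sigma_finite \<nu> std_normal_distribution ..
  interpret pp: pair_prob_space \<nu> std_normal_distribution ..
  have [measurable_cong]: "sets \<nu> = sets borel" using law by (simp add: standardised_law_def)
  have s: "0 < sqrt (\<sigma>\<^sup>2 + 1)" using \<sigma> by (simp add: add_pos_pos)
  have nb: "\<bar>normal_density 0 \<sigma> t\<bar> \<le> 1 / \<sigma>" for t using normal_density_bounded[OF \<sigma>, of t] by simp
  have i: "integrable (\<nu> \<Otimes>\<^sub>M std_normal_distribution) (case_prod (\<lambda>u' u. normal_density 0 \<sigma> (v - u - u')))"
    using nb by (intro pp.integrable_const_bound[of _ "1 / \<sigma>"]) auto
  have i1: "integrable std_normal_distribution (\<lambda>u. \<integral>u'. normal_density 0 \<sigma> (v - u - u') \<partial>\<nu>)"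
    using integrable_snd[OF i] by simp
  have i2: "integrable std_normal_distribution (\<lambda>u. normal_density 0 (sqrt (\<sigma>\<^sup>2 + 1)) (v - u))"
    using normal_density_bounded[OF s] by (intro N.integrable_const_bound[of _ "1 / sqrt (\<sigma>\<^sup>2 + 1)"]) auto
  have "(\<integral>u. smoothing_defect \<nu> \<sigma> (v - u) \<partial>std_normal_distribution)
    = (\<integral>u. (\<integral>u'. normal_density 0 \<sigma> (v - u - u') \<partial>\<nu>) \<partial>std_normal_distribution)
      - (\<integral>u. normal_density 0 (sqrt (\<sigma>\<^sup>2 + 1)) (v - u) \<partial>std_normal_distribution)"
    unfolding smoothing_defect_def by (rule Bochner_Integration.integral_diff[OF i1 i2])
  also have "(\<integral>u. (\<integral>u'. normal_density 0 \<sigma> (v - u - u') \<partial>\<nu>) \<partial>std_normal_distribution)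
     = (\<integral>u'. (\<integral>u. normal_density 0 \<sigma> (v - u' - u) \<partial>std_normal_distribution) \<partial>\<nu>)"
    using Fubini_integral[OF i] by (simp add: algebra_simps)
  also have "\<dots> = (\<integral>u'. normal_density 0 (sqrt (\<sigma>\<^sup>2 + 1)) (v - u') \<partial>\<nu>)"
    using normal_density_convolution[OF \<sigma>, of 1] by simp
  finally show ?thesis
    using normal_density_convolution[OF s, of 1 v] by (simp add: smoothing_defect_def)
qed

text \<open>Both terms of the defect are probability densities. The zero total mass will allow a
  half-line to be exchanged for its complement.\<close>

lemma integral_smoothing_defect:
  assumes law: "standardised_law \<nu> \<rho>" and \<sigma>: "0 < \<sigma>"
  shows "(\<integral>w. smoothing_defect \<nu> \<sigma> w \<partial>lborel) = 0"
proof -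
  have \<nu>: "prob_space \<nu>" "sets \<nu> = sets borel" using law by (auto simp: standardised_law_def)
  interpret prob_space \<nu> by fact
  note [measurable_cong] = \<nu>(2)
  have s: "0 < sqrt (\<sigma>\<^sup>2 + 1)" using \<sigma> by (simp add: add_pos_pos)
  have "(\<integral>w. (\<integral>u. 1 \<partial>\<nu>) * normal_density 0 \<sigma> (0 - w) \<partial>lborel)
     = (\<integral>w. 1 * (\<integral>u. normal_density 0 \<sigma> (0 - w - u) \<partial>\<nu>) \<partial>lborel)"
    by (rule fubini_shift[OF \<nu>, where f = "\<lambda>_. 1" and B = 1]) (use \<sigma> in auto)
  then have e: "(\<integral>w. (\<integral>u. normal_density 0 \<sigma> (0 - w - u) \<partial>\<nu>) \<partial>lborel) = 1"
    using integral_kernel_reflect[of "normal_density 0 \<sigma>" 0] integral_normal_density[OF \<sigma>, of 0]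
    by (simp add: prob_space)
  then have "(\<integral>w. (\<integral>u. normal_density 0 \<sigma> (w - u) \<partial>\<nu>) \<partial>lborel) = 1"
    using integral_kernel_reflect[of "\<lambda>w. \<integral>u. normal_density 0 \<sigma> (w - u) \<partial>\<nu>" 0] by simp
  \<comment> \<open>A function that is not integrable has Bochner integral 0, so the value 1 already
    proves integrability.\<close>
  moreover from this have "integrable lborel (\<lambda>w. \<integral>u. normal_density 0 \<sigma> (w - u) \<partial>\<nu>)"
    using not_integrable_integral_eq by force
  ultimately show ?thesis
    unfolding smoothing_defect_def using integral_normal_density[OF s, of 0] integrable_normal_density[OF s, of 0]
    by (subst Bochner_Integration.integral_diff) auto
qed

text \<open>One step of the telescoping: the last summand is absorbed by the kernel as if it were
  normal, which raises \<sigma>^2 by 1, and the defect records the error.\<close>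

lemma sumcdf_smoothing_step:
  assumes law: "standardised_law \<nu> \<rho>" and \<sigma>: "0 < \<sigma>"
  shows "(\<integral>w. sumcdf \<nu> (Suc k) w * normal_density 0 \<sigma> (x - w) \<partial>lborel) =
     (\<integral>w. sumcdf \<nu> k w * normal_density 0 (sqrt (\<sigma>\<^sup>2 + 1)) (x - w) \<partial>lborel)
     + (\<integral>w. sumcdf \<nu> k w * smoothing_defect \<nu> \<sigma> (x - w) \<partial>lborel)"
proof -
  have \<nu>: "prob_space \<nu>" "sets \<nu> = sets borel" using law by (auto simp: standardised_law_def)
  note b = borel_measurable_sumcdf_borel[OF \<nu>] sumcdf_abs_le_1[OF \<nu>]
  have "(\<integral>w. sumcdf \<nu> (Suc k) w * normal_density 0 \<sigma> (x - w) \<partial>lborel)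
    = (\<integral>w. sumcdf \<nu> k w * (\<integral>u. normal_density 0 \<sigma> (x - w - u) \<partial>\<nu>) \<partial>lborel)"
    unfolding sumcdf.simps by (rule fubini_shift[OF \<nu> _ b]) (use \<sigma> in auto)
  also have "\<dots> = (\<integral>w. sumcdf \<nu> k w * normal_density 0 (sqrt (\<sigma>\<^sup>2 + 1)) (x - w) +
      sumcdf \<nu> k w * smoothing_defect \<nu> \<sigma> (x - w) \<partial>lborel)"
    unfolding smoothing_defect_def by (simp add: algebra_simps)
  also have "\<dots> = (\<integral>w. sumcdf \<nu> k w * normal_density 0 (sqrt (\<sigma>\<^sup>2 + 1)) (x - w) \<partial>lborel)
     + (\<integral>w. sumcdf \<nu> k w * smoothing_defect \<nu> \<sigma> (x - w) \<partial>lborel)"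
    using \<sigma> by (intro Bochner_Integration.integral_add integrable_bounded_mult_kernel[OF _ b]
       integrable_smoothing_defect[OF law] integrable_normal_density) (auto simp: add_pos_pos)
  finally show ?thesis .
qed

text \<open>Normal summands can be moved into the kernel one by one. With \<open>k\<close> of them
  present the defect acts at variance \<sigma>^2 + k, and its \<sigma>^(-3) decay makes this part
  small.\<close>

lemma sumcdf_normal_defect:
  assumes law: "standardised_law \<nu> \<rho>" and \<sigma>: "0 < \<sigma>"
  shows "(\<integral>w. sumcdf std_normal_distribution k w * smoothing_defect \<nu> \<sigma> (x - w) \<partial>lborel)
    = (\<integral>w. indicator {0..} w * smoothing_defect \<nu> (sqrt (\<sigma>\<^sup>2 + real k)) (x - w) \<partial>lborel)"
  using \<sigma>
proof (induction k arbitrary: \<sigma>)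
  case 0
  then show ?case by simp
next
  case (Suc k)
  note N = prob_space_std_normal sets_std_normal
  have s: "0 < sqrt (\<sigma>\<^sup>2 + 1)" using Suc.prems by (simp add: add_pos_pos)
  have "(\<integral>w. sumcdf std_normal_distribution (Suc k) w * smoothing_defect \<nu> \<sigma> (x - w) \<partial>lborel)
    = (\<integral>w. sumcdf std_normal_distribution k w * (\<integral>u. smoothing_defect \<nu> \<sigma> (x - w - u) \<partial>std_normal_distribution) \<partial>lborel)"
    unfolding sumcdf.simps
    by (rule fubini_shift[OF N integrable_smoothing_defect[OF law Suc.prems]
        borel_measurable_sumcdf_borel[OF N] sumcdf_abs_le_1[OF N]])
  also have "\<dots> = (\<integral>w. sumcdf std_normal_distribution k w * smoothing_defect \<nu> (sqrt (\<sigma>\<^sup>2 + 1)) (x - w) \<partial>lborel)"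
    by (simp add: smoothing_defect_normal_conv[OF law Suc.prems])
  also have "\<dots> = (\<integral>w. indicator {0..} w * smoothing_defect \<nu> (sqrt ((sqrt (\<sigma>\<^sup>2 + 1))\<^sup>2 + real k)) (x - w) \<partial>lborel)"
    by (rule Suc.IH[OF s])
  finally show ?case by (simp add: add_ac)
qed

text \<open>A weighted Young inequality. The assumption concerns the product of \<open>f\<close> and
  the kernel, to cover two uses: \<open>D\<close> a weighted sup norm of \<open>f\<close>, by
  submultiplicativity, and \<open>D = 1\<close> for the indicator of a half-line on which the weight
  at x is at most that at x - w.\<close>

lemma weighted_kernel_bound:
  fixes \<kappa> :: "real \<Rightarrow> real"
  assumes r: "0 < r" and \<kappa>[measurable]: "\<kappa> \<in> borel_measurable borel"
    and K: "(\<integral>\<^sup>+v. ennreal (tail_weight r v * \<bar>\<kappa> v\<bar>) \<partial>lborel) \<le> ennreal K" "0 \<le> K"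
    and f[measurable]: "f \<in> borel_measurable borel"
    and D: "0 \<le> D" "\<And>w. tail_weight r x * \<bar>f w * \<kappa> (x - w)\<bar> \<le> D * (tail_weight r (x - w) * \<bar>\<kappa> (x - w)\<bar>)"
  shows "tail_weight r x * \<bar>\<integral>w. f w * \<kappa> (x - w) \<partial>lborel\<bar> \<le> D * K"
proof -
  have w0: "0 \<le> tail_weight r v" for v using tail_weight_ge_1[OF r, of v] by simp
  have "ennreal (tail_weight r x * \<bar>\<integral>w. f w * \<kappa> (x - w) \<partial>lborel\<bar>)
     \<le> (\<integral>\<^sup>+w. ennreal (tail_weight r x * \<bar>f w * \<kappa> (x - w)\<bar>) \<partial>lborel)"
  proof (cases "integrable lborel (\<lambda>w. f w * \<kappa> (x - w))")
    case True
    have "ennreal (tail_weight r x * \<bar>\<integral>w. f w * \<kappa> (x - w) \<partial>lborel\<bar>)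
      = ennreal (tail_weight r x) * ennreal (norm (\<integral>w. f w * \<kappa> (x - w) \<partial>lborel))"
      using w0 by (simp add: ennreal_mult)
    also have "\<dots> \<le> ennreal (tail_weight r x) * (\<integral>\<^sup>+w. ennreal (norm (f w * \<kappa> (x - w))) \<partial>lborel)"
      by (intro mult_left_mono integral_norm_bound_ennreal True) auto
    also have "\<dots> = (\<integral>\<^sup>+w. ennreal (tail_weight r x * \<bar>f w * \<kappa> (x - w)\<bar>) \<partial>lborel)"
      using w0 by (subst nn_integral_cmult[symmetric]) (auto simp: ennreal_mult)
    finally show ?thesis .
  next
    case False
    then show ?thesis by (simp add: not_integrable_integral_eq)
  qed
  also have "\<dots> \<le> (\<integral>\<^sup>+w. ennreal D * ennreal (tail_weight r (x - w) * \<bar>\<kappa> (x - w)\<bar>) \<partial>lborel)"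
    using D w0 by (intro nn_integral_mono) (auto simp: ennreal_mult[symmetric] intro!: ennreal_leI)
  also have "\<dots> = ennreal D * (\<integral>\<^sup>+w. ennreal (tail_weight r (x - w) * \<bar>\<kappa> (x - w)\<bar>) \<partial>lborel)"
    by (rule nn_integral_cmult) measurable
  also have "(\<integral>\<^sup>+w. ennreal (tail_weight r (x - w) * \<bar>\<kappa> (x - w)\<bar>) \<partial>lborel)
      = (\<integral>\<^sup>+w. ennreal (tail_weight r w * \<bar>\<kappa> w\<bar>) \<partial>lborel)"
    by (rule nn_integral_kernel_shift) measurable
  also have "ennreal D * \<dots> \<le> ennreal D * ennreal K" by (intro mult_left_mono K) auto
  also have "\<dots> = ennreal (D * K)" using D K by (simp add: ennreal_mult)
  finally show ?thesis using D K by (simp add: ennreal_le_iff)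
qed

lemma tail_weight_mono: "0 < r \<Longrightarrow> \<bar>v\<bar> \<le> \<bar>w\<bar> \<Longrightarrow> tail_weight r v \<le> tail_weight r w"
  unfolding tail_weight_def by (intro power_mono add_left_mono divide_right_mono) auto

text \<open>If x \<le> 0 then |x| \<le> |x - w| for all w \<ge> 0, so the weight can be moved inside
  the integral. If x > 0 this holds for w < 0 instead, and the zero total mass of the defect
  replaces the half-line by its complement up to sign.\<close>

lemma half_line_defect_bound:
  assumes law: "standardised_law \<nu> \<rho>" and \<sigma>: "0 < \<sigma>" and r: "0 < r"
    and K: "(\<integral>\<^sup>+v. ennreal (tail_weight r v * \<bar>smoothing_defect \<nu> \<sigma> v\<bar>) \<partial>lborel) \<le> ennreal K" "0 \<le> K"
  shows "tail_weight r x * \<bar>\<integral>w. indicator {0..} w * smoothing_defect \<nu> \<sigma> (x - w) \<partial>lborel\<bar> \<le> K"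
proof -
  let ?\<psi> = "smoothing_defect \<nu> \<sigma>"
  have [measurable]: "?\<psi> \<in> borel_measurable borel"
    using borel_measurable_smoothing_defect[OF law, of "\<lambda>x. x" borel \<sigma>] by simp
  have half: "tail_weight r x * \<bar>\<integral>w. indicator A w * ?\<psi> (x - w) \<partial>lborel\<bar> \<le> 1 * K"
    if [measurable]: "A \<in> sets borel" and A: "\<And>w. w \<in> A \<Longrightarrow> \<bar>x\<bar> \<le> \<bar>x - w\<bar>" for A
  proof (rule weighted_kernel_bound[OF r _ K])
    fix w
    have "tail_weight r x * \<bar>?\<psi> (x - w)\<bar> \<le> tail_weight r (x - w) * \<bar>?\<psi> (x - w)\<bar>" if "w \<in> A"
      using A[OF that] r by (intro mult_right_mono tail_weight_mono) auto
    then show "tail_weight r x * \<bar>indicator A w * ?\<psi> (x - w)\<bar> \<le> 1 * (tail_weight r (x - w) * \<bar>?\<psi> (x - w)\<bar>)"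
      using tail_weight_ge_1[OF r, of "x - w"] by (cases "w \<in> A") auto
  qed auto
  show ?thesis
  proof (cases "x \<le> 0")
    case True
    then show ?thesis using half[of "{0..}"] by auto
  next
    case False
    note i = integrable_bounded_mult_kernel[OF integrable_smoothing_defect[OF law \<sigma>], of _ 1 x]
    have "(\<integral>w. indicator {0..} w * ?\<psi> (x - w) \<partial>lborel) + (\<integral>w. indicator {..<0} w * ?\<psi> (x - w) \<partial>lborel)
      = (\<integral>w. indicator {0..} w * ?\<psi> (x - w) + indicator {..<0} w * ?\<psi> (x - w) \<partial>lborel)"
      by (rule Bochner_Integration.integral_add[symmetric]; rule i) (auto simp: indicator_def)
    also have "\<dots> = (\<integral>w. ?\<psi> (x - w) \<partial>lborel)"
      by (rule Bochner_Integration.integral_cong) (auto simp: indicator_def)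
    also have "\<dots> = 0" using integral_smoothing_defect[OF law \<sigma>] integral_kernel_reflect[of ?\<psi> x] by simp
    finally have "\<bar>\<integral>w. indicator {0..} w * ?\<psi> (x - w) \<partial>lborel\<bar> = \<bar>\<integral>w. indicator {..<0} w * ?\<psi> (x - w) \<partial>lborel\<bar>"
      by linarith
    then show ?thesis using half[of "{..<0}"] False by auto
  qed
qed

section \<open>Finiteness of the weighted norm for each n\<close>

lemma prob_space_standardised_law: "standardised_law \<nu> \<rho> \<Longrightarrow> prob_space \<nu>"
  and sets_standardised_law: "standardised_law \<nu> \<rho> \<Longrightarrow> sets \<nu> = sets borel"
  by (simp_all add: standardised_law_def)

lemma standardised_law_tail_weight:
  assumes law: "standardised_law \<nu> \<rho>"
  shows "integrable \<nu> (tail_weight 1)" "(\<integral>u. tail_weight 1 u \<partial>\<nu>) \<le> 8 * (1 + \<rho>)"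
proof -
  interpret prob_space \<nu> using law by (rule prob_space_standardised_law)
  note [measurable_cong] = sets_standardised_law[OF law]
  have le: "tail_weight 1 u \<le> 8 * (1 + \<bar>u\<bar> ^ 3)" for u
  proof -
    have "tail_weight 1 u \<le> (2 * max 1 \<bar>u\<bar>) ^ 3" unfolding tail_weight_def by (intro power_mono) auto
    then show ?thesis unfolding power_mult_distrib by (auto simp: max_def add_increasing2 split: if_splits)
  qed
  have i: "integrable \<nu> (\<lambda>u. 8 * (1 + \<bar>u\<bar> ^ 3))" using law by (simp add: standardised_law_def)
  show i1: "integrable \<nu> (tail_weight 1)"
    using le by (intro Bochner_Integration.integrable_bound[OF i]) (auto simp: tail_weight_def[abs_def])
  have "(\<integral>u. tail_weight 1 u \<partial>\<nu>) \<le> (\<integral>u. 8 * (1 + \<bar>u\<bar> ^ 3) \<partial>\<nu>)"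
    using le by (intro integral_mono i1 i) auto
  also have "\<dots> = 8 * (1 + (\<integral>u. \<bar>u\<bar> ^ 3 \<partial>\<nu>))"
    using law by (simp add: standardised_law_def prob_space)
  finally show "(\<integral>u. tail_weight 1 u \<partial>\<nu>) \<le> 8 * (1 + \<rho>)" using law by (simp add: standardised_law_def)
qed

text \<open>Only the finiteness of this bound matters: desmoothing absorbs a fraction of the weighted norm of
  the difference into the left-hand side, so that norm must be known to be finite.\<close>
primrec crude_tail :: "real \<Rightarrow> nat \<Rightarrow> real" where
  "crude_tail \<rho> 0 = 0"
| "crude_tail \<rho> (Suc n) = (crude_tail \<rho> n + 1) * (8 * (1 + \<rho>))"

lemma standardised_law_nonneg: "standardised_law \<nu> \<rho> \<Longrightarrow> 0 \<le> \<rho>"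
  unfolding standardised_law_def
  by (metis (no_types, lifting) integral_nonneg_AE AE_I2 zero_le_power abs_ge_zero order_trans)

lemma crude_tail_nonneg: "0 \<le> \<rho> \<Longrightarrow> 0 \<le> crude_tail \<rho> n"
  by (induction n) auto

text \<open>The comparison with the unit step survives one more convolution: the steps at y - u and
  at y differ only if |y| \<le> |u|, in which case the weight at y is at most that at u, and the
  latter is integrable.\<close>

lemma sumcdf_crude_tail:
  assumes law: "standardised_law \<nu> \<rho>"
  shows "\<bar>sumcdf \<nu> n y - indicator {0..} y\<bar> * tail_weight 1 y \<le> crude_tail \<rho> n"
proof (induction n arbitrary: y)
  case (Suc n)
  interpret prob_space \<nu> using law by (rule prob_space_standardised_law)
  note \<nu> = prob_space_axioms sets_standardised_law[OF law]
  note [measurable_cong] = \<nu>(2)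
  note [measurable] = borel_measurable_sumcdf_borel[OF \<nu>]
  note w1 = tail_weight_ge_1[of 1, OF zero_less_one]
  have \<rho>: "0 \<le> \<rho>" using law by (rule standardised_law_nonneg)
  let ?I = "indicator {0..} :: real \<Rightarrow> real"
  have pt: "\<bar>sumcdf \<nu> n (y - u) - ?I y\<bar> * tail_weight 1 y \<le> (crude_tail \<rho> n + 1) * tail_weight 1 u" for u
  proof -
    have "tail_weight 1 y \<le> tail_weight 1 (y - u) * tail_weight 1 u"
      using tail_weight_submult[of 1 "y - u" u] by simp
    then have "\<bar>sumcdf \<nu> n (y - u) - ?I (y - u)\<bar> * tail_weight 1 y
      \<le> \<bar>sumcdf \<nu> n (y - u) - ?I (y - u)\<bar> * (tail_weight 1 (y - u) * tail_weight 1 u)"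
      by (intro mult_left_mono) auto
    also have "\<dots> \<le> crude_tail \<rho> n * tail_weight 1 u"
      using Suc[of "y - u"] w1[of u] unfolding mult.assoc[symmetric] by (intro mult_right_mono) auto
    finally have 1: "\<bar>sumcdf \<nu> n (y - u) - ?I (y - u)\<bar> * tail_weight 1 y \<le> crude_tail \<rho> n * tail_weight 1 u" .
    have 2: "\<bar>?I (y - u) - ?I y\<bar> * tail_weight 1 y \<le> tail_weight 1 u"
    proof (cases "?I (y - u) = ?I y")
      case True
      then show ?thesis using w1[of u] by simp
    next
      case False
      then have "(0 \<le> y - u) \<noteq> (0 \<le> y)"
        by (cases "0 \<le> y - u"; cases "0 \<le> y") (auto simp: indicator_def)
      then have "\<bar>y\<bar> \<le> \<bar>u\<bar>" by arith
      then have "tail_weight 1 y \<le> tail_weight 1 u" by (intro tail_weight_mono) auto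
      then show ?thesis using False by (auto simp: indicator_def split: if_splits)
    qed
    have "\<bar>sumcdf \<nu> n (y - u) - ?I y\<bar> * tail_weight 1 y \<le>
      (\<bar>sumcdf \<nu> n (y - u) - ?I (y - u)\<bar> + \<bar>?I (y - u) - ?I y\<bar>) * tail_weight 1 y"
      using w1[of y] by (intro mult_right_mono) auto
    with 1 2 show ?thesis by (simp add: distrib_right)
  qed
  have i: "integrable \<nu> (\<lambda>u. sumcdf \<nu> n (y - u))"
    by (rule sumcdf_integrable[OF \<nu> sumcdf_le_1[OF \<nu>]])
  have "\<bar>sumcdf \<nu> (Suc n) y - ?I y\<bar> * tail_weight 1 y = \<bar>\<integral>u. (sumcdf \<nu> n (y - u) - ?I y) * tail_weight 1 y \<partial>\<nu>\<bar>"
    using i w1[of y] by (simp add: prob_space abs_mult)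
  also have "\<dots> \<le> (\<integral>u. (crude_tail \<rho> n + 1) * tail_weight 1 u \<partial>\<nu>)"
  proof (rule integral_abs_bound[THEN order_trans], rule integral_mono)
    show "integrable \<nu> (\<lambda>u. \<bar>(sumcdf \<nu> n (y - u) - ?I y) * tail_weight 1 y\<bar>)"
      using i by auto
    show "integrable \<nu> (\<lambda>u. (crude_tail \<rho> n + 1) * tail_weight 1 u)"
      using standardised_law_tail_weight(1)[OF law] by auto
    show "\<bar>(sumcdf \<nu> n (y - u) - ?I y) * tail_weight 1 y\<bar> \<le> (crude_tail \<rho> n + 1) * tail_weight 1 u" for u
      using pt[of u] w1[of y] by (simp add: abs_mult)
  qed
  also have "\<dots> \<le> crude_tail \<rho> (Suc n)"
    using standardised_law_tail_weight(2)[OF law] crude_tail_nonneg[OF \<rho>, of n] by (auto intro!: mult_left_mono)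
  finally show ?case .
qed (simp add: indicator_def)

section \<open>Explicit estimates for the normal law\<close>

lemma cdf_density_real:
  assumes [measurable]: "f \<in> borel_measurable borel" and f: "\<And>x. 0 \<le> f x" "integrable lborel f"
  shows "cdf (density lborel (\<lambda>x. ennreal (f x))) y = (\<integral>w. indicator {..y} w * f w \<partial>lborel)"
proof -
  have "emeasure (density lborel (\<lambda>x. ennreal (f x))) {..y} = (\<integral>\<^sup>+w. ennreal (indicator {..y} w * f w) \<partial>lborel)"
    by (subst emeasure_density) (auto intro!: nn_integral_cong simp: indicator_def)
  also have "\<dots> = ennreal (\<integral>w. indicator {..y} w * f w \<partial>lborel)"
    using f by (intro nn_integral_eq_integral Bochner_Integration.integrable_bound[OF f(2)])
      (auto simp: indicator_def)
  finally show ?thesis using f by (simp add: cdf_def measure_def integral_nonneg_AE indicator_def)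
qed

lemma sumcdf_normal:
  assumes "0 < n"
  shows "sumcdf std_normal_distribution n y = cdf std_normal_distribution (y / sqrt (real n))"
proof -
  note N = prob_space_std_normal sets_std_normal
  \<comment> \<open>The induction starts with one summand, because zero summands would require a
    normal density of variance 0.\<close>
  have "sumcdf std_normal_distribution (Suc n) y
     = (\<integral>w. indicator {0..} w * normal_density 0 (sqrt (real (Suc n))) (y - w) \<partial>lborel)" for n
  proof (induction n arbitrary: y)
    case 0
    have "sumcdf std_normal_distribution (Suc 0) y = (\<integral>u. std_normal_density u * indicator {0..} (y - u) \<partial>lborel)"
      by (simp add: integral_real_density)
    also have "\<dots> = (\<integral>w. indicator {0..} w * std_normal_density (y - w) \<partial>lborel)"
      using integral_kernel_reflect[of "\<lambda>u. std_normal_density u * indicator {0..} (y - u)" y]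
      by (simp add: mult.commute)
    finally show ?case by simp
  next
    case (Suc n)
    have "sumcdf std_normal_distribution (Suc (Suc n)) y
       = (\<integral>u. (\<integral>w. indicator {0..} w * normal_density 0 (sqrt (real (Suc n))) (y - w - u) \<partial>lborel) \<partial>std_normal_distribution)"
      by (subst sumcdf.simps(2)) (simp only: Suc.IH diff_diff_eq add.commute)
    also have "\<dots> = (\<integral>w. indicator {0..} w * (\<integral>u. normal_density 0 (sqrt (real (Suc n))) (y - w - u) \<partial>std_normal_distribution) \<partial>lborel)"
      by (rule fubini_kernel[OF N, where B = 1]) (auto simp: indicator_def)
    also have "\<dots> = (\<integral>w. indicator {0..} w * normal_density 0 (sqrt (real (Suc (Suc n)))) (y - w) \<partial>lborel)"
      using normal_density_convolution[of "sqrt (real (Suc n))" 1] by (simp add: add_ac)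
    finally show ?case .
  qed
  from this[of "n - 1"] assms
  have "sumcdf std_normal_distribution n y = (\<integral>w. indicator {0..} w * normal_density 0 (sqrt (real n)) (y - w) \<partial>lborel)"
    by simp
  also have "\<dots> = (\<integral>w. indicator {..y} w * normal_density 0 (sqrt (real n)) w \<partial>lborel)"
  proof -
    have "indicator {0..} w = (indicator {..y} (y - w) :: real)" for w by (auto simp: indicator_def)
    then show ?thesis
      using integral_kernel_reflect[of "\<lambda>w. indicator {..y} w * normal_density 0 (sqrt (real n)) w" y] by simp
  qed
  also have "\<dots> = sqrt (real n) * (\<integral>w. indicator {..y} (0 + sqrt (real n) * w) * normal_density 0 (sqrt (real n)) (0 + sqrt (real n) * w) \<partial>lborel)"
    using assms lborel_integral_real_affine[of "sqrt (real n)" "\<lambda>w. indicator {..y} w * normal_density 0 (sqrt (real n)) w" 0]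
    by simp
  also have "\<dots> = (\<integral>w. indicator {..y / sqrt (real n)} w * std_normal_density w \<partial>lborel)"
  proof -
    have "indicator {..y} (0 + sqrt (real n) * w) = (indicator {..y / sqrt (real n)} w :: real)" for w
      using assms by (auto simp: indicator_def field_simps)
    moreover have "sqrt (real n) * normal_density 0 (sqrt (real n)) (0 + sqrt (real n) * w) = std_normal_density w" for w
      using assms normal_density_scale[of "sqrt (real n)" "sqrt (real n) * w"] by simp
    ultimately have "sqrt (real n) * (indicator {..y} (0 + sqrt (real n) * w) * normal_density 0 (sqrt (real n)) (0 + sqrt (real n) * w))
       = indicator {..y / sqrt (real n)} w * std_normal_density w" for w
      by (metis mult.left_commute)
    then show ?thesis
      by (simp only: integral_mult_right_zero[symmetric])
  qed
  finally show ?thesis by (simp add: cdf_density_real)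
qed

text \<open>(1 + |x|)^2 \<le> 32 exp (x^2 / 16). Cubing gives the sixth power with constant 32^3 =
  32768, and the exponent 3 x^2 / 16 is still below the x^2 / 2 of the density.\<close>

lemma std_normal_density_decay:
  assumes "k \<le> 6" shows "std_normal_density x * (1 + \<bar>x\<bar>) ^ k \<le> 32768"
proof -
  have a: "(1 + \<bar>x\<bar>)\<^sup>2 \<le> 2 * (1 + x\<^sup>2)"
    using zero_le_power2[of "1 - \<bar>x\<bar>"] by (simp add: power2_eq_square algebra_simps)
  have b: "1 + x\<^sup>2 \<le> 16 * exp (x\<^sup>2 / 16)"
    using exp_ge_add_one_self[of "x\<^sup>2 / 16"] by linarith
  have "(1 + \<bar>x\<bar>)\<^sup>2 \<le> 32 * exp (x\<^sup>2 / 16)" by (rule order_trans[OF a]) (use b in simp)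
  then have "((1 + \<bar>x\<bar>)\<^sup>2) ^ 3 \<le> (32 * exp (x\<^sup>2 / 16)) ^ 3" by (intro power_mono) auto
  moreover have "((1 + \<bar>x\<bar>)\<^sup>2) ^ 3 = (1 + \<bar>x\<bar>) ^ 6" by (simp flip: power_mult)
  moreover have "(32 * exp (x\<^sup>2 / 16)) ^ 3 = 32768 * exp (3 * x\<^sup>2 / 16)"
    unfolding power3_eq_cube[of "32 * _"] by (simp add: mult_exp_exp)
  ultimately have "(1 + \<bar>x\<bar>) ^ 6 \<le> 32768 * exp (3 * x\<^sup>2 / 16)" by simp
  moreover have "(1 + \<bar>x\<bar>) ^ k \<le> (1 + \<bar>x\<bar>) ^ 6" using assms by (intro power_increasing) auto
  ultimately have c: "(1 + \<bar>x\<bar>) ^ k \<le> 32768 * exp (3 * x\<^sup>2 / 16)" by simp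
  have "1 \<le> sqrt (2 * pi)" using pi_gt3 by simp
  then have "std_normal_density x \<le> 1 * exp (- x\<^sup>2 / 2)"
    unfolding std_normal_density_def by (intro mult_right_mono) auto
  also have "\<dots> \<le> exp (- (3 * x\<^sup>2 / 16))" by simp
  finally have "std_normal_density x * (1 + \<bar>x\<bar>) ^ k \<le> exp (- (3 * x\<^sup>2 / 16)) * (32768 * exp (3 * x\<^sup>2 / 16))"
    using c by (intro mult_mono) auto
  also have "\<dots> = 32768" by (simp add: mult_exp_exp)
  finally show ?thesis .
qed

lemma cdf_std_normal_diff:
  assumes "x \<le> y" "\<And>w. x \<le> w \<Longrightarrow> w \<le> y \<Longrightarrow> std_normal_density w \<le> c" 
  shows "0 \<le> cdf std_normal_distribution y - cdf std_normal_distribution x"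
    and "cdf std_normal_distribution y - cdf std_normal_distribution x \<le> c * (y - x)"
proof -
  interpret N: real_distribution std_normal_distribution by (rule real_dist_normal_dist)
  show "0 \<le> cdf std_normal_distribution y - cdf std_normal_distribution x"
    using N.cdf_nondecreasing[OF assms(1)] by simp
  have c: "0 \<le> c" using assms(2)[of x] assms(1) normal_density_nonneg[of 0 1 x] by linarith
  have "cdf std_normal_distribution y - cdf std_normal_distribution x \<le> c * (y - x)" if "x < y"
  proof -
    have "cdf std_normal_distribution y - cdf std_normal_distribution x = measure std_normal_distribution {x<..y}"
      using N.cdf_diff_eq[OF that] .
    also have "\<dots> \<le> c * (y - x)"
    proof -
      have "emeasure std_normal_distribution {x<..y} = (\<integral>\<^sup>+w. ennreal (std_normal_density w) * indicator {x<..y} w \<partial>lborel)"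
        by (rule emeasure_density) auto
      also have "\<dots> \<le> (\<integral>\<^sup>+w. ennreal c * indicator {x<..y} w \<partial>lborel)"
        using assms(2) by (intro nn_integral_mono) (auto simp: indicator_def intro!: ennreal_leI)
      also have "\<dots> = ennreal (c * (y - x))"
        using that c by (subst nn_integral_cmult_indicator) (auto simp: ennreal_mult)
      finally show ?thesis using c that by (simp add: N.emeasure_eq_measure)
    qed
    finally show ?thesis .
  qed
  then show "cdf std_normal_distribution y - cdf std_normal_distribution x \<le> c * (y - x)"
    using assms(1) by (cases "x = y") auto
qed

text \<open>Within distance 1 the quantity 1 + |x| changes at most by a factor 2, which costs 2^3 in
  the weight: 262144 = 8 * 32768.\<close>

lemma cdf_std_normal_weighted_lipschitz:
  assumes "\<bar>y - x\<bar> \<le> 1"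
  shows "\<bar>cdf std_normal_distribution y - cdf std_normal_distribution x\<bar> * (1 + \<bar>x\<bar>) ^ 3 \<le> 262144 * \<bar>y - x\<bar>"
proof -
  have d: "std_normal_density w \<le> 262144 / (1 + \<bar>x\<bar>) ^ 3" if "\<bar>w - x\<bar> \<le> 1" for w
  proof -
    have "(1 + \<bar>x\<bar>) ^ 3 \<le> (2 * (1 + \<bar>w\<bar>)) ^ 3" using that by (intro power_mono) auto
    also have "\<dots> \<le> 8 * (1 + \<bar>w\<bar>) ^ 4"
      unfolding power_mult_distrib using power_increasing[of 3 4 "1 + \<bar>w\<bar>"] by simp
    finally have "std_normal_density w * (1 + \<bar>x\<bar>) ^ 3 \<le> std_normal_density w * (8 * (1 + \<bar>w\<bar>) ^ 4)"
      by (intro mult_left_mono) auto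
    also have "\<dots> \<le> 262144" using std_normal_density_decay[of 4 w] by (simp add: mult_ac)
    finally show ?thesis by (simp add: le_divide_eq add_pos_nonneg)
  qed
  define c where "c = 262144 / (1 + \<bar>x\<bar>) ^ 3"
  have "\<bar>cdf std_normal_distribution y - cdf std_normal_distribution x\<bar> \<le> c * \<bar>y - x\<bar>"
  proof (cases "x \<le> y")
    case True
    then show ?thesis using cdf_std_normal_diff[OF True, of c] d assms by (auto simp: c_def)
  next
    case False
    then show ?thesis using cdf_std_normal_diff[of y x c] d assms by (auto simp: c_def)
  qed
  then have "\<bar>cdf std_normal_distribution y - cdf std_normal_distribution x\<bar> * (1 + \<bar>x\<bar>) ^ 3 \<le> c * \<bar>y - x\<bar> * (1 + \<bar>x\<bar>) ^ 3"
    by (intro mult_right_mono) auto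
  also have "\<dots> = 262144 * \<bar>y - x\<bar>" by (simp add: c_def)
  finally show ?thesis .
qed

text \<open>If \<open>F\<close> is increasing and \<open>\<Phi>\<close> Lipschitz, a deviation \<open>F x - \<Phi> x\<close> persists, up to the Lipschitz loss, on an
  interval on one side of \<open>x\<close>, with midpoint \<open>x'\<close>. Outside the interval the fourth power, one more than
  the weight needs, makes the contribution of the normal tails a small multiple of \<open>D\<close>.\<close>
lemma smoothing_core:
  fixes \<Delta> :: "real \<Rightarrow> real"
  assumes M: "(\<integral>v. (1 + \<bar>v\<bar>) ^ 4 * std_normal_density v \<partial>lborel) = M" and A: "0 < A" "32 * M \<le> A"
    and r: "0 < r" and \<tau>: "0 < \<tau>" "\<tau> \<le> r" and xx: "\<bar>x - x'\<bar> \<le> r / 8"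
    and [measurable]: "\<Delta> \<in> borel_measurable borel"
    and D: "\<And>y. \<bar>\<Delta> y\<bar> * tail_weight r y \<le> D"
    and e: "e * tail_weight r x \<le> D" "\<And>w. \<bar>x' - w\<bar> \<le> A * \<tau> / 2 \<Longrightarrow> e \<le> \<Delta> w"
    and S: "tail_weight r x' * \<bar>\<integral>w. \<Delta> w * normal_density 0 \<tau> (x' - w) \<partial>lborel\<bar> \<le> S"
  shows "e * tail_weight r x \<le> 2 * S + 3 * D / 16"
proof -
  note w1 = tail_weight_ge_1[OF r]
  have wx: "0 < tail_weight r x" using w1[of x] by simp
  have D0: "0 \<le> D" using D[of 0] w1[of 0] by (meson abs_ge_zero mult_nonneg_nonneg order_trans zero_le_one)
  have b: "\<bar>\<Delta> y\<bar> \<le> D" for y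
    using D[of y] mult_left_mono[OF w1[of y], of "\<bar>\<Delta> y\<bar>"] by simp
  \<comment> \<open>The shift from x to the midpoint is harmless: at most r / 8, it changes the
    weight by a factor of at most (9/8)^3, which is below 2.\<close>
  have ww: "tail_weight r x \<le> 2 * tail_weight r x'"
  proof -
    have "tail_weight r (x - x') \<le> (1 + 1 / 8) ^ 3"
      unfolding tail_weight_def using xx r by (intro power_mono) (auto simp: field_simps)
    also have "\<dots> \<le> (2 :: real)" by (simp add: eval_nat_numeral)
    finally have "tail_weight r x' * tail_weight r (x - x') \<le> tail_weight r x' * 2"
      using w1[of x'] by (intro mult_left_mono) auto
    then show ?thesis using tail_weight_submult[OF r, of x' "x - x'"] by simp
  qed
  \<comment> \<open>The coefficient of the penalty outside the window: \<open>3 * D\<close> bounds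
    the weighted loss there up to \<open>t ^ 3\<close>, and \<open>2 / A\<close> is the price of one
    more factor \<open>t\<close>, which is at least A / 2 outside.\<close>
  define q where "q = (3 * D / tail_weight r x) * (2 / A)"
  have q0: "0 \<le> q" using D0 A wx by (simp add: q_def)
  have pt: "e - q * (1 + \<bar>(x' - w) / \<tau>\<bar>) ^ 4 \<le> \<Delta> w" for w
  proof (cases "\<bar>x' - w\<bar> \<le> A * \<tau> / 2")
    case True
    have "0 \<le> q * (1 + \<bar>(x' - w) / \<tau>\<bar>) ^ 4" using q0 by simp
    then show ?thesis using e(2)[OF True] by linarith
  next
    case False
    define t where "t = 1 + \<bar>(x' - w) / \<tau>\<bar>"
    have "A / 2 \<le> \<bar>(x' - w) / \<tau>\<bar>" using False \<tau> by (simp add: field_simps)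
    then have t: "1 \<le> 2 / A * t" "1 \<le> t" using A by (auto simp: t_def field_simps)
    have "1 + \<bar>x' - w\<bar> / r \<le> t"
      unfolding t_def using \<tau> r by (auto simp: intro!: divide_left_mono)
    then have "tail_weight r (x' - w) \<le> t ^ 3"
      unfolding tail_weight_def using r by (intro power_mono) auto
    moreover have "tail_weight r x' \<le> tail_weight r w * tail_weight r (x' - w)"
      using tail_weight_submult[OF r, of w "x' - w"] by simp
    ultimately have "tail_weight r x' \<le> tail_weight r w * t ^ 3"
      using w1[of w] by (meson mult_left_mono order_trans zero_le_one)
    with ww have ww2: "tail_weight r x \<le> 2 * (tail_weight r w * t ^ 3)" by linarith
    have "\<bar>\<Delta> w\<bar> * tail_weight r x \<le> \<bar>\<Delta> w\<bar> * (2 * (tail_weight r w * t ^ 3))"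
      using ww2 by (intro mult_left_mono) auto
    also have "\<dots> = 2 * (\<bar>\<Delta> w\<bar> * tail_weight r w) * t ^ 3" by simp
    also have "\<dots> \<le> 2 * D * t ^ 3" using D[of w] t by (intro mult_right_mono) auto
    finally have 1: "- (2 * D * t ^ 3) \<le> \<Delta> w * tail_weight r x"
      using abs_le_D2[of "\<Delta> w * tail_weight r x" "2 * D * t ^ 3"] wx by (simp add: abs_mult)
    have "D * 1 \<le> D * t ^ 3" using D0 t by (intro mult_left_mono one_le_power) auto
    then have "(e - \<Delta> w) * tail_weight r x \<le> 3 * D * t ^ 3"
      using e(1) 1 by (simp add: left_diff_distrib)
    also have "\<dots> \<le> 3 * D * t ^ 3 * (2 / A * t)"
      using D0 t mult_left_mono[of 1 "2 / A * t" "3 * D * t ^ 3"] by simp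
    also have "\<dots> = q * t ^ 4 * tail_weight r x" using wx by (simp add: q_def eval_nat_numeral)
    finally have "e - \<Delta> w \<le> q * t ^ 4" using wx by simp
    then show ?thesis by (simp add: t_def)
  qed
  have i1: "integrable lborel (\<lambda>w. e * normal_density 0 \<tau> (x' - w))"
    using integrable_lborel_reflect[OF integrable_normal_density[OF \<tau>(1), of 0], of x']
    by (rule integrable_mult_right)
  have i2: "integrable lborel (\<lambda>w. (1 + \<bar>(x' - w) / \<tau>\<bar>) ^ 4 * normal_density 0 \<tau> (x' - w))"
    and v2: "(\<integral>w. (1 + \<bar>(x' - w) / \<tau>\<bar>) ^ 4 * normal_density 0 \<tau> (x' - w) \<partial>lborel) = M"
  proof -
    let ?f = "\<lambda>v. (1 + \<bar>v\<bar>) ^ 4 * std_normal_density v"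
    have eq: "(1 + \<bar>(x' - w) / \<tau>\<bar>) ^ 4 * normal_density 0 \<tau> (x' - w) = ?f (x' / \<tau> + (- 1 / \<tau>) * w) / \<tau>" for w
      unfolding normal_density_scale[OF \<tau>(1)] by (simp add: diff_divide_distrib)
    have "integrable lborel ?f" using integrable_poly_normal_density[of 1 4] by simp
    from lborel_integrable_real_affine[OF this, of "- 1 / \<tau>" "x' / \<tau>"]
    show "integrable lborel (\<lambda>w. (1 + \<bar>(x' - w) / \<tau>\<bar>) ^ 4 * normal_density 0 \<tau> (x' - w))"
      unfolding eq using \<tau> by simp
    show "(\<integral>w. (1 + \<bar>(x' - w) / \<tau>\<bar>) ^ 4 * normal_density 0 \<tau> (x' - w) \<partial>lborel) = M"
      unfolding eq using lborel_integral_real_affine[of "- 1 / \<tau>" ?f "x' / \<tau>"] \<tau> M by simp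
  qed
  have "e - q * M = (\<integral>w. e * normal_density 0 \<tau> (x' - w) - q * ((1 + \<bar>(x' - w) / \<tau>\<bar>) ^ 4 * normal_density 0 \<tau> (x' - w)) \<partial>lborel)"
    using i1 i2 v2 \<tau> integral_kernel_reflect[of "normal_density 0 \<tau>" x']
    by (subst Bochner_Integration.integral_diff) auto
  also have "\<dots> \<le> (\<integral>w. \<Delta> w * normal_density 0 \<tau> (x' - w) \<partial>lborel)"
  proof (rule integral_mono)
    show "integrable lborel (\<lambda>w. \<Delta> w * normal_density 0 \<tau> (x' - w))"
      using \<tau> by (intro integrable_bounded_mult_kernel[of _ _ D] b) auto
    show "e * normal_density 0 \<tau> (x' - w) - q * ((1 + \<bar>(x' - w) / \<tau>\<bar>) ^ 4 * normal_density 0 \<tau> (x' - w))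
       \<le> \<Delta> w * normal_density 0 \<tau> (x' - w)" for w
      using mult_right_mono[OF pt[of w], of "normal_density 0 \<tau> (x' - w)"] by (simp add: algebra_simps)
  qed (use i1 i2 in auto)
  finally have "e - q * M \<le> \<bar>\<integral>w. \<Delta> w * normal_density 0 \<tau> (x' - w) \<partial>lborel\<bar>" by linarith
  then have "(e - q * M) * tail_weight r x \<le> \<bar>\<integral>w. \<Delta> w * normal_density 0 \<tau> (x' - w) \<partial>lborel\<bar> * tail_weight r x"
    using wx by (intro mult_right_mono) auto
  also have "\<dots> \<le> \<bar>\<integral>w. \<Delta> w * normal_density 0 \<tau> (x' - w) \<partial>lborel\<bar> * (2 * tail_weight r x')"
    using ww by (intro mult_left_mono) auto
  also have "\<dots> \<le> 2 * S" using S by (simp add: mult_ac)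
  finally have 3: "e * tail_weight r x \<le> 2 * S + q * M * tail_weight r x" by (simp add: left_diff_distrib)
  \<comment> \<open>Origin of the constant 3/16: the penalty is 6 D M / A, and 32 M \<le> A.\<close>
  have "q * M * tail_weight r x = 6 * D * (M / A)" using wx by (simp add: q_def)
  also have "\<dots> \<le> 6 * D * (1 / 32)"
    using D0 A by (intro mult_left_mono) (auto simp: divide_le_eq)
  finally show ?thesis using 3 by simp
qed

text \<open>The sign \<open>s\<close> treats both directions of the deviation at once. With a = A
  \<tau>, the window is [x, x + a] for s = 1, where the monotone F can only gain, and [x - a, x] for
  s = -1. The loss \<open>l\<close> bounds the variation of \<Phi> on the window, and 4 A \<tau>
  \<le> r keeps the shift a / 2 of the midpoint within r / 8.\<close>

lemma smoothing_inequality: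
  fixes F \<Phi> :: "real \<Rightarrow> real"
  assumes M: "(\<integral>v. (1 + \<bar>v\<bar>) ^ 4 * std_normal_density v \<partial>lborel) = M" and A: "1 \<le> A" "32 * M \<le> A"
    and r: "0 < r" and \<tau>: "0 < \<tau>" "4 * A * \<tau> \<le> r"
    and [measurable]: "F \<in> borel_measurable borel" "\<Phi> \<in> borel_measurable borel"
    and F: "mono F"
    and D: "\<And>y. \<bar>F y - \<Phi> y\<bar> * tail_weight r y \<le> D"
    and L: "\<And>x y. \<bar>y - x\<bar> \<le> r \<Longrightarrow> \<bar>\<Phi> y - \<Phi> x\<bar> * tail_weight r x \<le> L * \<bar>y - x\<bar> / r" "0 \<le> L"
    and S: "\<And>x. tail_weight r x * \<bar>\<integral>w. (F w - \<Phi> w) * normal_density 0 \<tau> (x - w) \<partial>lborel\<bar> \<le> S"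
  shows "\<bar>F x - \<Phi> x\<bar> * tail_weight r x \<le> 2 * S + 3 * D / 16 + L * A * \<tau> / r"
proof -
  define a where "a = A * \<tau>"
  have a: "0 < a" "4 * a \<le> r" using A \<tau> by (auto simp: a_def)
  have \<tau>r: "\<tau> \<le> r"
  proof -
    have "1 * \<tau> \<le> A * \<tau>" using A \<tau> by (intro mult_right_mono) auto
    then show ?thesis using a by (simp add: a_def)
  qed
  have wx: "0 < tail_weight r x" using tail_weight_ge_1[OF r, of x] by simp
  have L': "\<bar>\<Phi> y - \<Phi> x\<bar> \<le> L * a / r / tail_weight r x" if "\<bar>y - x\<bar> \<le> a" for y
  proof -
    have "\<bar>\<Phi> y - \<Phi> x\<bar> * tail_weight r x \<le> L * \<bar>y - x\<bar> / r" using that a by (intro L) auto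
    also have "\<dots> \<le> L * a / r" using that L(2) r by (intro divide_right_mono mult_left_mono) auto
    finally show ?thesis by (simp only: pos_le_divide_eq[OF wx])
  qed
  define l where "l = L * a / r / tail_weight r x"
  have l: "0 \<le> l" "l * tail_weight r x = L * a / r" using L(2) a r wx by (auto simp: l_def)
  have core: "(s * (F x - \<Phi> x) - l) * tail_weight r x \<le> 2 * S + 3 * D / 16"
    if s: "s = 1 \<or> s = - 1" for s :: real
  proof (rule smoothing_core[OF M _ A(2) r \<tau>(1) \<tau>r, where \<Delta> = "\<lambda>y. s * (F y - \<Phi> y)" and x' = "x + s * (a / 2)"])
    show "0 < A" using A by simp
    show "\<bar>x - (x + s * (a / 2))\<bar> \<le> r / 8" using s a by auto
    show "(\<lambda>y. s * (F y - \<Phi> y)) \<in> borel_measurable borel" by measurable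
    show "\<bar>s * (F y - \<Phi> y)\<bar> * tail_weight r y \<le> D" for y using D[of y] s by (auto simp: abs_minus_commute)
    have "(s * (F x - \<Phi> x) - l) * tail_weight r x \<le> \<bar>F x - \<Phi> x\<bar> * tail_weight r x"
      using s l wx by (intro mult_right_mono) auto
    then show "(s * (F x - \<Phi> x) - l) * tail_weight r x \<le> D" using D[of x] by linarith
    show "s * (F x - \<Phi> x) - l \<le> s * (F w - \<Phi> w)" if "\<bar>x + s * (a / 2) - w\<bar> \<le> A * \<tau> / 2" for w
    proof -
      have that: "\<bar>x + s * (a / 2) - w\<bar> \<le> a / 2" using that by (simp add: a_def)
      then have w: "\<bar>w - x\<bar> \<le> a" using s by (auto simp: abs_if split: if_splits)
      from s show ?thesis
      proof
        assume "s = 1"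
        then have "x \<le> w" using that by (auto simp: abs_if split: if_splits)
        then have "F x \<le> F w" using F by (simp add: monoD)
        then show ?thesis using L'[OF w] \<open>s = 1\<close> by (auto simp: l_def abs_le_iff)
      next
        assume "s = - 1"
        then have "w \<le> x" using that by (auto simp: abs_if split: if_splits)
        then have "F w \<le> F x" using F by (simp add: monoD)
        then show ?thesis using L'[OF w] \<open>s = - 1\<close> by (auto simp: l_def abs_le_iff)
      qed
    qed
    have "(\<integral>w. s * (F w - \<Phi> w) * normal_density 0 \<tau> (y - w) \<partial>lborel)
      = s * (\<integral>w. (F w - \<Phi> w) * normal_density 0 \<tau> (y - w) \<partial>lborel)" for y
      by (simp only: mult.assoc integral_mult_right_zero)
    then show "tail_weight r (x + s * (a / 2)) * \<bar>\<integral>w. s * (F w - \<Phi> w) * normal_density 0 \<tau> (x + s * (a / 2) - w) \<partial>lborel\<bar> \<le> S"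
      using S[of "x + s * (a / 2)"] s by (auto simp: abs_mult)
  qed
  have "\<bar>F x - \<Phi> x\<bar> * tail_weight r x \<le> 2 * S + 3 * D / 16 + l * tail_weight r x"
    using core[of 1] core[of "- 1"] by (auto simp: abs_if left_diff_distrib right_diff_distrib algebra_simps)
  then show ?thesis using l by (simp add: a_def mult.assoc)
qed

section \<open>The nonuniform Berry--Esseen bound\<close>

text \<open>Bergstroem's telescoping, by induction on \<open>n\<close> with varying \<sigma>. Each
  step replaces the last summand and raises \<sigma>^2 by 1. The product of the remaining
  convolution power with the defect is split: the difference to the normal power is charged to the
  bound \<open>d\<close>, and the normal power itself acts at variance \<sigma>^2 + n. The
  hypothesis \<sigma>^2 + n \<le> (2 r)^2 keeps all scales in the range where the defect bound
  holds.\<close>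

lemma smoothed_difference_bound:
  assumes law: "standardised_law \<nu> \<rho>" and r: "0 < r" and c: "0 \<le> c"
    and cb: "\<And>\<sigma>. 0 < \<sigma> \<Longrightarrow> \<sigma> \<le> 2 * r \<Longrightarrow>
      (\<integral>\<^sup>+v. ennreal (tail_weight r v * \<bar>smoothing_defect \<nu> \<sigma> v\<bar>) \<partial>lborel) \<le> ennreal (c / \<sigma> ^ 3)"
    and \<sigma>: "0 < \<sigma>" "\<sigma>\<^sup>2 + real n \<le> (2 * r)\<^sup>2"
    and d: "\<And>k w. k < n \<Longrightarrow> \<bar>sumcdf \<nu> k w - sumcdf std_normal_distribution k w\<bar> * tail_weight r w \<le> d k"
  shows "tail_weight r x * \<bar>\<integral>w. (sumcdf \<nu> n w - sumcdf std_normal_distribution n w) * normal_density 0 \<sigma> (x - w) \<partial>lborel\<bar>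
    \<le> (\<Sum>k<n. d k * c / sqrt (\<sigma>\<^sup>2 + real (n - Suc k)) ^ 3) + real n * (c / sqrt (\<sigma>\<^sup>2 + real (n - 1)) ^ 3)"
  using \<sigma> d
proof (induction n arbitrary: \<sigma>)
  case 0
  then show ?case by (simp add: tail_weight_def)
next
  case (Suc n)
  let ?N = std_normal_distribution
  define \<Delta> where "\<Delta> k w = sumcdf \<nu> k w - sumcdf ?N k w" for k w
  note \<nu> = prob_space_standardised_law[OF law] sets_standardised_law[OF law]
  note N = prob_space_std_normal sets_std_normal
  note b = borel_measurable_sumcdf_borel[OF \<nu>] sumcdf_abs_le_1[OF \<nu>]
  note bN = borel_measurable_sumcdf_borel[OF N] sumcdf_abs_le_1[OF N]
  note [measurable] = b(1) bN(1)
  note nlaw = standardised_law_normal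
  define s where "s = sqrt (\<sigma>\<^sup>2 + 1)"
  have s: "0 < s" "s\<^sup>2 = \<sigma>\<^sup>2 + 1" using Suc.prems(1) by (auto simp: s_def add_pos_pos)
  have [simp]: "s\<^sup>2 + real k = \<sigma>\<^sup>2 + real (Suc k)" for k using s by simp
  have sb: "sqrt (\<sigma>\<^sup>2 + real n) \<le> 2 * r" "\<sigma> \<le> 2 * r"
  proof -
    show "sqrt (\<sigma>\<^sup>2 + real n) \<le> 2 * r" using Suc.prems(2) r by (intro real_le_lsqrt) auto
    have "\<sigma>\<^sup>2 \<le> (2 * r)\<^sup>2" using Suc.prems(2) by simp
    then show "\<sigma> \<le> 2 * r" by (rule power2_le_imp_le) (use r in simp)
  qed
  have ig: "integrable lborel (\<lambda>w. sumcdf \<nu> k w * \<kappa> (x - w))" "integrable lborel (\<lambda>w. sumcdf ?N k w * \<kappa> (x - w))"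
    if "integrable lborel \<kappa>" for \<kappa> :: "real \<Rightarrow> real" and k
    using that by (auto intro!: integrable_bounded_mult_kernel[of _ _ 1] b bN)
  have n1: "integrable lborel (normal_density 0 \<sigma>)" "integrable lborel (normal_density 0 s)"
    using Suc.prems(1) s by auto
  note i\<psi> = integrable_smoothing_defect[OF law Suc.prems(1)]
  have \<Delta>i: "(\<integral>w. \<Delta> k w * \<kappa> (x - w) \<partial>lborel) = (\<integral>w. sumcdf \<nu> k w * \<kappa> (x - w) \<partial>lborel) - (\<integral>w. sumcdf ?N k w * \<kappa> (x - w) \<partial>lborel)"
    if "integrable lborel \<kappa>" for \<kappa> :: "real \<Rightarrow> real" and k
    unfolding \<Delta>_def left_diff_distrib by (rule Bochner_Integration.integral_diff[OF ig[OF that]])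
  have "(\<integral>w. \<Delta> (Suc n) w * normal_density 0 \<sigma> (x - w) \<partial>lborel)
    = (\<integral>w. \<Delta> n w * normal_density 0 s (x - w) \<partial>lborel) + (\<integral>w. sumcdf \<nu> n w * smoothing_defect \<nu> \<sigma> (x - w) \<partial>lborel)"
    unfolding \<Delta>i[OF n1(1)] \<Delta>i[OF n1(2)] sumcdf_smoothing_step[OF law Suc.prems(1)]
      sumcdf_smoothing_step[OF nlaw Suc.prems(1)] s_def[symmetric]
    by (simp add: smoothing_defect_normal[OF Suc.prems(1)])
  also have "(\<integral>w. sumcdf \<nu> n w * smoothing_defect \<nu> \<sigma> (x - w) \<partial>lborel)
    = (\<integral>w. \<Delta> n w * smoothing_defect \<nu> \<sigma> (x - w) \<partial>lborel)
      + (\<integral>w. indicator {0..} w * smoothing_defect \<nu> (sqrt (\<sigma>\<^sup>2 + real n)) (x - w) \<partial>lborel)"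
    unfolding \<Delta>i[OF i\<psi>] sumcdf_normal_defect[OF law Suc.prems(1)] by simp
  finally have eq: "(\<integral>w. \<Delta> (Suc n) w * normal_density 0 \<sigma> (x - w) \<partial>lborel)
    = (\<integral>w. \<Delta> n w * normal_density 0 s (x - w) \<partial>lborel)
      + ((\<integral>w. \<Delta> n w * smoothing_defect \<nu> \<sigma> (x - w) \<partial>lborel)
      + (\<integral>w. indicator {0..} w * smoothing_defect \<nu> (sqrt (\<sigma>\<^sup>2 + real n)) (x - w) \<partial>lborel))" .
  have w0: "0 \<le> tail_weight r v" "1 \<le> tail_weight r v" for v using tail_weight_ge_1[OF r, of v] by auto
  have dn: "0 \<le> d n" using Suc.prems(3)[of n 0] w0[of 0]
    by (meson abs_ge_zero lessI mult_nonneg_nonneg order_trans)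
  have "tail_weight r x * \<bar>\<integral>w. \<Delta> n w * normal_density 0 s (x - w) \<partial>lborel\<bar>
     \<le> (\<Sum>k<n. d k * c / sqrt (s\<^sup>2 + real (n - Suc k)) ^ 3) + real n * (c / sqrt (s\<^sup>2 + real (n - 1)) ^ 3)"
    unfolding \<Delta>_def using Suc.prems s by (intro Suc.IH) auto
  also have "(\<Sum>k<n. d k * c / sqrt (s\<^sup>2 + real (n - Suc k)) ^ 3) = (\<Sum>k<n. d k * c / sqrt (\<sigma>\<^sup>2 + real (Suc n - Suc k)) ^ 3)"
  proof (intro sum.cong refl)
    fix k assume "k \<in> {..<n}"
    then have "s\<^sup>2 + real (n - Suc k) = \<sigma>\<^sup>2 + real (Suc n - Suc k)" using s by (simp add: of_nat_diff)
    then show "d k * c / sqrt (s\<^sup>2 + real (n - Suc k)) ^ 3 = d k * c / sqrt (\<sigma>\<^sup>2 + real (Suc n - Suc k)) ^ 3"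
      by (simp only:)
  qed
  \<comment> \<open>For \<open>n = 0\<close> the truncated \<open>n - 1\<close> does not matter,
    since the factor in front is 0.\<close>
  also have "real n * (c / sqrt (s\<^sup>2 + real (n - 1)) ^ 3) = real n * (c / sqrt (\<sigma>\<^sup>2 + real n) ^ 3)"
    by (cases n) auto
  finally have 1: "tail_weight r x * \<bar>\<integral>w. \<Delta> n w * normal_density 0 s (x - w) \<partial>lborel\<bar>
     \<le> (\<Sum>k<n. d k * c / sqrt (\<sigma>\<^sup>2 + real (Suc n - Suc k)) ^ 3) + real n * (c / sqrt (\<sigma>\<^sup>2 + real n) ^ 3)" .
  have 2: "tail_weight r x * \<bar>\<integral>w. \<Delta> n w * smoothing_defect \<nu> \<sigma> (x - w) \<partial>lborel\<bar> \<le> d n * (c / \<sigma> ^ 3)"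
  proof (rule weighted_kernel_bound[OF r _ cb[OF Suc.prems(1) sb(2)] _ _ dn])
    show "smoothing_defect \<nu> \<sigma> \<in> borel_measurable borel"
      using borel_measurable_smoothing_defect[OF law, of "\<lambda>x. x" borel \<sigma>] by simp
    show "0 \<le> c / \<sigma> ^ 3" using c Suc.prems(1) by simp
    show "\<Delta> n \<in> borel_measurable borel" unfolding \<Delta>_def[abs_def] by measurable
    fix w
    have "tail_weight r x \<le> tail_weight r w * tail_weight r (x - w)"
      using tail_weight_submult[OF r, of w "x - w"] by simp
    then have "tail_weight r x * \<bar>\<Delta> n w\<bar> \<le> tail_weight r w * tail_weight r (x - w) * \<bar>\<Delta> n w\<bar>"
      by (rule mult_right_mono) auto
    also have "\<dots> = (\<bar>\<Delta> n w\<bar> * tail_weight r w) * tail_weight r (x - w)" by simp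
    also have "\<dots> \<le> d n * tail_weight r (x - w)"
      using Suc.prems(3)[of n w] w0 unfolding \<Delta>_def by (intro mult_right_mono) auto
    finally have "tail_weight r x * \<bar>\<Delta> n w\<bar> * \<bar>smoothing_defect \<nu> \<sigma> (x - w)\<bar>
      \<le> d n * tail_weight r (x - w) * \<bar>smoothing_defect \<nu> \<sigma> (x - w)\<bar>" by (rule mult_right_mono) auto
    then show "tail_weight r x * \<bar>\<Delta> n w * smoothing_defect \<nu> \<sigma> (x - w)\<bar>
      \<le> d n * (tail_weight r (x - w) * \<bar>smoothing_defect \<nu> \<sigma> (x - w)\<bar>)"
      by (simp add: abs_mult mult.assoc)
  qed
  have p: "0 < sqrt (\<sigma>\<^sup>2 + real n)" using Suc.prems(1) by (simp add: add_pos_nonneg)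
  have 3: "tail_weight r x * \<bar>\<integral>w. indicator {0..} w * smoothing_defect \<nu> (sqrt (\<sigma>\<^sup>2 + real n)) (x - w) \<partial>lborel\<bar>
    \<le> c / sqrt (\<sigma>\<^sup>2 + real n) ^ 3"
    using c p by (intro half_line_defect_bound[OF law p r] cb sb(1)) auto
  have "tail_weight r x * \<bar>\<integral>w. \<Delta> (Suc n) w * normal_density 0 \<sigma> (x - w) \<partial>lborel\<bar>
    \<le> tail_weight r x * (\<bar>\<integral>w. \<Delta> n w * normal_density 0 s (x - w) \<partial>lborel\<bar>
      + (\<bar>\<integral>w. \<Delta> n w * smoothing_defect \<nu> \<sigma> (x - w) \<partial>lborel\<bar>
      + \<bar>\<integral>w. indicator {0..} w * smoothing_defect \<nu> (sqrt (\<sigma>\<^sup>2 + real n)) (x - w) \<partial>lborel\<bar>))"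
    unfolding eq using w0 by (intro mult_left_mono) linarith+
  also have "\<dots> \<le> (\<Sum>k<n. d k * c / sqrt (\<sigma>\<^sup>2 + real (Suc n - Suc k)) ^ 3) + real n * (c / sqrt (\<sigma>\<^sup>2 + real n) ^ 3)
     + (d n * (c / \<sigma> ^ 3) + c / sqrt (\<sigma>\<^sup>2 + real n) ^ 3)"
    unfolding distrib_left by (intro add_mono 1 2 3)
  also have "\<dots> = (\<Sum>k<Suc n. d k * c / sqrt (\<sigma>\<^sup>2 + real (Suc n - Suc k)) ^ 3)
      + real (Suc n) * (c / sqrt (\<sigma>\<^sup>2 + real (Suc n - 1)) ^ 3)"
    using Suc.prems(1) by (simp add: algebra_simps add_divide_distrib)
  finally show ?case by (simp add: \<Delta>_def)
qed

text \<open>Since (b - a) (a + b) = 1, the difference 1/a - 1/b equals 1 / (a b (a + b)). From a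
  \<ge> 1 follows b \<le> 3a/2, so the denominator is at most 15/4 a^3.\<close>

lemma inverse_cube_telescope:
  fixes a b :: real
  assumes "1 \<le> a" "0 < b" "b\<^sup>2 = a\<^sup>2 + 1"
  shows "1 / a ^ 3 \<le> 4 * (1 / a - 1 / b)"
proof -
  have "1 \<le> a\<^sup>2" using assms by (simp add: one_le_power)
  then have "b\<^sup>2 \<le> (3 / 2 * a)\<^sup>2" using assms by (simp add: power_mult_distrib power2_eq_square)
  then have b: "b \<le> 3 / 2 * a" by (rule power2_le_imp_le) (use assms in simp)
  have ab: "(b - a) * (a + b) = 1" using assms by (simp add: algebra_simps power2_eq_square)
  have "a * b * (a + b) \<le> a * (3 / 2 * a) * (a + 3 / 2 * a)"
    using b assms by (intro mult_mono) auto
  also have "\<dots> \<le> 4 * a ^ 3" using assms by (simp add: power3_eq_cube)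
  finally have "1 / (4 * a ^ 3) \<le> 1 / (a * b * (a + b))"
    using assms by (intro divide_left_mono) auto
  also have "\<dots> = ((b - a) * (a + b)) / (a * b * (a + b))" by (simp only: ab)
  also have "\<dots> = (b - a) / (a * b)" using assms by simp
  also have "\<dots> = 1 / a - 1 / b" using assms by (simp add: field_simps)
  finally show ?thesis by simp
qed

lemma sum_inverse_cube_le:
  fixes \<tau> :: real
  assumes "1 \<le> \<tau>"
  shows "(\<Sum>j<n. 1 / sqrt (\<tau>\<^sup>2 + real j) ^ 3) \<le> 4 / \<tau>"
proof -
  define a where "a j = sqrt (\<tau>\<^sup>2 + real j)" for j
  have t: "1 \<le> \<tau>\<^sup>2" using assms by (simp add: one_le_power)
  have a: "1 \<le> a j" "0 < a j" "(a (Suc j))\<^sup>2 = (a j)\<^sup>2 + 1" for j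
    using t by (auto simp: a_def add_pos_nonneg)
  have "(\<Sum>j<n. 1 / a j ^ 3) \<le> (\<Sum>j<n. 4 * (1 / a j - 1 / a (Suc j)))"
    by (intro sum_mono inverse_cube_telescope a)
  also have "\<dots> = 4 * (1 / a 0 - 1 / a n)"
    by (simp only: sum_distrib_left[symmetric] sum_lessThan_telescope'[where f = "\<lambda>j. 1 / a j"])
  also have "\<dots> \<le> 4 / \<tau>" using a(2)[of n] assms by (simp add: a_def)
  finally show ?thesis by (simp add: a_def)
qed

text \<open>The summand for k = 0 counts as 0, because division by 0 yields 0. The remaining ones
  telescope against 2 (sqrt k - sqrt (k - 1)).\<close>

lemma sum_inverse_sqrt_le: "(\<Sum>k<Suc n. 1 / sqrt (real k)) \<le> 2 * sqrt (real n)"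
proof (induction n)
  case (Suc n)
  define p q where "p = sqrt (real (Suc n))" "q = sqrt (real n)"
  have pq: "0 < p" "q \<le> p" "(p - q) * (p + q) = 1"
    by (auto simp: p_q_def algebra_simps)
  have "(p - q) * (p + q) \<le> (p - q) * (p + p)" using pq by (intro mult_left_mono) auto
  then have "1 \<le> 2 * (p - q) * p" unfolding pq(3) by (simp add: algebra_simps)
  then have "1 / p \<le> 2 * (p - q)" by (simp only: pos_divide_le_eq[OF pq(1)])
  moreover have "(\<Sum>k<Suc (Suc n). 1 / sqrt (real k)) = (\<Sum>k<Suc n. 1 / sqrt (real k)) + 1 / p"
    unfolding p_q_def by (rule sum.lessThan_Suc)
  ultimately show ?case using Suc unfolding p_q_def(2)[symmetric] p_q_def(1)[symmetric] by argo
qed simp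

text \<open>Split at k = n / 2. For larger k the factor 1 / sqrt k is at most 2 / sqrt n and the
  inverse cubes sum to 4 / \<tau>; for smaller k the inverse cube is at most 8 / n^(3/2) and the
  inverse roots sum to 2 sqrt n. The first contribution becomes small for large \<tau>, the second
  for large n.\<close>

lemma convolution_sum_bound:
  fixes \<tau> :: real
  assumes \<tau>: "1 \<le> \<tau>" and n: "1 \<le> n"
  shows "(\<Sum>k<n. 1 / sqrt (real k) * (1 / sqrt (\<tau>\<^sup>2 + real (n - Suc k)) ^ 3))
    \<le> 8 / (\<tau> * sqrt (real n)) + 16 / real n"
proof -
  define r where "r = sqrt (real n)"
  have r: "0 < r" "r\<^sup>2 = real n" using n by (auto simp: r_def)
  have t: "1 \<le> \<tau>\<^sup>2" using \<tau> by (simp add: one_le_power)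
  have "1 / sqrt (real k) * (1 / sqrt (\<tau>\<^sup>2 + real (n - Suc k)) ^ 3)
     \<le> 2 / r * (1 / sqrt (\<tau>\<^sup>2 + real (n - Suc k)) ^ 3) + 8 / r ^ 3 * (1 / sqrt (real k))" if "k < n" for k
  proof (cases "n \<le> 2 * k")
    case True
    have "(r / 2)\<^sup>2 \<le> (sqrt (real k))\<^sup>2" using True r by (simp add: power_divide)
    then have "r / 2 \<le> sqrt (real k)" by (rule power2_le_imp_le) auto
    then have "1 / sqrt (real k) \<le> 1 / (r / 2)" using r by (intro frac_le) auto
    then have "1 / sqrt (real k) \<le> 2 / r" by simp
    then have "1 / sqrt (real k) * (1 / sqrt (\<tau>\<^sup>2 + real (n - Suc k)) ^ 3)
       \<le> 2 / r * (1 / sqrt (\<tau>\<^sup>2 + real (n - Suc k)) ^ 3)" by (rule mult_right_mono) (simp add: t)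
    moreover have "0 \<le> 8 / r ^ 3 * (1 / sqrt (real k))" using r by simp
    ultimately show ?thesis by linarith
  next
    case False
    have "real n / 4 \<le> real (n - Suc k) + 1" using False that by (simp add: of_nat_diff)
    then have "(r / 2)\<^sup>2 \<le> (sqrt (\<tau>\<^sup>2 + real (n - Suc k)))\<^sup>2" using t r by (simp add: power_divide)
    then have "r / 2 \<le> sqrt (\<tau>\<^sup>2 + real (n - Suc k))" by (rule power2_le_imp_le) (simp add: t)
    then have "(r / 2) ^ 3 \<le> sqrt (\<tau>\<^sup>2 + real (n - Suc k)) ^ 3" using r by (intro power_mono) auto
    then have "1 / sqrt (\<tau>\<^sup>2 + real (n - Suc k)) ^ 3 \<le> 1 / (r / 2) ^ 3" using r by (intro frac_le) auto
    also have "\<dots> = 8 / r ^ 3" by (simp add: power_divide)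
    finally have "1 / sqrt (real k) * (1 / sqrt (\<tau>\<^sup>2 + real (n - Suc k)) ^ 3) \<le> 1 / sqrt (real k) * (8 / r ^ 3)"
      by (rule mult_left_mono) simp
    moreover have "0 \<le> 2 / r * (1 / sqrt (\<tau>\<^sup>2 + real (n - Suc k)) ^ 3)" using r t by simp
    ultimately show ?thesis unfolding mult.commute[of "8 / r ^ 3"] by argo
  qed
  then have "(\<Sum>k<n. 1 / sqrt (real k) * (1 / sqrt (\<tau>\<^sup>2 + real (n - Suc k)) ^ 3))
    \<le> (\<Sum>k<n. 2 / r * (1 / sqrt (\<tau>\<^sup>2 + real (n - Suc k)) ^ 3) + 8 / r ^ 3 * (1 / sqrt (real k)))"
    by (intro sum_mono) auto
  also have "\<dots> = 2 / r * (\<Sum>k<n. 1 / sqrt (\<tau>\<^sup>2 + real (n - Suc k)) ^ 3) + 8 / r ^ 3 * (\<Sum>k<n. 1 / sqrt (real k))"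
    by (simp only: sum.distrib sum_distrib_left)
  also have "(\<Sum>k<n. 1 / sqrt (\<tau>\<^sup>2 + real (n - Suc k)) ^ 3) = (\<Sum>j<n. 1 / sqrt (\<tau>\<^sup>2 + real j) ^ 3)"
    by (rule sum.nat_diff_reindex)
  also have "2 / r * (\<Sum>j<n. 1 / sqrt (\<tau>\<^sup>2 + real j) ^ 3) + 8 / r ^ 3 * (\<Sum>k<n. 1 / sqrt (real k))
    \<le> 2 / r * (4 / \<tau>) + 8 / r ^ 3 * (2 * r)"
  proof (intro add_mono mult_left_mono sum_inverse_cube_le \<tau>)
    obtain m where m: "n = Suc m" using n by (cases n) auto
    have "(\<Sum>k<n. 1 / sqrt (real k)) \<le> 2 * sqrt (real m)" unfolding m by (rule sum_inverse_sqrt_le)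
    also have "\<dots> \<le> 2 * r" by (simp add: r_def m)
    finally show "(\<Sum>k<n. 1 / sqrt (real k)) \<le> 2 * r" .
  qed (use r in auto)
  also have "\<dots> = 8 / (\<tau> * r) + 16 / r\<^sup>2" using r by (simp add: power3_eq_cube power2_eq_square)
  finally show ?thesis using r by (simp add: r_def)
qed

text \<open>Strong induction on \<open>n\<close>: the bounds K / sqrt k for all k < n enter the
  smoothed estimate, desmoothing returns a bound for n, and \<tau> and \<open>n0\<close> are such
  that the coefficient of K comes back small enough. The cases n < \<open>n0\<close> are covered by
  the crude bounds, which are uniform in the law.\<close>

theorem nonuniform_berry_esseen_sumcdf:
  assumes \<rho>: "0 \<le> \<rho>"
  obtains K where "0 < K" "\<And>\<nu> n y. standardised_law \<nu> \<rho> \<Longrightarrow> 1 \<le> n \<Longrightarrow>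
    \<bar>sumcdf \<nu> n y - sumcdf std_normal_distribution n y\<bar> * tail_weight (sqrt (real n)) y \<le> K / sqrt (real n)"
proof -
  let ?N = std_normal_distribution
  define M where "M = (\<integral>v. (1 + \<bar>v\<bar>) ^ 4 * std_normal_density v \<partial>lborel)"
  have M0: "0 \<le> M" by (simp add: M_def)
  define A where "A = 1 + 32 * M"
  have A: "1 \<le> A" "32 * M \<le> A" using M0 by (auto simp: A_def)
  obtain C where C: "0 < C" "\<And>\<nu> \<rho> \<sigma> r. standardised_law \<nu> \<rho> \<Longrightarrow> 0 < \<sigma> \<Longrightarrow> \<sigma> \<le> 2 * r \<Longrightarrow>
    (\<integral>\<^sup>+v. ennreal (tail_weight r v * \<bar>smoothing_defect \<nu> \<sigma> v\<bar>) \<partial>lborel) \<le> ennreal (C * (1 + \<rho>) / \<sigma> ^ 3)"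
    using smoothing_defect_bound by blast
  define c where "c = C * (1 + \<rho>)"
  have c: "0 < c" using C(1) \<rho> by (simp add: c_def)
  define L :: real where "L = 262144"
  \<comment> \<open>Chosen so that 8 c / \<tau> \<le> 1/16 in the bound for the convolution
    sum.\<close>
  define \<tau> where "\<tau> = 1 + 128 * c"
  have \<tau>: "1 \<le> \<tau>" "128 * c \<le> \<tau>" using c by (auto simp: \<tau>_def)
  \<comment> \<open>The first part is the window condition 4 A \<tau> \<le> r of the smoothing
    inequality, the second gives 16 c / r \<le> 1/16.\<close>
  define r0 where "r0 = 4 * A * \<tau> + 256 * c"
  have r0: "0 < r0" using A \<tau> c by (simp add: r0_def add_pos_pos)
  define n0 where "n0 = nat \<lceil>r0\<^sup>2\<rceil>"
  define \<rho>N where "\<rho>N = (LINT x|?N. \<bar>x\<bar> ^ 3)"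
  note nlaw = standardised_law_normal[folded \<rho>N_def]
  have \<rho>N: "0 \<le> \<rho>N" by (simp add: \<rho>N_def)
  define B where "B n = crude_tail \<rho> n + crude_tail \<rho>N n" for n
  have B0: "0 \<le> B n" for n using crude_tail_nonneg[OF \<rho>] crude_tail_nonneg[OF \<rho>N] by (simp add: B_def)
  \<comment> \<open>Half of K has to absorb the terms 4 c + 2 L A \<tau> that do not involve K, the
    other half being used by the recursion. The finite sum covers the crude bounds for n <
    \<open>n0\<close>.\<close>
  define K where "K = 16 * c + 4 * L * A * \<tau> + (\<Sum>n<n0. sqrt (real n) * B n)"
  have K1: "0 \<le> (\<Sum>n<n0. sqrt (real n) * B n)" using B0 by (intro sum_nonneg) auto
  have LA: "0 \<le> L * A * \<tau>" using A \<tau> by (simp add: L_def)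
  have K: "0 < K" using K1 LA c unfolding K_def by linarith
  have main: "\<bar>sumcdf \<nu> n y - sumcdf ?N n y\<bar> * tail_weight (sqrt (real n)) y \<le> K / sqrt (real n)"
    if law: "standardised_law \<nu> \<rho>" and n: "1 \<le> n" for \<nu> n y
    using n
  proof (induction n arbitrary: y rule: less_induct)
    case (less n)
    define r where "r = sqrt (real n)"
    have r: "1 \<le> r" "0 < r" "r\<^sup>2 = real n" using less.prems by (auto simp: r_def)
    define \<Delta> where "\<Delta> k w = sumcdf \<nu> k w - sumcdf ?N k w" for k w
    have crude: "\<bar>\<Delta> n w\<bar> * tail_weight r w \<le> B n" for w
    proof -
      have "tail_weight r w \<le> tail_weight 1 w"
      proof -
        have "\<bar>w\<bar> / r \<le> \<bar>w\<bar> / 1" using r by (intro divide_left_mono) auto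
        then show ?thesis unfolding tail_weight_def using r by (intro power_mono) auto
      qed
      then have "\<bar>\<Delta> n w\<bar> * tail_weight r w \<le> \<bar>\<Delta> n w\<bar> * tail_weight 1 w" by (intro mult_left_mono) auto
      also have "\<dots> \<le> (\<bar>sumcdf \<nu> n w - indicator {0..} w\<bar> + \<bar>sumcdf ?N n w - indicator {0..} w\<bar>) * tail_weight 1 w"
        using tail_weight_ge_1[of 1 w] unfolding \<Delta>_def by (intro mult_right_mono) auto
      also have "\<dots> \<le> B n"
        using sumcdf_crude_tail[OF law, of n w] sumcdf_crude_tail[OF nlaw, of n w]
        by (simp add: B_def distrib_right)
      finally show ?thesis .
    qed
    show ?case
    proof (cases "n < n0")
      case True
      have "sqrt (real n) * B n \<le> (\<Sum>n<n0. sqrt (real n) * B n)"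
        using True B0 by (intro member_le_sum) auto
      also have "\<dots> \<le> K" using LA c unfolding K_def by linarith
      finally have "B n \<le> K / r" using r by (simp add: le_divide_eq r_def mult.commute)
      then show ?thesis using crude[of y] by (simp add: \<Delta>_def r_def)
    next
      case False
      have "r0\<^sup>2 \<le> r\<^sup>2" using False r unfolding n0_def by linarith
      then have rr: "r0 \<le> r" by (rule power2_le_imp_le) (use r in simp)
      have 4: "4 * A * \<tau> \<le> r" using rr c by (simp add: r0_def)
      have c256: "256 * c \<le> r"
      proof -
        have "0 \<le> 4 * A * \<tau>" using A \<tau> by simp
        then show ?thesis using rr unfolding r0_def by linarith
      qed
      have \<tau>r: "\<tau> \<le> r"
      proof -
        have "1 * \<tau> \<le> 4 * A * \<tau>" using A \<tau> by (intro mult_right_mono) auto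
        then show ?thesis using 4 by linarith
      qed
      \<comment> \<open>The weight at scale sqrt n is at most that at scale sqrt k for 0 < k < n, so
        the induction hypothesis can be used at scale \<open>r\<close>. For k = 0 both convolution
        powers are the same unit step, in agreement with \<open>d 0 = 0\<close> by division by
        0.\<close>
      define d where "d k = K * (1 / sqrt (real k))" for k
      have d: "\<bar>\<Delta> k w\<bar> * tail_weight r w \<le> d k" if "k < n" for k w
      proof (cases "k = 0")
        case True
        then show ?thesis by (simp add: \<Delta>_def d_def)
      next
        case False
        have "\<bar>w\<bar> / r \<le> \<bar>w\<bar> / sqrt (real k)"
          using False that r by (intro divide_left_mono) (auto simp: r_def)
        then have "tail_weight r w \<le> tail_weight (sqrt (real k)) w"
          unfolding tail_weight_def using r by (intro power_mono) auto
        then have "\<bar>\<Delta> k w\<bar> * tail_weight r w \<le> \<bar>\<Delta> k w\<bar> * tail_weight (sqrt (real k)) w"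
          by (intro mult_left_mono) auto
        also have "\<dots> \<le> K / sqrt (real k)" using less.IH[OF that, of w] False by (simp add: \<Delta>_def)
        finally show ?thesis by (simp add: d_def)
      qed
      define S where "S = K * c * (8 / (\<tau> * r) + 16 / r\<^sup>2) + c / r"
      have S: "tail_weight r x * \<bar>\<integral>w. (sumcdf \<nu> n w - sumcdf ?N n w) * normal_density 0 \<tau> (x - w) \<partial>lborel\<bar> \<le> S" for x
      proof -
        have "\<tau>\<^sup>2 \<le> r\<^sup>2" using \<tau>r \<tau> by (intro power_mono) auto
        then have tn: "\<tau>\<^sup>2 + real n \<le> (2 * r)\<^sup>2" using r by (simp add: power_mult_distrib)
        have "tail_weight r x * \<bar>\<integral>w. (sumcdf \<nu> n w - sumcdf ?N n w) * normal_density 0 \<tau> (x - w) \<partial>lborel\<bar>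
          \<le> (\<Sum>k<n. d k * c / sqrt (\<tau>\<^sup>2 + real (n - Suc k)) ^ 3) + real n * (c / sqrt (\<tau>\<^sup>2 + real (n - 1)) ^ 3)"
          using c \<tau> r d tn by (intro smoothed_difference_bound[OF law]) (auto simp: c_def \<Delta>_def intro!: C(2)[OF law])
        also have "(\<Sum>k<n. d k * c / sqrt (\<tau>\<^sup>2 + real (n - Suc k)) ^ 3)
           = K * c * (\<Sum>k<n. 1 / sqrt (real k) * (1 / sqrt (\<tau>\<^sup>2 + real (n - Suc k)) ^ 3))"
          by (simp add: d_def sum_distrib_left mult_ac)
        also have "\<dots> \<le> K * c * (8 / (\<tau> * r) + 16 / r\<^sup>2)"
          using convolution_sum_bound[OF \<tau>(1) less.prems] K c unfolding r(3) r_def by (intro mult_left_mono) auto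
        also have "real n * (c / sqrt (\<tau>\<^sup>2 + real (n - 1)) ^ 3) \<le> c / r"
        proof -
          have "1 \<le> \<tau>\<^sup>2" using \<tau> by (simp add: one_le_power)
          then have "r \<le> sqrt (\<tau>\<^sup>2 + real (n - 1))" using less.prems by (simp add: r_def of_nat_diff)
          then have "r ^ 3 \<le> sqrt (\<tau>\<^sup>2 + real (n - 1)) ^ 3" using r by (intro power_mono) auto
          then have "c / sqrt (\<tau>\<^sup>2 + real (n - 1)) ^ 3 \<le> c / r ^ 3" using r c by (intro frac_le) auto
          then have "real n * (c / sqrt (\<tau>\<^sup>2 + real (n - 1)) ^ 3) \<le> real n * (c / r ^ 3)"
            by (rule mult_left_mono) auto
          also have "\<dots> = c / r" using r by (simp flip: r(3) add: power2_eq_square power3_eq_cube)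
          finally show ?thesis .
        qed
        finally show ?thesis unfolding S_def by simp
      qed
      define R where "R = 2 * S + L * A * \<tau> / r"
      note \<nu> = prob_space_standardised_law[OF law] sets_standardised_law[OF law]
      note N = prob_space_std_normal sets_std_normal
      have step: "\<bar>\<Delta> n x\<bar> * tail_weight r x \<le> R + 3 * D / 16"
        if D: "\<And>w. \<bar>\<Delta> n w\<bar> * tail_weight r w \<le> D" for D x
      proof -
        have "\<bar>sumcdf \<nu> n x - sumcdf ?N n x\<bar> * tail_weight r x \<le> 2 * S + 3 * D / 16 + L * A * \<tau> / r"
        proof (rule smoothing_inequality[OF M_def[symmetric] A r(2) _ 4 _ _ _ _ _ _ S])
          show "0 < \<tau>" using \<tau> by simp
          show "sumcdf \<nu> n \<in> borel_measurable borel" by (rule borel_measurable_sumcdf_borel[OF \<nu>])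
          show "sumcdf ?N n \<in> borel_measurable borel" by (rule borel_measurable_sumcdf_borel[OF N])
          show "mono (sumcdf \<nu> n)" by (intro monoI sumcdf_mono[OF \<nu>])
          show "\<bar>sumcdf \<nu> n w - sumcdf ?N n w\<bar> * tail_weight r w \<le> D" for w using D[of w] by (simp add: \<Delta>_def)
          show "0 \<le> L" by (simp add: L_def)
          fix x y assume "\<bar>y - x\<bar> \<le> r"
          then have "\<bar>y / r - x / r\<bar> \<le> 1" using r by (simp flip: diff_divide_distrib)
          from cdf_std_normal_weighted_lipschitz[OF this]
          show "\<bar>sumcdf ?N n y - sumcdf ?N n x\<bar> * tail_weight r x \<le> L * \<bar>y - x\<bar> / r"
            using less.prems r by (simp add: sumcdf_normal r_def[symmetric] tail_weight_def L_def flip: diff_divide_distrib)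
        qed
        then show ?thesis by (simp add: R_def \<Delta>_def)
      qed
      \<comment> \<open>The crude bound makes this supremum finite. Applying \<open>step\<close> to
        it gives Ds \<le> R + 3 Ds / 16, and the fraction can be absorbed.\<close>
      define Ds where "Ds = (SUP w. \<bar>\<Delta> n w\<bar> * tail_weight r w)"
      have bdd: "bdd_above (range (\<lambda>w. \<bar>\<Delta> n w\<bar> * tail_weight r w))" by (rule bdd_aboveI2[OF crude])
      have Ds: "\<bar>\<Delta> n w\<bar> * tail_weight r w \<le> Ds" for w unfolding Ds_def by (rule cSUP_upper[OF _ bdd]) auto
      have "Ds \<le> R + 3 * Ds / 16" unfolding Ds_def[of] by (rule cSUP_least) (auto intro: step[OF Ds, unfolded Ds_def])
      moreover have "0 \<le> Ds" using Ds[of 0] tail_weight_ge_1[OF r(2), of 0]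
        by (meson abs_ge_zero mult_nonneg_nonneg order_trans zero_le_one)
      ultimately have "Ds \<le> 2 * R" by linarith
      also have "2 * R \<le> K / r"
      proof -
        have "K * c * (8 / (\<tau> * r)) \<le> K / r * (1 / 16)"
        proof -
          have "c * 8 / \<tau> \<le> 1 / 16" using \<tau> c by (simp add: divide_le_eq)
          then have "K / r * (c * 8 / \<tau>) \<le> K / r * (1 / 16)" using K r by (intro mult_left_mono) auto
          then show ?thesis by (simp add: mult_ac)
        qed
        moreover have "K * c * (16 / r\<^sup>2) \<le> K / r * (1 / 16)"
        proof -
          have "c * 16 / r \<le> 1 / 16" using c256 r by (simp add: divide_le_eq)
          then have "K / r * (c * 16 / r) \<le> K / r * (1 / 16)" using K r by (intro mult_left_mono) auto
          then show ?thesis by (simp add: mult_ac power2_eq_square)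
        qed
        ultimately have "S \<le> K / r / 8 + c / r" unfolding S_def distrib_left by argo
        moreover have "(4 * c + 2 * (L * A * \<tau>)) / r \<le> (K / 2) / r"
          using r K1 LA c unfolding K_def by (intro divide_right_mono) (auto simp: field_simps)
        ultimately show ?thesis unfolding R_def by (simp add: add_divide_distrib)
      qed
      finally show ?thesis using Ds[of y] by (simp add: \<Delta>_def r_def)
    qed
  qed
  with K show thesis using that by blast
qed

section \<open>From convolution powers to i.i.d. samples\<close>

lemma (in prob_space) prob_sum_eq_sumcdf:
  fixes X :: "'i \<Rightarrow> 'a \<Rightarrow> real"
  assumes \<nu>: "prob_space \<nu>" "sets \<nu> = sets borel"
    and "finite I" "indep_vars (\<lambda>_. borel) X I" "\<And>i. i \<in> I \<Longrightarrow> distr M borel (X i) = \<nu>"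
  shows "prob {\<omega> \<in> space M. (\<Sum>i\<in>I. X i \<omega>) \<le> y} = sumcdf \<nu> (card I) y"
  using assms(3-)
proof (induction I arbitrary: y rule: finite_induct)
  case empty
  then show ?case by (auto simp: prob_space indicator_def)
next
  case (insert a F)
  let ?S = "\<lambda>\<omega>. \<Sum>i\<in>F. X i \<omega>"
  interpret N: prob_space \<nu> by fact
  have iv: "indep_var borel (X a) borel ?S"
    using insert by (intro indep_vars_sum) auto
  then have [measurable]: "X a \<in> borel_measurable M" "?S \<in> borel_measurable M"
    by (auto dest: indep_var_rv1 indep_var_rv2)
  interpret S: prob_space "distr M borel ?S" by (rule prob_space_distr) measurable
  have [measurable_cong]: "sets \<nu> = sets borel" by fact
  note [measurable] = borel_measurable_sumcdf_borel[OF \<nu>]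
  have IH: "prob {\<omega> \<in> space M. ?S \<omega> \<le> y} = sumcdf \<nu> (card F) y" for y
    using insert.prems by (intro insert.IH indep_vars_subset[OF insert.prems(1)]) auto
  have "emeasure M {\<omega> \<in> space M. (\<Sum>i\<in>insert a F. X i \<omega>) \<le> y}
     = emeasure (distr M borel (\<lambda>\<omega>. X a \<omega> + ?S \<omega>)) {..y}"
    using insert.hyps by (subst emeasure_distr) (auto intro!: arg_cong2[where f = emeasure])
  also have "\<dots> = emeasure (\<nu> \<star> distr M borel ?S) {..y}"
    using sum_indep_random_variable[OF iv] insert.prems(2)[of a] by simp
  also have "\<dots> = (\<integral>\<^sup>+x. emeasure (distr M borel ?S) {b. b + x \<in> {..y}} \<partial>\<nu>)"
    using \<nu> sets_eq_imp_space_eq[OF \<nu>(2)]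
    by (intro convolution_emeasure) (auto simp: N.finite_measure_axioms S.finite_measure_axioms)
  also have "\<dots> = (\<integral>\<^sup>+x. ennreal (sumcdf \<nu> (card F) (y - x)) \<partial>\<nu>)"
  proof (rule nn_integral_cong)
    fix x
    have "emeasure (distr M borel ?S) {b. b + x \<in> {..y}} = emeasure M {\<omega> \<in> space M. ?S \<omega> \<le> y - x}"
      by (subst emeasure_distr) (auto intro!: arg_cong2[where f = emeasure])
    then show "emeasure (distr M borel ?S) {b. b + x \<in> {..y}} = ennreal (sumcdf \<nu> (card F) (y - x))"
      by (simp add: emeasure_eq_measure IH)
  qed
  also have "\<dots> = ennreal (sumcdf \<nu> (Suc (card F)) y)"
    by (simp add: nn_integral_eq_integral[OF sumcdf_integrable[OF \<nu> sumcdf_le_1[OF \<nu>]]] sumcdf_nonneg[OF \<nu>(1)])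
  finally show ?case
    using insert.hyps sumcdf_nonneg[OF \<nu>(1), of "Suc (card F)" y]
    by (simp add: emeasure_eq_measure del: sumcdf.simps sum.insert)
qed

text \<open>Markov's inequality for the fourth power of 1 + |v|. The exponent 4 turns into n^(-2)
  when |y| is of order sqrt n.\<close>

lemma std_normal_tail:
  obtains M where "0 \<le> M"
    "\<And>y. 0 \<le> y \<Longrightarrow> 1 - cdf std_normal_distribution y \<le> M / (1 + \<bar>y\<bar>) ^ 4"
    "\<And>y. y \<le> 0 \<Longrightarrow> cdf std_normal_distribution y \<le> M / (1 + \<bar>y\<bar>) ^ 4"
proof -
  interpret N: real_distribution std_normal_distribution by (rule real_dist_normal_dist)
  obtain M where M: "0 \<le> M"
    "(\<integral>\<^sup>+v. ennreal ((1 + \<bar>v\<bar>) ^ 4 * std_normal_density v) \<partial>lborel) = ennreal M"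
    using nn_integral_poly_normal_density[of 1 4] by auto
  have *: "measure std_normal_distribution A \<le> M / (1 + \<bar>y\<bar>) ^ 4"
    if [measurable]: "A \<in> sets borel" and A: "\<And>w. w \<in> A \<Longrightarrow> \<bar>y\<bar> \<le> \<bar>w\<bar>" for A y
  proof -
    have "ennreal ((1 + \<bar>y\<bar>) ^ 4) * emeasure std_normal_distribution A
      = (\<integral>\<^sup>+w. ennreal ((1 + \<bar>y\<bar>) ^ 4) * (ennreal (std_normal_density w) * indicator A w) \<partial>lborel)"
      by (subst emeasure_density) (auto simp: nn_integral_cmult)
    also have "\<dots> \<le> (\<integral>\<^sup>+v. ennreal ((1 + \<bar>v\<bar>) ^ 4 * std_normal_density v) \<partial>lborel)"
    proof (rule nn_integral_mono)
      fix w
      show "ennreal ((1 + \<bar>y\<bar>) ^ 4) * (ennreal (std_normal_density w) * indicator A w)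
        \<le> ennreal ((1 + \<bar>w\<bar>) ^ 4 * std_normal_density w)"
      proof (cases "w \<in> A")
        case True
        then have "(1 + \<bar>y\<bar>) ^ 4 * std_normal_density w \<le> (1 + \<bar>w\<bar>) ^ 4 * std_normal_density w"
          using A[OF True] by (intro mult_right_mono power_mono) auto
        then show ?thesis using True by (simp add: ennreal_leI flip: ennreal_mult)
      qed simp
    qed
    also have "\<dots> = ennreal M" by (rule M(2))
    finally have "ennreal ((1 + \<bar>y\<bar>) ^ 4 * measure std_normal_distribution A) \<le> ennreal M"
      by (simp add: N.emeasure_eq_measure ennreal_mult)
    then show ?thesis using M(1) by (simp add: ennreal_le_iff pos_le_divide_eq mult.commute)
  qed
  show thesis
  proof (rule that[OF M(1)])
    fix y :: real assume "0 \<le> y"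
    have "1 - cdf std_normal_distribution y = measure std_normal_distribution (space std_normal_distribution - {..y})"
      by (subst N.prob_compl) (auto simp: cdf_def)
    also have "space std_normal_distribution - {..y} = {y<..}" by auto
    also have "measure std_normal_distribution {y<..} \<le> M / (1 + \<bar>y\<bar>) ^ 4"
      using \<open>0 \<le> y\<close> by (intro *) auto
    finally show "1 - cdf std_normal_distribution y \<le> M / (1 + \<bar>y\<bar>) ^ 4" .
  next
    fix y :: real assume "y \<le> 0"
    then show "cdf std_normal_distribution y \<le> M / (1 + \<bar>y\<bar>) ^ 4"
      unfolding cdf_def by (intro *) auto
  qed
qed

lemma (in prob_space) integrable_of_cube:
  fixes g :: "'a \<Rightarrow> real"
  assumes [measurable]: "g \<in> borel_measurable M" and i: "integrable M (\<lambda>x. \<bar>g x\<bar> ^ 3)"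
  shows "integrable M g" "integrable M (\<lambda>x. (g x)\<^sup>2)" "\<bar>expectation g\<bar> \<le> 1 + expectation (\<lambda>x. \<bar>g x\<bar> ^ 3)"
    "expectation (\<lambda>x. (g x)\<^sup>2) \<le> 1 + expectation (\<lambda>x. \<bar>g x\<bar> ^ 3)"
proof -
  have le: "\<bar>u\<bar> \<le> 1 + \<bar>u\<bar> ^ 3 \<and> u\<^sup>2 \<le> 1 + \<bar>u\<bar> ^ 3" for u :: real
  proof (cases "\<bar>u\<bar> \<le> 1")
    case True
    then show ?thesis by (simp add: power_le_one add_increasing2 abs_square_le_1)
  next
    case False
    then show ?thesis using self_le_power[of "\<bar>u\<bar>" 3] power_increasing[of 2 3 "\<bar>u\<bar>"]
      by simp
  qed
  have i': "integrable M (\<lambda>x. 1 + \<bar>g x\<bar> ^ 3)" using i by simp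
  show i1: "integrable M g" and i2: "integrable M (\<lambda>x. (g x)\<^sup>2)"
    using le by (auto intro!: Bochner_Integration.integrable_bound[OF i'])
  have "\<bar>expectation g\<bar> \<le> expectation (\<lambda>x. 1 + \<bar>g x\<bar> ^ 3)"
    using i1 i' le by (intro integral_abs_bound[THEN order_trans] integral_mono) auto
  then show "\<bar>expectation g\<bar> \<le> 1 + expectation (\<lambda>x. \<bar>g x\<bar> ^ 3)" using i by (simp add: prob_space)
  have "expectation (\<lambda>x. (g x)\<^sup>2) \<le> expectation (\<lambda>x. 1 + \<bar>g x\<bar> ^ 3)"
    using i2 i' le by (intro integral_mono) auto
  then show "expectation (\<lambda>x. (g x)\<^sup>2) \<le> 1 + expectation (\<lambda>x. \<bar>g x\<bar> ^ 3)" using i by (simp add: prob_space)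
qed

lemma abs_diff_cube_le: "\<bar>a - b :: real\<bar> ^ 3 \<le> 8 * (\<bar>a\<bar> ^ 3 + \<bar>b\<bar> ^ 3)"
proof -
  have "\<bar>a - b\<bar> ^ 3 \<le> (2 * max \<bar>a\<bar> \<bar>b\<bar>) ^ 3" by (intro power_mono) auto
  also have "\<dots> \<le> 8 * (\<bar>a\<bar> ^ 3 + \<bar>b\<bar> ^ 3)" unfolding power_mult_distrib by (auto simp: max_def)
  finally show ?thesis .
qed

lemma (in prob_space) variance_eq_moments:
  fixes g :: "'a \<Rightarrow> real"
  assumes "integrable M g" "integrable M (\<lambda>x. (g x)\<^sup>2)"
  shows "expectation (\<lambda>x. (g x - expectation g)\<^sup>2) = expectation (\<lambda>x. (g x)\<^sup>2) - (expectation g)\<^sup>2"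
  by (rule variance_eq[OF assms])

text \<open>\<open>D\<close> has a double role: it is the common law of the observations and carries
  the sigma-algebra of the observation space.\<close>

locale iid_sample = prob_space M for M :: "'w measure" +
  fixes D :: "'x measure" and X :: "nat \<Rightarrow> 'w \<Rightarrow> 'x"
  assumes law_prob: "prob_space D" and indep_sample: "indep_vars (\<lambda>_. D) X UNIV"
    and law_sample: "\<And>i. distr M D (X i) = D"
begin

sublocale D: prob_space D by (rule law_prob)

lemma measurable_sample[measurable]: "X i \<in> measurable M D"
  using indep_sample by (auto simp: indep_vars_def2)

lemma indep_sample_subset: "indep_vars (\<lambda>_. D) X I"
  by (rule indep_vars_subset[OF indep_sample]) auto

lemma AE_sample:
  assumes "AE x in D. Q x" shows "AE w in M. Q (X i w)"
  using assms AE_distrD[OF measurable_sample[of i], of Q] unfolding law_sample by blast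

text \<open>\<open>K\<close> is fixed before \<open>g\<close>: it depends on the bounds
  \<open>b\<close> and \<open>v0\<close> only. The score at \<theta>0 + t with t = z / sqrt (n I)
  changes with n and z, and a constant chosen for each \<open>g\<close> would be of no help.\<close>

theorem nonuniform_berry_esseen:
  fixes b v0 :: real
  assumes b: "0 \<le> b" and v0: "0 < v0"
  obtains K where "0 < K"
    "\<And>g n y. g \<in> borel_measurable D \<Longrightarrow> integrable D (\<lambda>x. \<bar>g x\<bar> ^ 3) \<Longrightarrow> (\<integral>x. \<bar>g x\<bar> ^ 3 \<partial>D) \<le> b \<Longrightarrow>
      v0 \<le> (\<integral>x. (g x)\<^sup>2 \<partial>D) - (\<integral>x. g x \<partial>D)\<^sup>2 \<Longrightarrow> 1 \<le> n \<Longrightarrow>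
      \<bar>prob {w \<in> space M. (\<Sum>i\<in>{1..n}. g (X i w)) \<le> real n * (\<integral>x. g x \<partial>D) +
          sqrt (real n) * sqrt ((\<integral>x. (g x)\<^sup>2 \<partial>D) - (\<integral>x. g x \<partial>D)\<^sup>2) * y} - cdf std_normal_distribution y\<bar>
        \<le> K / (sqrt (real n) * (1 + \<bar>y\<bar>) ^ 3)"
proof -
  \<comment> \<open>Bounds the third moment of the standardised variable: |g - m|^3 \<le> 8 (|g|^3 +
    |m|^3) with |m| \<le> 1 + b, divided by a standard deviation of at least sqrt v0.\<close>
  define \<rho> where "\<rho> = 8 * (b + (1 + b) ^ 3) / sqrt v0 ^ 3"
  have "0 \<le> \<rho>" using b v0 by (simp add: \<rho>_def)
  from nonuniform_berry_esseen_sumcdf[OF this] obtain K where K: "0 < K" "\<And>\<nu> n y. standardised_law \<nu> \<rho> \<Longrightarrow> 1 \<le> n \<Longrightarrow>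
    \<bar>sumcdf \<nu> n y - sumcdf std_normal_distribution n y\<bar> * tail_weight (sqrt (real n)) y \<le> K / sqrt (real n)"
    by blast
  show thesis
  proof (rule that[OF K(1)])
    fix g and n :: nat and y
    assume g[measurable]: "g \<in> borel_measurable D" and i3: "integrable D (\<lambda>x. \<bar>g x\<bar> ^ 3)" and le: "(\<integral>x. \<bar>g x\<bar> ^ 3 \<partial>D) \<le> b"
      and var: "v0 \<le> (\<integral>x. (g x)\<^sup>2 \<partial>D) - (\<integral>x. g x \<partial>D)\<^sup>2" and n: "1 \<le> n"
    define m where "m = (\<integral>x. g x \<partial>D)"
    define s where "s = sqrt ((\<integral>x. (g x)\<^sup>2 \<partial>D) - m\<^sup>2)"
    note ig = D.integrable_of_cube[OF g i3]
    have s: "0 < s" "s\<^sup>2 = (\<integral>x. (g x)\<^sup>2 \<partial>D) - m\<^sup>2" "sqrt v0 \<le> s"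
      using var v0 by (auto simp: s_def m_def)
    have mb: "\<bar>m\<bar> ^ 3 \<le> (1 + b) ^ 3" using ig(3) le by (intro power_mono) (auto simp: m_def)
    define h where "h x = (g x - m) / s" for x
    have h[measurable]: "h \<in> borel_measurable D" unfolding h_def[abs_def] by measurable
    define \<nu> where "\<nu> = distr D borel h"
    have pw: "\<bar>h x\<bar> ^ 3 \<le> 8 * (\<bar>g x\<bar> ^ 3 + (1 + b) ^ 3) / s ^ 3" for x
    proof -
      have "\<bar>g x - m\<bar> ^ 3 \<le> 8 * (\<bar>g x\<bar> ^ 3 + (1 + b) ^ 3)" using abs_diff_cube_le[of "g x" m] mb by simp
      then have "\<bar>g x - m\<bar> ^ 3 / s ^ 3 \<le> 8 * (\<bar>g x\<bar> ^ 3 + (1 + b) ^ 3) / s ^ 3"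
        using s by (intro divide_right_mono) auto
      then show ?thesis using s by (simp add: h_def power_divide)
    qed
    have bi: "integrable D (\<lambda>x. 8 * (\<bar>g x\<bar> ^ 3 + (1 + b) ^ 3) / s ^ 3)" using i3 by simp
    have hi: "integrable D (\<lambda>x. \<bar>h x\<bar> ^ 3)"
    proof (rule Bochner_Integration.integrable_bound[OF bi])
      have "norm (\<bar>h x\<bar> ^ 3) \<le> norm (8 * (\<bar>g x\<bar> ^ 3 + (1 + b) ^ 3) / s ^ 3)" for x
      proof -
        have "norm (\<bar>h x\<bar> ^ 3) = \<bar>h x\<bar> ^ 3" by simp
        also note pw[of x]
        also have "8 * (\<bar>g x\<bar> ^ 3 + (1 + b) ^ 3) / s ^ 3 \<le> norm (8 * (\<bar>g x\<bar> ^ 3 + (1 + b) ^ 3) / s ^ 3)"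
          unfolding real_norm_def by (rule abs_ge_self)
        finally show ?thesis .
      qed
      then show "AE x in D. norm (\<bar>h x\<bar> ^ 3) \<le> norm (8 * (\<bar>g x\<bar> ^ 3 + (1 + b) ^ 3) / s ^ 3)" by simp
    qed measurable
    have "standardised_law \<nu> \<rho>"
      unfolding standardised_law_def
    proof (intro conjI)
      show "prob_space \<nu>" unfolding \<nu>_def by (rule D.prob_space_distr) measurable
      show "sets \<nu> = sets borel" by (simp add: \<nu>_def)
      show "integrable \<nu> (\<lambda>u. \<bar>u\<bar> ^ 3)" unfolding \<nu>_def by (subst integrable_distr_eq) (auto simp: hi)
      have "(\<integral>u. u \<partial>\<nu>) = (\<integral>x. h x \<partial>D)" unfolding \<nu>_def by (subst integral_distr) auto
      also have "\<dots> = 0" using ig(1) by (simp add: h_def D.prob_space m_def)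
      finally show "(\<integral>u. u \<partial>\<nu>) = 0" .
      have "(\<integral>u. u\<^sup>2 \<partial>\<nu>) = (\<integral>x. (g x - m)\<^sup>2 / s\<^sup>2 \<partial>D)"
        unfolding \<nu>_def by (subst integral_distr) (auto simp: h_def power_divide)
      also have "\<dots> = s\<^sup>2 / s\<^sup>2"
        using D.variance_eq_moments[OF ig(1,2)] unfolding s(2) m_def by simp
      also have "\<dots> = 1" using s(1) by simp
      finally show "(\<integral>u. u\<^sup>2 \<partial>\<nu>) = 1" .
      have "(\<integral>u. \<bar>u\<bar> ^ 3 \<partial>\<nu>) = (\<integral>x. \<bar>h x\<bar> ^ 3 \<partial>D)" unfolding \<nu>_def by (subst integral_distr) auto
      also have "\<dots> \<le> (\<integral>x. 8 * (\<bar>g x\<bar> ^ 3 + (1 + b) ^ 3) / s ^ 3 \<partial>D)" by (intro integral_mono hi bi pw)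
      also have "\<dots> = 8 * ((\<integral>x. \<bar>g x\<bar> ^ 3 \<partial>D) + (1 + b) ^ 3) / s ^ 3" using i3 by (simp add: D.prob_space)
      also have "\<dots> \<le> \<rho>" unfolding \<rho>_def using le s v0 b
        by (intro frac_le power_mono mult_left_mono add_mono) auto
      finally show "(\<integral>u. \<bar>u\<bar> ^ 3 \<partial>\<nu>) \<le> \<rho>" .
    qed
    note law = this
    define r where "r = sqrt (real n)"
    have r: "0 < r" "r * r = real n" using n by (auto simp: r_def)
    have ind': "indep_vars (\<lambda>_. borel) (\<lambda>i w. h (X i w)) {1..n}"
      by (rule indep_vars_compose2[OF indep_sample_subset]) measurable
    have "distr M borel (\<lambda>w. h (X i w)) = \<nu>" if "i \<in> {1..n}" for i
    proof -
      have "distr M borel (\<lambda>w. h (X i w)) = distr (distr M D (X i)) borel h"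
        by (subst distr_distr) (auto simp: comp_def)
      then show ?thesis using law_sample by (simp add: \<nu>_def)
    qed
    from prob_sum_eq_sumcdf[OF prob_space_standardised_law[OF law] sets_standardised_law[OF law] _ ind' this, of "y * r"]
    have "measure M {w \<in> space M. (\<Sum>i\<in>{1..n}. h (X i w)) \<le> y * r} = sumcdf \<nu> n (y * r)" by simp
    moreover have "(\<Sum>i\<in>{1..n}. h (X i w)) \<le> y * r \<longleftrightarrow> (\<Sum>i\<in>{1..n}. g (X i w)) \<le> real n * m + r * s * y" for w
    proof -
      have "(\<Sum>i\<in>{1..n}. h (X i w)) = ((\<Sum>i\<in>{1..n}. g (X i w)) - real n * m) / s"
        by (simp add: h_def sum_divide_distrib[symmetric] sum_subtractf)
      then show ?thesis using s by (simp add: pos_divide_le_eq algebra_simps)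
    qed
    ultimately have "measure M {w \<in> space M. (\<Sum>i\<in>{1..n}. g (X i w)) \<le> real n * m + r * s * y} = sumcdf \<nu> n (y * r)"
      by simp
    moreover have "sumcdf std_normal_distribution n (y * r) = cdf std_normal_distribution y"
      using sumcdf_normal[of n "y * r"] n r by (simp add: r_def[symmetric])
    moreover have "tail_weight r (y * r) = (1 + \<bar>y\<bar>) ^ 3" using r by (simp add: tail_weight_def abs_mult)
    ultimately have "\<bar>measure M {w \<in> space M. (\<Sum>i\<in>{1..n}. g (X i w)) \<le> real n * m + r * s * y} - cdf std_normal_distribution y\<bar> * (1 + \<bar>y\<bar>) ^ 3 \<le> K / r"
      using K(2)[OF law n, of "y * r"] by (simp add: r_def)
    then have "\<bar>measure M {w \<in> space M. (\<Sum>i\<in>{1..n}. g (X i w)) \<le> real n * m + r * s * y} - cdf std_normal_distribution y\<bar> \<le> K / r / (1 + \<bar>y\<bar>) ^ 3"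
      by (subst pos_le_divide_eq) (auto simp: add_pos_nonneg)
    then show "\<bar>measure M {w \<in> space M. (\<Sum>i\<in>{1..n}. g (X i w)) \<le> real n * (\<integral>x. g x \<partial>D) +
          sqrt (real n) * sqrt ((\<integral>x. (g x)\<^sup>2 \<partial>D) - (\<integral>x. g x \<partial>D)\<^sup>2) * y} - cdf std_normal_distribution y\<bar>
        \<le> K / (sqrt (real n) * (1 + \<bar>y\<bar>) ^ 3)"
      by (simp add: r_def s_def m_def)
  qed
qed

text \<open>The nonuniform bound at y = a sqrt n has error of order 1 / (sqrt n y^3), that is
  n^(-2), and the normal tail is of the same order. So third moments give the rate that Chebyshev's
  inequality would draw from fourth moments. Variance 0 is separate: \<open>g\<close> is then almost
  surely constant and the event is null.\<close>

lemma sum_deviation_bound: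
  fixes g :: "'x \<Rightarrow> real"
  assumes g[measurable]: "g \<in> borel_measurable D" and i3: "integrable D (\<lambda>x. \<bar>g x\<bar> ^ 3)" and c: "0 < c"
  obtains C where "0 \<le> C" "\<And>n. 1 \<le> n \<Longrightarrow>
    prob {w \<in> space M. real n * (D.expectation g + c) < (\<Sum>i\<in>{1..n}. g (X i w))} \<le> C / (real n)\<^sup>2"
proof -
  note ig = D.integrable_of_cube[OF g i3]
  define m where "m = D.expectation g"
  define v where "v = D.expectation (\<lambda>x. (g x)\<^sup>2) - m\<^sup>2"
  have v: "v = D.expectation (\<lambda>x. (g x - m)\<^sup>2)"
    using D.variance_eq_moments[OF ig(1,2)] by (simp add: v_def m_def)
  then have v0: "0 \<le> v" by simp
  show thesis
  proof (cases "v = 0")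
    case True
    have "integrable D (\<lambda>x. (g x - m)\<^sup>2)" using ig by (simp add: power2_diff)
    then have "AE x in D. (g x - m)\<^sup>2 = 0"
      using True v integral_nonneg_eq_0_iff_AE[of D "\<lambda>x. (g x - m)\<^sup>2"] by auto
    then have "AE x in D. g x = m" by simp
    then have "AE w in M. \<forall>i. g (X i w) = m" by (subst AE_all_countable) (auto intro: AE_sample)
    then have "AE w in M. \<not> real n * (m + c) < (\<Sum>i\<in>{1..n}. g (X i w))" if "1 \<le> n" for n
      by eventually_elim (use c in \<open>simp add: algebra_simps not_less\<close>)
    then have "prob {w \<in> space M. real n * (m + c) < (\<Sum>i\<in>{1..n}. g (X i w))} = 0" if "1 \<le> n" for n
      using that by (subst prob_eq_0) auto
    then show thesis by (intro that[of 0]) (auto simp: m_def)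
  next
    case False
    then have v1: "0 < v" using v0 by simp
    obtain K where K: "0 < K" "\<And>n y. 1 \<le> n \<Longrightarrow>
      \<bar>prob {w \<in> space M. (\<Sum>i\<in>{1..n}. g (X i w)) \<le> real n * m + sqrt (real n) * sqrt v * y} - cdf std_normal_distribution y\<bar>
        \<le> K / (sqrt (real n) * (1 + \<bar>y\<bar>) ^ 3)"
    proof -
      have b: "0 \<le> (\<integral>x. \<bar>g x\<bar> ^ 3 \<partial>D)" by simp
      show thesis
      proof (rule nonuniform_berry_esseen[OF b v1], goal_cases)
        case (1 K)
        show ?case
          by (rule that[OF 1(1)]) (rule 1(2)[OF g i3 order_refl, folded m_def, folded v_def, OF order_refl])
      qed
    qed
    obtain C4 where C4: "0 \<le> C4" "\<And>y. 0 \<le> y \<Longrightarrow> 1 - cdf std_normal_distribution y \<le> C4 / (1 + \<bar>y\<bar>) ^ 4"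
      "\<And>y. y \<le> 0 \<Longrightarrow> cdf std_normal_distribution y \<le> C4 / (1 + \<bar>y\<bar>) ^ 4"
      by (rule std_normal_tail) (rule that)
    define a where "a = c / sqrt v"
    have a: "0 < a" using c v1 by (simp add: a_def)
    show thesis
    proof (rule that[of "C4 / a ^ 4 + K / a ^ 3"])
      show "0 \<le> C4 / a ^ 4 + K / a ^ 3" using C4 K a by simp
      fix n :: nat assume n: "1 \<le> n"
      define r where "r = sqrt (real n)"
      have r: "1 \<le> r" "r\<^sup>2 = real n" using n by (auto simp: r_def)
      define y where "y = a * r"
      have y: "0 < y" using a r by (simp add: y_def)
      have eq: "real n * m + sqrt (real n) * sqrt v * y = real n * (m + c)"
        using v1 r by (simp add: y_def a_def r_def[symmetric] distrib_left power2_eq_square mult_ac flip: r(2))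
      have "prob {w \<in> space M. real n * (m + c) < (\<Sum>i\<in>{1..n}. g (X i w))}
        = 1 - prob {w \<in> space M. (\<Sum>i\<in>{1..n}. g (X i w)) \<le> real n * (m + c)}"
        by (subst prob_neg[symmetric]) (auto simp: not_le)
      also have "\<dots> \<le> (1 - cdf std_normal_distribution y) + K / (r * (1 + \<bar>y\<bar>) ^ 3)"
        using K(2)[OF n, of y] unfolding eq r_def by (simp add: abs_le_iff)
      also have "\<dots> \<le> C4 / (1 + \<bar>y\<bar>) ^ 4 + K / (r * (1 + \<bar>y\<bar>) ^ 3)"
        using C4(2)[of y] y by simp
      also have "\<dots> \<le> C4 / (a * r) ^ 4 + K / (r * (a * r) ^ 3)"
        using C4(1) K(1) a r y by (intro add_mono divide_left_mono mult_left_mono power_mono mult_pos_pos zero_less_power)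
          (auto simp: y_def[symmetric] add_pos_pos)
      also have "\<dots> = (C4 / a ^ 4 + K / a ^ 3) / (r\<^sup>2)\<^sup>2"
      proof -
        have r4: "(r\<^sup>2)\<^sup>2 = r ^ 4" by (simp flip: power_mult)
        show ?thesis unfolding r4 power_mult_distrib add_divide_distrib
          using a r(1) by (simp add: eval_nat_numeral)
      qed
      finally show "prob {w \<in> space M. real n * (D.expectation g + c) < (\<Sum>i\<in>{1..n}. g (X i w))}
        \<le> (C4 / a ^ 4 + K / a ^ 3) / (real n)\<^sup>2" unfolding r(2) m_def .
    qed
  qed
qed

end

section \<open>Comparison of the estimator with the score\<close>

text \<open>The only property of the two readings of probability that is used: both lie between the
  measures of a measurable subset and a measurable superset.\<close>

lemma outer_measure_of_sandwich:
  assumes "finite_measure M" and A: "A \<in> sets M" "A \<subseteq> E" and B: "B \<in> sets M" "E \<subseteq> B"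
    and Q: "Q \<in> {outer_measure_of M, inner_measure_of M}"
  shows "measure M A \<le> enn2real (Q E)" "enn2real (Q E) \<le> measure M B"
proof -
  interpret finite_measure M by fact
  have "emeasure M A \<le> Q E \<and> Q E \<le> emeasure M B"
  proof -
    have "emeasure M A \<le> outer_measure_of M E"
      unfolding outer_measure_of_def using A by (intro INF_greatest emeasure_mono) auto
    moreover have "outer_measure_of M E \<le> emeasure M B"
      unfolding outer_measure_of_def using B by (intro INF_lower) auto
    moreover have "emeasure M A \<le> inner_measure_of M E"
      unfolding inner_measure_of_def using A by (intro SUP_upper) auto
    moreover have "inner_measure_of M E \<le> emeasure M B"
      unfolding inner_measure_of_def using B by (intro SUP_least emeasure_mono) auto
    ultimately show ?thesis using Q by auto
  qed
  then have AE: "ennreal (measure M A) \<le> Q E" and EB: "Q E \<le> ennreal (measure M B)"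
    by (simp_all add: emeasure_eq_measure)
  show "enn2real (Q E) \<le> measure M B" using enn2real_mono[OF EB] by simp
  have "Q E < top" using EB by (simp add: order_le_less_trans)
  then show "measure M A \<le> enn2real (Q E)" using enn2real_mono[OF AE] by simp
qed

text \<open>It will be applied with |y - z| of order z^2 / sqrt n; the fifth power pays for z^2 and
  leaves the cubic weight. The relative closeness gives 1 + |z| \<le> 2 (1 + |w|) between the two
  points, whence 2^20 = 32 * 32768.\<close>

lemma cdf_std_normal_close:
  assumes "\<bar>y - z\<bar> \<le> \<bar>z\<bar> / 2"
  shows "\<bar>cdf std_normal_distribution y - cdf std_normal_distribution z\<bar> * (1 + \<bar>z\<bar>) ^ 5 \<le> 2 ^ 20 * \<bar>y - z\<bar>"
proof -
  define c where "c = 2 ^ 20 / (1 + \<bar>z\<bar>) ^ 5"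
  have d: "std_normal_density w \<le> c" if "\<bar>w - z\<bar> \<le> \<bar>z\<bar> / 2" for w
  proof -
    have "\<bar>z\<bar> \<le> \<bar>w\<bar> + \<bar>w - z\<bar>" by simp
    then have "1 + \<bar>z\<bar> \<le> 2 * (1 + \<bar>w\<bar>)" using that by simp
    then have "(1 + \<bar>z\<bar>) ^ 5 \<le> (2 * (1 + \<bar>w\<bar>)) ^ 5" by (intro power_mono) auto
    also have "\<dots> = 32 * (1 + \<bar>w\<bar>) ^ 5" unfolding power_mult_distrib by simp
    finally have "std_normal_density w * (1 + \<bar>z\<bar>) ^ 5 \<le> std_normal_density w * (32 * (1 + \<bar>w\<bar>) ^ 5)"
      by (intro mult_left_mono) auto
    also have "\<dots> \<le> 2 ^ 20" using std_normal_density_decay[of 5 w] by (simp add: mult_ac)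
    finally show ?thesis unfolding c_def by (subst pos_le_divide_eq) (auto simp: add_pos_nonneg)
  qed
  have "\<bar>cdf std_normal_distribution y - cdf std_normal_distribution z\<bar> \<le> c * \<bar>y - z\<bar>"
  proof (cases "z \<le> y")
    case True
    then show ?thesis using cdf_std_normal_diff[OF True, of c] d assms by auto
  next
    case False
    then show ?thesis using cdf_std_normal_diff[of y z c] d assms by auto
  qed
  then have "\<bar>cdf std_normal_distribution y - cdf std_normal_distribution z\<bar> * (1 + \<bar>z\<bar>) ^ 5 \<le> c * \<bar>y - z\<bar> * (1 + \<bar>z\<bar>) ^ 5"
    by (intro mult_right_mono) auto
  also have "\<dots> = 2 ^ 20 * \<bar>y - z\<bar>" by (simp add: c_def)
  finally show ?thesis .
qed

text \<open>\<open>Y t\<close> is the score of one observation at \<open>\<theta>\<^sub>0 + t\<close>, \<open>Z\<close> and \<open>U\<close> are its value and its derivative at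
  \<open>t = 0\<close>, and \<open>I\<close> is the Fisher information.\<close>
locale score_sample = iid_sample M D X
  for M :: "'w measure" and D :: "'x measure" and X :: "nat \<Rightarrow> 'w \<Rightarrow> 'x" +
  fixes Z U R :: "'x \<Rightarrow> real" and Y :: "real \<Rightarrow> 'x \<Rightarrow> real" and \<delta> I :: real
  assumes \<delta>_pos: "0 < \<delta>" and I_pos: "0 < I"
    and meas[measurable]: "Z \<in> borel_measurable D" "U \<in> borel_measurable D" "R \<in> borel_measurable D"
    and Y_meas: "\<And>t. \<bar>t\<bar> \<le> \<delta> \<Longrightarrow> Y t \<in> borel_measurable D"
    and Y_expand: "\<And>t x. \<bar>t\<bar> \<le> \<delta> \<Longrightarrow> x \<in> space D \<Longrightarrow> \<bar>Y t x - Z x - t * U x\<bar> \<le> R x * t\<^sup>2"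
    and cubes: "integrable D (\<lambda>x. \<bar>Z x\<bar> ^ 3)" "integrable D (\<lambda>x. \<bar>U x\<bar> ^ 3)" "integrable D (\<lambda>x. \<bar>R x\<bar> ^ 3)"
    and mean_Z: "D.expectation Z = 0" and var_Z: "D.expectation (\<lambda>x. (Z x)\<^sup>2) = I" and mean_U: "D.expectation U = - I"
begin

lemma R_nonneg: "x \<in> space D \<Longrightarrow> 0 \<le> R x"
proof -
  assume x: "x \<in> space D"
  have "0 \<le> R x * \<delta>\<^sup>2" by (rule order_trans[OF abs_ge_zero Y_expand]) (use x \<delta>_pos in auto)
  then show "0 \<le> R x" using \<delta>_pos by (simp add: zero_le_mult_iff)
qed

text \<open>At \<theta>0 + t the score has mean -t I + O(t^2) and variance I + O(t). In its own
  standardisation the threshold 0 becomes a point y with |y - z| of order sqrt n t^2, that is z^2 /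
  sqrt n, and replacing \<Phi>(y) by \<Phi>(z) costs no more than the Berry--Esseen error.\<close>

lemma score_local_comparison:
  obtains \<delta>1 C where "0 < \<delta>1" "\<delta>1 \<le> \<delta>" "0 < C"
    "\<And>n z. 1 \<le> n \<Longrightarrow> \<bar>z / sqrt (real n * I)\<bar> \<le> \<delta>1 \<Longrightarrow>
      \<bar>prob {w \<in> space M. (\<Sum>i\<in>{1..n}. Y (z / sqrt (real n * I)) (X i w)) \<le> 0} - cdf std_normal_distribution z\<bar>
        \<le> C / (sqrt (real n) * (1 + \<bar>z\<bar>) ^ 3)"
proof -
  note Zi = D.integrable_of_cube[OF meas(1) cubes(1)]
  note Ui = D.integrable_of_cube[OF meas(2) cubes(2)]
  note Ri = D.integrable_of_cube[OF meas(3) cubes(3)]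
  \<comment> \<open>A Lipschitz constant in t at the origin: |Y t - Z| \<le> |t| V for |t| \<le>
    \<delta>, with finite third moment.\<close>
  define V where "V x = \<bar>U x\<bar> + \<delta> * \<bar>R x\<bar>" for x
  have Vm[measurable]: "V \<in> borel_measurable D" unfolding V_def[abs_def] by measurable
  have V0: "0 \<le> V x" for x using \<delta>_pos by (simp add: V_def)
  have Vc: "integrable D (\<lambda>x. \<bar>V x\<bar> ^ 3)"
  proof (rule Bochner_Integration.integrable_bound)
    show "integrable D (\<lambda>x. 8 * (\<bar>U x\<bar> ^ 3 + \<delta> ^ 3 * \<bar>R x\<bar> ^ 3))" using cubes by simp
    have "\<bar>V x\<bar> ^ 3 \<le> 8 * (\<bar>U x\<bar> ^ 3 + \<delta> ^ 3 * \<bar>R x\<bar> ^ 3)" for x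
      using abs_diff_cube_le[of "\<bar>U x\<bar>" "- (\<delta> * \<bar>R x\<bar>)"] \<delta>_pos
      by (simp add: V_def abs_mult power_mult_distrib)
    then show "AE x in D. norm (\<bar>V x\<bar> ^ 3) \<le> norm (8 * (\<bar>U x\<bar> ^ 3 + \<delta> ^ 3 * \<bar>R x\<bar> ^ 3))"
      using \<delta>_pos by (intro AE_I2) (simp add: power_abs)
  qed measurable
  note Vi = D.integrable_of_cube[OF Vm Vc]
  have YZ: "\<bar>Y t x - Z x\<bar> \<le> \<bar>t\<bar> * V x" if "\<bar>t\<bar> \<le> \<delta>" "x \<in> space D" for t x
  proof -
    have "\<bar>Y t x - Z x\<bar> \<le> \<bar>t * U x\<bar> + R x * t\<^sup>2" using Y_expand[OF that] by linarith
    also have "\<dots> = \<bar>t\<bar> * (\<bar>U x\<bar> + \<bar>t\<bar> * R x)" by (simp add: abs_mult algebra_simps power2_eq_square)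
    also have "\<dots> \<le> \<bar>t\<bar> * V x"
      unfolding V_def using that R_nonneg[OF that(2)] by (intro mult_left_mono add_mono mult_mono) auto
    finally show ?thesis .
  qed
  \<comment> \<open>A bound for the third moment of \<open>Y t\<close> that is the same for all |t|
    \<le> \<delta>, as the uniform theorem demands.\<close>
  define b where "b = D.expectation (\<lambda>x. 8 * (\<bar>Z x\<bar> ^ 3 + \<delta> ^ 3 * \<bar>V x\<bar> ^ 3))"
  have bi: "integrable D (\<lambda>x. 8 * (\<bar>Z x\<bar> ^ 3 + \<delta> ^ 3 * \<bar>V x\<bar> ^ 3))" using cubes Vc by simp
  have b0: "0 \<le> b" unfolding b_def using \<delta>_pos by (intro integral_nonneg_AE) simp
  have Ycube: "integrable D (\<lambda>x. \<bar>Y t x\<bar> ^ 3)" "D.expectation (\<lambda>x. \<bar>Y t x\<bar> ^ 3) \<le> b" if t: "\<bar>t\<bar> \<le> \<delta>" for t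
  proof -
    note [measurable] = Y_meas[OF t]
    have le: "\<bar>Y t x\<bar> ^ 3 \<le> 8 * (\<bar>Z x\<bar> ^ 3 + \<delta> ^ 3 * \<bar>V x\<bar> ^ 3)" if "x \<in> space D" for x
    proof -
      have "\<bar>t\<bar> * V x \<le> \<delta> * V x" using t V0 by (intro mult_right_mono) auto
      then have "\<bar>Y t x\<bar> \<le> \<bar>\<bar>Z x\<bar> - (- (\<delta> * V x))\<bar>" using YZ[OF t that] by linarith
      then have "\<bar>Y t x\<bar> ^ 3 \<le> \<bar>\<bar>Z x\<bar> - (- (\<delta> * V x))\<bar> ^ 3" by (intro power_mono) auto
      also have "\<dots> \<le> 8 * (\<bar>Z x\<bar> ^ 3 + \<delta> ^ 3 * \<bar>V x\<bar> ^ 3)"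
        using abs_diff_cube_le[of "\<bar>Z x\<bar>" "- (\<delta> * V x)"] \<delta>_pos by (simp add: abs_mult power_mult_distrib)
      finally show ?thesis .
    qed
    have n: "AE x in D. norm (\<bar>Y t x\<bar> ^ 3) \<le> norm (8 * (\<bar>Z x\<bar> ^ 3 + \<delta> ^ 3 * \<bar>V x\<bar> ^ 3))"
      using le \<delta>_pos by (intro AE_I2) (simp add: power_abs)
    show i: "integrable D (\<lambda>x. \<bar>Y t x\<bar> ^ 3)"
      by (rule Bochner_Integration.integrable_bound[OF bi _ n]) measurable
    show "D.expectation (\<lambda>x. \<bar>Y t x\<bar> ^ 3) \<le> b" unfolding b_def by (rule integral_mono[OF i bi le])
  qed
  define r where "r = D.expectation R"
  have r0: "0 \<le> r" unfolding r_def using R_nonneg by (intro integral_nonneg_AE) simp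
  define k1 where "k1 = D.expectation (\<lambda>x. \<bar>V x * (2 * \<bar>Z x\<bar> + \<delta> * V x)\<bar>)"
  have VZi: "integrable D (\<lambda>x. V x * (2 * \<bar>Z x\<bar> + \<delta> * V x))"
  proof (rule Bochner_Integration.integrable_bound)
    show "integrable D (\<lambda>x. (V x)\<^sup>2 * (1 + \<delta>) + (Z x)\<^sup>2)" using Vi Zi by simp
    have "V x * (2 * \<bar>Z x\<bar> + \<delta> * V x) \<le> (V x)\<^sup>2 * (1 + \<delta>) + (Z x)\<^sup>2" for x
      using zero_le_power2[of "V x - \<bar>Z x\<bar>"] by (simp add: power2_eq_square algebra_simps)
    then show "AE x in D. norm (V x * (2 * \<bar>Z x\<bar> + \<delta> * V x)) \<le> norm ((V x)\<^sup>2 * (1 + \<delta>) + (Z x)\<^sup>2)"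
      using V0 \<delta>_pos by (intro AE_I2) (simp add: abs_mult)
  qed measurable
  have k10: "0 \<le> k1" by (simp add: k1_def)
  have mt: "\<bar>D.expectation (Y t) + t * I\<bar> \<le> t\<^sup>2 * r"
    and qt: "\<bar>D.expectation (\<lambda>x. (Y t x)\<^sup>2) - I\<bar> \<le> \<bar>t\<bar> * k1" if t: "\<bar>t\<bar> \<le> \<delta>" for t
  proof -
    note [measurable] = Y_meas[OF t]
    note Yi = D.integrable_of_cube[OF Y_meas[OF t] Ycube(1)[OF t]]
    have "D.expectation (Y t) + t * I = D.expectation (\<lambda>x. Y t x - Z x - t * U x)"
      using Yi Zi Ui mean_Z mean_U by simp
    also have "\<bar>\<dots>\<bar> \<le> D.expectation (\<lambda>x. R x * t\<^sup>2)"
      using Yi Zi Ui Ri Y_expand[OF t] by (intro integral_abs_bound[THEN order_trans] integral_mono) auto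
    also have "\<dots> = t\<^sup>2 * r" by (simp add: r_def)
    finally show "\<bar>D.expectation (Y t) + t * I\<bar> \<le> t\<^sup>2 * r" .
    have "D.expectation (\<lambda>x. (Y t x)\<^sup>2) - I = D.expectation (\<lambda>x. (Y t x)\<^sup>2 - (Z x)\<^sup>2)"
      using Yi Zi var_Z by simp
    also have "\<bar>\<dots>\<bar> \<le> D.expectation (\<lambda>x. \<bar>t\<bar> * \<bar>V x * (2 * \<bar>Z x\<bar> + \<delta> * V x)\<bar>)"
    proof (intro integral_abs_bound[THEN order_trans] integral_mono)
      show "integrable D (\<lambda>x. \<bar>(Y t x)\<^sup>2 - (Z x)\<^sup>2\<bar>)" using Yi Zi by simp
      show "integrable D (\<lambda>x. \<bar>t\<bar> * \<bar>V x * (2 * \<bar>Z x\<bar> + \<delta> * V x)\<bar>)" using VZi by simp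
      fix x assume x: "x \<in> space D"
      have "\<bar>t\<bar> * V x \<le> \<delta> * V x" using t V0 by (intro mult_right_mono) auto
      then have "\<bar>Y t x + Z x\<bar> \<le> 2 * \<bar>Z x\<bar> + \<delta> * V x" using YZ[OF t x] by linarith
      then have "\<bar>Y t x - Z x\<bar> * \<bar>Y t x + Z x\<bar> \<le> (\<bar>t\<bar> * V x) * (2 * \<bar>Z x\<bar> + \<delta> * V x)"
        using YZ[OF t x] V0[of x] by (intro mult_mono) auto
      also have "\<dots> \<le> \<bar>t\<bar> * \<bar>V x * (2 * \<bar>Z x\<bar> + \<delta> * V x)\<bar>"
        unfolding mult.assoc by (intro mult_left_mono abs_ge_self) auto
      also have "\<bar>Y t x - Z x\<bar> * \<bar>Y t x + Z x\<bar> = \<bar>(Y t x)\<^sup>2 - (Z x)\<^sup>2\<bar>"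
        by (simp add: abs_mult[symmetric] power2_eq_square algebra_simps)
      finally show "\<bar>(Y t x)\<^sup>2 - (Z x)\<^sup>2\<bar> \<le> \<bar>t\<bar> * \<bar>V x * (2 * \<bar>Z x\<bar> + \<delta> * V x)\<bar>" .
    qed
    also have "\<dots> = \<bar>t\<bar> * k1" by (simp add: k1_def)
    finally show "\<bar>D.expectation (\<lambda>x. (Y t x)\<^sup>2) - I\<bar> \<le> \<bar>t\<bar> * k1" .
  qed
  \<comment> \<open>The second summand accounts for the squared mean, which is O(t^2) and hence at
    most \<delta> |t| times a constant.\<close>
  define k2 where "k2 = k1 + \<delta> * (I + \<delta> * r)\<^sup>2"
  have k20: "0 \<le> k2" using k10 \<delta>_pos by (simp add: k2_def)
  have vt: "\<bar>D.expectation (\<lambda>x. (Y t x)\<^sup>2) - (D.expectation (Y t))\<^sup>2 - I\<bar> \<le> k2 * \<bar>t\<bar>" if t: "\<bar>t\<bar> \<le> \<delta>" for t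
  proof -
    have "\<bar>D.expectation (Y t)\<bar> \<le> \<bar>t * I\<bar> + t\<^sup>2 * r" using mt[OF t] by linarith
    also have "\<dots> = \<bar>t\<bar> * (I + \<bar>t\<bar> * r)" using I_pos by (simp add: abs_mult algebra_simps power2_eq_square)
    also have "\<dots> \<le> \<bar>t\<bar> * (I + \<delta> * r)" using t r0 by (intro mult_left_mono add_left_mono mult_right_mono) auto
    finally have "\<bar>D.expectation (Y t)\<bar>\<^sup>2 \<le> (\<bar>t\<bar> * (I + \<delta> * r))\<^sup>2" by (intro power_mono) auto
    also have "\<dots> = \<bar>t\<bar> * (\<bar>t\<bar> * (I + \<delta> * r)\<^sup>2)" by (simp add: power2_eq_square algebra_simps)
    also have "\<dots> \<le> \<bar>t\<bar> * (\<delta> * (I + \<delta> * r)\<^sup>2)" using t by (intro mult_left_mono mult_right_mono) auto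
    finally have "(D.expectation (Y t))\<^sup>2 \<le> \<bar>t\<bar> * (\<delta> * (I + \<delta> * r)\<^sup>2)" by simp
    moreover have "k2 * \<bar>t\<bar> = \<bar>t\<bar> * k1 + \<bar>t\<bar> * (\<delta> * (I + \<delta> * r)\<^sup>2)" by (simp add: k2_def algebra_simps)
    moreover have "0 \<le> (D.expectation (Y t))\<^sup>2" by simp
    ultimately show ?thesis using qt[OF t] by linarith
  qed
  define e where "e = sqrt I"
  have e: "0 < e" "e * e = I" using I_pos by (auto simp: e_def)
  define k3 where "k3 = 2 * (r + k2) / e"
  have k30: "0 \<le> k3" using r0 k20 e by (simp add: k3_def)
  have v0: "0 < I / 2" using I_pos by simp
  obtain K where K: "0 < K"
    "\<And>g n y. g \<in> borel_measurable D \<Longrightarrow> integrable D (\<lambda>x. \<bar>g x\<bar> ^ 3) \<Longrightarrow> (\<integral>x. \<bar>g x\<bar> ^ 3 \<partial>D) \<le> b \<Longrightarrow>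
      I / 2 \<le> (\<integral>x. (g x)\<^sup>2 \<partial>D) - (\<integral>x. g x \<partial>D)\<^sup>2 \<Longrightarrow> 1 \<le> n \<Longrightarrow>
      \<bar>prob {w \<in> space M. (\<Sum>i\<in>{1..n}. g (X i w)) \<le> real n * (\<integral>x. g x \<partial>D) +
          sqrt (real n) * sqrt ((\<integral>x. (g x)\<^sup>2 \<partial>D) - (\<integral>x. g x \<partial>D)\<^sup>2) * y} - cdf std_normal_distribution y\<bar>
        \<le> K / (sqrt (real n) * (1 + \<bar>y\<bar>) ^ 3)"
    using nonuniform_berry_esseen[OF b0 v0] by blast
  \<comment> \<open>The second entry keeps the variance at least I / 2, the third makes |y - z|
    \<le> |z| / 2. Adding 1 to \<open>k2\<close> and \<open>k3\<close> avoids a division by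
    0.\<close>
  define \<delta>1 where "\<delta>1 = min \<delta> (min (I / (2 * (1 + k2))) (e / (2 * (1 + k3))))"
  have \<delta>1: "0 < \<delta>1" "\<delta>1 \<le> \<delta>" using \<delta>_pos I_pos e k20 k30 by (auto simp: \<delta>1_def)
  have cancel: "d * (x / (2 * d)) = x / 2" if "0 < d" for d x :: real using that by simp
  have \<delta>1k2: "k2 * \<delta>1 \<le> I / 2"
  proof -
    have "k2 * \<delta>1 \<le> (1 + k2) * (I / (2 * (1 + k2)))"
      using k20 \<delta>1 by (intro mult_mono) (auto simp: \<delta>1_def)
    also have "(1 + k2) * (I / (2 * (1 + k2))) = I / 2" using k20 by (intro cancel) auto
    finally show ?thesis .
  qed
  have \<delta>1k3: "k3 * \<delta>1 \<le> e / 2"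
  proof -
    have "k3 * \<delta>1 \<le> (1 + k3) * (e / (2 * (1 + k3)))"
      using k30 \<delta>1 by (intro mult_mono) (auto simp: \<delta>1_def)
    also have "(1 + k3) * (e / (2 * (1 + k3))) = e / 2" using k30 by (intro cancel) auto
    finally show ?thesis .
  qed
  define C where "C = 8 * K + 2 ^ 20 * (k3 / I)"
  have C: "0 < C" using K k30 I_pos by (simp add: C_def add_pos_nonneg)
  show thesis
  proof (rule that[OF \<delta>1 C])
    fix n :: nat and z assume n: "1 \<le> n" and z: "\<bar>z / sqrt (real n * I)\<bar> \<le> \<delta>1"
    define t where "t = z / sqrt (real n * I)"
    define q where "q = sqrt (real n)"
    have q: "0 < q" "q * q = real n" using n by (auto simp: q_def)
    have zt: "z = t * (q * e)" using q e by (simp add: t_def real_sqrt_mult q_def[symmetric] e_def[symmetric])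
    have t: "\<bar>t\<bar> \<le> \<delta>1" "\<bar>t\<bar> \<le> \<delta>" using z \<delta>1 by (auto simp: t_def)
    define m where "m = D.expectation (Y t)"
    define v where "v = D.expectation (\<lambda>x. (Y t x)\<^sup>2) - m\<^sup>2"
    define s where "s = sqrt v"
    have "k2 * \<bar>t\<bar> \<le> k2 * \<delta>1" using t k20 by (intro mult_left_mono) auto
    then have v: "I / 2 \<le> v" "\<bar>v - I\<bar> \<le> k2 * \<bar>t\<bar>"
      using vt[OF t(2)] \<delta>1k2 unfolding v_def m_def by linarith+
    have s: "e / 2 \<le> s" "0 < s" "s * s = v"
    proof -
      have "(e / 2)\<^sup>2 \<le> v" using v(1) e I_pos by (simp add: power2_eq_square)
      then show "e / 2 \<le> s" unfolding s_def by (rule real_le_rsqrt)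
      then show "0 < s" using e by simp
      show "s * s = v" using v I_pos by (simp add: s_def)
    qed
    have se: "e * \<bar>e - s\<bar> \<le> k2 * \<bar>t\<bar>"
    proof -
      have "e * \<bar>e - s\<bar> \<le> (e + s) * \<bar>e - s\<bar>" using s e by (intro mult_right_mono) auto
      also have "\<dots> = \<bar>(e + s) * (e - s)\<bar>" using s e by (simp add: abs_mult)
      also have "\<dots> = \<bar>v - I\<bar>" using e(2) s(3) by (simp add: algebra_simps abs_minus_commute)
      finally show ?thesis using v(2) by simp
    qed
    define y where "y = - q * m / s"
    have yz: "\<bar>y - z\<bar> \<le> q * t\<^sup>2 * k3"
    proof -
      \<comment> \<open>Separates the error of the mean from that of the standard deviation, using e
        * e = I. The latter is controlled by e |e - s| \<le> |v - I|.\<close>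
      have eq: "y - z = q * ((- m - t * I) + t * (e * (e - s))) / s"
        using s q e(2) unfolding y_def zt by (simp add: field_simps)
      have "\<bar>(- m - t * I) + t * (e * (e - s))\<bar> \<le> t\<^sup>2 * r + \<bar>t\<bar> * (k2 * \<bar>t\<bar>)"
      proof -
        have "\<bar>t * (e * (e - s))\<bar> \<le> \<bar>t\<bar> * (k2 * \<bar>t\<bar>)"
          using se e by (simp add: abs_mult mult_left_mono)
        moreover have "\<bar>- m - t * I\<bar> \<le> t\<^sup>2 * r" using mt[OF t(2)] by (simp add: m_def abs_minus_commute abs_if split: if_splits)
        ultimately show ?thesis by linarith
      qed
      also have "\<dots> = t\<^sup>2 * (r + k2)" by (simp add: power2_eq_square algebra_simps)
      finally have "\<bar>y - z\<bar> \<le> q * (t\<^sup>2 * (r + k2)) / s"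
        unfolding eq using q s by (simp add: abs_mult divide_right_mono)
      also have "\<dots> \<le> q * (t\<^sup>2 * (r + k2)) / (e / 2)"
        using s e q r0 k20 by (intro divide_left_mono) auto
      also have "\<dots> = q * t\<^sup>2 * k3" using e by (simp add: k3_def)
      finally show ?thesis .
    qed
    have yz2: "\<bar>y - z\<bar> \<le> \<bar>z\<bar> / 2"
    proof -
      have "k3 * \<bar>t\<bar> \<le> e / 2" using \<delta>1k3 t k30 by (meson mult_left_mono order_trans)
      then have "(q * \<bar>t\<bar>) * (k3 * \<bar>t\<bar>) \<le> (q * \<bar>t\<bar>) * (e / 2)" using q by (intro mult_left_mono) auto
      moreover have "(q * \<bar>t\<bar>) * (k3 * \<bar>t\<bar>) = q * t\<^sup>2 * k3" by (simp add: power2_eq_square)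
      moreover have "(q * \<bar>t\<bar>) * (e / 2) = \<bar>z\<bar> / 2" using q e by (simp add: zt abs_mult)
      ultimately show ?thesis using yz by linarith
    qed
    have "real n * m + q * s * y = 0" using s q by (simp add: y_def flip: q(2))
    then have "\<bar>prob {w \<in> space M. (\<Sum>i\<in>{1..n}. Y t (X i w)) \<le> 0} - cdf std_normal_distribution y\<bar> \<le> K / (q * (1 + \<bar>y\<bar>) ^ 3)"
      using K(2)[OF Y_meas[OF t(2)] Ycube[OF t(2)] _ n, of y] v
      unfolding m_def v_def s_def q_def by simp
    also have "\<dots> \<le> 8 * K / (q * (1 + \<bar>z\<bar>) ^ 3)"
    proof -
      have "(1 + \<bar>z\<bar>) ^ 3 \<le> (2 * (1 + \<bar>y\<bar>)) ^ 3" using yz2 by (intro power_mono) (auto simp: abs_if split: if_splits)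
      then have "(1 + \<bar>z\<bar>) ^ 3 \<le> 8 * (1 + \<bar>y\<bar>) ^ 3" unfolding power_mult_distrib by simp
      then have "q * (1 + \<bar>z\<bar>) ^ 3 \<le> 8 * (q * (1 + \<bar>y\<bar>) ^ 3)" using q by simp
      then have "8 * K / (8 * (q * (1 + \<bar>y\<bar>) ^ 3)) \<le> 8 * K / (q * (1 + \<bar>z\<bar>) ^ 3)"
        using K q by (intro divide_left_mono mult_pos_pos zero_less_power) auto
      then show ?thesis by simp
    qed
    finally have 1: "\<bar>prob {w \<in> space M. (\<Sum>i\<in>{1..n}. Y t (X i w)) \<le> 0} - cdf std_normal_distribution y\<bar> \<le> 8 * K / (q * (1 + \<bar>z\<bar>) ^ 3)" .
    have 2: "\<bar>cdf std_normal_distribution y - cdf std_normal_distribution z\<bar> \<le> 2 ^ 20 * (k3 / I) / (q * (1 + \<bar>z\<bar>) ^ 3)"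
    proof -
      define a where "a = 1 + \<bar>z\<bar>"
      have a: "1 \<le> a" "z\<^sup>2 \<le> a\<^sup>2" by (auto simp: a_def abs_le_square_iff[symmetric])
      have "\<bar>cdf std_normal_distribution y - cdf std_normal_distribution z\<bar> * a ^ 5 \<le> 2 ^ 20 * \<bar>y - z\<bar>"
        using cdf_std_normal_close[OF yz2] by (simp add: a_def)
      also have "\<dots> \<le> 2 ^ 20 * (q * t\<^sup>2 * k3)" using yz by simp
      also have "q * t\<^sup>2 * k3 = z\<^sup>2 * (k3 / I) / q"
      proof -
        have z2: "z\<^sup>2 = t\<^sup>2 * (q * q) * (e * e)" by (simp add: zt power2_eq_square)
        show ?thesis unfolding z2 e(2) using q(1) I_pos by simp
      qed
      also have "2 ^ 20 * (z\<^sup>2 * (k3 / I) / q) \<le> 2 ^ 20 * (a\<^sup>2 * (k3 / I) / q)"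
        using a k30 I_pos q by (intro mult_left_mono divide_right_mono mult_right_mono) auto
      finally have "\<bar>cdf std_normal_distribution y - cdf std_normal_distribution z\<bar> \<le> 2 ^ 20 * (a\<^sup>2 * (k3 / I) / q) / a ^ 5"
        using a by (subst pos_le_divide_eq) auto
      also have "\<dots> = 2 ^ 20 * (k3 / I) / (q * a ^ 3)"
        using a q by (simp add: eval_nat_numeral)
      finally show ?thesis by (simp add: a_def)
    qed
    have "\<bar>prob {w \<in> space M. (\<Sum>i\<in>{1..n}. Y t (X i w)) \<le> 0} - cdf std_normal_distribution z\<bar>
      \<le> 8 * K / (q * (1 + \<bar>z\<bar>) ^ 3) + 2 ^ 20 * (k3 / I) / (q * (1 + \<bar>z\<bar>) ^ 3)"
      using 1 2 by linarith
    also have "\<dots> = C / (q * (1 + \<bar>z\<bar>) ^ 3)" unfolding C_def by (rule add_divide_distrib[symmetric])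
    finally show "\<bar>prob {w \<in> space M. (\<Sum>i\<in>{1..n}. Y (z / sqrt (real n * I)) (X i w)) \<le> 0} - cdf std_normal_distribution z\<bar>
        \<le> C / (sqrt (real n) * (1 + \<bar>z\<bar>) ^ 3)" by (simp add: t_def q_def)
  qed
qed

text \<open>The exceptional set may depend on \<open>n\<close> but not on \<open>t\<close>, so that
  one set serves all z. Off this set the equivalence is exact and pointwise, which is what a
  non-measurable estimator requires.\<close>

definition localises :: "(nat \<Rightarrow> 'w \<Rightarrow> ereal) \<Rightarrow> real \<Rightarrow> real \<Rightarrow> real \<Rightarrow> bool" where
  "localises T \<theta>\<^sub>0 \<delta>' C \<longleftrightarrow> (\<forall>n\<ge>1. \<exists>B\<in>sets M. prob B \<le> C / (real n)\<^sup>2 \<and>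
     (\<forall>w\<in>space M - B. \<exists>\<tau>. T n w = ereal \<tau> \<and> \<bar>\<tau> - \<theta>\<^sub>0\<bar> \<le> \<delta>' \<and>
        (\<forall>t. \<bar>t\<bar> \<le> \<delta>' \<longrightarrow> (\<tau> \<le> \<theta>\<^sub>0 + t \<longleftrightarrow> (\<Sum>i\<in>{1..n}. Y t (X i w)) \<le> 0))))"

text \<open>Put t = z / sqrt (n I). For |t| \<le> \<delta>2 the event and the score event agree
  outside \<open>B\<close>. For larger |t| the event is, up to \<open>B\<close>, everything or
  nothing, and since |z| is then at least of order sqrt n, the normal tail at z is itself
  O(1/n^2).\<close>

lemma estimator_comparison:
  assumes loc: "\<And>\<delta>1. 0 < \<delta>1 \<Longrightarrow> \<delta>1 \<le> \<delta> \<Longrightarrow> \<exists>\<delta>2 C. 0 < \<delta>2 \<and> \<delta>2 \<le> \<delta>1 \<and> localises T \<theta>\<^sub>0 \<delta>2 C"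
  obtains C where "0 < C" "\<And>Q n z. Q \<in> {outer_measure_of M, inner_measure_of M} \<Longrightarrow> 1 \<le> n \<Longrightarrow>
    \<bar>enn2real (Q {w \<in> space M. ereal (sqrt (real n * I)) * (T n w - ereal \<theta>\<^sub>0) \<le> ereal z})
      - cdf std_normal_distribution z\<bar> \<le> C / (sqrt (real n) * (1 + \<bar>z\<bar>) ^ 3) + C / (real n)\<^sup>2"
proof -
  obtain \<delta>1 C1 where \<delta>1: "0 < \<delta>1" "\<delta>1 \<le> \<delta>" "0 < C1" and c1:
    "\<And>n z. 1 \<le> n \<Longrightarrow> \<bar>z / sqrt (real n * I)\<bar> \<le> \<delta>1 \<Longrightarrow>
      \<bar>prob {w \<in> space M. (\<Sum>i\<in>{1..n}. Y (z / sqrt (real n * I)) (X i w)) \<le> 0} - cdf std_normal_distribution z\<bar>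
        \<le> C1 / (sqrt (real n) * (1 + \<bar>z\<bar>) ^ 3)" using score_local_comparison by blast
  obtain \<delta>2 C2 where \<delta>2: "0 < \<delta>2" "\<delta>2 \<le> \<delta>1" and lc: "localises T \<theta>\<^sub>0 \<delta>2 C2" using loc[OF \<delta>1(1,2)] by blast
  obtain C4 where C4: "0 \<le> C4"
    "\<And>y. 0 \<le> y \<Longrightarrow> 1 - cdf std_normal_distribution y \<le> C4 / (1 + \<bar>y\<bar>) ^ 4"
    "\<And>y. y \<le> 0 \<Longrightarrow> cdf std_normal_distribution y \<le> C4 / (1 + \<bar>y\<bar>) ^ 4"
    by (rule std_normal_tail) (rule that)
  interpret N: real_distribution std_normal_distribution by (rule real_dist_normal_dist)
  \<comment> \<open>From |t| \<ge> \<delta>2 follows c3 n^2 \<le> (1 + |z|)^4, the conversion of the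
    normal tail into n^(-2).\<close>
  define c3 where "c3 = (\<delta>2 * sqrt I) ^ 4"
  have c3: "0 < c3" using \<delta>2 I_pos by (simp add: c3_def)
  define C where "C = C1 + \<bar>C2\<bar> + C4 / c3"
  have "0 \<le> C4 / c3" using C4(1) c3 by simp
  then have C: "0 < C" "C1 \<le> C" "C2 + C4 / c3 \<le> C" "C2 \<le> C"
    using \<delta>1(3) unfolding C_def by linarith+
  show thesis
  proof (rule that[OF C(1)])
    fix Q :: "'w set \<Rightarrow> ennreal" and n :: nat and z :: real
    assume Q: "Q \<in> {outer_measure_of M, inner_measure_of M}" and n: "1 \<le> n"
    define E where "E = {w \<in> space M. ereal (sqrt (real n * I)) * (T n w - ereal \<theta>\<^sub>0) \<le> ereal z}"
    define t where "t = z / sqrt (real n * I)"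
    obtain B where B[measurable]: "B \<in> sets M" and PB: "prob B \<le> C2 / (real n)\<^sup>2"
      and BT0: "\<forall>w\<in>space M - B. \<exists>\<tau>. T n w = ereal \<tau> \<and> \<bar>\<tau> - \<theta>\<^sub>0\<bar> \<le> \<delta>2 \<and>
        (\<forall>t. \<bar>t\<bar> \<le> \<delta>2 \<longrightarrow> (\<tau> \<le> \<theta>\<^sub>0 + t \<longleftrightarrow> (\<Sum>i\<in>{1..n}. Y t (X i w)) \<le> 0))"
      using lc[unfolded localises_def, rule_format, OF n] by (elim bexE conjE) (rule that)
    note BT = bspec[OF BT0]
    note sw = outer_measure_of_sandwich[OF finite_measure_axioms _ _ _ _ Q]
    have ni: "0 < sqrt (real n * I)" using n I_pos by simp
    have Eiff: "w \<in> E \<longleftrightarrow> \<tau> \<le> \<theta>\<^sub>0 + t" if "w \<in> space M" "T n w = ereal \<tau>" for w \<tau>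
    proof -
      have "w \<in> E \<longleftrightarrow> sqrt (real n * I) * (\<tau> - \<theta>\<^sub>0) \<le> z" using that by (simp add: E_def)
      also have "\<dots> \<longleftrightarrow> \<tau> - \<theta>\<^sub>0 \<le> t" unfolding t_def using ni by (simp add: pos_le_divide_eq mult.commute)
      finally show ?thesis by auto
    qed
    have ESp: "E \<subseteq> space M" by (auto simp: E_def)
    have nonneg: "0 \<le> C / (sqrt (real n) * (1 + \<bar>z\<bar>) ^ 3)" using C by simp
    have z4: "C4 / (1 + \<bar>z\<bar>) ^ 4 \<le> C4 / c3 / (real n)\<^sup>2" if "\<delta>2 \<le> \<bar>t\<bar>"
    proof -
      have "\<delta>2 * sqrt (real n * I) \<le> \<bar>z\<bar>"
        using that ni by (simp add: t_def pos_le_divide_eq)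
      then have "\<delta>2 * sqrt I * sqrt (real n) \<le> 1 + \<bar>z\<bar>" by (simp add: real_sqrt_mult mult_ac)
      then have "(\<delta>2 * sqrt I * sqrt (real n)) ^ 4 \<le> (1 + \<bar>z\<bar>) ^ 4"
        using \<delta>2 I_pos by (intro power_mono) auto
      moreover have "sqrt (real n) ^ (2 * 2) = ((sqrt (real n))\<^sup>2)\<^sup>2" by (rule power_mult)
      ultimately have "c3 * (real n)\<^sup>2 \<le> (1 + \<bar>z\<bar>) ^ 4"
        by (simp add: power_mult_distrib c3_def)
      then have "C4 / (1 + \<bar>z\<bar>) ^ 4 \<le> C4 / (c3 * (real n)\<^sup>2)"
        using C4(1) c3 n by (intro divide_left_mono mult_pos_pos) (auto simp: add_pos_nonneg)
      then show ?thesis by simp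
    qed
    have "\<bar>enn2real (Q E) - cdf std_normal_distribution z\<bar> \<le> C / (sqrt (real n) * (1 + \<bar>z\<bar>) ^ 3) + C / (real n)\<^sup>2"
    proof -
      consider "\<bar>t\<bar> \<le> \<delta>2" | "\<delta>2 < t" | "t < - \<delta>2" by linarith
      then show ?thesis
      proof cases
        case 1
        then have t\<delta>: "\<bar>t\<bar> \<le> \<delta>1" "\<bar>t\<bar> \<le> \<delta>" using \<delta>1 \<delta>2 by auto
        note [measurable] = Y_meas[OF t\<delta>(2)]
        define S where "S = {w \<in> space M. (\<Sum>i\<in>{1..n}. Y t (X i w)) \<le> 0}"
        have S[measurable]: "S \<in> sets M" unfolding S_def by measurable
        have "S - B \<subseteq> E" "E \<subseteq> S \<union> B"
          using BT Eiff 1 ESp by (fastforce simp: S_def)+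
        then have "prob (S - B) \<le> enn2real (Q E)" "enn2real (Q E) \<le> prob (S \<union> B)"
          using sw[of "S - B" E "S \<union> B"] by auto
        moreover have "prob (S \<union> B) \<le> prob S + prob B" by (rule measure_Un_le) auto
        moreover have "prob S \<le> prob (S - B) + prob B"
        proof -
          have "prob S \<le> prob ((S - B) \<union> B)" by (rule finite_measure_mono) auto
          also have "\<dots> \<le> prob (S - B) + prob B" by (rule measure_Un_le) auto
          finally show ?thesis .
        qed
        moreover have "\<bar>prob S - cdf std_normal_distribution z\<bar> \<le> C1 / (sqrt (real n) * (1 + \<bar>z\<bar>) ^ 3)"
          using c1[OF n, of z] t\<delta>(1) by (simp add: t_def S_def)
        moreover have "C1 / (sqrt (real n) * (1 + \<bar>z\<bar>) ^ 3) \<le> C / (sqrt (real n) * (1 + \<bar>z\<bar>) ^ 3)"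
          using C by (intro divide_right_mono) auto
        moreover have "C2 / (real n)\<^sup>2 \<le> C / (real n)\<^sup>2" using C by (intro divide_right_mono) auto
        ultimately show ?thesis using PB by linarith
      next
        case 2
        have "0 < t" using 2 \<delta>2 by simp
        then have zp: "0 \<le> z" using ni by (simp add: t_def zero_less_divide_iff)
        have "space M - B \<subseteq> E"
        proof
          fix w assume w: "w \<in> space M - B"
          then obtain \<tau> where "T n w = ereal \<tau>" "\<bar>\<tau> - \<theta>\<^sub>0\<bar> \<le> \<delta>2" using BT by blast
          then show "w \<in> E" using Eiff w 2 by auto
        qed
        then have "prob (space M - B) \<le> enn2real (Q E)" "enn2real (Q E) \<le> prob (space M)"
          using sw[of "space M - B" E "space M"] ESp by auto
        then have "1 - prob B \<le> enn2real (Q E)" "enn2real (Q E) \<le> 1" using prob_compl[of B] by (auto simp: prob_space)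
        moreover have "cdf std_normal_distribution z \<le> 1" by (rule N.cdf_bounded_prob)
        moreover have "1 - cdf std_normal_distribution z \<le> C4 / c3 / (real n)\<^sup>2"
          using C4(2)[OF zp] z4 2 by linarith
        moreover have "C2 / (real n)\<^sup>2 + C4 / c3 / (real n)\<^sup>2 \<le> C / (real n)\<^sup>2"
          using C unfolding add_divide_distrib[symmetric] by (intro divide_right_mono) auto
        moreover have "0 \<le> prob B" by simp
        moreover have "0 \<le> C4 / c3 / (real n)\<^sup>2" using C4 c3 by simp
        ultimately show ?thesis using PB nonneg by linarith
      next
        case 3
        have "t < 0" using 3 \<delta>2 by simp
        then have zp: "z \<le> 0" using ni by (simp add: t_def divide_less_0_iff)
        have "E \<subseteq> B"
        proof
          fix w assume w: "w \<in> E"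
          show "w \<in> B"
          proof (rule ccontr)
            assume "w \<notin> B"
            then obtain \<tau> where "T n w = ereal \<tau>" "\<bar>\<tau> - \<theta>\<^sub>0\<bar> \<le> \<delta>2" using BT[of w] w ESp by blast
            then show False using Eiff[of w \<tau>] w ESp 3 by auto
          qed
        qed
        then have "enn2real (Q E) \<le> prob B" using sw[of "{}" E B] by auto
        moreover have "0 \<le> cdf std_normal_distribution z" by (rule N.cdf_nonneg)
        moreover have "cdf std_normal_distribution z \<le> C4 / c3 / (real n)\<^sup>2"
          using C4(3)[OF zp] z4 3 by linarith
        moreover have "C2 / (real n)\<^sup>2 + C4 / c3 / (real n)\<^sup>2 \<le> C / (real n)\<^sup>2"
          using C unfolding add_divide_distrib[symmetric] by (intro divide_right_mono) auto
        moreover have "0 \<le> prob B" "0 \<le> enn2real (Q E)" by auto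
        moreover have "0 \<le> C4 / c3 / (real n)\<^sup>2" using C4 c3 by simp
        ultimately show ?thesis using PB nonneg by linarith
      qed
    qed
    then show "\<bar>enn2real (Q {w \<in> space M. ereal (sqrt (real n * I)) * (T n w - ereal \<theta>\<^sub>0) \<le> ereal z})
      - cdf std_normal_distribution z\<bar> \<le> C / (sqrt (real n) * (1 + \<bar>z\<bar>) ^ 3) + C / (real n)\<^sup>2"
      by (simp add: E_def)
  qed
qed

end

text \<open>For the uniform rate 1 / n^2 \<le> 1 / sqrt n suffices. For the other rate, z \<le>
  \<omega> sqrt n gives z^3 sqrt n \<le> \<omega>^3 n^2, so the term 1 / n^2 fits at the price of a
  factor \<omega>^3.\<close>

lemma combined_bound_imp_rates:
  fixes e :: "nat \<Rightarrow> real \<Rightarrow> real"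
  assumes C: "0 < C" and e: "\<And>n z. 1 \<le> n \<Longrightarrow> e n z \<le> C / (sqrt (real n) * (1 + \<bar>z\<bar>) ^ 3) + C / (real n)\<^sup>2"
  shows "\<exists>C>0. \<forall>n\<ge>1. \<forall>z. e n z \<le> C / sqrt (real n)"
    and "\<forall>\<omega>>0. \<exists>C>0. \<forall>n\<ge>1. \<forall>z. 0 < z \<and> z \<le> \<omega> * sqrt (real n) \<longrightarrow> e n z \<le> C / (z ^ 3 * sqrt (real n))"
proof -
  have q: "1 \<le> sqrt (real n)" "sqrt (real n) ^ 4 = (real n)\<^sup>2" if "1 \<le> n" for n :: nat
  proof -
    show "1 \<le> sqrt (real n)" using that by simp
    have "sqrt (real n) ^ (2 * 2) = ((sqrt (real n))\<^sup>2)\<^sup>2" by (rule power_mult)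
    then show "sqrt (real n) ^ 4 = (real n)\<^sup>2" by simp
  qed
  show "\<exists>C>0. \<forall>n\<ge>1. \<forall>z. e n z \<le> C / sqrt (real n)"
  proof (intro exI[of _ "2 * C"] conjI allI impI)
    show "0 < 2 * C" using C by simp
    fix n :: nat and z assume n: "1 \<le> n"
    have "C / (sqrt (real n) * (1 + \<bar>z\<bar>) ^ 3) \<le> C / (sqrt (real n) * 1)"
      using C q(1)[OF n] by (intro divide_left_mono mult_left_mono one_le_power mult_pos_pos) (auto simp: add_pos_nonneg)
    moreover have "C / (real n)\<^sup>2 \<le> C / sqrt (real n)"
      unfolding q(2)[OF n, symmetric] using C q(1)[OF n] self_le_power[of "sqrt (real n)" 4] by (intro divide_left_mono) auto
    ultimately show "e n z \<le> 2 * C / sqrt (real n)" using e[OF n, of z] by simp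
  qed
  show "\<forall>\<omega>>0. \<exists>C>0. \<forall>n\<ge>1. \<forall>z. 0 < z \<and> z \<le> \<omega> * sqrt (real n) \<longrightarrow> e n z \<le> C / (z ^ 3 * sqrt (real n))"
  proof (intro allI impI)
    fix \<omega> :: real assume \<omega>: "0 < \<omega>"
    show "\<exists>C>0. \<forall>n\<ge>1. \<forall>z. 0 < z \<and> z \<le> \<omega> * sqrt (real n) \<longrightarrow> e n z \<le> C / (z ^ 3 * sqrt (real n))"
    proof (intro exI[of _ "C + C * \<omega> ^ 3"] conjI allI impI)
      show "0 < C + C * \<omega> ^ 3" using C \<omega> by (simp add: add_pos_pos)
      fix n :: nat and z assume n: "1 \<le> n" and z: "0 < z \<and> z \<le> \<omega> * sqrt (real n)"
      define r where "r = sqrt (real n)"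
      have r: "1 \<le> r" "r ^ 4 = (real n)\<^sup>2" using q[OF n] by (auto simp: r_def)
      have "C / (r * (1 + \<bar>z\<bar>) ^ 3) \<le> C / (r * z ^ 3)"
        using C r z by (intro divide_left_mono mult_left_mono power_mono mult_pos_pos) (auto simp: add_pos_nonneg)
      moreover have "C / (real n)\<^sup>2 \<le> C * \<omega> ^ 3 / (r * z ^ 3)"
      proof -
        have "z ^ 3 \<le> (\<omega> * r) ^ 3" using z by (intro power_mono) (auto simp: r_def)
        then have "C * (r * z ^ 3) \<le> C * (r * (\<omega> * r) ^ 3)" using C r by (intro mult_left_mono) auto
        also have "\<dots> = C * \<omega> ^ 3 * r ^ 4" by (simp add: power_mult_distrib eval_nat_numeral)
        finally show ?thesis using r z unfolding r(2)[symmetric]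
          by (subst frac_le_eq[symmetric, THEN iffD1] | simp add: divide_le_eq le_divide_eq field_simps)+
      qed
      ultimately have "e n z \<le> C / (r * z ^ 3) + C * \<omega> ^ 3 / (r * z ^ 3)" using e[OF n, of z] unfolding r_def by linarith
      then show "e n z \<le> (C + C * \<omega> ^ 3) / (z ^ 3 * sqrt (real n))"
        by (simp add: r_def add_divide_distrib mult.commute)
    qed
  qed
qed

section \<open>Localisation of the estimator\<close>

text \<open>The points of the extended line outside [\<theta>0 - d, \<theta>0 + d], both infinities
  included, form an open set. Near such a point all likelihood values are at most \<open>c\<close>,
  so the limsup there stays strictly below the supremum.\<close>

lemma generalized_maximizer_localised:
  assumes gm: "generalized_maximizer \<Theta> L T" and a: "a \<in> \<Theta>" "c < L a"
    and far: "\<And>\<theta>. \<theta> \<in> \<Theta> \<Longrightarrow> d < \<bar>\<theta> - \<theta>\<^sub>0\<bar> \<Longrightarrow> L \<theta> \<le> c"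
  obtains \<tau> where "T = ereal \<tau>" "\<bar>\<tau> - \<theta>\<^sub>0\<bar> \<le> d"
proof (rule ccontr)
  assume nt: "\<not> thesis"
  define S where "S = {..<ereal (\<theta>\<^sub>0 - d)} \<union> {ereal (\<theta>\<^sub>0 + d)<..}"
  have S: "open S" "T \<in> S"
  proof -
    show "open S" by (simp add: S_def open_Un)
    show "T \<in> S"
    proof (rule ccontr)
      assume "T \<notin> S"
      then have T: "ereal (\<theta>\<^sub>0 - d) \<le> T" "T \<le> ereal (\<theta>\<^sub>0 + d)" by (auto simp: S_def not_less)
      then obtain \<tau> where "T = ereal \<tau>" by (cases T) auto
      then show False using nt that[of \<tau>] T by (auto simp: abs_le_iff)
    qed
  qed
  define F where "F = inf (filtercomap ereal (nhds T)) (principal \<Theta>)"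
  have "eventually (\<lambda>t. t \<in> S) (nhds T)" using S by (rule eventually_nhds_in_open)
  then have "eventually (\<lambda>\<theta>. ereal \<theta> \<in> S) (filtercomap ereal (nhds T))"
    by (auto simp: eventually_filtercomap)
  then have "eventually (\<lambda>\<theta>. ereal (L \<theta>) \<le> ereal c) F"
    unfolding F_def eventually_inf_principal
    by eventually_elim (auto simp: S_def intro!: far)
  then have "Limsup F (\<lambda>\<theta>. ereal (L \<theta>)) \<le> ereal c" by (rule Limsup_bounded)
  moreover have "ereal (L a) \<le> (SUP \<theta>\<in>\<Theta>. ereal (L \<theta>))" using a(1) by (rule SUP_upper)
  moreover have "(SUP \<theta>\<in>\<Theta>. ereal (L \<theta>)) = Limsup F (\<lambda>\<theta>. ereal (L \<theta>))"
    using gm unfolding generalized_maximizer_def F_def by blast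
  ultimately have "ereal (L a) \<le> ereal c" by (metis order_trans)
  then show False using a(2) by simp
qed

text \<open>At a point of continuity the limsup does not exceed the value, so a generalised
  maximiser is a maximiser in the ordinary sense.\<close>

lemma generalized_maximizer_attained:
  assumes gm: "generalized_maximizer \<Theta> L (ereal \<tau>)" and cont: "isCont L \<tau>" and \<theta>: "\<theta> \<in> \<Theta>"
  shows "L \<theta> \<le> L \<tau>"
proof (rule field_le_epsilon)
  fix e :: real assume "0 < e"
  define F where "F = inf (filtercomap ereal (nhds (ereal \<tau>))) (principal \<Theta>)"
  have "(L \<longlongrightarrow> L \<tau>) (nhds \<tau>)" using cont by (simp add: isCont_def tendsto_at_iff_tendsto_nhds)
  then have "eventually (\<lambda>t. L t < L \<tau> + e) (nhds \<tau>)" using \<open>0 < e\<close> by (intro order_tendstoD) auto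
  then obtain S where S: "open S" "\<tau> \<in> S" "\<And>t. t \<in> S \<Longrightarrow> L t < L \<tau> + e"
    unfolding eventually_nhds by blast
  have "eventually (\<lambda>t. t \<in> ereal ` S) (nhds (ereal \<tau>))"
    using S open_ereal[OF S(1)] by (intro eventually_nhds_in_open) auto
  then have "eventually (\<lambda>\<theta>. ereal \<theta> \<in> ereal ` S) (filtercomap ereal (nhds (ereal \<tau>)))"
    by (auto simp: eventually_filtercomap)
  then have "eventually (\<lambda>\<theta>. ereal (L \<theta>) \<le> ereal (L \<tau> + e)) F"
    unfolding F_def eventually_inf_principal
    by eventually_elim (auto dest: S(3) less_imp_le)
  then have "Limsup F (\<lambda>\<theta>. ereal (L \<theta>)) \<le> ereal (L \<tau> + e)" by (rule Limsup_bounded)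
  moreover have "ereal (L \<theta>) \<le> (SUP \<theta>\<in>\<Theta>. ereal (L \<theta>))" using \<theta> by (rule SUP_upper)
  moreover have "(SUP \<theta>\<in>\<Theta>. ereal (L \<theta>)) = Limsup F (\<lambda>\<theta>. ereal (L \<theta>))"
    using gm unfolding generalized_maximizer_def F_def by blast
  ultimately have "ereal (L \<theta>) \<le> ereal (L \<tau> + e)" by (metis order_trans)
  then show "L \<theta> \<le> L \<tau> + e" by simp
qed

text \<open>\<open>A\<close> is a set of full measure on which all regularity holds for every |t|
  \<le> \<delta> simultaneously, and \<open>W t\<close> is the second derivative of the
  log-likelihood at \<theta>0 + t. The bound on \<open>W\<close> is one-sided because only its
  negativity is wanted.\<close>

locale mle_model = score_sample M D X Z U R Y \<delta> I
  for M :: "'w measure" and D :: "'x measure" and X :: "nat \<Rightarrow> 'w \<Rightarrow> 'x"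
    and Z U R :: "'x \<Rightarrow> real" and Y :: "real \<Rightarrow> 'x \<Rightarrow> real" and \<delta> I :: real +
  fixes \<Theta> :: "real set" and p :: "real \<Rightarrow> 'x \<Rightarrow> real" and \<theta>\<^sub>0 :: real and A :: "'x set"
    and W :: "real \<Rightarrow> 'x \<Rightarrow> real"
  assumes A_sets: "A \<in> sets D" and A_AE: "AE x in D. x \<in> A"
    and p_nonneg: "\<And>\<theta> x. \<theta> \<in> \<Theta> \<Longrightarrow> x \<in> space D \<Longrightarrow> 0 \<le> p \<theta> x"
    and near_interior: "{\<theta>\<^sub>0 - \<delta> .. \<theta>\<^sub>0 + \<delta>} \<subseteq> interior \<Theta>"
    and p_pos: "\<And>x t. x \<in> A \<Longrightarrow> \<bar>t\<bar> \<le> \<delta> \<Longrightarrow> 0 < p (\<theta>\<^sub>0 + t) x"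
    and score_deriv: "\<And>x t. x \<in> A \<Longrightarrow> \<bar>t\<bar> \<le> \<delta> \<Longrightarrow> ((\<lambda>t. ln (p (\<theta>\<^sub>0 + t) x)) has_real_derivative Y t x) (at t)"
    and hess_deriv: "\<And>x t. x \<in> A \<Longrightarrow> \<bar>t\<bar> \<le> \<delta> \<Longrightarrow> ((\<lambda>t. Y t x) has_real_derivative W t x) (at t)"
    and hess_bound: "\<And>x t. x \<in> A \<Longrightarrow> \<bar>t\<bar> \<le> \<delta> \<Longrightarrow> W t x \<le> U x + \<bar>t\<bar> * R x"
begin

abbreviation "r \<equiv> D.expectation R"

text \<open>The score decreases strictly on [-d, d] and changes sign between -d/2 and d/2. The signs
  are taken at half the radius, so that an estimator confined to radius d/2 lies in the interior of
  the region where the score is monotone.\<close>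

definition regular_sample :: "real \<Rightarrow> nat \<Rightarrow> 'w \<Rightarrow> bool" where
  "regular_sample d n w \<longleftrightarrow> (\<forall>i. X i w \<in> A) \<and> (\<forall>t. \<bar>t\<bar> \<le> d \<longrightarrow> (\<Sum>i\<in>{1..n}. W t (X i w)) < 0) \<and>
     (\<Sum>i\<in>{1..n}. Y (d / 2) (X i w)) < 0 \<and> 0 < (\<Sum>i\<in>{1..n}. Y (- (d / 2)) (X i w))"

lemma R_mean_nonneg: "0 \<le> r"
  using R_nonneg by (intro integral_nonneg_AE) simp

text \<open>A null set and four deviations are excluded. Then the sum of the \<open>U\<close> is at
  most -n I / 2 and d times the sum of the \<open>R\<close> at most n I / 4, so the second
  derivative is negative. At s = d/2 the score is at most n s I (1/8 - 1/2 + 1/8), and symmetrically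
  at -s.\<close>

lemma regular_sample_event:
  assumes d: "0 < d" "d \<le> \<delta>" "4 * (d * (r + 1)) \<le> I"
  obtains C where "\<And>n. 1 \<le> n \<Longrightarrow> \<exists>B\<in>sets M. prob B \<le> C / (real n)\<^sup>2 \<and> (\<forall>w\<in>space M - B. regular_sample d n w)"
proof -
  define s where "s = d / 2"
  have s: "0 < s" "s \<le> \<delta>" "d = 2 * s" using d by (auto simp: s_def)
  have I2: "0 < I / 2" and e: "0 < s * I / 8" using I_pos s by auto
  have mm: "integrable D (\<lambda>x. \<bar>- Z x\<bar> ^ 3)" "(\<lambda>x. - Z x) \<in> borel_measurable D" using cubes by auto
  have mZ: "D.expectation (\<lambda>x. - Z x) = 0" using mean_Z by simp
  obtain C1 where C1: "0 \<le> C1" "\<And>n. 1 \<le> n \<Longrightarrow> prob {w \<in> space M. real n * (- I + I / 2) < (\<Sum>i\<in>{1..n}. U (X i w))} \<le> C1 / (real n)\<^sup>2"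
    by (rule sum_deviation_bound[OF meas(2) cubes(2) I2, unfolded mean_U]) (rule that)
  obtain C2 where C2: "0 \<le> C2" "\<And>n. 1 \<le> n \<Longrightarrow> prob {w \<in> space M. real n * (r + 1) < (\<Sum>i\<in>{1..n}. R (X i w))} \<le> C2 / (real n)\<^sup>2"
    by (rule sum_deviation_bound[OF meas(3) cubes(3) zero_less_one]) (rule that)
  obtain C3 where C3: "0 \<le> C3" "\<And>n. 1 \<le> n \<Longrightarrow> prob {w \<in> space M. real n * (0 + s * I / 8) < (\<Sum>i\<in>{1..n}. Z (X i w))} \<le> C3 / (real n)\<^sup>2"
    by (rule sum_deviation_bound[OF meas(1) cubes(1) e, unfolded mean_Z]) (rule that)
  obtain C4 where C4: "0 \<le> C4" "\<And>n. 1 \<le> n \<Longrightarrow> prob {w \<in> space M. real n * (0 + s * I / 8) < (\<Sum>i\<in>{1..n}. - Z (X i w))} \<le> C4 / (real n)\<^sup>2"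
    by (rule sum_deviation_bound[OF mm(2,1) e, unfolded mZ]) (rule that)
  show thesis
  proof (rule that[of "C1 + C2 + C3 + C4"])
    fix n :: nat assume n: "1 \<le> n"
    define B0 where "B0 = {w \<in> space M. \<not> (\<forall>i. X i w \<in> A)}"
    define B1 where "B1 = {w \<in> space M. real n * (- I + I / 2) < (\<Sum>i\<in>{1..n}. U (X i w))}"
    define B2 where "B2 = {w \<in> space M. real n * (r + 1) < (\<Sum>i\<in>{1..n}. R (X i w))}"
    define B3 where "B3 = {w \<in> space M. real n * (0 + s * I / 8) < (\<Sum>i\<in>{1..n}. Z (X i w))}"
    define B4 where "B4 = {w \<in> space M. real n * (0 + s * I / 8) < (\<Sum>i\<in>{1..n}. - Z (X i w))}"
    note [measurable] = A_sets
    have [measurable]: "B0 \<in> sets M" "B1 \<in> sets M" "B2 \<in> sets M" "B3 \<in> sets M" "B4 \<in> sets M"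
      unfolding B0_def B1_def B2_def B3_def B4_def by measurable
    have "AE w in M. \<forall>i. X i w \<in> A" using A_AE by (subst AE_all_countable) (auto intro: AE_sample)
    then have "prob B0 = 0" unfolding B0_def by (subst prob_eq_0) (auto, measurable)
    moreover have "prob B1 \<le> C1 / (real n)\<^sup>2" "prob B2 \<le> C2 / (real n)\<^sup>2" "prob B3 \<le> C3 / (real n)\<^sup>2" "prob B4 \<le> C4 / (real n)\<^sup>2"
      unfolding B1_def B2_def B3_def B4_def by (rule C1 C2 C3 C4, rule n)+
    moreover have "prob (B0 \<union> (B1 \<union> (B2 \<union> (B3 \<union> B4)))) \<le> prob B0 + (prob B1 + (prob B2 + (prob B3 + prob B4)))"
      by (intro order_trans[OF measure_Un_le] add_left_mono) auto
    ultimately have PB: "prob (B0 \<union> (B1 \<union> (B2 \<union> (B3 \<union> B4)))) \<le> (C1 + C2 + C3 + C4) / (real n)\<^sup>2"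
      by (simp add: add_divide_distrib)
    have "regular_sample d n w" if w: "w \<in> space M - (B0 \<union> (B1 \<union> (B2 \<union> (B3 \<union> B4))))" for w
    proof -
      have wA: "X i w \<in> A" "X i w \<in> space D" for i
        using w sets.sets_into_space[OF A_sets] by (auto simp: B0_def)
      define SU SR SZ where "SU = (\<Sum>i\<in>{1..n}. U (X i w))" and "SR = (\<Sum>i\<in>{1..n}. R (X i w))" and "SZ = (\<Sum>i\<in>{1..n}. Z (X i w))"
      have b: "SU \<le> - (real n * I / 2)" "SR \<le> real n * (r + 1)" "SZ \<le> real n * (s * I / 8)" "- SZ \<le> real n * (s * I / 8)"
        using w by (auto simp: B1_def B2_def B3_def B4_def SU_def SR_def SZ_def not_less sum_negf algebra_simps)
      have SR0: "0 \<le> SR" unfolding SR_def using R_nonneg wA by (intro sum_nonneg) auto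
      have nI: "0 < real n * I" using n I_pos by simp
      have dR: "d * SR \<le> real n * I / 4"
      proof -
        have "d * SR \<le> d * (real n * (r + 1))" using b d by (intro mult_left_mono) auto
        also have "\<dots> = real n * (d * (r + 1))" by simp
        also have "\<dots> \<le> real n * (I / 4)" using d by (intro mult_left_mono) auto
        finally show ?thesis by simp
      qed
      have "(\<Sum>i\<in>{1..n}. W t (X i w)) < 0" if t: "\<bar>t\<bar> \<le> d" for t
      proof -
        have "(\<Sum>i\<in>{1..n}. W t (X i w)) \<le> (\<Sum>i\<in>{1..n}. U (X i w) + \<bar>t\<bar> * R (X i w))"
          using t d wA by (intro sum_mono hess_bound) auto
        also have "\<dots> = SU + \<bar>t\<bar> * SR" by (simp add: SU_def SR_def sum.distrib sum_distrib_left)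
        also have "\<dots> \<le> SU + d * SR" using t SR0 by (intro add_left_mono mult_right_mono) auto
        also have "\<dots> < 0" using b dR nI by linarith
        finally show ?thesis .
      qed
      moreover have Ys: "\<bar>(\<Sum>i\<in>{1..n}. Y t (X i w)) - SZ - t * SU\<bar> \<le> SR * s\<^sup>2" if t: "t = s \<or> t = - s" for t
      proof -
        have ts: "\<bar>t\<bar> \<le> \<delta>" "t\<^sup>2 = s\<^sup>2" using t s by auto
        have "(\<Sum>i\<in>{1..n}. Y t (X i w)) - SZ - t * SU = (\<Sum>i\<in>{1..n}. Y t (X i w) - Z (X i w) - t * U (X i w))"
          by (simp add: SZ_def SU_def sum_subtractf sum_distrib_left)
        also have "\<bar>\<dots>\<bar> \<le> (\<Sum>i\<in>{1..n}. R (X i w) * t\<^sup>2)"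
          using Y_expand[OF ts(1)] wA by (intro sum_abs[THEN order_trans] sum_mono) auto
        also have "\<dots> = SR * s\<^sup>2" by (simp add: SR_def sum_distrib_right ts)
        finally show ?thesis .
      qed
      have sU: "s * SU \<le> s * (- (real n * I / 2))" using b s by (intro mult_left_mono) auto
      have sR: "SR * s\<^sup>2 \<le> s * (real n * I / 8)"
      proof -
        have "SR * s\<^sup>2 = s * (d * SR) / 2" by (simp add: s(3) power2_eq_square)
        also have "\<dots> \<le> s * (real n * I / 4) / 2" using dR s by (intro divide_right_mono mult_left_mono) auto
        finally show ?thesis by simp
      qed
      have snI: "0 < s * (real n * I)" using s nI by simp
      have "(\<Sum>i\<in>{1..n}. Y s (X i w)) < 0"
        using Ys[of s] sU sR b(3) snI by (simp add: abs_le_iff algebra_simps)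
      moreover have "0 < (\<Sum>i\<in>{1..n}. Y (- s) (X i w))"
        using Ys[of "- s"] sU sR b(4) snI by (simp add: abs_le_iff algebra_simps)
      ultimately show ?thesis using wA unfolding regular_sample_def s_def by auto
    qed
    then show "\<exists>B\<in>sets M. prob B \<le> (C1 + C2 + C3 + C4) / (real n)\<^sup>2 \<and> (\<forall>w\<in>space M - B. regular_sample d n w)"
      using PB by (intro bexI[of _ "B0 \<union> (B1 \<union> (B2 \<union> (B3 \<union> B4)))"]) auto
  qed
qed

text \<open>The common interface of the two alternatives. Being conditional on
  \<open>regular_sample\<close>, it needs no exceptional set at all in the concave case. The
  inequality for \<open>a\<close> is strict because a limsup equal to the supremum has to be
  contradicted.\<close>

definition far_controlled :: "real \<Rightarrow> bool" where
  "far_controlled d \<longleftrightarrow> (\<exists>C. \<forall>n\<ge>1. \<exists>B\<in>sets M. prob B \<le> C / (real n)\<^sup>2 \<and> (\<forall>w\<in>space M - B. regular_sample d n w \<longrightarrow>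
     (\<exists>c. \<exists>a\<in>\<Theta>. c < likelihood p n (\<lambda>i. X i w) a \<and>
       (\<forall>\<theta>\<in>\<Theta>. d / 2 < \<bar>\<theta> - \<theta>\<^sub>0\<bar> \<longrightarrow> likelihood p n (\<lambda>i. X i w) \<theta> \<le> c))))"

lemma loglik_sum_deriv:
  assumes "\<And>i. X i w \<in> A" "\<bar>t\<bar> \<le> \<delta>"
  shows "((\<lambda>t. \<Sum>i\<in>{1..n}. ln (p (\<theta>\<^sub>0 + t) (X i w))) has_real_derivative (\<Sum>i\<in>{1..n}. Y t (X i w))) (at t)"
    and "((\<lambda>t. \<Sum>i\<in>{1..n}. Y t (X i w)) has_real_derivative (\<Sum>i\<in>{1..n}. W t (X i w))) (at t)"
  using assms by (auto intro!: DERIV_sum score_deriv hess_deriv)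

lemma likelihood_eq_exp:
  assumes "\<And>i. X i w \<in> A" "\<bar>t\<bar> \<le> \<delta>"
  shows "likelihood p n (\<lambda>i. X i w) (\<theta>\<^sub>0 + t) = exp (\<Sum>i\<in>{1..n}. ln (p (\<theta>\<^sub>0 + t) (X i w)))"
  unfolding likelihood_def using p_pos assms by (simp add: exp_sum)

lemma isCont_likelihood:
  assumes A: "\<And>i. X i w \<in> A" and t: "\<bar>t\<bar> < \<delta>"
  shows "isCont (likelihood p n (\<lambda>i. X i w)) (\<theta>\<^sub>0 + t)"
proof -
  let ?g = "\<lambda>t. exp (\<Sum>i\<in>{1..n}. ln (p (\<theta>\<^sub>0 + t) (X i w)))"
  have "isCont ?g t"
    using loglik_sum_deriv(1)[OF A, of t n] t by (intro isCont_exp') (auto dest: DERIV_isCont)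
  then have "isCont (\<lambda>\<theta>. ?g (\<theta> - \<theta>\<^sub>0)) (\<theta>\<^sub>0 + t)"
    by (intro isCont_o2[where f = "\<lambda>\<theta>. \<theta> - \<theta>\<^sub>0" and g = ?g]) auto
  moreover have "eventually (\<lambda>\<theta>. likelihood p n (\<lambda>i. X i w) \<theta> = ?g (\<theta> - \<theta>\<^sub>0)) (nhds (\<theta>\<^sub>0 + t))"
  proof -
    have "eventually (\<lambda>\<theta>. \<theta> \<in> {\<theta>\<^sub>0 - \<delta> <..< \<theta>\<^sub>0 + \<delta>}) (nhds (\<theta>\<^sub>0 + t))"
      using t by (intro eventually_nhds_in_open) (auto simp: abs_less_iff)
    then show ?thesis
    proof (rule eventually_mono)
      fix \<theta> assume "\<theta> \<in> {\<theta>\<^sub>0 - \<delta> <..< \<theta>\<^sub>0 + \<delta>}"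
      then have "\<bar>\<theta> - \<theta>\<^sub>0\<bar> \<le> \<delta>" by (auto simp: abs_le_iff)
      from likelihood_eq_exp[OF A this, of n]
      show "likelihood p n (\<lambda>i. X i w) \<theta> = ?g (\<theta> - \<theta>\<^sub>0)" by simp
    qed
  qed
  ultimately show ?thesis by (subst isCont_cong) auto
qed

lemma near_mem: "\<bar>t\<bar> \<le> \<delta> \<Longrightarrow> \<theta>\<^sub>0 + t \<in> \<Theta>"
  using near_interior interior_subset[of \<Theta>] by (auto simp: abs_le_iff subset_iff)

lemma regular_sample_decreasing:
  assumes reg: "regular_sample d n w" and d: "d \<le> \<delta>" and st: "- d \<le> s" "s < t" "t \<le> d"
  shows "(\<Sum>i\<in>{1..n}. Y t (X i w)) < (\<Sum>i\<in>{1..n}. Y s (X i w))"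
proof (rule DERIV_neg_imp_decreasing[OF st(2)])
  fix x assume "s \<le> x" "x \<le> t"
  then have "\<bar>x\<bar> \<le> d" using st by auto
  then show "\<exists>y. ((\<lambda>t. \<Sum>i\<in>{1..n}. Y t (X i w)) has_real_derivative y) (at x) \<and> y < 0"
    using reg loglik_sum_deriv(2)[of w x n] d unfolding regular_sample_def by (intro exI[of _ "\<Sum>i\<in>{1..n}. W x (X i w)"]) auto
qed

text \<open>The far bound confines the estimator to radius d/2, where continuity makes it a genuine
  maximiser; being interior, it is a zero of the score.\<close>

lemma localisesI:
  assumes d: "0 < d" "d \<le> \<delta>" "4 * (d * (r + 1)) \<le> I" and far: "far_controlled d"
    and gm: "\<And>n w. 1 \<le> n \<Longrightarrow> w \<in> space M \<Longrightarrow> generalized_maximizer \<Theta> (likelihood p n (\<lambda>i. X i w)) (T n w)"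
  shows "\<exists>C. localises T \<theta>\<^sub>0 d C"
proof -
  obtain C1 where C1: "\<And>n. 1 \<le> n \<Longrightarrow> \<exists>B\<in>sets M. prob B \<le> C1 / (real n)\<^sup>2 \<and> (\<forall>w\<in>space M - B. regular_sample d n w)"
    using regular_sample_event[OF d] by blast
  obtain C2 where C2: "\<And>n. 1 \<le> n \<Longrightarrow> \<exists>B\<in>sets M. prob B \<le> C2 / (real n)\<^sup>2 \<and> (\<forall>w\<in>space M - B. regular_sample d n w \<longrightarrow>
     (\<exists>c. \<exists>a\<in>\<Theta>. c < likelihood p n (\<lambda>i. X i w) a \<and>
       (\<forall>\<theta>\<in>\<Theta>. d / 2 < \<bar>\<theta> - \<theta>\<^sub>0\<bar> \<longrightarrow> likelihood p n (\<lambda>i. X i w) \<theta> \<le> c)))"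
    using far unfolding far_controlled_def by blast
  have "\<exists>B\<in>sets M. prob B \<le> (C1 + C2) / (real n)\<^sup>2 \<and>
     (\<forall>w\<in>space M - B. \<exists>\<tau>. T n w = ereal \<tau> \<and> \<bar>\<tau> - \<theta>\<^sub>0\<bar> \<le> d \<and>
        (\<forall>t. \<bar>t\<bar> \<le> d \<longrightarrow> (\<tau> \<le> \<theta>\<^sub>0 + t \<longleftrightarrow> (\<Sum>i\<in>{1..n}. Y t (X i w)) \<le> 0)))" if n: "1 \<le> n" for n
  proof -
    obtain B1 where B1: "B1 \<in> sets M" "prob B1 \<le> C1 / (real n)\<^sup>2" "\<And>w. w \<in> space M - B1 \<Longrightarrow> regular_sample d n w"
      using C1[OF n] by blast
    obtain B2 where B2: "B2 \<in> sets M" "prob B2 \<le> C2 / (real n)\<^sup>2" "\<And>w. w \<in> space M - B2 \<Longrightarrow> regular_sample d n w \<Longrightarrow>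
     (\<exists>c. \<exists>a\<in>\<Theta>. c < likelihood p n (\<lambda>i. X i w) a \<and>
       (\<forall>\<theta>\<in>\<Theta>. d / 2 < \<bar>\<theta> - \<theta>\<^sub>0\<bar> \<longrightarrow> likelihood p n (\<lambda>i. X i w) \<theta> \<le> c))"
      using C2[OF n] by blast
    have "\<exists>\<tau>. T n w = ereal \<tau> \<and> \<bar>\<tau> - \<theta>\<^sub>0\<bar> \<le> d \<and>
        (\<forall>t. \<bar>t\<bar> \<le> d \<longrightarrow> (\<tau> \<le> \<theta>\<^sub>0 + t \<longleftrightarrow> (\<Sum>i\<in>{1..n}. Y t (X i w)) \<le> 0))" if w: "w \<in> space M - (B1 \<union> B2)" for w
    proof -
      have reg: "regular_sample d n w" using B1 w by auto
      then have A: "\<And>i. X i w \<in> A" by (auto simp: regular_sample_def)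
      let ?L = "likelihood p n (\<lambda>i. X i w)"
      let ?G = "\<lambda>t. \<Sum>i\<in>{1..n}. Y t (X i w)"
      have gmw: "generalized_maximizer \<Theta> ?L (T n w)" using gm[OF n] w by auto
      obtain c a where ca: "a \<in> \<Theta>" "c < ?L a" "\<And>\<theta>. \<theta> \<in> \<Theta> \<Longrightarrow> d / 2 < \<bar>\<theta> - \<theta>\<^sub>0\<bar> \<Longrightarrow> ?L \<theta> \<le> c"
        using B2(3)[of w] w reg by auto
      obtain \<tau> where \<tau>: "T n w = ereal \<tau>" "\<bar>\<tau> - \<theta>\<^sub>0\<bar> \<le> d / 2"
        using generalized_maximizer_localised[OF gmw ca(1,2), where d = "d / 2" and \<theta>\<^sub>0 = \<theta>\<^sub>0] ca(3) by metis
      define u where "u = \<tau> - \<theta>\<^sub>0"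
      have u: "\<bar>u\<bar> < d" "\<tau> = \<theta>\<^sub>0 + u" using \<tau> d by (auto simp: u_def)
      have max: "?L \<theta> \<le> ?L \<tau>" if "\<theta> \<in> \<Theta>" for \<theta>
        using gmw isCont_likelihood[OF A, of u n] u d that unfolding \<tau>(1)
        by (intro generalized_maximizer_attained) auto
      have "?G u = 0"
      proof (rule DERIV_local_max[OF loglik_sum_deriv(1)[OF A]])
        show "\<bar>u\<bar> \<le> \<delta>" using u d by auto
        show "0 < d - \<bar>u\<bar>" using u by simp
        show "\<forall>y. \<bar>u - y\<bar> < d - \<bar>u\<bar> \<longrightarrow> (\<Sum>i\<in>{1..n}. ln (p (\<theta>\<^sub>0 + y) (X i w))) \<le> (\<Sum>i\<in>{1..n}. ln (p (\<theta>\<^sub>0 + u) (X i w)))"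
        proof (intro allI impI)
          fix y assume "\<bar>u - y\<bar> < d - \<bar>u\<bar>"
          then have y: "\<bar>y\<bar> \<le> \<delta>" using d by (auto simp: abs_if split: if_splits)
          have "?L (\<theta>\<^sub>0 + y) \<le> ?L \<tau>" using max near_mem[OF y] by blast
          then show "(\<Sum>i\<in>{1..n}. ln (p (\<theta>\<^sub>0 + y) (X i w))) \<le> (\<Sum>i\<in>{1..n}. ln (p (\<theta>\<^sub>0 + u) (X i w)))"
            using likelihood_eq_exp[OF A y, of n] likelihood_eq_exp[OF A, of u n] u d by simp
        qed
      qed
      \<comment> \<open>The score vanishes at \<open>u\<close> and decreases strictly on [-d, d], so
        its sign at \<open>t\<close> decides the order of \<open>u\<close> and
        \<open>t\<close>.\<close>
      then have "\<tau> \<le> \<theta>\<^sub>0 + t \<longleftrightarrow> ?G t \<le> 0" if "\<bar>t\<bar> \<le> d" for t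
        using regular_sample_decreasing[OF reg d(2), of u t] regular_sample_decreasing[OF reg d(2), of t u] u that
        by (cases u t rule: linorder_cases) (auto simp: abs_le_iff abs_less_iff)
      then show ?thesis using \<tau> d by auto
    qed
    moreover have "prob (B1 \<union> B2) \<le> (C1 + C2) / (real n)\<^sup>2"
      using measure_Un_le[OF B1(1) B2(1)] B1(2) B2(2) by (simp add: add_divide_distrib)
    ultimately show ?thesis using B1(1) B2(1) by (intro bexI[of _ "B1 \<union> B2"]) auto
  qed
  then show ?thesis unfolding localises_def by blast
qed

section \<open>The concave alternative\<close>

lemma concave_loglik_strict:
  assumes cc: "ereal_concave_on \<Theta> (loglik p x)" and \<Theta>: "a \<in> \<Theta>" "m \<in> \<Theta>" "\<theta> \<in> \<Theta>"
    and t: "t \<in> {0..1}" "m = (1 - t) * a + t * \<theta>" and pos: "0 < p a x" "0 < p m x" "0 < p \<theta> x"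
  shows "(1 - t) * ln (p a x) + t * ln (p \<theta> x) \<le> ln (p m x)"
proof -
  have "ereal (1 - t) * loglik p x a + ereal t * loglik p x \<theta> \<le> loglik p x ((1 - t) * a + t * \<theta>)"
    using cc \<Theta> t unfolding ereal_concave_on_def by blast
  then show ?thesis using pos by (simp add: loglik_def flip: t(2))
qed

text \<open>A concave function that has dropped between \<open>a\<close> and \<open>m\<close> cannot
  recover beyond \<open>m\<close>. The log-likelihood may be -\<infinity> at \<theta>; then some
  factor vanishes and so does the likelihood, which is why this case is treated first.\<close>

lemma concave_likelihood_beyond:
  assumes cc: "\<And>x. x \<in> space D \<Longrightarrow> ereal_concave_on \<Theta> (loglik p x)" and A: "\<And>i. X i w \<in> A"
    and a: "\<bar>a\<bar> \<le> \<delta>" and m: "\<bar>m\<bar> \<le> \<delta>"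
    and less: "(\<Sum>i\<in>{1..n}. ln (p (\<theta>\<^sub>0 + m) (X i w))) < (\<Sum>i\<in>{1..n}. ln (p (\<theta>\<^sub>0 + a) (X i w)))"
    and \<theta>: "\<theta> \<in> \<Theta>" "a < m \<and> m < \<theta> - \<theta>\<^sub>0 \<or> \<theta> - \<theta>\<^sub>0 < m \<and> m < a"
  shows "likelihood p n (\<lambda>i. X i w) \<theta> \<le> likelihood p n (\<lambda>i. X i w) (\<theta>\<^sub>0 + m)"
proof (cases "\<forall>i\<in>{1..n}. 0 < p \<theta> (X i w)")
  case False
  have sp: "X i w \<in> space D" for i using A sets.sets_into_space[OF A_sets] by blast
  from False obtain i where "i \<in> {1..n}" "p \<theta> (X i w) = 0"
    using p_nonneg[OF \<theta>(1) sp] by (metis less_eq_real_def)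
  then have "likelihood p n (\<lambda>i. X i w) \<theta> = 0" by (auto simp: likelihood_def)
  then show ?thesis using likelihood_eq_exp[OF A m, of n] by simp
next
  case True
  have sp: "X i w \<in> space D" for i using A sets.sets_into_space[OF A_sets] by blast
  define t where "t = (m - a) / (\<theta> - \<theta>\<^sub>0 - a)"
  have t: "0 < t" "t \<in> {0..1}" "\<theta>\<^sub>0 + m = (1 - t) * (\<theta>\<^sub>0 + a) + t * \<theta>"
  proof -
    have nz: "\<theta> - \<theta>\<^sub>0 - a \<noteq> 0" using \<theta>(2) by auto
    show "0 < t" unfolding t_def using \<theta>(2) by (auto simp: zero_less_divide_iff)
    then show "t \<in> {0..1}" unfolding t_def using \<theta>(2) by (auto simp: divide_le_eq)
    have "t * (\<theta> - \<theta>\<^sub>0 - a) = m - a" using nz by (simp add: t_def)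
    then show "\<theta>\<^sub>0 + m = (1 - t) * (\<theta>\<^sub>0 + a) + t * \<theta>" by (simp add: algebra_simps)
  qed
  let ?S = "\<lambda>\<theta>. \<Sum>i\<in>{1..n}. ln (p \<theta> (X i w))"
  have "(1 - t) * ?S (\<theta>\<^sub>0 + a) + t * ?S \<theta> = (\<Sum>i\<in>{1..n}. (1 - t) * ln (p (\<theta>\<^sub>0 + a) (X i w)) + t * ln (p \<theta> (X i w)))"
    by (simp add: sum.distrib sum_distrib_left)
  also have "\<dots> \<le> ?S (\<theta>\<^sub>0 + m)"
    using True by (intro sum_mono concave_loglik_strict[OF cc[OF sp] near_mem[OF a] near_mem[OF m] \<theta>(1) t(2,3)]
        p_pos[OF A a] p_pos[OF A m]) auto
  finally have "t * ?S \<theta> \<le> ?S (\<theta>\<^sub>0 + m) - (1 - t) * ?S (\<theta>\<^sub>0 + a)" by simp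
  also have "\<dots> \<le> ?S (\<theta>\<^sub>0 + m) - (1 - t) * ?S (\<theta>\<^sub>0 + m)"
    using less t by (intro diff_left_mono mult_left_mono) auto
  also have "\<dots> = t * ?S (\<theta>\<^sub>0 + m)" by (simp add: algebra_simps)
  finally have "?S \<theta> \<le> ?S (\<theta>\<^sub>0 + m)" using t by simp
  moreover have "likelihood p n (\<lambda>i. X i w) \<theta> = exp (?S \<theta>)"
    using True by (simp add: likelihood_def exp_sum)
  ultimately show ?thesis using likelihood_eq_exp[OF A m, of n] by simp
qed

text \<open>The score is negative at d/2, so slightly to the left of d/2 the likelihood is strictly
  larger, and concavity carries the decrease on to all of \<theta> > \<theta>0 + d/2. The same holds
  on the other side.\<close>

lemma far_controlled_concave:
  assumes cc: "\<And>x. x \<in> space D \<Longrightarrow> ereal_concave_on \<Theta> (loglik p x)" and d: "0 < d" "d \<le> \<delta>"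
  shows "far_controlled d"
  unfolding far_controlled_def
proof (rule exI[of _ 0], intro allI impI bexI[of _ "{}"] conjI ballI)
  fix n :: nat and w assume reg: "regular_sample d n w"
  then have A: "\<And>i. X i w \<in> A" by (auto simp: regular_sample_def)
  let ?L = "likelihood p n (\<lambda>i. X i w)"
  let ?S = "\<lambda>t. \<Sum>i\<in>{1..n}. ln (p (\<theta>\<^sub>0 + t) (X i w))"
  have d2: "\<bar>d / 2\<bar> \<le> \<delta>" "\<bar>- (d / 2)\<bar> \<le> \<delta>" using d by auto
  obtain h1 where h1: "0 < h1" "\<And>h. 0 < h \<Longrightarrow> h < h1 \<Longrightarrow> ?S (d / 2) < ?S (d / 2 - h)"
    using DERIV_neg_dec_left[OF loglik_sum_deriv(1)[OF A d2(1)]] reg unfolding regular_sample_def by blast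
  obtain h2 where h2: "0 < h2" "\<And>h. 0 < h \<Longrightarrow> h < h2 \<Longrightarrow> ?S (- (d / 2)) < ?S (- (d / 2) + h)"
    using DERIV_pos_inc_right[OF loglik_sum_deriv(1)[OF A d2(2)]] reg unfolding regular_sample_def by blast
  define h where "h = min (min h1 h2) d / 2"
  have h: "0 < h" "h < h1" "h < h2" "h < d" using h1 h2 d by (auto simp: h_def)
  define a1 a2 where "a1 = d / 2 - h" and "a2 = - (d / 2) + h"
  have a: "\<bar>a1\<bar> \<le> \<delta>" "\<bar>a2\<bar> \<le> \<delta>" "a1 < d / 2" "- (d / 2) < a2"
    using h d by (auto simp: a1_def a2_def abs_le_iff)
  have l: "?S (d / 2) < ?S a1" "?S (- (d / 2)) < ?S a2" using h1 h2 h by (auto simp: a1_def a2_def)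
  \<comment> \<open>One bound has to serve both sides: the larger of the two barrier values is
    exceeded at the inner point next to it.\<close>
  define c where "c = max (?L (\<theta>\<^sub>0 + d / 2)) (?L (\<theta>\<^sub>0 + - (d / 2)))"
  have far: "?L \<theta> \<le> c" if "\<theta> \<in> \<Theta>" "d / 2 < \<bar>\<theta> - \<theta>\<^sub>0\<bar>" for \<theta>
  proof -
    have "d / 2 < \<theta> - \<theta>\<^sub>0 \<or> \<theta> - \<theta>\<^sub>0 < - (d / 2)" using that(2) by (cases "0 \<le> \<theta> - \<theta>\<^sub>0") auto
    then consider "d / 2 < \<theta> - \<theta>\<^sub>0" | "\<theta> - \<theta>\<^sub>0 < - (d / 2)" by blast
    then show ?thesis
    proof cases
      case 1
      then have "?L \<theta> \<le> ?L (\<theta>\<^sub>0 + d / 2)"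
        using a by (intro concave_likelihood_beyond[OF cc A a(1) d2(1) l(1) that(1)]) auto
      then show ?thesis by (simp add: c_def)
    next
      case 2
      then have "?L \<theta> \<le> ?L (\<theta>\<^sub>0 + - (d / 2))"
        using a by (intro concave_likelihood_beyond[OF cc A a(2) d2(2) l(2) that(1)]) auto
      then show ?thesis by (simp add: c_def)
    qed
  qed
  have "?L (\<theta>\<^sub>0 + d / 2) < ?L (\<theta>\<^sub>0 + a1)" "?L (\<theta>\<^sub>0 + - (d / 2)) < ?L (\<theta>\<^sub>0 + a2)"
    using l likelihood_eq_exp[OF A d2(1), of n] likelihood_eq_exp[OF A d2(2), of n]
      likelihood_eq_exp[OF A a(1), of n] likelihood_eq_exp[OF A a(2), of n] by auto
  then have "c < ?L (\<theta>\<^sub>0 + a1) \<or> c < ?L (\<theta>\<^sub>0 + a2)" by (auto simp: c_def max_def)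
  then show "\<exists>c. \<exists>a\<in>\<Theta>. c < ?L a \<and> (\<forall>\<theta>\<in>\<Theta>. d / 2 < \<bar>\<theta> - \<theta>\<^sub>0\<bar> \<longrightarrow> ?L \<theta> \<le> c)"
    using far near_mem[OF a(1)] near_mem[OF a(2)] by blast
qed auto

end

section \<open>Far parameters and the Hellinger distance\<close>

text \<open>The root of \<open>f\<close> need not be differentiable at zeros of \<open>f\<close>, so
  the fundamental theorem is applied to sqrt (f + e) and e tends to 0. The gauge integral asks only
  for differentiability inside, with no regularity of f'. Where f > 0, adding e only lowers the
  derivative of the root.\<close>

lemma sqrt_increment_le:
  fixes f f' g :: "real \<Rightarrow> real"
  assumes uv: "u \<le> v" and cont: "continuous_on {u..v} f" and f0: "\<And>t. t \<in> {u..v} \<Longrightarrow> 0 \<le> f t"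
    and deriv: "\<And>t. u < t \<Longrightarrow> t < v \<Longrightarrow> (f has_real_derivative f' t) (at t)"
    and g[measurable]: "g \<in> borel_measurable borel" and g0: "\<And>t. 0 \<le> g t"
    and bound: "\<And>t. u < t \<Longrightarrow> t < v \<Longrightarrow> 0 < f t \<Longrightarrow> \<bar>f' t\<bar> / (2 * sqrt (f t)) \<le> g t"
  shows "ennreal \<bar>sqrt (f v) - sqrt (f u)\<bar> \<le> (\<integral>\<^sup>+t. ennreal (g t) * indicator {u..v} t \<partial>lborel)"
proof (cases "(\<integral>\<^sup>+t. ennreal (g t) * indicator {u..v} t \<partial>lborel) = \<infinity>")
  case False
  have eq: "(\<integral>\<^sup>+t. ennreal (g t) * indicator {u..v} t \<partial>lborel) = (\<integral>\<^sup>+t. ennreal (indicator {u..v} t * g t) \<partial>lborel)"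
    by (intro nn_integral_cong) (auto simp: indicator_def)
  have int: "integrable lborel (\<lambda>t. indicator {u..v} t * g t)"
    using False g0 unfolding eq by (intro integrableI_nonneg) (auto simp: less_top)
  define J where "J = (\<integral>t. indicator {u..v} t * g t \<partial>lborel)"
  have J: "(\<integral>\<^sup>+t. ennreal (g t) * indicator {u..v} t \<partial>lborel) = ennreal J"
    unfolding eq J_def using g0 by (intro nn_integral_eq_integral int) auto
  have "((\<lambda>t. indicator {u..v} t * g t) has_integral J) UNIV"
    unfolding J_def by (rule has_integral_integral_lborel[OF int])
  moreover have "(\<lambda>t. indicator {u..v} t * g t) = (\<lambda>t. if t \<in> {u..v} then g t else 0)" by (auto simp: indicator_def)
  ultimately have gJ: "(g has_integral J) {u..v}" by (simp only: has_integral_restrict_UNIV)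
  have step: "\<bar>sqrt (f v + e) - sqrt (f u + e)\<bar> \<le> J" if e: "0 < e" for e
  proof -
    define h' where "h' t = (if t \<in> {u<..<v} then f' t / (2 * sqrt (f t + e)) else 0)" for t
    have h: "(h' has_integral (sqrt (f v + e) - sqrt (f u + e))) {u..v}"
    proof (rule fundamental_theorem_of_calculus_interior[OF uv])
      show "continuous_on {u..v} (\<lambda>t. sqrt (f t + e))" by (intro continuous_intros cont)
      fix t assume t: "t \<in> {u<..<v}"
      then have ft: "0 < f t + e" using f0[of t] e by (auto simp: add_nonneg_pos)
      have "((\<lambda>t. sqrt (f t + e)) has_real_derivative h' t) (at t)"
        using t ft deriv[of t] by (auto intro!: derivative_eq_intros simp: h'_def divide_simps)
      then show "((\<lambda>t. sqrt (f t + e)) has_vector_derivative h' t) (at t)"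
        by (simp add: has_real_derivative_iff_has_vector_derivative)
    qed
    have le: "norm (h' t) \<le> g t" if "t \<in> {u..v}" for t
    proof (cases "t \<in> {u<..<v}")
      case True
      show ?thesis
      proof (cases "0 < f t")
        case True
        have "norm (h' t) = \<bar>f' t\<bar> / (2 * sqrt (f t + e))" using \<open>t \<in> {u<..<v}\<close> True e by (simp add: h'_def)
        also have "\<dots> \<le> \<bar>f' t\<bar> / (2 * sqrt (f t))"
          using True e by (intro divide_left_mono) auto
        also have "\<dots> \<le> g t" using bound[of t] \<open>t \<in> {u<..<v}\<close> True by auto
        finally show ?thesis .
      next
        case False
        \<comment> \<open>An interior zero is a minimum of the nonnegative \<open>f\<close>, so the
          derivative vanishes there.\<close>
        then have ft: "f t = 0" using f0[of t] that by simp
        have "f' t = 0"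
        proof (rule DERIV_local_min[OF deriv])
          show "u < t" "t < v" using True by auto
          show "0 < min (t - u) (v - t)" using True by auto
          show "\<forall>y. \<bar>t - y\<bar> < min (t - u) (v - t) \<longrightarrow> f t \<le> f y"
            unfolding ft by (auto intro!: f0 simp: abs_if split: if_splits)
        qed
        then show ?thesis using g0[of t] by (simp add: h'_def)
      qed
    next
      case False
      then show ?thesis using g0[of t] by (auto simp: h'_def)
    qed
    have "norm (integral {u..v} h') \<le> integral {u..v} g"
      using h gJ le by (intro integral_norm_bound_integral) (auto simp: has_integral_integrable)
    then show ?thesis using h gJ by (simp add: integral_unique)
  qed
  have "\<bar>sqrt (f v) - sqrt (f u)\<bar> \<le> J"
  proof (rule LIMSEQ_le_const2)
    have z: "(\<lambda>n. inverse (real (Suc n))) \<longlonglongrightarrow> 0" by (rule LIMSEQ_inverse_real_of_nat)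
    have "(\<lambda>n. \<bar>sqrt (f v + inverse (real (Suc n))) - sqrt (f u + inverse (real (Suc n)))\<bar>)
      \<longlonglongrightarrow> \<bar>sqrt (f v + 0) - sqrt (f u + 0)\<bar>"
      by (intro tendsto_intros z)
    then show "(\<lambda>n. \<bar>sqrt (f v + inverse (real (Suc n))) - sqrt (f u + inverse (real (Suc n)))\<bar>)
      \<longlonglongrightarrow> \<bar>sqrt (f v) - sqrt (f u)\<bar>" by simp
    show "\<exists>N. \<forall>n\<ge>N. \<bar>sqrt (f v + inverse (real (Suc n))) - sqrt (f u + inverse (real (Suc n)))\<bar> \<le> J"
      using step by auto
  qed
  then show ?thesis unfolding J by (rule ennreal_leI)
next
  case True
  show ?thesis unfolding True by simp
qed

lemma deriv_within_interior:
  assumes "(f has_real_derivative f') (at x)" "x \<in> interior S"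
  shows "deriv_within S f x = f'"
  unfolding deriv_within_def at_within_interior[OF assms(2)]
  using assms(1) unfolding has_real_derivative_iff_has_vector_derivative by (rule vector_derivative_at)

lemma loglik_deriv_1:
  assumes d: "((\<lambda>t. p t x) has_real_derivative d) (at \<theta>)" and pos: "0 < p \<theta> x" and \<theta>: "\<theta> \<in> interior \<Theta>"
  shows "loglik_deriv 1 \<Theta> p x \<theta> = d / p \<theta> x"
proof -
  have "((\<lambda>t. p t x) \<longlongrightarrow> p \<theta> x) (nhds \<theta>)"
    using DERIV_isCont[OF d] by (simp only: isCont_def tendsto_at_iff_tendsto_nhds[of "\<lambda>t. p t x" \<theta>])
  then have "eventually (\<lambda>t. 0 < p t x) (nhds \<theta>)" using pos by (rule order_tendstoD)
  then have "eventually (\<lambda>t. real_of_ereal (loglik p x t) = ln (p t x)) (nhds \<theta>)"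
    by eventually_elim (simp add: loglik_def)
  moreover have "((\<lambda>t. ln (p t x)) has_real_derivative d / p \<theta> x) (at \<theta>)"
    using d pos by (auto intro!: derivative_eq_intros)
  ultimately have "((\<lambda>t. real_of_ereal (loglik p x t)) has_real_derivative d / p \<theta> x) (at \<theta>)"
    by (subst DERIV_cong_ev) auto
  then show ?thesis using \<theta> by (simp add: loglik_deriv_def deriv_within_interior)
qed

locale hellinger_model = mle_model M D X Z U R Y \<delta> I \<Theta> p \<theta>\<^sub>0 A W
  for M :: "'w measure" and D :: "'x measure" and X :: "nat \<Rightarrow> 'w \<Rightarrow> 'x"
    and Z U R :: "'x \<Rightarrow> real" and Y :: "real \<Rightarrow> 'x \<Rightarrow> real" and \<delta> I :: real
    and \<Theta> :: "real set" and p :: "real \<Rightarrow> 'x \<Rightarrow> real" and \<theta>\<^sub>0 :: real and A :: "'x set"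
    and W :: "real \<Rightarrow> 'x \<Rightarrow> real" +
  fixes \<mu> :: "'x measure"
  assumes D_eq: "D = density \<mu> (\<lambda>x. ennreal (p \<theta>\<^sub>0 x))"
    and p_meas: "\<And>\<theta>. \<theta> \<in> \<Theta> \<Longrightarrow> p \<theta> \<in> borel_measurable \<mu>"
    and p_mass: "\<And>\<theta>. \<theta> \<in> \<Theta> \<Longrightarrow> (\<integral>\<^sup>+x. ennreal (p \<theta> x) \<partial>\<mu>) = 1"
    and interval: "is_interval \<Theta>"
    and wd: "fisher_info_well_defined \<mu> \<Theta> p"
begin

lemma space_D: "space D = space \<mu>" and sets_D[measurable_cong]: "sets D = sets \<mu>"
  by (simp_all add: D_eq)

lemma \<theta>\<^sub>0_mem: "\<theta>\<^sub>0 \<in> \<Theta>"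
  using near_mem[of 0] \<delta>_pos by simp

text \<open>\<open>\<Theta>\<close> need not contain its endpoints; dropping them loses a null set of parameters and makes all
  derivatives two-sided.\<close>
definition pint :: "real \<Rightarrow> 'x \<Rightarrow> real" where
  "pint \<theta> x = (if \<theta> \<in> interior \<Theta> then p \<theta> x else 0)"

lemma interior_mem: "\<theta> \<in> interior \<Theta> \<Longrightarrow> \<theta> \<in> \<Theta>"
  using interior_subset by blast

section \<open>Joint measurability in the parameter and the observation\<close>

lemma pint_measurable: "pint \<theta> \<in> borel_measurable \<mu>"
  by (cases "\<theta> \<in> interior \<Theta>") (auto simp: pint_def[abs_def] intro: p_meas interior_mem)

lemma p_has_deriv:
  assumes "x \<in> space \<mu>" "\<theta> \<in> interior \<Theta>"
  shows "((\<lambda>t. p t x) has_real_derivative deriv (\<lambda>t. p t x) \<theta>) (at \<theta>)"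
proof -
  have "(\<lambda>t. p t x) differentiable (at \<theta> within \<Theta>)"
    using wd assms interior_mem unfolding fisher_info_well_defined_def by blast
  then obtain d where d: "((\<lambda>t. p t x) has_real_derivative d) (at \<theta>)"
    unfolding at_within_interior[OF assms(2)] real_differentiable_def by blast
  show ?thesis using d unfolding DERIV_imp_deriv[OF d] .
qed

lemma eventually_pint: "\<theta> \<in> interior \<Theta> \<Longrightarrow> eventually (\<lambda>t. pint t x = p t x) (nhds \<theta>)"
  using eventually_nhds_in_open[of "interior \<Theta>" \<theta>] by (auto elim!: eventually_mono simp: pint_def)

lemma pint_has_deriv:
  assumes "x \<in> space \<mu>" "\<theta> \<in> interior \<Theta>"
  shows "((\<lambda>t. pint t x) has_real_derivative deriv (\<lambda>t. p t x) \<theta>) (at \<theta>)"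
  using p_has_deriv[OF assms] eventually_pint[OF assms(2), of x] by (subst DERIV_cong_ev) auto

lemma interior_borel[measurable]: "interior \<Theta> \<in> sets borel" by simp

text \<open>The density is measurable in x and continuous in \<theta> on the interior, hence a limit
  of functions that depend on \<theta> only through countably many grid points. A grid point may
  fall outside \<Theta>, where \<open>pint\<close> is 0 and so still measurable; for fixed interior
  \<theta> this happens only finitely often.\<close>

lemma pint_joint_measurable: "(\<lambda>z. pint (fst z) (snd z)) \<in> borel_measurable (borel \<Otimes>\<^sub>M \<mu>)"
proof (rule borel_measurable_LIMSEQ_real)
  define \<tau> where "\<tau> n \<theta> = real_of_int \<lceil>real (Suc n) * \<theta>\<rceil> / real (Suc n)" for n and \<theta> :: real
  define f where "f n z = indicator (interior \<Theta>) (fst z) * pint (\<tau> n (fst z)) (snd z)" for n and z :: "real \<times> 'x"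
  show "f n \<in> borel_measurable (borel \<Otimes>\<^sub>M \<mu>)" for n
  proof -
    have 1: "(\<lambda>z. pint (real_of_int i / real (Suc n)) (snd z)) \<in> borel_measurable ((borel :: real measure) \<Otimes>\<^sub>M \<mu>)" for i
      using pint_measurable by measurable
    have "(\<lambda>z. \<lceil>real (Suc n) * fst z\<rceil>) \<in> measurable ((borel :: real measure) \<Otimes>\<^sub>M \<mu>) (count_space UNIV)"
      by measurable
    from measurable_compose_countable[OF 1 this]
    have "(\<lambda>z. pint (\<tau> n (fst z)) (snd z)) \<in> borel_measurable (borel \<Otimes>\<^sub>M \<mu>)" by (simp add: \<tau>_def)
    then show ?thesis unfolding f_def by measurable
  qed
  fix z assume z: "z \<in> space ((borel :: real measure) \<Otimes>\<^sub>M \<mu>)"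
  obtain \<theta> x where zz: "z = (\<theta>, x)" "x \<in> space \<mu>" using z by (cases z) (auto simp: space_pair_measure)
  show "(\<lambda>n. f n z) \<longlonglongrightarrow> pint (fst z) (snd z)"
  proof (cases "\<theta> \<in> interior \<Theta>")
    case True
    have "(\<lambda>n. \<tau> n \<theta>) \<longlonglongrightarrow> \<theta>"
    proof (rule LIMSEQ_I)
      fix e :: real assume "0 < e"
      then obtain N where N: "inverse (real (Suc N)) < e" using reals_Archimedean by blast
      have "norm (\<tau> n \<theta> - \<theta>) < e" if "N \<le> n" for n
      proof -
        have "\<bar>real_of_int \<lceil>real (Suc n) * \<theta>\<rceil> - real (Suc n) * \<theta>\<bar> \<le> 1" by linarith
        moreover have "\<tau> n \<theta> - \<theta> = (real_of_int \<lceil>real (Suc n) * \<theta>\<rceil> - real (Suc n) * \<theta>) / real (Suc n)"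
          by (simp add: \<tau>_def diff_divide_distrib)
        ultimately have "\<bar>\<tau> n \<theta> - \<theta>\<bar> \<le> 1 / real (Suc n)"
          by (simp only: abs_divide abs_of_nat) (intro divide_right_mono, auto)
        also have "\<dots> \<le> inverse (real (Suc N))" using that by (simp add: field_simps)
        finally show ?thesis using N by simp
      qed
      then show "\<exists>no. \<forall>n\<ge>no. norm (\<tau> n \<theta> - \<theta>) < e" by blast
    qed
    moreover have "isCont (\<lambda>t. pint t x) \<theta>" using pint_has_deriv[OF zz(2) True] by (rule DERIV_isCont)
    ultimately have "(\<lambda>n. pint (\<tau> n \<theta>) x) \<longlonglongrightarrow> pint \<theta> x" by (intro isCont_tendsto_compose[where g = "\<lambda>t. pint t x"])
    then show ?thesis using True by (simp add: f_def zz)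
  next
    case False
    then show ?thesis by (simp add: f_def zz pint_def)
  qed
qed

definition dp :: "real \<Rightarrow> 'x \<Rightarrow> real" where
  "dp \<theta> x = (if \<theta> \<in> interior \<Theta> then deriv (\<lambda>t. p t x) \<theta> else 0)"

text \<open>The derivative is the limit of difference quotients along the steps 1 / (n + 1). With
  \<open>pint\<close> they are measurable even where \<theta> + h leaves the interior.\<close>

lemma dp_joint_measurable: "(\<lambda>z. dp (fst z) (snd z)) \<in> borel_measurable (borel \<Otimes>\<^sub>M \<mu>)"
proof (rule borel_measurable_LIMSEQ_real)
  define h where "h n = inverse (real (Suc n))" for n
  define f where "f n z = indicator (interior \<Theta>) (fst z) * ((pint (fst z + h n) (snd z) - pint (fst z) (snd z)) / h n)"
    for n and z :: "real \<times> 'x"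
  note [measurable] = pint_joint_measurable
  show "f n \<in> borel_measurable (borel \<Otimes>\<^sub>M \<mu>)" for n
  proof -
    have "(\<lambda>z. (fst z + h n, snd z)) \<in> measurable (borel \<Otimes>\<^sub>M \<mu>) (borel \<Otimes>\<^sub>M \<mu>)" by measurable
    from measurable_compose[OF this pint_joint_measurable]
    have [measurable]: "(\<lambda>z. pint (fst z + h n) (snd z)) \<in> borel_measurable (borel \<Otimes>\<^sub>M \<mu>)" by simp
    show ?thesis unfolding f_def by measurable
  qed
  fix z assume z: "z \<in> space ((borel :: real measure) \<Otimes>\<^sub>M \<mu>)"
  obtain \<theta> x where zz: "z = (\<theta>, x)" "x \<in> space \<mu>" using z by (cases z) (auto simp: space_pair_measure)
  show "(\<lambda>n. f n z) \<longlonglongrightarrow> dp (fst z) (snd z)"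
  proof (cases "\<theta> \<in> interior \<Theta>")
    case True
    have "filterlim h (at 0) sequentially"
      unfolding h_def filterlim_at using LIMSEQ_inverse_real_of_nat by (auto intro!: always_eventually)
    moreover have "((\<lambda>t. (pint (\<theta> + t) x - pint \<theta> x) / t) \<longlongrightarrow> deriv (\<lambda>t. p t x) \<theta>) (at 0)"
      using pint_has_deriv[OF zz(2) True] by (simp add: DERIV_def)
    ultimately have "(\<lambda>n. (pint (\<theta> + h n) x - pint \<theta> x) / h n) \<longlonglongrightarrow> deriv (\<lambda>t. p t x) \<theta>"
      by (rule filterlim_compose[rotated])
    then show ?thesis using True by (simp add: f_def zz dp_def)
  next
    case False
    then show ?thesis by (simp add: f_def zz dp_def)
  qed
qed

text \<open>The absolute \<open>\<theta>\<close>-derivative of \<open>sqrt (p \<theta> x / p \<theta>\<^sub>0 x)\<close> where \<open>p \<theta> x\<close> is positive. At a zero of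
  \<open>p\<close> the root may fail to be differentiable, which is why the increments are controlled through
  \<open>sqrt_increment_le\<close>.\<close>
definition rate :: "real \<Rightarrow> 'x \<Rightarrow> real" where
  "rate \<theta> x = (if 0 < pint \<theta> x \<and> 0 < p \<theta>\<^sub>0 x then \<bar>dp \<theta> x\<bar> / (2 * sqrt (p \<theta> x * p \<theta>\<^sub>0 x)) else 0)"

lemma rate_alt: "rate \<theta> x = (if 0 < pint \<theta> x \<and> 0 < p \<theta>\<^sub>0 x then \<bar>dp \<theta> x\<bar> / (2 * sqrt (pint \<theta> x * p \<theta>\<^sub>0 x)) else 0)"
  by (auto simp: rate_def pint_def)

lemma rate_nonneg: "0 \<le> rate \<theta> x"
  unfolding rate_alt by auto

lemma rate_joint_measurable: "(\<lambda>z. rate (fst z) (snd z)) \<in> borel_measurable (borel \<Otimes>\<^sub>M \<mu>)"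
proof -
  note [measurable] = pint_joint_measurable dp_joint_measurable p_meas[OF \<theta>\<^sub>0_mem]
  show ?thesis unfolding rate_alt by measurable
qed

lemma fisher_info_eq:
  assumes \<theta>: "\<theta> \<in> interior \<Theta>"
  shows "fisher_info \<mu> \<Theta> p \<theta> = (\<integral>\<^sup>+x. ennreal (if 0 < p \<theta> x then (dp \<theta> x)\<^sup>2 / p \<theta> x else 0) \<partial>\<mu>)"
proof -
  note [measurable] = p_meas[OF interior_mem[OF \<theta>]]
  have dpm[measurable]: "dp \<theta> \<in> borel_measurable \<mu>"
    using measurable_compose[OF measurable_Pair1' dp_joint_measurable, of \<theta>] by simp
  let ?S = "positivity_set \<mu> p \<theta>"
  have S: "?S \<in> sets \<mu>" unfolding positivity_set_def by measurable
  have "fisher_info \<mu> \<Theta> p \<theta> = (\<integral>\<^sup>+x. ennreal ((dp \<theta> x / p \<theta> x)\<^sup>2) \<partial>obs_law \<mu> p \<theta>)"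
    unfolding fisher_info_def
  proof (rule nn_integral_cong)
    fix x assume "x \<in> space (obs_law \<mu> p \<theta>)"
    then have x: "x \<in> space \<mu>" "0 < p \<theta> x" by (auto simp: obs_law_def space_restrict_space positivity_set_def)
    show "ennreal ((loglik_deriv 1 \<Theta> p x \<theta>)\<^sup>2) = ennreal ((dp \<theta> x / p \<theta> x)\<^sup>2)"
      using loglik_deriv_1[where p = p and x = x and \<theta> = \<theta>, OF p_has_deriv[OF x(1) \<theta>] x(2) \<theta>] \<theta> by (simp add: dp_def)
  qed
  also have "\<dots> = (\<integral>\<^sup>+x. ennreal ((dp \<theta> x / p \<theta> x)\<^sup>2) * indicator ?S x \<partial>density \<mu> (\<lambda>x. ennreal (p \<theta> x)))"
    unfolding obs_law_def using S by (intro nn_integral_restrict_space) auto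
  also have "\<dots> = (\<integral>\<^sup>+x. ennreal (p \<theta> x) * (ennreal ((dp \<theta> x / p \<theta> x)\<^sup>2) * indicator ?S x) \<partial>\<mu>)"
    using S by (intro nn_integral_density) auto
  also have "\<dots> = (\<integral>\<^sup>+x. ennreal (if 0 < p \<theta> x then (dp \<theta> x)\<^sup>2 / p \<theta> x else 0) \<partial>\<mu>)"
  proof (rule nn_integral_cong)
    fix x assume x: "x \<in> space \<mu>"
    show "ennreal (p \<theta> x) * (ennreal ((dp \<theta> x / p \<theta> x)\<^sup>2) * indicator ?S x)
      = ennreal (if 0 < p \<theta> x then (dp \<theta> x)\<^sup>2 / p \<theta> x else 0)"
    proof (cases "0 < p \<theta> x")
      case True
      then have "ennreal (p \<theta> x) * ennreal ((dp \<theta> x / p \<theta> x)\<^sup>2) = ennreal ((dp \<theta> x)\<^sup>2 / p \<theta> x)"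
        by (subst ennreal_mult[symmetric]) (auto simp: power2_eq_square)
      then show ?thesis using True x by (simp add: positivity_set_def)
    next
      case False
      then show ?thesis by (simp add: positivity_set_def)
    qed
  qed
  finally show ?thesis .
qed

text \<open>Under \<open>D\<close> the factor \<open>p \<theta>\<^sub>0 x\<close> cancels in the
  square of the rate, so its second moment is at most a quarter of the Fisher information. The mean
  follows from x \<le> x^2 / (2c) + c / 2, a form of the Cauchy--Schwarz inequality, with c = sqrt K
  / 2.\<close>

lemma rate_mean_le:
  assumes \<theta>: "\<theta> \<in> \<Theta>" and K: "0 < K" "fisher_info \<mu> \<Theta> p \<theta> \<le> ennreal K"
  shows "(\<integral>\<^sup>+x. ennreal (rate \<theta> x) \<partial>D) \<le> ennreal (sqrt K / 2)"
proof (cases "\<theta> \<in> interior \<Theta>")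
  case False
  then show ?thesis by (simp add: rate_def pint_def)
next
  case True
  note [measurable] = p_meas[OF \<theta>] p_meas[OF \<theta>\<^sub>0_mem]
  have [measurable]: "rate \<theta> \<in> borel_measurable \<mu>"
    using measurable_compose[OF measurable_Pair1' rate_joint_measurable, of \<theta>] by simp
  define c where "c = sqrt K / 2"
  have c: "0 < c" "4 * c * c = K" using K by (auto simp: c_def)
  have "(\<integral>\<^sup>+x. ennreal ((rate \<theta> x)\<^sup>2) \<partial>D) = (\<integral>\<^sup>+x. ennreal (p \<theta>\<^sub>0 x) * ennreal ((rate \<theta> x)\<^sup>2) \<partial>\<mu>)"
    unfolding D_eq by (rule nn_integral_density) auto
  also have "\<dots> \<le> (\<integral>\<^sup>+x. ennreal (1 / 4) * ennreal (if 0 < p \<theta> x then (dp \<theta> x)\<^sup>2 / p \<theta> x else 0) \<partial>\<mu>)"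
  proof (rule nn_integral_mono)
    fix x assume x: "x \<in> space \<mu>"
    show "ennreal (p \<theta>\<^sub>0 x) * ennreal ((rate \<theta> x)\<^sup>2) \<le> ennreal (1 / 4) * ennreal (if 0 < p \<theta> x then (dp \<theta> x)\<^sup>2 / p \<theta> x else 0)"
    proof (cases "0 < p \<theta> x \<and> 0 < p \<theta>\<^sub>0 x")
      case pp: True
      have "(rate \<theta> x)\<^sup>2 = (dp \<theta> x)\<^sup>2 / (4 * (p \<theta> x * p \<theta>\<^sub>0 x))"
        using pp True by (simp add: rate_def pint_def power_divide power_mult_distrib)
      then have "p \<theta>\<^sub>0 x * (rate \<theta> x)\<^sup>2 = 1 / 4 * ((dp \<theta> x)\<^sup>2 / p \<theta> x)" using pp by simp
      then show ?thesis using pp by (subst (1 2) ennreal_mult[symmetric]) auto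
    next
      case False
      then have "rate \<theta> x = 0" using True by (auto simp: rate_def pint_def)
      then show ?thesis by simp
    qed
  qed
  also have "\<dots> = ennreal (1 / 4) * fisher_info \<mu> \<Theta> p \<theta>"
  proof -
    have [measurable]: "dp \<theta> \<in> borel_measurable \<mu>"
      using measurable_compose[OF measurable_Pair1' dp_joint_measurable, of \<theta>] by simp
    show ?thesis unfolding fisher_info_eq[OF True] by (rule nn_integral_cmult) measurable
  qed
  also have "\<dots> \<le> ennreal (1 / 4) * ennreal K" by (intro mult_left_mono K) auto
  also have "\<dots> = ennreal (c * c)" using K c by (simp flip: ennreal_mult)
  finally have sq: "(\<integral>\<^sup>+x. ennreal ((rate \<theta> x)\<^sup>2) \<partial>D) \<le> ennreal (c * c)" .
  have "(\<integral>\<^sup>+x. ennreal (rate \<theta> x) \<partial>D) \<le> (\<integral>\<^sup>+x. ennreal (1 / (2 * c)) * ennreal ((rate \<theta> x)\<^sup>2) + ennreal (c / 2) \<partial>D)"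
  proof (rule nn_integral_mono)
    fix x
    have "0 \<le> (rate \<theta> x - c)\<^sup>2" by simp
    then have "2 * c * rate \<theta> x \<le> (rate \<theta> x)\<^sup>2 + c * c" by (simp add: power2_eq_square algebra_simps)
    then have "rate \<theta> x \<le> ((rate \<theta> x)\<^sup>2 + c * c) / (2 * c)"
      using c by (subst pos_le_divide_eq) (auto simp: mult_ac)
    also have "\<dots> = 1 / (2 * c) * (rate \<theta> x)\<^sup>2 + c / 2" using c by (simp add: add_divide_distrib)
    finally show "ennreal (rate \<theta> x) \<le> ennreal (1 / (2 * c)) * ennreal ((rate \<theta> x)\<^sup>2) + ennreal (c / 2)"
      using c by (simp add: ennreal_leI flip: ennreal_mult ennreal_plus)
  qed
  also have "\<dots> = ennreal (1 / (2 * c)) * (\<integral>\<^sup>+x. ennreal ((rate \<theta> x)\<^sup>2) \<partial>D) + ennreal (c / 2)"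
    by (subst nn_integral_add) (auto simp: nn_integral_cmult D.emeasure_space_1)
  also have "\<dots> \<le> ennreal (1 / (2 * c)) * ennreal (c * c) + ennreal (c / 2)"
    by (intro add_right_mono mult_left_mono sq) auto
  also have "\<dots> = ennreal c" using c by (simp flip: ennreal_mult ennreal_plus)
  finally show ?thesis by (simp add: c_def)
qed

text \<open>The Hellinger affinity, or Bhattacharyya coefficient. It is also the mean, under the
  true law, of the square root of the likelihood ratio of one observation.\<close>

definition affinity :: "real \<Rightarrow> real" where
  "affinity \<theta> = (\<integral>x. sqrt (p \<theta> x) * sqrt (p \<theta>\<^sub>0 x) \<partial>\<mu>)"

lemma p_integrable:
  assumes \<theta>: "\<theta> \<in> \<Theta>" shows "integrable \<mu> (p \<theta>)" "(\<integral>x. p \<theta> x \<partial>\<mu>) = 1"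
proof -
  have n: "AE x in \<mu>. 0 \<le> p \<theta> x" using p_nonneg[OF \<theta>] by (auto simp: space_D)
  show i: "integrable \<mu> (p \<theta>)"
    using p_meas[OF \<theta>] p_mass[OF \<theta>] n by (intro integrableI_nonneg) auto
  show "(\<integral>x. p \<theta> x \<partial>\<mu>) = 1"
    using nn_integral_eq_integral[OF i n] p_mass[OF \<theta>] by simp
qed

lemma affinity_integrable:
  assumes \<theta>: "\<theta> \<in> \<Theta>" shows "integrable \<mu> (\<lambda>x. sqrt (p \<theta> x) * sqrt (p \<theta>\<^sub>0 x))"
proof (rule Bochner_Integration.integrable_bound)
  note [measurable] = p_meas[OF \<theta>] p_meas[OF \<theta>\<^sub>0_mem]
  show "integrable \<mu> (\<lambda>x. p \<theta> x + p \<theta>\<^sub>0 x)" using p_integrable[OF \<theta>] p_integrable[OF \<theta>\<^sub>0_mem] by simp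
  show "(\<lambda>x. sqrt (p \<theta> x) * sqrt (p \<theta>\<^sub>0 x)) \<in> borel_measurable \<mu>" by measurable
  have "norm (sqrt (p \<theta> x) * sqrt (p \<theta>\<^sub>0 x)) \<le> norm (p \<theta> x + p \<theta>\<^sub>0 x)" if "x \<in> space \<mu>" for x
  proof -
    have a: "0 \<le> p \<theta> x" "0 \<le> p \<theta>\<^sub>0 x" using p_nonneg \<theta> \<theta>\<^sub>0_mem that by (auto simp: space_D)
    then have "2 * (sqrt (p \<theta> x) * sqrt (p \<theta>\<^sub>0 x)) \<le> p \<theta> x + p \<theta>\<^sub>0 x"
      using zero_le_power2[of "sqrt (p \<theta> x) - sqrt (p \<theta>\<^sub>0 x)"] by (simp add: power2_diff)
    moreover have "0 \<le> sqrt (p \<theta> x) * sqrt (p \<theta>\<^sub>0 x)" using a by simp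
    ultimately show ?thesis using a by simp
  qed
  then show "AE x in \<mu>. norm (sqrt (p \<theta> x) * sqrt (p \<theta>\<^sub>0 x)) \<le> norm (p \<theta> x + p \<theta>\<^sub>0 x)" by simp
qed

lemma affinity_nonneg:
  assumes "\<theta> \<in> \<Theta>" shows "0 \<le> affinity \<theta>"
  unfolding affinity_def using p_nonneg assms \<theta>\<^sub>0_mem by (intro integral_nonneg_AE) (auto simp: space_D)

lemma affinity_hellinger:
  assumes \<theta>: "\<theta> \<in> \<Theta>" shows "affinity \<theta> = 1 - hellinger_sq \<mu> p \<theta> \<theta>\<^sub>0 / 2"
proof -
  have "hellinger_sq \<mu> p \<theta> \<theta>\<^sub>0 = (\<integral>x. p \<theta> x + p \<theta>\<^sub>0 x - 2 * (sqrt (p \<theta> x) * sqrt (p \<theta>\<^sub>0 x)) \<partial>\<mu>)"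
    unfolding hellinger_sq_def
    using p_nonneg \<theta> \<theta>\<^sub>0_mem by (intro Bochner_Integration.integral_cong refl) (auto simp: space_D power2_diff)
  also have "\<dots> = 2 - 2 * affinity \<theta>"
    using p_integrable[OF \<theta>] p_integrable[OF \<theta>\<^sub>0_mem] affinity_integrable[OF \<theta>]
    by (simp add: affinity_def)
  finally show ?thesis by (simp add: field_simps)
qed

lemma likelihood_ratio_mean:
  assumes \<theta>: "\<theta> \<in> \<Theta>" shows "(\<integral>\<^sup>+x. ennreal (sqrt (p \<theta> x / p \<theta>\<^sub>0 x)) \<partial>D) = ennreal (affinity \<theta>)"
proof -
  note [measurable] = p_meas[OF \<theta>] p_meas[OF \<theta>\<^sub>0_mem]
  have "(\<integral>\<^sup>+x. ennreal (sqrt (p \<theta> x / p \<theta>\<^sub>0 x)) \<partial>D) = (\<integral>\<^sup>+x. ennreal (p \<theta>\<^sub>0 x) * ennreal (sqrt (p \<theta> x / p \<theta>\<^sub>0 x)) \<partial>\<mu>)"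
    unfolding D_eq by (rule nn_integral_density) auto
  also have "\<dots> = (\<integral>\<^sup>+x. ennreal (sqrt (p \<theta> x) * sqrt (p \<theta>\<^sub>0 x)) \<partial>\<mu>)"
  proof (rule nn_integral_cong)
    fix x assume "x \<in> space \<mu>"
    then have a: "0 \<le> p \<theta> x" "0 \<le> p \<theta>\<^sub>0 x" using p_nonneg \<theta> \<theta>\<^sub>0_mem by (auto simp: space_D)
    have "p \<theta>\<^sub>0 x * sqrt (p \<theta> x / p \<theta>\<^sub>0 x) = sqrt (p \<theta> x) * sqrt (p \<theta>\<^sub>0 x)"
    proof (cases "p \<theta>\<^sub>0 x = 0")
      case False
      then show ?thesis using a by (simp add: real_sqrt_divide real_div_sqrt field_simps)
    qed simp
    then show "ennreal (p \<theta>\<^sub>0 x) * ennreal (sqrt (p \<theta> x / p \<theta>\<^sub>0 x)) = ennreal (sqrt (p \<theta> x) * sqrt (p \<theta>\<^sub>0 x))"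
      using a by (simp flip: ennreal_mult)
  qed
  also have "\<dots> = ennreal (affinity \<theta>)"
    unfolding affinity_def using p_nonneg \<theta> \<theta>\<^sub>0_mem by (intro nn_integral_eq_integral affinity_integrable) (auto simp: space_D)
  finally show ?thesis .
qed

text \<open>A supremum over an uncountable set of parameters need not be measurable, hence a
  measurable majorant \<open>G\<close>. Its values are in \<open>ennreal\<close> because the
  integral that defines it may diverge at some x.\<close>

definition cell_bound :: "real set \<Rightarrow> real \<Rightarrow> bool" where
  "cell_bound S \<beta> \<longleftrightarrow> 0 \<le> \<beta> \<and> (\<exists>G\<in>borel_measurable D. (\<forall>x\<in>A. \<forall>\<theta>\<in>S. ennreal (sqrt (p \<theta> x / p \<theta>\<^sub>0 x)) \<le> G x) \<and>
     (\<integral>\<^sup>+x. G x \<partial>D) \<le> ennreal \<beta>)"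

lemma A_space: "x \<in> A \<Longrightarrow> x \<in> space \<mu>"
  using sets.sets_into_space[OF A_sets] space_D by auto

lemma A_pos: "x \<in> A \<Longrightarrow> 0 < p \<theta>\<^sub>0 x"
  using p_pos[of x 0] \<delta>_pos by simp

lemma sqrt_ratio_increment:
  assumes x: "x \<in> A" and uv: "u \<in> \<Theta>" "v \<in> \<Theta>" "u \<le> v"
  shows "ennreal \<bar>sqrt (p v x / p \<theta>\<^sub>0 x) - sqrt (p u x / p \<theta>\<^sub>0 x)\<bar> \<le> (\<integral>\<^sup>+t. ennreal (rate t x) * indicator {u..v} t \<partial>lborel)"
proof -
  have xs: "x \<in> space \<mu>" and p0: "0 < p \<theta>\<^sub>0 x" using A_space[OF x] A_pos[OF x] by auto
  have sub: "{u..v} \<subseteq> \<Theta>" using interval uv unfolding is_interval_1 by (meson atLeastAtMost_iff subsetI)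
  then have int: "t \<in> interior \<Theta>" if "u < t" "t < v" for t
    using that by (intro interiorI[of "{u<..<v}"]) auto
  show ?thesis
  proof (rule sqrt_increment_le[OF uv(3)])
    have "continuous_on \<Theta> (\<lambda>t. p t x)"
      using wd xs unfolding fisher_info_well_defined_def
      by (intro differentiable_imp_continuous_on) (auto simp: differentiable_on_def)
    then have "continuous_on {u..v} (\<lambda>t. p t x)" using sub by (rule continuous_on_subset)
    then show "continuous_on {u..v} (\<lambda>t. p t x / p \<theta>\<^sub>0 x)" using p0 by (intro continuous_intros) auto
    show "0 \<le> p t x / p \<theta>\<^sub>0 x" if "t \<in> {u..v}" for t
      using p_nonneg[of t x] sub that xs p0 by (auto simp: space_D)
    show "((\<lambda>t. p t x / p \<theta>\<^sub>0 x) has_real_derivative deriv (\<lambda>t. p t x) t / p \<theta>\<^sub>0 x) (at t)" if "u < t" "t < v" for t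
      using p_has_deriv[OF xs int[OF that]] by (rule DERIV_cdivide)
    show "(\<lambda>t. rate t x) \<in> borel_measurable borel"
      using measurable_compose[OF measurable_Pair2' rate_joint_measurable] xs by (auto dest: measurable_compose)
    show "0 \<le> rate t x" for t by (rule rate_nonneg)
    show "\<bar>deriv (\<lambda>t. p t x) t / p \<theta>\<^sub>0 x\<bar> / (2 * sqrt (p t x / p \<theta>\<^sub>0 x)) \<le> rate t x"
      if t: "u < t" "t < v" "0 < p t x / p \<theta>\<^sub>0 x" for t
    proof -
      have pt: "0 < p t x" using t(3) p0 by (simp add: zero_less_divide_iff)
      have "p \<theta>\<^sub>0 x * (2 * sqrt (p t x / p \<theta>\<^sub>0 x)) = 2 * sqrt (p t x * p \<theta>\<^sub>0 x)"
        using p0 pt by (simp add: real_sqrt_divide real_sqrt_mult real_div_sqrt field_simps)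
      moreover have "\<bar>deriv (\<lambda>t. p t x) t / p \<theta>\<^sub>0 x\<bar> / s = \<bar>deriv (\<lambda>t. p t x) t\<bar> / (p \<theta>\<^sub>0 x * s)" for s
        using p0 by (simp add: abs_divide)
      ultimately have "\<bar>deriv (\<lambda>t. p t x) t / p \<theta>\<^sub>0 x\<bar> / (2 * sqrt (p t x / p \<theta>\<^sub>0 x)) = \<bar>deriv (\<lambda>t. p t x) t\<bar> / (2 * sqrt (p t x * p \<theta>\<^sub>0 x))"
        by (simp only:)
      also have "\<dots> = rate t x" using pt p0 int[OF t(1,2)] by (simp add: rate_def pint_def dp_def)
      finally show ?thesis by simp
    qed
  qed
qed

text \<open>The majorant is the root of the ratio at the base point \<open>a\<close> plus the
  integral of the rate over the whole cell, which no longer involves \<theta>. Its mean is computed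
  by Tonelli's theorem; parameters of the cell outside the interior of \<Theta> contribute
  0.\<close>

lemma cell_bound_interval:
  assumes a: "a \<in> \<Theta>" "lo \<le> a" "a \<le> hi" and K: "0 < K" "\<And>\<theta>. \<theta> \<in> \<Theta> \<Longrightarrow> lo \<le> \<theta> \<Longrightarrow> \<theta> \<le> hi \<Longrightarrow> fisher_info \<mu> \<Theta> p \<theta> \<le> ennreal K"
  shows "cell_bound ({lo..hi} \<inter> \<Theta>) (affinity a + (hi - lo) * (sqrt K / 2))"
proof -
  interpret pair_sigma_finite lborel D
    by (intro pair_sigma_finite.intro lborel.sigma_finite_measure_axioms D.sigma_finite_measure_axioms)
  have rm[measurable]: "(\<lambda>z. rate (fst z) (snd z)) \<in> borel_measurable (borel \<Otimes>\<^sub>M D)"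
    using rate_joint_measurable by (simp cong: measurable_cong_sets add: sets_pair_measure_cong[OF refl sets_D])
  have rm': "(\<lambda>(\<theta>, x). ennreal (rate \<theta> x) * indicator {lo..hi} \<theta>) \<in> borel_measurable (lborel \<Otimes>\<^sub>M D)"
    using rm unfolding case_prod_beta by measurable
  have pm[measurable]: "p a \<in> borel_measurable D" "p \<theta>\<^sub>0 \<in> borel_measurable D"
    unfolding measurable_cong_sets[OF sets_D refl] by (rule p_meas[OF a(1)] p_meas[OF \<theta>\<^sub>0_mem])+
  define H where "H x = (\<integral>\<^sup>+\<theta>. ennreal (rate \<theta> x) * indicator {lo..hi} \<theta> \<partial>lborel)" for x
  define G where "G x = ennreal (sqrt (p a x / p \<theta>\<^sub>0 x)) + H x" for x
  have Hm[measurable]: "H \<in> borel_measurable D"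
  proof -
    have "(\<lambda>z. (snd z, fst z)) \<in> measurable (D \<Otimes>\<^sub>M lborel) (lborel \<Otimes>\<^sub>M D)" by measurable
    from measurable_compose[OF this rm']
    have "case_prod (\<lambda>x \<theta>. ennreal (rate \<theta> x) * indicator {lo..hi} \<theta>) \<in> borel_measurable (D \<Otimes>\<^sub>M lborel)"
      by (simp add: case_prod_beta)
    then show ?thesis unfolding H_def[abs_def] by (rule lborel.borel_measurable_nn_integral)
  qed
  have "ennreal (sqrt (p \<theta> x / p \<theta>\<^sub>0 x)) \<le> G x" if x: "x \<in> A" and \<theta>: "\<theta> \<in> {lo..hi} \<inter> \<Theta>" for x \<theta>
  proof -
    have "ennreal \<bar>sqrt (p \<theta> x / p \<theta>\<^sub>0 x) - sqrt (p a x / p \<theta>\<^sub>0 x)\<bar>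
       \<le> (\<integral>\<^sup>+t. ennreal (rate t x) * indicator {min a \<theta>..max a \<theta>} t \<partial>lborel)"
      using sqrt_ratio_increment[OF x a(1), of \<theta>] sqrt_ratio_increment[OF x _ a(1), of \<theta>] \<theta>
      by (cases "a \<le> \<theta>") (auto simp: abs_minus_commute min_def max_def)
    also have "\<dots> \<le> H x" unfolding H_def using a \<theta> by (intro nn_integral_mono mult_left_mono) (auto simp: indicator_def)
    finally have "ennreal \<bar>sqrt (p \<theta> x / p \<theta>\<^sub>0 x) - sqrt (p a x / p \<theta>\<^sub>0 x)\<bar> \<le> H x" .
    moreover have "ennreal (sqrt (p \<theta> x / p \<theta>\<^sub>0 x)) \<le> ennreal (sqrt (p a x / p \<theta>\<^sub>0 x)) + ennreal \<bar>sqrt (p \<theta> x / p \<theta>\<^sub>0 x) - sqrt (p a x / p \<theta>\<^sub>0 x)\<bar>"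
    proof -
      have "0 \<le> sqrt (p a x / p \<theta>\<^sub>0 x)"
        using p_nonneg[OF a(1), of x] A_space[OF x] A_pos[OF x] by (simp add: space_D)
      then have "ennreal (sqrt (p a x / p \<theta>\<^sub>0 x)) + ennreal \<bar>sqrt (p \<theta> x / p \<theta>\<^sub>0 x) - sqrt (p a x / p \<theta>\<^sub>0 x)\<bar>
        = ennreal (sqrt (p a x / p \<theta>\<^sub>0 x) + \<bar>sqrt (p \<theta> x / p \<theta>\<^sub>0 x) - sqrt (p a x / p \<theta>\<^sub>0 x)\<bar>)"
        by (rule ennreal_plus[symmetric]) (rule abs_ge_zero)
      moreover have "u \<le> v + \<bar>u - v\<bar>" for u v :: real by linarith
      ultimately show ?thesis by (simp only: ennreal_leI)
    qed
    ultimately show ?thesis unfolding G_def by (meson add_left_mono order_trans)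
  qed
  moreover have "(\<integral>\<^sup>+x. G x \<partial>D) \<le> ennreal (affinity a + (hi - lo) * (sqrt K / 2))"
  proof -
    have "(\<integral>\<^sup>+x. G x \<partial>D) = ennreal (affinity a) + (\<integral>\<^sup>+x. H x \<partial>D)"
      unfolding G_def by (subst nn_integral_add) (auto simp: likelihood_ratio_mean[OF a(1)])
    also have "(\<integral>\<^sup>+x. H x \<partial>D) = (\<integral>\<^sup>+\<theta>. \<integral>\<^sup>+x. ennreal (rate \<theta> x) * indicator {lo..hi} \<theta> \<partial>D \<partial>lborel)"
      unfolding H_def by (rule Fubini'[OF rm'])
    also have "\<dots> \<le> (\<integral>\<^sup>+\<theta>. ennreal (sqrt K / 2) * indicator {lo..hi} \<theta> \<partial>lborel)"
    proof (rule nn_integral_mono)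
      fix \<theta> :: real
      show "(\<integral>\<^sup>+x. ennreal (rate \<theta> x) * indicator {lo..hi} \<theta> \<partial>D) \<le> ennreal (sqrt K / 2) * indicator {lo..hi} \<theta>"
      proof (cases "\<theta> \<in> {lo..hi} \<inter> \<Theta>")
        case True
        then show ?thesis using rate_mean_le[of \<theta> K] K by simp
      next
        case False
        then have "\<theta> \<notin> {lo..hi} \<or> \<theta> \<notin> interior \<Theta>" by (auto dest: interior_mem)
        then show ?thesis by (auto simp: indicator_def rate_def pint_def)
      qed
    qed
    also have "\<dots> = ennreal ((hi - lo) * (sqrt K / 2))"
      using a K by (subst nn_integral_cmult_indicator) (auto simp: mult.commute simp flip: ennreal_mult)
    finally show ?thesis using affinity_nonneg[OF a(1)] a K by (simp add: ennreal_plus)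
  qed
  moreover have "G \<in> borel_measurable D" unfolding G_def[abs_def] by measurable
  ultimately show ?thesis unfolding cell_bound_def using affinity_nonneg[OF a(1)] a K by (intro conjI bexI[of _ G]) auto
qed

text \<open>By independence the product of the majorants has mean at most \<beta>^n. Where it stays
  below 1/2, so do the roots of the likelihood ratio for all \<theta> in the cell at once, and
  squaring gives 1/4.\<close>

lemma cell_bound_event:
  assumes cb: "cell_bound S \<beta>" and S: "S \<subseteq> \<Theta>"
  shows "\<exists>B\<in>sets M. prob B \<le> 2 * \<beta> ^ n \<and> (\<forall>w\<in>space M - B. (\<forall>i. X i w \<in> A) \<longrightarrow>
    (\<forall>\<theta>\<in>S. likelihood p n (\<lambda>i. X i w) \<theta> \<le> likelihood p n (\<lambda>i. X i w) \<theta>\<^sub>0 / 4))"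
proof -
  obtain G where G[measurable]: "G \<in> borel_measurable D" and Gle: "\<And>x \<theta>. x \<in> A \<Longrightarrow> \<theta> \<in> S \<Longrightarrow> ennreal (sqrt (p \<theta> x / p \<theta>\<^sub>0 x)) \<le> G x"
    and Gint: "(\<integral>\<^sup>+x. G x \<partial>D) \<le> ennreal \<beta>" and \<beta>: "0 \<le> \<beta>" using cb unfolding cell_bound_def by blast
  define g where "g w = (\<Prod>i\<in>{1..n}. G (X i w))" for w
  have [measurable]: "g \<in> borel_measurable M" unfolding g_def[abs_def] by measurable
  define B where "B = {w \<in> space M. 1 \<le> 2 * g w}"
  have [measurable]: "B \<in> sets M" unfolding B_def by measurable
  have ind: "indep_vars (\<lambda>_. borel) (\<lambda>i w. G (X i w)) {1..n}"
    by (rule indep_vars_compose2[OF indep_sample_subset]) measurable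
  have "(\<integral>\<^sup>+w. g w \<partial>M) = (\<Prod>i\<in>{1..n}. \<integral>\<^sup>+w. G (X i w) \<partial>M)"
    unfolding g_def by (rule indep_vars_nn_integral[OF _ ind]) auto
  also have "\<dots> = (\<Prod>i\<in>{1..n}. \<integral>\<^sup>+x. G x \<partial>D)"
    by (intro prod.cong refl) (metis G law_sample measurable_sample nn_integral_distr)
  also have "\<dots> \<le> (\<Prod>i\<in>{1..n}. ennreal \<beta>)" by (intro prod_mono_ennreal Gint)
  also have "\<dots> = ennreal (\<beta> ^ n)" using \<beta> by (simp add: ennreal_power)
  finally have gi: "(\<integral>\<^sup>+w. g w \<partial>M) \<le> ennreal (\<beta> ^ n)" .
  have "emeasure M B \<le> 2 * (\<integral>\<^sup>+w. g w * indicator (space M) w \<partial>M)"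
    unfolding B_def by (rule nn_integral_Markov_inequality) auto
  also have "(\<integral>\<^sup>+w. g w * indicator (space M) w \<partial>M) = (\<integral>\<^sup>+w. g w \<partial>M)" by (rule nn_integral_cong) simp
  also have "2 * \<dots> \<le> 2 * ennreal (\<beta> ^ n)" by (intro mult_left_mono gi) auto
  also have "\<dots> = ennreal (2 * \<beta> ^ n)" using \<beta> by (simp add: ennreal_mult)
  finally have "prob B \<le> 2 * \<beta> ^ n" using \<beta> by (simp add: emeasure_eq_measure)
  moreover have "likelihood p n (\<lambda>i. X i w) \<theta> \<le> likelihood p n (\<lambda>i. X i w) \<theta>\<^sub>0 / 4"
    if w: "w \<in> space M - B" and A: "\<forall>i. X i w \<in> A" and \<theta>: "\<theta> \<in> S" for w \<theta>
  proof -
    have nn: "0 \<le> p \<theta> (X i w)" "0 < p \<theta>\<^sub>0 (X i w)" for i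
      using p_nonneg[of \<theta> "X i w"] A_space A_pos A \<theta> S by (auto simp: space_D)
    let ?q = "\<Prod>i\<in>{1..n}. sqrt (p \<theta> (X i w) / p \<theta>\<^sub>0 (X i w))"
    have q0: "0 \<le> ?q" using nn by (intro prod_nonneg) (auto simp: less_imp_le)
    have "ennreal ?q = (\<Prod>i\<in>{1..n}. ennreal (sqrt (p \<theta> (X i w) / p \<theta>\<^sub>0 (X i w))))"
      using nn by (intro prod_ennreal[symmetric]) (auto simp: less_imp_le)
    also have "\<dots> \<le> g w" unfolding g_def using A \<theta> by (intro prod_mono_ennreal Gle) auto
    finally have "2 * ennreal ?q \<le> 2 * g w" by (intro mult_left_mono) auto
    also have "2 * g w < 1" using w by (auto simp: B_def not_le)
    finally have "ennreal (2 * ?q) < ennreal 1" using q0 by (simp add: ennreal_mult)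
    then have "2 * ?q < 1" using q0 by (subst (asm) ennreal_less_iff) auto
    then have "?q\<^sup>2 \<le> (1 / 2)\<^sup>2" using q0 by (intro power_mono) auto
    moreover have "?q\<^sup>2 = (\<Prod>i\<in>{1..n}. p \<theta> (X i w) / p \<theta>\<^sub>0 (X i w))"
      unfolding prod_power_distrib using nn by (intro prod.cong refl) (simp add: less_imp_le)
    moreover have "\<dots> = likelihood p n (\<lambda>i. X i w) \<theta> / likelihood p n (\<lambda>i. X i w) \<theta>\<^sub>0"
      unfolding likelihood_def by (rule prod_dividef)
    moreover have "0 < likelihood p n (\<lambda>i. X i w) \<theta>\<^sub>0" unfolding likelihood_def using nn by (intro prod_pos) auto
    ultimately show ?thesis by (simp add: power_divide pos_divide_le_eq)
  qed
  ultimately show ?thesis by (intro bexI[of _ B]) auto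
qed

end

section \<open>Covering the far part of the parameter set\<close>

lemma geometric_le_inverse_square:
  fixes q :: real
  assumes "0 \<le> q" "q < 1"
  obtains C where "0 \<le> C" "\<And>n. 1 \<le> n \<Longrightarrow> q ^ n \<le> C / (real n)\<^sup>2"
proof -
  have "norm (sqrt q) < 1" using assms by simp
  then have "(\<lambda>n. real n * sqrt q ^ n) \<longlonglongrightarrow> 0" by (rule powser_times_n_limit_0)
  then have "Bseq (\<lambda>n. real n * sqrt q ^ n)" by (intro convergent_imp_Bseq convergentI)
  then obtain K where K: "0 < K" "\<And>n. norm (real n * sqrt q ^ n) \<le> K" by (auto elim: BseqE)
  show thesis
  proof (rule that[of "K\<^sup>2"])
    fix n :: nat assume n: "1 \<le> n"
    have "(real n * sqrt q ^ n)\<^sup>2 \<le> K\<^sup>2" using K(2)[of n] assms by (intro power_mono) auto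
    moreover have "(real n * sqrt q ^ n)\<^sup>2 = (real n)\<^sup>2 * (sqrt q ^ 2) ^ n"
      by (simp only: power_mult_distrib power_mult[symmetric] mult.commute)
    ultimately have "(real n)\<^sup>2 * q ^ n \<le> K\<^sup>2" using assms by simp
    then show "q ^ n \<le> K\<^sup>2 / (real n)\<^sup>2" using n by (subst pos_le_divide_eq) (auto simp: mult.commute)
  qed simp
qed

lemma powr_ge_of_root:
  fixes x y s :: real
  assumes "0 < y" "0 < s" "y powr (1 / s) \<le> x"
  shows "y \<le> x powr s"
proof -
  have "y = (y powr (1 / s)) powr s" using assms by (simp add: powr_powr)
  also have "\<dots> \<le> x powr s" using assms by (intro powr_mono2) auto
  finally show ?thesis .
qed

context hellinger_model
begin

text \<open>A set of parameters that may be discarded. The constant 1/4 only has to be less than 1,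
  to leave the likelihood at \<theta>0 strictly above the bound; the form C / n^2 is stable under
  finite unions.\<close>

definition far_ok :: "real set \<Rightarrow> bool" where
  "far_ok S \<longleftrightarrow> (\<exists>C\<ge>0. \<forall>n\<ge>1. \<exists>B\<in>sets M. prob B \<le> C / (real n)\<^sup>2 \<and> (\<forall>w\<in>space M - B. (\<forall>i. X i w \<in> A) \<longrightarrow>
    (\<forall>\<theta>\<in>S. likelihood p n (\<lambda>i. X i w) \<theta> \<le> likelihood p n (\<lambda>i. X i w) \<theta>\<^sub>0 / 4)))"

lemma far_ok_subset: "far_ok T \<Longrightarrow> S \<subseteq> T \<Longrightarrow> far_ok S"
  unfolding far_ok_def by (meson subset_iff)

lemma far_ok_Un:
  assumes "far_ok S" "far_ok T" shows "far_ok (S \<union> T)"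
proof -
  obtain C1 where C1: "0 \<le> C1" "\<And>n. 1 \<le> n \<Longrightarrow> \<exists>B\<in>sets M. prob B \<le> C1 / (real n)\<^sup>2 \<and> (\<forall>w\<in>space M - B. (\<forall>i. X i w \<in> A) \<longrightarrow>
    (\<forall>\<theta>\<in>S. likelihood p n (\<lambda>i. X i w) \<theta> \<le> likelihood p n (\<lambda>i. X i w) \<theta>\<^sub>0 / 4))"
    using assms(1) unfolding far_ok_def by blast
  obtain C2 where C2: "0 \<le> C2" "\<And>n. 1 \<le> n \<Longrightarrow> \<exists>B\<in>sets M. prob B \<le> C2 / (real n)\<^sup>2 \<and> (\<forall>w\<in>space M - B. (\<forall>i. X i w \<in> A) \<longrightarrow>
    (\<forall>\<theta>\<in>T. likelihood p n (\<lambda>i. X i w) \<theta> \<le> likelihood p n (\<lambda>i. X i w) \<theta>\<^sub>0 / 4))"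
    using assms(2) unfolding far_ok_def by blast
  show ?thesis unfolding far_ok_def
  proof (rule exI[of _ "C1 + C2"], intro conjI allI impI)
    show "0 \<le> C1 + C2" using C1 C2 by simp
    fix n :: nat assume n: "1 \<le> n"
    obtain B1 where B1: "B1 \<in> sets M" "prob B1 \<le> C1 / (real n)\<^sup>2" "\<forall>w\<in>space M - B1. (\<forall>i. X i w \<in> A) \<longrightarrow>
      (\<forall>\<theta>\<in>S. likelihood p n (\<lambda>i. X i w) \<theta> \<le> likelihood p n (\<lambda>i. X i w) \<theta>\<^sub>0 / 4)" using C1(2)[OF n] by blast
    obtain B2 where B2: "B2 \<in> sets M" "prob B2 \<le> C2 / (real n)\<^sup>2" "\<forall>w\<in>space M - B2. (\<forall>i. X i w \<in> A) \<longrightarrow>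
      (\<forall>\<theta>\<in>T. likelihood p n (\<lambda>i. X i w) \<theta> \<le> likelihood p n (\<lambda>i. X i w) \<theta>\<^sub>0 / 4)" using C2(2)[OF n] by blast
    have "prob (B1 \<union> B2) \<le> (C1 + C2) / (real n)\<^sup>2"
      using measure_Un_le[OF B1(1) B2(1)] B1(2) B2(2) by (simp add: add_divide_distrib)
    then show "\<exists>B\<in>sets M. prob B \<le> (C1 + C2) / (real n)\<^sup>2 \<and> (\<forall>w\<in>space M - B. (\<forall>i. X i w \<in> A) \<longrightarrow>
      (\<forall>\<theta>\<in>S \<union> T. likelihood p n (\<lambda>i. X i w) \<theta> \<le> likelihood p n (\<lambda>i. X i w) \<theta>\<^sub>0 / 4))"
      using B1 B2 by (intro bexI[of _ "B1 \<union> B2"]) auto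
  qed
qed

text \<open>Of the \<open>n\<close> factors of \<open>\<beta> j ^ n\<close>, \<open>n0\<close> are
  spent on summing over the cells and the other n - n0 are bounded by powers of \<open>q\<close>,
  which beat 1 / n^2. For n < \<open>n0\<close> the constant makes the claimed bound at least 1, and
  the whole space serves as exceptional set.\<close>

lemma far_ok_countable:
  fixes S :: "nat \<Rightarrow> real set"
  assumes cb: "\<And>j. cell_bound (S j) (\<beta> j)" and S: "\<And>j. S j \<subseteq> \<Theta>"
    and q: "\<And>j. \<beta> j \<le> q" "0 < q" "q < 1" and sm: "summable (\<lambda>j. \<beta> j ^ n0)"
  shows "far_ok (\<Union>j. S j)"
proof -
  have \<beta>0: "0 \<le> \<beta> j" for j using cb[of j] by (simp add: cell_bound_def)
  define s where "s = (\<Sum>j. \<beta> j ^ n0)"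
  have s0: "0 \<le> s" unfolding s_def using \<beta>0 by (intro suminf_nonneg sm) auto
  obtain C1 where C1: "0 \<le> C1" "\<And>n. 1 \<le> n \<Longrightarrow> q ^ n \<le> C1 / (real n)\<^sup>2"
    using geometric_le_inverse_square[of q] q by (metis less_imp_le)
  define C where "C = (real n0)\<^sup>2 + 2 * s * C1 / q ^ n0"
  have C: "0 \<le> C" using s0 C1 q by (simp add: C_def)
  show ?thesis unfolding far_ok_def
  proof (rule exI[of _ C], intro conjI allI impI C)
    fix n :: nat assume n: "1 \<le> n"
    show "\<exists>B\<in>sets M. prob B \<le> C / (real n)\<^sup>2 \<and> (\<forall>w\<in>space M - B. (\<forall>i. X i w \<in> A) \<longrightarrow>
      (\<forall>\<theta>\<in>\<Union>j. S j. likelihood p n (\<lambda>i. X i w) \<theta> \<le> likelihood p n (\<lambda>i. X i w) \<theta>\<^sub>0 / 4))"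
    proof (cases "n < n0")
      case True
      have "(real n)\<^sup>2 \<le> (real n0)\<^sup>2" using True by (intro power_mono) auto
      also have "\<dots> \<le> C" using s0 C1 q by (simp add: C_def)
      finally have "1 \<le> C / (real n)\<^sup>2" using n by (subst pos_le_divide_eq) auto
      then show ?thesis by (intro bexI[of _ "space M"]) (auto simp: prob_space)
    next
      case False
      have "\<exists>B. \<forall>j. B j \<in> sets M \<and> prob (B j) \<le> 2 * \<beta> j ^ n \<and> (\<forall>w\<in>space M - B j. (\<forall>i. X i w \<in> A) \<longrightarrow>
        (\<forall>\<theta>\<in>S j. likelihood p n (\<lambda>i. X i w) \<theta> \<le> likelihood p n (\<lambda>i. X i w) \<theta>\<^sub>0 / 4))"
        using cell_bound_event[OF cb S, of _ n] by (intro choice allI) blast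
      then obtain B where B: "\<And>j. B j \<in> sets M" "\<And>j. prob (B j) \<le> 2 * \<beta> j ^ n"
        "\<And>j w. w \<in> space M - B j \<Longrightarrow> \<forall>i. X i w \<in> A \<Longrightarrow>
        \<forall>\<theta>\<in>S j. likelihood p n (\<lambda>i. X i w) \<theta> \<le> likelihood p n (\<lambda>i. X i w) \<theta>\<^sub>0 / 4" by metis
      have le: "prob (B j) \<le> 2 * q ^ (n - n0) * \<beta> j ^ n0" for j
      proof -
        have "\<beta> j ^ n = \<beta> j ^ (n - n0) * \<beta> j ^ n0" using False by (simp add: power_add[symmetric])
        also have "\<dots> \<le> q ^ (n - n0) * \<beta> j ^ n0"
          using q(1)[of j] \<beta>0 by (intro mult_right_mono power_mono) auto
        finally show ?thesis using B(2)[of j] by simp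
      qed
      have sm': "summable (\<lambda>j. 2 * q ^ (n - n0) * \<beta> j ^ n0)" by (intro summable_mult sm)
      have smB: "summable (\<lambda>j. prob (B j))"
        by (rule summable_comparison_test'[OF sm', of 0]) (use le in auto)
      have "prob (\<Union>j. B j) \<le> (\<Sum>j. prob (B j))"
        using B(1) by (intro finite_measure_subadditive_countably smB) auto
      also have "\<dots> \<le> (\<Sum>j. 2 * q ^ (n - n0) * \<beta> j ^ n0)" by (intro suminf_le le smB sm')
      also have "\<dots> = 2 * q ^ (n - n0) * s" unfolding s_def by (rule suminf_mult[OF sm])
      also have "q ^ (n - n0) = q ^ n / q ^ n0" using False q by (simp add: power_diff)
      also have "2 * (q ^ n / q ^ n0) * s \<le> 2 * (C1 / (real n)\<^sup>2 / q ^ n0) * s"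
        using C1(2)[OF n] q s0 by (intro mult_right_mono mult_left_mono divide_right_mono) auto
      also have "\<dots> = 2 * s * C1 / q ^ n0 / (real n)\<^sup>2" by (simp add: mult_ac)
      also have "\<dots> \<le> C / (real n)\<^sup>2" unfolding C_def by (intro divide_right_mono) auto
      finally have "prob (\<Union>j. B j) \<le> C / (real n)\<^sup>2" .
      moreover have "(\<Union>j. B j) \<in> sets M" using B(1) by (intro sets.countable_UN) auto
      moreover have "likelihood p n (\<lambda>i. X i w) \<theta> \<le> likelihood p n (\<lambda>i. X i w) \<theta>\<^sub>0 / 4"
        if w: "w \<in> space M - (\<Union>j. B j)" "\<forall>i. X i w \<in> A" "\<theta> \<in> (\<Union>j. S j)" for w \<theta>
      proof -
        from w(3) obtain j where "\<theta> \<in> S j" by blast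
        then show ?thesis using B(3)[of w j] w by auto
      qed
      ultimately show ?thesis by (intro bexI[of _ "\<Union>j. B j"]) auto
    qed
  qed
qed

lemma cell_bound_mono: "cell_bound S \<beta> \<Longrightarrow> \<beta> \<le> \<beta>' \<Longrightarrow> cell_bound S \<beta>'"
  unfolding cell_bound_def by (meson ennreal_leI order_trans)

lemma cell_bound_empty: "0 \<le> \<beta> \<Longrightarrow> cell_bound {} \<beta>"
  unfolding cell_bound_def by (auto intro!: bexI[of _ "\<lambda>_. 0"])

lemma far_ok_cell:
  assumes cb: "cell_bound S \<beta>" and S: "S \<subseteq> \<Theta>" and \<beta>: "\<beta> < 1"
  shows "far_ok S"
proof -
  have \<beta>0: "0 \<le> \<beta>" using cb by (simp add: cell_bound_def)
  have "far_ok (\<Union>j::nat. if j = 0 then S else {})"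
  \<comment> \<open>The exponent is 1 because with 0 each empty cell would contribute 0^0 = 1. The
    maximum with 1/2 makes \<open>q\<close> positive even if \<beta> is 0.\<close>
  proof (rule far_ok_countable[where \<beta> = "\<lambda>j. if j = 0 then \<beta> else 0" and q = "max \<beta> (1 / 2)" and ?n0.0 = 1])
    show "cell_bound (if j = 0 then S else {}) (if j = 0 then \<beta> else 0)" for j :: nat
      using cb cell_bound_empty by simp
    show "summable (\<lambda>j::nat. (if j = 0 then \<beta> else 0) ^ 1)"
      by (rule summable_finite[of "{0}"]) auto
  qed (use S \<beta> \<beta>0 in auto)
  then show ?thesis by (rule far_ok_subset) auto
qed

text \<open>The sign \<open>\<sigma>\<close>, 1 or -1, selects a side of \<theta>0; \<open>u\<close>
  and \<open>v\<close> are distances from \<theta>0.\<close>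

definition segment_from :: "real \<Rightarrow> real \<Rightarrow> real \<Rightarrow> real set" where
  "segment_from \<sigma> u v = {\<theta>\<in>\<Theta>. u \<le> \<sigma> * (\<theta> - \<theta>\<^sub>0) \<and> \<sigma> * (\<theta> - \<theta>\<^sub>0) \<le> v}"

text \<open>The base point is the end nearer to \<theta>0. It belongs to \<Theta> as soon as the
  segment is not empty, \<Theta> being an interval through \<theta>0.\<close>

lemma cell_bound_segment:
  assumes \<sigma>: "\<sigma> = 1 \<or> \<sigma> = - 1" and uv: "0 \<le> u" "u \<le> v" and K: "0 < K"
    and fi: "\<And>\<theta>. \<theta> \<in> \<Theta> \<Longrightarrow> \<bar>\<theta> - \<theta>\<^sub>0\<bar> \<le> v \<Longrightarrow> fisher_info \<mu> \<Theta> p \<theta> \<le> ennreal K"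
    and b: "0 \<le> b" "\<And>a. a \<in> \<Theta> \<Longrightarrow> \<bar>a - \<theta>\<^sub>0\<bar> = u \<Longrightarrow> affinity a \<le> b"
  shows "cell_bound (segment_from \<sigma> u v) (b + (v - u) * (sqrt K / 2))"
proof (cases "segment_from \<sigma> u v = {}")
  case True
  then show ?thesis using b uv K by (simp add: cell_bound_empty)
next
  case False
  then obtain \<theta> where \<theta>: "\<theta> \<in> \<Theta>" "u \<le> \<sigma> * (\<theta> - \<theta>\<^sub>0)" by (auto simp: segment_from_def)
  define a where "a = \<theta>\<^sub>0 + \<sigma> * u"
  have a: "a \<in> \<Theta>"
    using \<sigma>
  proof
    assume "\<sigma> = 1"
    then show ?thesis using \<theta> uv by (intro mem_is_interval_1_I[OF interval \<theta>\<^sub>0_mem \<theta>(1)]) (auto simp: a_def)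
  next
    assume "\<sigma> = - 1"
    then show ?thesis using \<theta> uv by (intro mem_is_interval_1_I[OF interval \<theta>(1) \<theta>\<^sub>0_mem]) (auto simp: a_def)
  qed
  have au: "\<bar>a - \<theta>\<^sub>0\<bar> = u" using \<sigma> uv by (auto simp: a_def)
  define lo hi where "lo = (if \<sigma> = 1 then \<theta>\<^sub>0 + u else \<theta>\<^sub>0 - v)" and "hi = (if \<sigma> = 1 then \<theta>\<^sub>0 + v else \<theta>\<^sub>0 - u)"
  have "cell_bound ({lo..hi} \<inter> \<Theta>) (affinity a + (hi - lo) * (sqrt K / 2))"
    using \<sigma> uv by (intro cell_bound_interval[OF a _ _ K] fi) (auto simp: lo_def hi_def a_def)
  moreover have "{lo..hi} \<inter> \<Theta> = segment_from \<sigma> u v" using \<sigma> by (auto simp: lo_def hi_def segment_from_def)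
  moreover have "hi - lo = v - u" using \<sigma> by (auto simp: lo_def hi_def)
  ultimately show ?thesis using b(2)[OF a au] by (auto elim!: cell_bound_mono)
qed

lemma segment_from_subset: "segment_from \<sigma> u v \<subseteq> \<Theta>"
  by (auto simp: segment_from_def)

text \<open>On a segment away from \<theta>0 the lower Hellinger bound keeps the affinity at most 1
  - e/2. Cutting it into cells so short that the Fisher term is at most e/4 leaves every mean at
  most 1 - e/4, and finitely many cells suffice.\<close>

lemma far_ok_bounded_segment:
  assumes \<sigma>: "\<sigma> = 1 \<or> \<sigma> = - 1" and uv: "0 < u" "u < v"
    and c12: "0 < c1" "0 < c2" "0 < \<alpha>"
    and fi: "\<And>\<theta>. \<theta> \<in> \<Theta> \<Longrightarrow> fisher_info \<mu> \<Theta> p \<theta> \<le> ennreal (c1 + c2 * \<bar>\<theta> - \<theta>\<^sub>0\<bar> powr \<alpha>)"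
    and D0: "\<And>U. bounded U \<Longrightarrow> \<theta>\<^sub>0 \<in> interior U \<Longrightarrow> \<exists>c>0. \<forall>\<theta>\<in>U \<inter> \<Theta>. c * (\<theta> - \<theta>\<^sub>0)\<^sup>2 \<le> hellinger_sq \<mu> p \<theta> \<theta>\<^sub>0"
  shows "far_ok (segment_from \<sigma> u v)"
proof -
  have "\<exists>c>0. \<forall>\<theta>\<in>ball \<theta>\<^sub>0 (v + 1) \<inter> \<Theta>. c * (\<theta> - \<theta>\<^sub>0)\<^sup>2 \<le> hellinger_sq \<mu> p \<theta> \<theta>\<^sub>0"
    using uv by (intro D0) auto
  then obtain c where c: "0 < c" "\<And>\<theta>. \<theta> \<in> \<Theta> \<Longrightarrow> \<bar>\<theta> - \<theta>\<^sub>0\<bar> \<le> v \<Longrightarrow> c * (\<theta> - \<theta>\<^sub>0)\<^sup>2 \<le> hellinger_sq \<mu> p \<theta> \<theta>\<^sub>0"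
    by (auto simp: dist_real_def abs_minus_commute)
  define K where "K = c1 + c2 * v powr \<alpha>"
  have K: "0 < K" using c12 by (simp add: K_def add_pos_nonneg)
  have fiK: "fisher_info \<mu> \<Theta> p \<theta> \<le> ennreal K" if "\<theta> \<in> \<Theta>" "\<bar>\<theta> - \<theta>\<^sub>0\<bar> \<le> v" for \<theta>
  proof -
    have "c1 + c2 * \<bar>\<theta> - \<theta>\<^sub>0\<bar> powr \<alpha> \<le> K"
      unfolding K_def using that c12 by (intro add_left_mono mult_left_mono powr_mono2) auto
    then show ?thesis using fi[OF that(1)] by (meson ennreal_leI order_trans)
  qed
  \<comment> \<open>The minimum with 1 keeps 1 - e/2 nonnegative, as required of a bound for the
    affinity.\<close>
  define e where "e = min (c * u\<^sup>2) 1"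
  have e: "0 < e" "e \<le> 1" "e \<le> c * u\<^sup>2" using c uv by (auto simp: e_def)
  have aff: "affinity a \<le> 1 - e / 2" if "a \<in> \<Theta>" "u \<le> \<bar>a - \<theta>\<^sub>0\<bar>" "\<bar>a - \<theta>\<^sub>0\<bar> \<le> v" for a
  proof -
    have "u\<^sup>2 \<le> \<bar>a - \<theta>\<^sub>0\<bar>\<^sup>2" using that uv by (intro power_mono) auto
    then have "c * u\<^sup>2 \<le> c * (a - \<theta>\<^sub>0)\<^sup>2" using c(1) by simp
    then show ?thesis using affinity_hellinger[OF that(1)] c(2)[OF that(1,3)] e(3) by simp
  qed
  obtain N :: nat where N: "(v - u) * (2 * sqrt K) / e < real N" using reals_Archimedean2 by blast
  have "0 \<le> (v - u) * (2 * sqrt K) / e" using uv K e by simp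
  then have N0: "0 < real N" using N by linarith
  define h where "h = (v - u) / real N"
  have h: "0 < h" "h * (sqrt K / 2) \<le> e / 4"
  proof -
    show "0 < h" using uv N0 by (simp add: h_def)
    have "(v - u) * (2 * sqrt K) < real N * e" using N e by (simp add: pos_divide_less_eq)
    then have "(v - u) * (2 * sqrt K) / real N < e" using N0 by (simp add: pos_divide_less_eq mult.commute)
    moreover have "x / y * (z / 2) = (x * (2 * z) / y) / 4" for x y z :: real by simp
    then have "h * (sqrt K / 2) = ((v - u) * (2 * sqrt K) / real N) / 4" unfolding h_def .
    ultimately show "h * (sqrt K / 2) \<le> e / 4" by argo
  qed
  have cell: "far_ok (segment_from \<sigma> u' v')" if uv': "u \<le> u'" "u' \<le> v'" "v' \<le> v" "v' - u' \<le> h" for u' v'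
  proof (rule far_ok_cell)
    show "cell_bound (segment_from \<sigma> u' v') ((1 - e / 2) + (v' - u') * (sqrt K / 2))"
      using uv uv' e by (intro cell_bound_segment[OF \<sigma> _ _ K] fiK aff) auto
    have "(v' - u') * (sqrt K / 2) \<le> h * (sqrt K / 2)" using uv' K by (intro mult_right_mono) auto
    then show "(1 - e / 2) + (v' - u') * (sqrt K / 2) < 1" using h e by linarith
  qed (rule segment_from_subset)
  have "far_ok (segment_from \<sigma> u (u + real k * h))" if "k \<le> N" for k
    using that
  proof (induction k)
    case 0
    show ?case using cell[of u u] uv h by simp
  next
    case (Suc k)
    have "real (Suc k) * h \<le> real N * h" using Suc.prems h by (intro mult_right_mono) auto
    also have "\<dots> = v - u" using N0 by (simp add: h_def)
    finally have le: "u + real (Suc k) * h \<le> v" by simp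
    have next_cell: "far_ok (segment_from \<sigma> (u + real k * h) (u + real (Suc k) * h))"
      using h le by (intro cell) (auto simp: algebra_simps)
    have "far_ok (segment_from \<sigma> u (u + real k * h))" using Suc by simp
    then show ?case
      by (rule far_ok_subset[OF far_ok_Un[OF _ next_cell]]) (auto simp: segment_from_def)
  qed
  from this[of N] show ?thesis using N0 by (simp add: h_def)
qed

text \<open>The means on successive cells decay only like a negative power of j, possibly too slowly
  to be summed. Their \<open>n0\<close>-th powers are summable, and this is enough because the
  failure probability on a cell is their n-th power.\<close>

lemma far_ok_tail:
  assumes \<sigma>: "\<sigma> = 1 \<or> \<sigma> = - 1"
    and c12: "0 < c1" "0 < c2" "0 < \<alpha>"
    and fi: "\<And>\<theta>. \<theta> \<in> \<Theta> \<Longrightarrow> fisher_info \<mu> \<Theta> p \<theta> \<le> ennreal (c1 + c2 * \<bar>\<theta> - \<theta>\<^sub>0\<bar> powr \<alpha>)"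
    and D1: "0 < \<gamma>" "bounded V" "0 < C" "\<And>\<theta>. \<theta> \<in> \<Theta> - V \<Longrightarrow> affinity \<theta> \<le> C * \<bar>\<theta> - \<theta>\<^sub>0\<bar> powr (- \<gamma>)"
  obtains v where "w < v" "far_ok {\<theta>\<in>\<Theta>. v \<le> \<sigma> * (\<theta> - \<theta>\<^sub>0)}"
proof -
  obtain e where e: "0 < e" "V \<subseteq> ball \<theta>\<^sub>0 e" using bounded_subset_ballD[OF D1(2)] by blast
  txt \<open>Cells \<open>[j\<^sup>s, (j + 1)\<^sup>s]\<close>: their length, of order \<open>j\<^sup>s / j\<close>, times the root of the Fisher information,
    of order the square root of \<open>j powr (s * \<alpha>)\<close>, is of order \<open>1 / sqrt j\<close> for this \<open>s\<close>.\<close>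
  define s where "s = 1 / (2 + \<alpha>)"
  have s: "0 < s" "s \<le> 1" "s * \<alpha> \<le> 1" "s * (1 + \<alpha> / 2) = 1 / 2" using c12 by (auto simp: s_def field_simps)
  define b where "b x = x powr s" for x
  \<comment> \<open>The slower of the two decay rates on cell j: \<open>s * \<gamma>\<close> comes
    from the affinity at distance j^s, 1/2 from the length and the Fisher information.\<close>
  define k where "k = min (s * \<gamma>) (1 / 2)"
  have k: "0 < k" "k \<le> s * \<gamma>" "k \<le> 1 / 2" using s D1 by (auto simp: k_def)
  define L where "L = c1 + 2 * c2"
  have L: "0 < L" using c12 by (simp add: L_def)
  define C' where "C' = C + sqrt L / 2"
  have C': "0 < C'" using D1 L by (simp add: C'_def add_pos_pos)
  have cell: "cell_bound (segment_from \<sigma> (b x) (b (x + 1))) (C' * x powr (- k))"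
    if x: "1 \<le> x" "e \<le> b x" for x
  proof -
    have bx: "0 < b x" using x by (simp add: b_def)
    \<comment> \<open>Because s \<le> 1, (1 + 1/x)^s is at most 1 + 1/x.\<close>
    have b1: "b (x + 1) - b x \<le> x powr (s - 1)"
    proof -
      have "b (x + 1) = b x * (1 + 1 / x) powr s"
        using x by (simp add: b_def powr_mult[symmetric] distrib_left)
      also have "(1 + 1 / x) powr s \<le> (1 + 1 / x) powr 1" using s x by (intro powr_mono) auto
      then have "b x * (1 + 1 / x) powr s \<le> b x * (1 + 1 / x)" using x bx by (intro mult_left_mono) auto
      also have "b x * (1 + 1 / x) = b x + x powr (s - 1)" using x by (simp add: b_def powr_diff distrib_left)
      finally show ?thesis by simp
    qed
    have bm: "b x \<le> b (x + 1)" using x s by (auto simp: b_def intro!: powr_mono2)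
    define K where "K = L * x powr (s * \<alpha>)"
    have K: "0 < K" using L x by (simp add: K_def)
    have fiK: "fisher_info \<mu> \<Theta> p \<theta> \<le> ennreal K" if "\<theta> \<in> \<Theta>" "\<bar>\<theta> - \<theta>\<^sub>0\<bar> \<le> b (x + 1)" for \<theta>
    proof -
      have "\<bar>\<theta> - \<theta>\<^sub>0\<bar> powr \<alpha> \<le> b (x + 1) powr \<alpha>" using that c12 by (intro powr_mono2) auto
      also have "\<dots> = (x + 1) powr (s * \<alpha>)" by (simp add: b_def powr_powr)
      also have "\<dots> \<le> (2 * x) powr (s * \<alpha>)" using x s c12 by (intro powr_mono2) auto
      also have "\<dots> = 2 powr (s * \<alpha>) * x powr (s * \<alpha>)" using x by (simp add: powr_mult)
      also have "\<dots> \<le> 2 powr 1 * x powr (s * \<alpha>)" using s by (intro mult_right_mono powr_mono) auto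
      finally have 1: "c2 * \<bar>\<theta> - \<theta>\<^sub>0\<bar> powr \<alpha> \<le> c2 * (2 * x powr (s * \<alpha>))" using c12 by (intro mult_left_mono) auto
      have "1 \<le> x powr (s * \<alpha>)" using x s c12 by (intro ge_one_powr_ge_zero) auto
      then have "c1 * 1 \<le> c1 * x powr (s * \<alpha>)" using c12 by (intro mult_left_mono) auto
      then have "c1 + c2 * \<bar>\<theta> - \<theta>\<^sub>0\<bar> powr \<alpha> \<le> K" using 1 by (simp add: K_def L_def algebra_simps)
      then show ?thesis using fi[OF that(1)] by (meson ennreal_leI order_trans)
    qed
    have aff: "affinity a \<le> C * b x powr (- \<gamma>)" if "a \<in> \<Theta>" "\<bar>a - \<theta>\<^sub>0\<bar> = b x" for a
    proof -
      have "a \<notin> V" using e(2) x(2) that(2) by (auto simp: dist_real_def abs_minus_commute subset_iff)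
      then show ?thesis using D1(4)[of a] that by simp
    qed
    have "cell_bound (segment_from \<sigma> (b x) (b (x + 1))) (C * b x powr (- \<gamma>) + (b (x + 1) - b x) * (sqrt K / 2))"
      using bx bm D1 by (intro cell_bound_segment[OF \<sigma> _ _ K] fiK aff) auto
    moreover have "C * b x powr (- \<gamma>) + (b (x + 1) - b x) * (sqrt K / 2) \<le> C' * x powr (- k)"
    proof -
      have "b x powr (- \<gamma>) = x powr (- (s * \<gamma>))" by (simp add: b_def powr_powr)
      also have "\<dots> \<le> x powr (- k)" using x k by (intro powr_mono) auto
      finally have 1: "C * b x powr (- \<gamma>) \<le> C * x powr (- k)" using D1 by (intro mult_left_mono) auto
      have "sqrt (x powr (s * \<alpha>)) = x powr (s * \<alpha> / 2)" using x by (simp add: powr_half_sqrt[symmetric] powr_powr)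
      then have "(b (x + 1) - b x) * (sqrt K / 2) = sqrt L / 2 * ((b (x + 1) - b x) * x powr (s * \<alpha> / 2))"
        by (simp add: K_def real_sqrt_mult)
      also have "\<dots> \<le> sqrt L / 2 * (x powr (s - 1) * x powr (s * \<alpha> / 2))"
        using b1 L by (intro mult_left_mono mult_right_mono) auto
      also have "x powr (s - 1) * x powr (s * \<alpha> / 2) = x powr (s * (1 + \<alpha> / 2) - 1)"
        by (simp add: powr_add[symmetric] algebra_simps)
      also have "\<dots> = x powr (- (1 / 2))" unfolding s(4) by simp
      also have "sqrt L / 2 * x powr (- (1 / 2)) \<le> sqrt L / 2 * x powr (- k)"
        using x k L by (intro mult_left_mono powr_mono) auto
      finally show ?thesis using 1 by (simp add: C'_def distrib_right)
    qed
    ultimately show ?thesis by (rule cell_bound_mono)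
  qed
  define y where "y = max e (\<bar>w\<bar> + 1)"
  have y: "0 < y" "e \<le> y" "w < y" using e by (auto simp: y_def)
  \<comment> \<open>The first cell lies so far out that it is outside \<open>V\<close> and beyond
    \<open>w\<close>; the last entry makes every mean at most 1/2.\<close>
  define J where "J = nat \<lceil>max 1 (max (y powr (1 / s)) ((2 * C') powr (1 / k)))\<rceil>"
  have J: "1 \<le> real J" "y powr (1 / s) \<le> real J" "(2 * C') powr (1 / k) \<le> real J"
    unfolding J_def by linarith+
  have bJ: "y \<le> b (real J)" unfolding b_def using y s J by (intro powr_ge_of_root) auto
  have bmono: "b x \<le> b x'" if "0 \<le> x" "x \<le> x'" for x x' using that s by (auto simp: b_def intro!: powr_mono2)
  define \<beta> where "\<beta> j = C' * real (J + j) powr (- k)" for j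
  \<comment> \<open>With k n0 > 2 the \<open>n0\<close>-th powers are O(j^(-2)). The comparison with
    \<open>Suc j\<close> below uses J \<ge> 1.\<close>
  obtain n0 :: nat where n0: "2 / k < real n0" using reals_Archimedean2 by blast
  have "far_ok (\<Union>j. segment_from \<sigma> (b (real (J + j))) (b (real (J + j) + 1)))"
  proof (rule far_ok_countable[where \<beta> = \<beta> and q = "1 / 2" and ?n0.0 = n0])
    show "cell_bound (segment_from \<sigma> (b (real (J + j))) (b (real (J + j) + 1))) (\<beta> j)" for j
      unfolding \<beta>_def using J bJ y bmono[of "real J" "real (J + j)"] by (intro cell) auto
    show "\<beta> j \<le> 1 / 2" for j
    proof -
      have "2 * C' \<le> real (J + j) powr k" using J C' k by (intro powr_ge_of_root) auto
      then have "C' \<le> 1 / 2 * real (J + j) powr k" by simp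
      then show ?thesis using J by (simp add: \<beta>_def powr_minus divide_simps)
    qed
    show "summable (\<lambda>j. \<beta> j ^ n0)"
    proof (rule summable_comparison_test'[where N = 0])
      show "summable (\<lambda>j. C' ^ n0 * (1 / real (Suc j) ^ 2))"
        using inverse_power_summable[of 2, where 'a = real] by (intro summable_mult) (subst summable_Suc_iff, simp add: inverse_eq_divide)
      fix j :: nat
      have "0 < real (J + j) powr (- k)" using J(1) by (subst powr_gt_zero) linarith
      then have "(real (J + j) powr (- k)) ^ n0 = (real (J + j) powr (- k)) powr real n0"
        by (rule powr_realpow[symmetric])
      also have "\<dots> = real (J + j) powr (- k * real n0)" by (rule powr_powr)
      also have "\<dots> \<le> real (J + j) powr (- 2)"
        using J n0 k by (intro powr_mono) (auto simp: pos_divide_less_eq mult.commute)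
      also have "\<dots> \<le> real (Suc j) powr (- 2)" using J by (intro powr_mono2') auto
      also have "\<dots> = 1 / real (Suc j) ^ 2" by (simp add: powr_minus powr_numeral inverse_eq_divide)
      finally have "C' ^ n0 * (real (J + j) powr (- k)) ^ n0 \<le> C' ^ n0 * (1 / real (Suc j) ^ 2)"
        using C' by (intro mult_left_mono) auto
      moreover have "norm (\<beta> j ^ n0) = C' ^ n0 * (real (J + j) powr (- k)) ^ n0"
        using C' by (simp add: \<beta>_def power_mult_distrib abs_mult)
      ultimately show "norm (\<beta> j ^ n0) \<le> C' ^ n0 * (1 / real (Suc j) ^ 2)" by (simp only:)
    qed
  qed (auto intro: segment_from_subset[THEN subsetD])
  then have "far_ok {\<theta>\<in>\<Theta>. b (real J) \<le> \<sigma> * (\<theta> - \<theta>\<^sub>0)}"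
  proof (rule far_ok_subset, intro subsetI)
    fix \<theta> assume "\<theta> \<in> {\<theta>\<in>\<Theta>. b (real J) \<le> \<sigma> * (\<theta> - \<theta>\<^sub>0)}"
    then have \<theta>: "\<theta> \<in> \<Theta>" "b (real J) \<le> \<sigma> * (\<theta> - \<theta>\<^sub>0)" by auto
    define t where "t = \<sigma> * (\<theta> - \<theta>\<^sub>0)"
    have t: "0 < t" using \<theta>(2) bJ y by (simp add: t_def)
    define x where "x = t powr (1 / s)"
    have bx: "b x = t" using t s by (simp add: b_def x_def powr_powr)
    have "real J = b (real J) powr (1 / s)" using J s by (simp add: b_def powr_powr)
    also have "\<dots> \<le> x" unfolding x_def using \<theta>(2) bJ y s by (intro powr_mono2) (auto simp: t_def)
    finally have Jx: "real J \<le> x" .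
    define m where "m = nat \<lfloor>x\<rfloor>"
    have m: "real m \<le> x" "x \<le> real m + 1" "J \<le> m" using Jx unfolding m_def by linarith+
    have "b (real m) \<le> t" "t \<le> b (real m + 1)" using bmono[OF _ m(1)] bmono[OF _ m(2)] bx Jx J by auto
    then have "\<theta> \<in> segment_from \<sigma> (b (real (J + (m - J)))) (b (real (J + (m - J)) + 1))"
      using m \<theta> by (simp add: segment_from_def t_def)
    then show "\<theta> \<in> (\<Union>j. segment_from \<sigma> (b (real (J + j))) (b (real (J + j) + 1)))" by blast
  qed
  moreover have "w < b (real J)" using bJ y by simp
  ultimately show thesis using that by blast
qed

lemma far_controlled_hellinger:
  assumes d: "0 < d"
    and c12: "0 < c1" "0 < c2" "0 < \<alpha>"
    and fi: "\<And>\<theta>. \<theta> \<in> \<Theta> \<Longrightarrow> fisher_info \<mu> \<Theta> p \<theta> \<le> ennreal (c1 + c2 * \<bar>\<theta> - \<theta>\<^sub>0\<bar> powr \<alpha>)"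
    and D0: "\<And>U. bounded U \<Longrightarrow> \<theta>\<^sub>0 \<in> interior U \<Longrightarrow> \<exists>c>0. \<forall>\<theta>\<in>U \<inter> \<Theta>. c * (\<theta> - \<theta>\<^sub>0)\<^sup>2 \<le> hellinger_sq \<mu> p \<theta> \<theta>\<^sub>0"
    and D1: "0 < \<gamma>" "bounded V" "0 < C" "\<And>\<theta>. \<theta> \<in> \<Theta> - V \<Longrightarrow> affinity \<theta> \<le> C * \<bar>\<theta> - \<theta>\<^sub>0\<bar> powr (- \<gamma>)"
  shows "far_controlled d"
proof -
  have side: "far_ok {\<theta>\<in>\<Theta>. d / 2 \<le> \<sigma> * (\<theta> - \<theta>\<^sub>0)}" if \<sigma>: "\<sigma> = 1 \<or> \<sigma> = - 1" for \<sigma>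
  proof -
    obtain v where v: "d / 2 < v" "far_ok {\<theta>\<in>\<Theta>. v \<le> \<sigma> * (\<theta> - \<theta>\<^sub>0)}"
      using far_ok_tail[OF \<sigma> c12 fi D1] by metis
    have "far_ok (segment_from \<sigma> (d / 2) v)"
      using d v by (intro far_ok_bounded_segment[OF \<sigma> _ _ c12 fi D0]) auto
    from far_ok_Un[OF this v(2)] show ?thesis
      by (rule far_ok_subset) (auto simp: segment_from_def)
  qed
  have "far_ok ({\<theta>\<in>\<Theta>. d / 2 \<le> 1 * (\<theta> - \<theta>\<^sub>0)} \<union> {\<theta>\<in>\<Theta>. d / 2 \<le> - 1 * (\<theta> - \<theta>\<^sub>0)})"
    by (intro far_ok_Un side) auto
  then have "far_ok {\<theta>\<in>\<Theta>. d / 2 < \<bar>\<theta> - \<theta>\<^sub>0\<bar>}"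
    by (rule far_ok_subset) (auto simp: abs_if split: if_splits)
  then obtain C where C: "\<And>n. 1 \<le> n \<Longrightarrow> \<exists>B\<in>sets M. prob B \<le> C / (real n)\<^sup>2 \<and> (\<forall>w\<in>space M - B. (\<forall>i. X i w \<in> A) \<longrightarrow>
    (\<forall>\<theta>\<in>{\<theta>\<in>\<Theta>. d / 2 < \<bar>\<theta> - \<theta>\<^sub>0\<bar>}. likelihood p n (\<lambda>i. X i w) \<theta> \<le> likelihood p n (\<lambda>i. X i w) \<theta>\<^sub>0 / 4))"
    unfolding far_ok_def by blast
  show ?thesis
    unfolding far_controlled_def
  proof (rule exI[of _ C], intro allI impI)
    fix n :: nat assume "1 \<le> n"
    then obtain B where B: "B \<in> sets M" "prob B \<le> C / (real n)\<^sup>2" "\<forall>w\<in>space M - B. (\<forall>i. X i w \<in> A) \<longrightarrow>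
      (\<forall>\<theta>\<in>{\<theta>\<in>\<Theta>. d / 2 < \<bar>\<theta> - \<theta>\<^sub>0\<bar>}. likelihood p n (\<lambda>i. X i w) \<theta> \<le> likelihood p n (\<lambda>i. X i w) \<theta>\<^sub>0 / 4)"
      using C by blast
    have "\<exists>c. \<exists>a\<in>\<Theta>. c < likelihood p n (\<lambda>i. X i w) a \<and>
       (\<forall>\<theta>\<in>\<Theta>. d / 2 < \<bar>\<theta> - \<theta>\<^sub>0\<bar> \<longrightarrow> likelihood p n (\<lambda>i. X i w) \<theta> \<le> c)"
      if w: "w \<in> space M - B" and reg: "regular_sample d n w" for w
    proof -
      have A: "\<And>i. X i w \<in> A" using reg by (auto simp: regular_sample_def)
      have "0 < likelihood p n (\<lambda>i. X i w) \<theta>\<^sub>0" using likelihood_eq_exp[OF A, of 0 n] \<delta>_pos by simp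
      then show ?thesis using B(3) w A \<theta>\<^sub>0_mem
        by (intro exI[of _ "likelihood p n (\<lambda>i. X i w) \<theta>\<^sub>0 / 4"] bexI[of _ \<theta>\<^sub>0]) auto
    qed
    then show "\<exists>B\<in>sets M. prob B \<le> C / (real n)\<^sup>2 \<and> (\<forall>w\<in>space M - B. regular_sample d n w \<longrightarrow>
       (\<exists>c. \<exists>a\<in>\<Theta>. c < likelihood p n (\<lambda>i. X i w) a \<and>
         (\<forall>\<theta>\<in>\<Theta>. d / 2 < \<bar>\<theta> - \<theta>\<^sub>0\<bar> \<longrightarrow> likelihood p n (\<lambda>i. X i w) \<theta> \<le> c)))"
      using B by blast
  qed
qed

end

section \<open>Regularity of the log-likelihood\<close>

lemma differentiable_imp_deriv_within:
  fixes g :: "real \<Rightarrow> real"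
  assumes "g differentiable (at y within S)" "y \<in> interior S"
  shows "(g has_real_derivative deriv_within S g y) (at y)"
proof -
  obtain d where d: "(g has_real_derivative d) (at y)"
    using assms(1) unfolding at_within_interior[OF assms(2)] real_differentiable_def by blast
  show ?thesis using d unfolding deriv_within_interior[OF d assms(2)] .
qed

text \<open>To be differentiated again, a derivative must be identified on a neighbourhood and not
  just at a point. A property that holds near \<theta> also holds near every point close to
  \<theta>, which makes the iteration possible.\<close>

lemma deriv_within_eventually:
  assumes g: "eventually (\<lambda>y. (g has_real_derivative h y) (at y)) (nhds \<theta>)"
    and l: "eventually (\<lambda>y. l y = g y) (nhds \<theta>)" and \<theta>: "\<theta> \<in> interior S"
  shows "eventually (\<lambda>y. deriv_within S l y = h y) (nhds \<theta>)"
    and "(g has_real_derivative deriv_within S l \<theta>) (at \<theta>)"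
proof -
  have "eventually (\<lambda>y. y \<in> interior S) (nhds \<theta>)" using \<theta> by (intro eventually_nhds_in_open) auto
  moreover have "eventually (\<lambda>y. eventually (\<lambda>y'. l y' = g y') (nhds y)) (nhds \<theta>)"
    using l by (simp only: eventually_eventually)
  ultimately show ev: "eventually (\<lambda>y. deriv_within S l y = h y) (nhds \<theta>)"
    using g
  proof eventually_elim
    case (elim y)
    have "(l has_real_derivative h y) (at y)"
      using elim(3) DERIV_cong_ev[OF refl elim(2) refl] by blast
    then show ?case using elim(1) by (rule deriv_within_interior)
  qed
  show "(g has_real_derivative deriv_within S l \<theta>) (at \<theta>)"
    using eventually_nhds_x_imp_x[OF ev] eventually_nhds_x_imp_x[OF g] by simp
qed

lemma loglik_deriv_Suc: "loglik_deriv (Suc k) \<Theta> p x = deriv_within \<Theta> (loglik_deriv k \<Theta> p x)"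
  by (simp add: loglik_deriv_def)

text \<open>The quotient formulas for the first two derivatives hold near \<theta>. The second
  derivative of the density is differentiable at \<theta> itself only, so the third derivative is
  obtained at this single point.\<close>

lemma loglik_derivs:
  assumes td: "times_differentiable_within \<Theta> 3 (\<lambda>t. p t x) \<theta>" and pos: "0 < p \<theta> x" and \<theta>: "\<theta> \<in> interior \<Theta>"
  shows "((\<lambda>t. ln (p t x)) has_real_derivative loglik_deriv 1 \<Theta> p x \<theta>) (at \<theta>)"
    and "(loglik_deriv 1 \<Theta> p x has_real_derivative loglik_deriv 2 \<Theta> p x \<theta>) (at \<theta>)"
    and "(loglik_deriv 2 \<Theta> p x has_real_derivative loglik_deriv 3 \<Theta> p x \<theta>) (at \<theta>)"
proof -
  define f where "f t = p t x" for t
  define f1 where "f1 = deriv_within \<Theta> f"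
  define f2 where "f2 = deriv_within \<Theta> f1"
  have td': "eventually (\<lambda>y. y \<in> \<Theta> \<longrightarrow> f differentiable (at y within \<Theta>)) (nhds \<theta>)"
    "eventually (\<lambda>y. y \<in> \<Theta> \<longrightarrow> f1 differentiable (at y within \<Theta>)) (nhds \<theta>)"
    "f2 differentiable (at \<theta> within \<Theta>)"
    using td by (simp_all add: numeral_3_eq_3 f_def[abs_def] f1_def f2_def)
  have int: "eventually (\<lambda>y. y \<in> interior \<Theta>) (nhds \<theta>)" using \<theta> by (intro eventually_nhds_in_open) auto
  have d0: "eventually (\<lambda>y. (f has_real_derivative f1 y) (at y)) (nhds \<theta>)"
    using td'(1) int
  proof eventually_elim
    case (elim y)
    then show ?case unfolding f1_def using interior_subset by (intro differentiable_imp_deriv_within) auto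
  qed
  have d1: "eventually (\<lambda>y. (f1 has_real_derivative f2 y) (at y)) (nhds \<theta>)"
    using td'(2) int
  proof eventually_elim
    case (elim y)
    then show ?case unfolding f2_def using interior_subset by (intro differentiable_imp_deriv_within) auto
  qed
  define f3 where "f3 = deriv_within \<Theta> f2 \<theta>"
  have d2: "(f2 has_real_derivative f3) (at \<theta>)"
    unfolding f3_def by (rule differentiable_imp_deriv_within[OF td'(3) \<theta>])
  have "(f \<longlongrightarrow> f \<theta>) (nhds \<theta>)"
    using DERIV_isCont[OF eventually_nhds_x_imp_x[OF d0]] by (simp only: isCont_def tendsto_at_iff_tendsto_nhds[of f \<theta>])
  moreover have f0: "0 < f \<theta>" using pos by (simp add: f_def)
  ultimately have fpos: "eventually (\<lambda>y. 0 < f y) (nhds \<theta>)" by (rule order_tendstoD)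
  have c0: "eventually (\<lambda>y. loglik_deriv 0 \<Theta> p x y = ln (f y)) (nhds \<theta>)"
    using fpos by eventually_elim (simp add: loglik_deriv_def loglik_def f_def)
  have g0: "eventually (\<lambda>y. ((\<lambda>y. ln (f y)) has_real_derivative f1 y / f y) (at y)) (nhds \<theta>)"
    using d0 fpos by eventually_elim (auto intro!: derivative_eq_intros)
  have l1: "eventually (\<lambda>y. loglik_deriv 1 \<Theta> p x y = f1 y / f y) (nhds \<theta>)"
    and l1': "((\<lambda>y. ln (f y)) has_real_derivative loglik_deriv 1 \<Theta> p x \<theta>) (at \<theta>)"
    using deriv_within_eventually[OF g0 c0 \<theta>] by (simp_all only: One_nat_def loglik_deriv_Suc)
  show "((\<lambda>t. ln (p t x)) has_real_derivative loglik_deriv 1 \<Theta> p x \<theta>) (at \<theta>)" using l1' by (simp only: f_def)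
  define h where "h y = (f2 y * f y - f1 y * f1 y) / (f y * f y)" for y
  have g1: "eventually (\<lambda>y. ((\<lambda>y. f1 y / f y) has_real_derivative h y) (at y)) (nhds \<theta>)"
    using d0 d1 fpos by eventually_elim (auto intro!: derivative_eq_intros simp: h_def)
  have l2: "eventually (\<lambda>y. loglik_deriv 2 \<Theta> p x y = h y) (nhds \<theta>)"
    and l2': "((\<lambda>y. f1 y / f y) has_real_derivative loglik_deriv 2 \<Theta> p x \<theta>) (at \<theta>)"
    using deriv_within_eventually[OF g1 l1 \<theta>] by (simp_all only: numeral_2_eq_2 One_nat_def loglik_deriv_Suc[of "Suc 0"])
  show "(loglik_deriv 1 \<Theta> p x has_real_derivative loglik_deriv 2 \<Theta> p x \<theta>) (at \<theta>)"
    using l2' DERIV_cong_ev[OF refl l1 refl] by blast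
  obtain e where "(h has_real_derivative e) (at \<theta>)"
  proof -
    have "((\<lambda>y. (f2 y * f y - f1 y * f1 y) / (f y * f y)) has_real_derivative
      ((f3 * f \<theta> + f1 \<theta> * f2 \<theta> - (f2 \<theta> * f1 \<theta> + f2 \<theta> * f1 \<theta>)) * (f \<theta> * f \<theta>)
        - (f2 \<theta> * f \<theta> - f1 \<theta> * f1 \<theta>) * (f1 \<theta> * f \<theta> + f1 \<theta> * f \<theta>)) / ((f \<theta> * f \<theta>) * (f \<theta> * f \<theta>))) (at \<theta>)"
      using d2 eventually_nhds_x_imp_x[OF d0] eventually_nhds_x_imp_x[OF d1] f0
      by (intro DERIV_divide DERIV_diff DERIV_mult) auto
    then show thesis using that unfolding h_def[abs_def] by blast
  qed
  then have "(loglik_deriv 2 \<Theta> p x has_real_derivative e) (at \<theta>)"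
    using DERIV_cong_ev[OF refl l2 refl] by blast
  then show "(loglik_deriv 2 \<Theta> p x has_real_derivative loglik_deriv 3 \<Theta> p x \<theta>) (at \<theta>)"
    using deriv_within_interior[OF _ \<theta>] unfolding numeral_3_eq_3 loglik_deriv_Suc[of "Suc (Suc 0)"] numeral_2_eq_2 by metis
qed

text \<open>A pointwise limit of measurable difference quotients; iterating it passes from the
  density to the first and then to the second derivative of the log-likelihood.\<close>

lemma measurable_parameter_derivative:
  fixes g g' :: "'x \<Rightarrow> real \<Rightarrow> real" and \<delta> :: real
  assumes \<delta>: "0 < \<delta>" and S: "S \<in> sets N"
    and g: "\<And>\<theta>. \<theta> \<in> {\<theta>\<^sub>0 - \<delta> .. \<theta>\<^sub>0 + \<delta>} \<Longrightarrow> (\<lambda>x. indicator S x * g x \<theta>) \<in> borel_measurable N"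
    and d: "\<And>x \<theta>. x \<in> S \<Longrightarrow> \<theta> \<in> {\<theta>\<^sub>0 - \<delta> .. \<theta>\<^sub>0 + \<delta>} \<Longrightarrow> (g x has_real_derivative g' x \<theta>) (at \<theta>)"
    and \<theta>: "\<theta> \<in> {\<theta>\<^sub>0 - \<delta> .. \<theta>\<^sub>0 + \<delta>}"
  shows "(\<lambda>x. indicator S x * g' x \<theta>) \<in> borel_measurable N"
proof (rule borel_measurable_LIMSEQ_real)
  \<comment> \<open>The steps point towards the centre, so that \<theta> + h stays in the closed
    interval on which \<open>g\<close> is known to be measurable.\<close>
  define c where "c = (if \<theta> \<le> \<theta>\<^sub>0 then \<delta> else - \<delta>)"
  define h where "h n = c * inverse (real (Suc n))" for n
  have h0: "h n \<noteq> 0" for n using \<delta> by (simp add: h_def c_def)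
  have hJ: "\<theta> + h n \<in> {\<theta>\<^sub>0 - \<delta> .. \<theta>\<^sub>0 + \<delta>}" for n
  proof -
    define r where "r = \<delta> * inverse (real (Suc n))"
    have "inverse (real (Suc n)) \<le> 1" "0 \<le> inverse (real (Suc n))" by (auto simp: inverse_le_1_iff)
    then have "r \<le> \<delta> * 1" "0 \<le> r"
      unfolding r_def using \<delta> by (intro mult_left_mono mult_nonneg_nonneg; simp)+
    moreover have "h n = (if \<theta> \<le> \<theta>\<^sub>0 then r else - r)" by (simp add: h_def c_def r_def)
    ultimately show ?thesis using \<theta> by auto
  qed
  have hlim: "filterlim h (at 0) sequentially"
  proof -
    have "h \<longlonglongrightarrow> c * 0" unfolding h_def by (intro tendsto_mult tendsto_const LIMSEQ_inverse_real_of_nat)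
    then show ?thesis using h0 by (auto simp: filterlim_at intro!: always_eventually)
  qed
  define f where "f n x = (indicator S x * g x (\<theta> + h n) - indicator S x * g x \<theta>) / h n" for n x
  note [measurable] = g[OF hJ] g[OF \<theta>]
  show "f n \<in> borel_measurable N" for n unfolding f_def by measurable
  fix x
  show "(\<lambda>n. f n x) \<longlonglongrightarrow> indicator S x * g' x \<theta>"
  proof (cases "x \<in> S")
    case True
    have "((\<lambda>t. (g x (\<theta> + t) - g x \<theta>) / t) \<longlongrightarrow> g' x \<theta>) (at 0)" using d[OF True \<theta>] by (simp add: DERIV_def)
    from filterlim_compose[OF this hlim] show ?thesis using True by (simp add: f_def)
  qed (simp add: f_def)
qed

text \<open>Carries an inequality from countably many parameters, where measurable suprema are
  available, to all of them. The condition u < v provides rationals near each point, endpoints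
  included.\<close>

lemma continuous_nonneg_on_rationals:
  fixes g :: "real \<Rightarrow> real"
  assumes uv: "u < v" and cont: "continuous_on {u..v} g" and r: "\<And>q. q \<in> \<rat> \<Longrightarrow> q \<in> {u..v} \<Longrightarrow> 0 \<le> g q"
    and a: "a \<in> {u..v}"
  shows "0 \<le> g a"
proof (rule ccontr)
  assume "\<not> 0 \<le> g a"
  then have ga: "0 < - g a" by simp
  obtain d where d: "0 < d" "\<And>y. y \<in> {u..v} \<Longrightarrow> \<bar>y - a\<bar> < d \<Longrightarrow> \<bar>g y - g a\<bar> < - g a"
    using cont a ga unfolding continuous_on_iff dist_real_def by meson
  have "max u (a - d) < min v (a + d)" using uv a d(1) by auto
  then obtain q where q: "q \<in> \<rat>" "max u (a - d) < q" "q < min v (a + d)" using Rats_dense_in_real by blast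
  then have "q \<in> {u..v}" "\<bar>q - a\<bar> < d" by auto
  then show False using d(2)[of q] r[OF q(1)] by auto
qed

lemma (in prob_space) indep_vars_cong_sets:
  assumes "indep_vars M' X S" "\<And>i. i \<in> S \<Longrightarrow> sets (N' i) = sets (M' i)"
  shows "indep_vars N' X S"
proof -
  have "measurable M (N' i) = measurable M (M' i)" if "i \<in> S" for i
    using assms(2)[OF that] by (intro measurable_cong_sets) auto
  then show ?thesis using assms unfolding indep_vars_def2 by (simp cong: indep_sets_cong)
qed

lemma nn_integral_restrict_density:
  assumes S: "S \<in> sets N"
  shows "(\<integral>\<^sup>+x. f x \<partial>restrict_space N S) = (\<integral>\<^sup>+x. f x * indicator S x \<partial>N)"
  using S by (intro nn_integral_restrict_space) auto

theorem theorem7p1: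
  fixes M :: "'w measure" and \<mu> :: "'x measure"
    and \<Theta> :: "real set" and P :: "real \<Rightarrow> 'w measure"
    and X :: "nat \<Rightarrow> 'w \<Rightarrow> 'x" (* X 0 is the generic observation, X 1, X 2, ... the sample *)
    and p :: "real \<Rightarrow> 'x \<Rightarrow> real"
    and \<theta>\<^sub>0 \<delta> :: real
    and \<theta>hat :: "nat \<Rightarrow> (nat \<Rightarrow> 'x) \<Rightarrow> ereal"
  assumes prob: "\<And>\<theta>. \<theta> \<in> \<Theta> \<Longrightarrow> prob_space (P \<theta>)"
    and sets_P: "\<And>\<theta>. \<theta> \<in> \<Theta> \<Longrightarrow> sets (P \<theta>) = sets M"
    and meas_X: "\<And>i. X i \<in> M \<rightarrow>\<^sub>M \<mu>"
    and indep: "\<And>\<theta>. \<theta> \<in> \<Theta> \<Longrightarrow> prob_space.indep_vars (P \<theta>) (\<lambda>_. \<mu>) X UNIV"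
    and ident: "\<And>\<theta> i. \<theta> \<in> \<Theta> \<Longrightarrow> distr (P \<theta>) \<mu> (X i) = distr (P \<theta>) \<mu> (X 0)"
    and p_nonneg: "\<And>\<theta> x. \<theta> \<in> \<Theta> \<Longrightarrow> x \<in> space \<mu> \<Longrightarrow> 0 \<le> p \<theta> x"
    and dens: "\<And>\<theta>. \<theta> \<in> \<Theta> \<Longrightarrow> distributed (P \<theta>) \<mu> (X 0) (\<lambda>x. ennreal (p \<theta> x))"
    and \<theta>\<^sub>0: "\<theta>\<^sub>0 \<in> \<Theta>"
    and \<delta>: "\<delta> > 0" "{\<theta>\<^sub>0 - \<delta> .. \<theta>\<^sub>0 + \<delta>} \<subseteq> interior \<Theta>"
    and MLE: "\<And>n. n \<ge> 1 \<Longrightarrow> is_MLE \<mu> \<Theta> p n (\<theta>hat n)"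
    and I_pos: "\<And>\<theta>. \<theta> \<in> {\<theta>\<^sub>0 - \<delta> .. \<theta>\<^sub>0 + \<delta>} \<Longrightarrow>
        positivity_set \<mu> p \<theta> = positivity_set \<mu> p \<theta>\<^sub>0"
    and I_diff: "\<And>x \<theta>. x \<in> positivity_set \<mu> p \<theta>\<^sub>0 \<Longrightarrow> \<theta> \<in> {\<theta>\<^sub>0 - \<delta> .. \<theta>\<^sub>0 + \<delta>} \<Longrightarrow>
        times_differentiable_within \<Theta> 3 (\<lambda>t. p t x) \<theta>"
    and II_mean: "has_bochner_integral (obs_law \<mu> p \<theta>\<^sub>0) (\<lambda>x. loglik_deriv 1 \<Theta> p x \<theta>\<^sub>0) 0"
    and II_var: "(\<integral>\<^sup>+x. ennreal ((loglik_deriv 1 \<Theta> p x \<theta>\<^sub>0)\<^sup>2) \<partial>obs_law \<mu> p \<theta>\<^sub>0)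
        = fisher_info \<mu> \<Theta> p \<theta>\<^sub>0"
    and II_hess: "has_bochner_integral (obs_law \<mu> p \<theta>\<^sub>0) (\<lambda>x. loglik_deriv 2 \<Theta> p x \<theta>\<^sub>0)
        (- enn2real (fisher_info \<mu> \<Theta> p \<theta>\<^sub>0))"
    and II_pos: "0 < fisher_info \<mu> \<Theta> p \<theta>\<^sub>0" "fisher_info \<mu> \<Theta> p \<theta>\<^sub>0 < \<infinity>"
    and III: "(\<integral>\<^sup>+x. ennreal (\<bar>loglik_deriv 1 \<Theta> p x \<theta>\<^sub>0\<bar> ^ 3) \<partial>obs_law \<mu> p \<theta>\<^sub>0)
        + (\<integral>\<^sup>+x. ennreal (\<bar>loglik_deriv 2 \<Theta> p x \<theta>\<^sub>0\<bar> ^ 3) \<partial>obs_law \<mu> p \<theta>\<^sub>0) < \<infinity>"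
    and IV: "(\<integral>\<^sup>+x. (SUP \<theta>\<in>{\<theta>\<^sub>0 - \<delta> .. \<theta>\<^sub>0 + \<delta>}. ennreal (\<bar>loglik_deriv 3 \<Theta> p x \<theta>\<bar> ^ 3))
        \<partial>obs_law \<mu> p \<theta>\<^sub>0) < \<infinity>"
    and alternatives:
      "(\<forall>x\<in>space \<mu>. ereal_concave_on \<Theta> (loglik p x)) \<or>
       (is_interval \<Theta> \<and> fisher_info_well_defined \<mu> \<Theta> p \<and>
        (\<exists>c\<^sub>1>0. \<exists>c\<^sub>2>0. \<exists>\<alpha>>0. \<forall>\<theta>\<in>\<Theta>.
           fisher_info \<mu> \<Theta> p \<theta> \<le> ennreal (c\<^sub>1 + c\<^sub>2 * \<bar>\<theta> - \<theta>\<^sub>0\<bar> powr \<alpha>)) \<and>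
        (\<forall>U. bounded U \<and> \<theta>\<^sub>0 \<in> interior U \<longrightarrow>
           (\<exists>c>0. \<forall>\<theta>\<in>U \<inter> \<Theta>. hellinger_sq \<mu> p \<theta> \<theta>\<^sub>0 \<ge> c * (\<theta> - \<theta>\<^sub>0)\<^sup>2)) \<and>
        (\<exists>\<gamma>>0. \<exists>V. bounded V \<and> \<theta>\<^sub>0 \<in> interior V \<and>
           (\<exists>C>0. \<forall>\<theta>\<in>\<Theta> - V.
              (\<integral>x. sqrt (p \<theta> x) * sqrt (p \<theta>\<^sub>0 x) \<partial>\<mu>) \<le> C * \<bar>\<theta> - \<theta>\<^sub>0\<bar> powr (- \<gamma>))))"
  defines "E \<equiv> \<lambda>n z. {w \<in> space M.
      ereal (sqrt (real n * enn2real (fisher_info \<mu> \<Theta> p \<theta>\<^sub>0))) *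
        (\<theta>hat n (\<lambda>i\<in>{1..n}. X i w) - ereal \<theta>\<^sub>0) \<le> ereal z}"
  shows "\<forall>Q \<in> {outer_measure_of (P \<theta>\<^sub>0), inner_measure_of (P \<theta>\<^sub>0)}.
      (\<exists>C>0. \<forall>n\<ge>1. \<forall>z.
         \<bar>enn2real (Q (E n z)) - cdf std_normal_distribution z\<bar> \<le> C / sqrt (real n)) \<and>
      (\<forall>\<omega>>0. \<exists>C>0. \<forall>n\<ge>1. \<forall>z. 0 < z \<and> z \<le> \<omega> * sqrt (real n) \<longrightarrow>
         \<bar>enn2real (Q (E n z)) - cdf std_normal_distribution z\<bar> \<le> C / (z ^ 3 * sqrt (real n)))"
proof -
  define N where "N = P \<theta>\<^sub>0"
  define I where "I = enn2real (fisher_info \<mu> \<Theta> p \<theta>\<^sub>0)"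
  have I: "0 < I" "fisher_info \<mu> \<Theta> p \<theta>\<^sub>0 = ennreal I"
    using II_pos by (auto simp: I_def enn2real_positive_iff less_top)
  interpret N: prob_space N unfolding N_def by (rule prob[OF \<theta>\<^sub>0])
  have space_N: "space N = space M"
    using sets_eq_imp_space_eq[OF sets_P[OF \<theta>\<^sub>0]] by (simp add: N_def)
  define D where "D = density \<mu> (\<lambda>x. ennreal (p \<theta>\<^sub>0 x))"
  have sets_D[measurable_cong]: "sets D = sets \<mu>" and space_D: "space D = space \<mu>" by (auto simp: D_def)
  have dens_distr: "distr (P \<theta>) \<mu> (X 0) = density \<mu> (\<lambda>x. ennreal (p \<theta> x))"
    and p_meas_enn: "(\<lambda>x. ennreal (p \<theta> x)) \<in> borel_measurable \<mu>" if "\<theta> \<in> \<Theta>" for \<theta>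
    using dens[OF that] by (auto simp: distributed_def)
  have p_meas: "p \<theta> \<in> borel_measurable \<mu>" if "\<theta> \<in> \<Theta>" for \<theta>
  proof -
    have "(\<lambda>x. enn2real (ennreal (p \<theta> x))) \<in> borel_measurable \<mu>" using p_meas_enn[OF that] by measurable
    then show ?thesis using p_nonneg[OF that] by (subst (asm) measurable_cong[where g = "p \<theta>"]) auto
  qed
  have XP: "X i \<in> measurable (P \<theta>) \<mu>" if "\<theta> \<in> \<Theta>" for \<theta> i
    using meas_X[of i] measurable_cong_sets[OF sets_P[OF that] refl, of \<mu>] by simp
  have p_mass: "(\<integral>\<^sup>+x. ennreal (p \<theta> x) \<partial>\<mu>) = 1" if "\<theta> \<in> \<Theta>" for \<theta>
  proof -
    interpret P: prob_space "P \<theta>" by (rule prob[OF that])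
    have "prob_space (density \<mu> (\<lambda>x. ennreal (p \<theta> x)))"
      using P.prob_space_distr[OF XP[OF that, of 0]] dens_distr[OF that] by simp
    then have "emeasure (density \<mu> (\<lambda>x. ennreal (p \<theta> x))) (space \<mu>) = 1"
      using prob_space.emeasure_space_1 by force
    then show ?thesis using p_meas_enn[OF that] by (subst (asm) emeasure_density) (auto cong: nn_integral_cong)
  qed
  have distr_D: "distr N D (X i) = D" for i
  proof -
    have "distr N D (X i) = distr N \<mu> (X i)" by (rule distr_cong) (auto simp: sets_D)
    also have "\<dots> = D" using ident[OF \<theta>\<^sub>0, of i] dens_distr[OF \<theta>\<^sub>0] by (simp add: N_def D_def)
    finally show ?thesis .
  qed
  have prob_D: "prob_space D"
    using N.prob_space_distr[OF XP[OF \<theta>\<^sub>0, folded N_def, of 0]]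
    unfolding N_def D_def dens_distr[OF \<theta>\<^sub>0] .
  interpret D: prob_space D by (rule prob_D)
  have indep_D: "N.indep_vars (\<lambda>_. D) X UNIV"
    by (rule N.indep_vars_cong_sets[OF indep[OF \<theta>\<^sub>0, folded N_def]]) (rule sets_D)
  let ?J = "{\<theta>\<^sub>0 - \<delta> .. \<theta>\<^sub>0 + \<delta>}"
  let ?l = "\<lambda>k x. loglik_deriv k \<Theta> p x"
  define S where "S = positivity_set \<mu> p \<theta>\<^sub>0"
  have S[measurable]: "S \<in> sets \<mu>"
    unfolding S_def positivity_set_def using p_meas[OF \<theta>\<^sub>0] by measurable
  have SD: "S \<in> sets D" using S sets_D by simp
  have O: "obs_law \<mu> p \<theta>\<^sub>0 = restrict_space D S" by (simp add: obs_law_def D_def S_def)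
  have J: "\<theta> \<in> interior \<Theta>" "\<theta> \<in> \<Theta>" if "\<theta> \<in> ?J" for \<theta> using that \<delta>(2) interior_subset[of \<Theta>] by auto
  have Jabs: "\<theta>\<^sub>0 + t \<in> ?J" if "\<bar>t\<bar> \<le> \<delta>" for t using that by (auto simp: abs_le_iff)
  have J0: "\<theta>\<^sub>0 \<in> ?J" using \<delta>(1) by auto
  have S_pos: "0 < p \<theta> x" "x \<in> space \<mu>" if "x \<in> S" "\<theta> \<in> ?J" for x \<theta>
    using I_pos[OF that(2)] that(1) by (auto simp: S_def positivity_set_def)
  have ld: "((\<lambda>t. ln (p t x)) has_real_derivative ?l 1 x \<theta>) (at \<theta>)"
    "(?l 1 x has_real_derivative ?l 2 x \<theta>) (at \<theta>)"
    "(?l 2 x has_real_derivative ?l 3 x \<theta>) (at \<theta>)" if "x \<in> S" "\<theta> \<in> ?J" for x \<theta>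
    using loglik_derivs[where p = p and x = x and \<theta> = \<theta> and \<Theta> = \<Theta>, OF I_diff S_pos(1)[OF that] J(1)[OF that(2)]] that
    by (auto simp: S_def)
  have m0: "(\<lambda>x. indicator S x * ln (p \<theta> x)) \<in> borel_measurable \<mu>" if "\<theta> \<in> ?J" for \<theta>
    using p_meas[OF J(2)[OF that]] by measurable
  have m1: "(\<lambda>x. indicator S x * ?l 1 x \<theta>) \<in> borel_measurable \<mu>" if "\<theta> \<in> ?J" for \<theta>
    by (rule measurable_parameter_derivative[where g = "\<lambda>x t. ln (p t x)" and \<theta>\<^sub>0 = \<theta>\<^sub>0, OF \<delta>(1) S m0 ld(1) that])
  have m2: "(\<lambda>x. indicator S x * ?l 2 x \<theta>) \<in> borel_measurable \<mu>" if "\<theta> \<in> ?J" for \<theta>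
    by (rule measurable_parameter_derivative[where g = "?l 1" and \<theta>\<^sub>0 = \<theta>\<^sub>0, OF \<delta>(1) S m1 ld(2) that])
  txt \<open>The supremum over all of \<open>?J\<close> need not be measurable, so the Lipschitz constant of the second
    derivative is taken over the rationals.\<close>
  define JQ where "JQ = ?J \<inter> \<rat> - {\<theta>\<^sub>0}"
  have JQ: "countable JQ" "\<And>a. a \<in> JQ \<Longrightarrow> a \<in> ?J \<and> a \<noteq> \<theta>\<^sub>0"
    unfolding JQ_def by (auto intro: countable_subset[OF _ countable_rat])
  \<comment> \<open>The cubed slope of the second derivative between \<theta>0 and \<open>a\<close>;
    the division by \<open>\<bar>a - \<theta>\<^sub>0\<bar>\<close> is the reason for removing
    \<theta>0 from \<open>JQ\<close>.\<close>
  define q where "q a x = indicator S x * (\<bar>?l 2 x a - ?l 2 x \<theta>\<^sub>0\<bar> / \<bar>a - \<theta>\<^sub>0\<bar>) ^ 3" for a x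
  have q_meas: "q a \<in> borel_measurable \<mu>" if "a \<in> JQ" for a
  proof -
    have aJ: "a \<in> ?J" using JQ(2)[OF that] by blast
    have "(\<lambda>x. (\<bar>indicator S x * ?l 2 x a - indicator S x * ?l 2 x \<theta>\<^sub>0\<bar> / \<bar>a - \<theta>\<^sub>0\<bar>) ^ 3) \<in> borel_measurable \<mu>"
      by (intro borel_measurable_power borel_measurable_divide borel_measurable_abs borel_measurable_diff
          m2[OF aJ] m2[OF J0] borel_measurable_const)
    also have "(\<lambda>x. (\<bar>indicator S x * ?l 2 x a - indicator S x * ?l 2 x \<theta>\<^sub>0\<bar> / \<bar>a - \<theta>\<^sub>0\<bar>) ^ 3) = q a"
      by (auto simp: q_def indicator_def fun_eq_iff)
    finally show ?thesis .
  qed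
  define Qs where "Qs x = (SUP a\<in>JQ. ennreal (q a x))" for x
  have Qs_meas[measurable]: "Qs \<in> borel_measurable D"
  proof -
    have "Qs \<in> borel_measurable \<mu>"
      unfolding Qs_def[abs_def] using q_meas by (intro borel_measurable_SUP JQ(1)) auto
    then show ?thesis using measurable_cong_sets[OF sets_D refl, of borel] by simp
  qed
  have q_le: "ennreal (q a x) \<le> (SUP \<theta>\<in>?J. ennreal (\<bar>?l 3 x \<theta>\<bar> ^ 3)) * indicator S x" if a: "a \<in> JQ" for a x
  proof (cases "x \<in> S")
    case True
    \<comment> \<open>By the mean value theorem the slope is a value of the third derivative, whose
      cube is dominated by the supremum in hypothesis \<open>IV\<close>.\<close>
    have "\<exists>z\<in>?J. \<bar>?l 2 x a - ?l 2 x \<theta>\<^sub>0\<bar> = \<bar>a - \<theta>\<^sub>0\<bar> * \<bar>?l 3 x z\<bar>"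
    proof (cases "a < \<theta>\<^sub>0")
      case lt: True
      have "\<exists>z>a. z < \<theta>\<^sub>0 \<and> ?l 2 x \<theta>\<^sub>0 - ?l 2 x a = (\<theta>\<^sub>0 - a) * ?l 3 x z"
        using JQ(2)[OF a] \<delta>(1) by (intro MVT2[OF lt] ld(3)[OF True]) auto
      then obtain z where "z > a" "z < \<theta>\<^sub>0" and z: "?l 2 x \<theta>\<^sub>0 - ?l 2 x a = (\<theta>\<^sub>0 - a) * ?l 3 x z" by blast
      moreover have "\<bar>?l 2 x a - ?l 2 x \<theta>\<^sub>0\<bar> = \<bar>(\<theta>\<^sub>0 - a) * ?l 3 x z\<bar>" unfolding z[symmetric] by (rule abs_minus_commute)
      ultimately show ?thesis using JQ(2)[OF a] \<delta>(1) by (intro bexI[of _ z]) (auto simp: abs_mult abs_minus_commute)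
    next
      case False
      then have lt: "\<theta>\<^sub>0 < a" using JQ(2)[OF a] by simp
      have "\<exists>z>\<theta>\<^sub>0. z < a \<and> ?l 2 x a - ?l 2 x \<theta>\<^sub>0 = (a - \<theta>\<^sub>0) * ?l 3 x z"
        using JQ(2)[OF a] \<delta>(1) by (intro MVT2[OF lt] ld(3)[OF True]) auto
      then obtain z where "z > \<theta>\<^sub>0" "z < a" and z: "?l 2 x a - ?l 2 x \<theta>\<^sub>0 = (a - \<theta>\<^sub>0) * ?l 3 x z" by blast
      then show ?thesis using JQ(2)[OF a] \<delta>(1) unfolding z by (intro bexI[of _ z]) (auto simp: abs_mult)
    qed
    then obtain z where z: "z \<in> ?J" "\<bar>?l 2 x a - ?l 2 x \<theta>\<^sub>0\<bar> = \<bar>a - \<theta>\<^sub>0\<bar> * \<bar>?l 3 x z\<bar>" by blast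
    have "q a x = \<bar>?l 3 x z\<bar> ^ 3" using JQ(2)[OF a] True unfolding q_def z(2) by simp
    then show ?thesis using True z(1) by (auto intro: SUP_upper)
  qed (simp add: q_def)
  have Qs_int: "(\<integral>\<^sup>+x. Qs x \<partial>D) < \<infinity>"
  proof -
    have "(\<integral>\<^sup>+x. Qs x \<partial>D) \<le> (\<integral>\<^sup>+x. (SUP \<theta>\<in>?J. ennreal (\<bar>?l 3 x \<theta>\<bar> ^ 3)) * indicator S x \<partial>D)"
      unfolding Qs_def by (intro nn_integral_mono SUP_least q_le)
    also have "\<dots> < \<infinity>" using IV unfolding O nn_integral_restrict_density[OF SD] .
    finally show ?thesis .
  qed
  \<comment> \<open>\<open>Qs\<close> has a finite integral and is therefore finite almost
    everywhere; on \<open>A\<close> the Lipschitz constant is a genuine real number.\<close>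
  define A where "A = {x \<in> space D. x \<in> S \<and> Qs x \<noteq> \<infinity>}"
  have A[measurable]: "A \<in> sets D" unfolding A_def using SD by measurable
  have AS: "A \<subseteq> S" by (auto simp: A_def)
  have S_AE: "AE x in D. x \<in> S"
    unfolding D_def using p_meas_enn[OF \<theta>\<^sub>0] p_nonneg[OF \<theta>\<^sub>0]
    by (subst AE_density) (auto simp: S_def positivity_set_def)
  have A_AE: "AE x in D. x \<in> A"
    using S_AE nn_integral_PInf_AE[OF Qs_meas] Qs_int AE_space by (auto simp: A_def)
  \<comment> \<open>The indicator of \<open>A\<close> makes these functions measurable on the whole
    space, and the expansion of the score then holds at every x, trivially off
    \<open>A\<close>.\<close>
  define Z where "Z x = indicator A x * ?l 1 x \<theta>\<^sub>0" for x
  define U where "U x = indicator A x * ?l 2 x \<theta>\<^sub>0" for x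
  \<comment> \<open>The cube root of \<open>Qs\<close> is a Lipschitz constant of the second
    derivative at \<theta>0, and its third moment is at most the integral of
    \<open>Qs\<close>.\<close>
  define R where "R x = indicator A x * root 3 (enn2real (Qs x))" for x
  define Y where "Y t x = indicator A x * ?l 1 x (\<theta>\<^sub>0 + t)" for t x
  have meas_D: "f \<in> borel_measurable D \<longleftrightarrow> f \<in> borel_measurable \<mu>" for f :: "'x \<Rightarrow> real"
    using measurable_cong_sets[OF sets_D refl, of "borel :: real measure"] by simp
  have meas_A: "(\<lambda>x. indicator A x * f x) \<in> borel_measurable D"
    if "(\<lambda>x. indicator S x * f x) \<in> borel_measurable \<mu>" for f :: "'x \<Rightarrow> real"
  proof -
    have "(\<lambda>x. indicator A x * (indicator S x * f x)) \<in> borel_measurable D"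
      by (intro borel_measurable_times borel_measurable_indicator A that[folded meas_D])
    also have "(\<lambda>x. indicator A x * (indicator S x * f x)) = (\<lambda>x. indicator A x * f x)"
      using AS by (auto simp: indicator_def fun_eq_iff)
    finally show ?thesis .
  qed
  have Y_meas: "Y t \<in> borel_measurable D" if "\<bar>t\<bar> \<le> \<delta>" for t
    unfolding Y_def by (rule meas_A[OF m1[OF Jabs[OF that]]])
  have Z_meas: "Z \<in> borel_measurable D" unfolding Z_def by (rule meas_A[OF m1[OF J0]])
  have U_meas: "U \<in> borel_measurable D" unfolding U_def by (rule meas_A[OF m2[OF J0]])
  have R_meas: "R \<in> borel_measurable D" unfolding R_def[abs_def] by measurable
  have R0: "0 \<le> R x" for x by (simp add: R_def)
  have lip: "\<bar>?l 2 x a - ?l 2 x \<theta>\<^sub>0\<bar> \<le> R x * \<bar>a - \<theta>\<^sub>0\<bar>" if x: "x \<in> A" and a: "a \<in> ?J" for x a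
  proof -
    have xS: "x \<in> S" using x AS by auto
    have "0 \<le> R x * \<bar>a - \<theta>\<^sub>0\<bar> - \<bar>?l 2 x a - ?l 2 x \<theta>\<^sub>0\<bar>"
    proof (rule continuous_nonneg_on_rationals[OF _ _ _ a])
      show "\<theta>\<^sub>0 - \<delta> < \<theta>\<^sub>0 + \<delta>" using \<delta>(1) by simp
      have "continuous_on ?J (?l 2 x)"
        using DERIV_isCont[OF ld(3)[OF xS]] by (intro continuous_at_imp_continuous_on) auto
      then show "continuous_on ?J (\<lambda>a. R x * \<bar>a - \<theta>\<^sub>0\<bar> - \<bar>?l 2 x a - ?l 2 x \<theta>\<^sub>0\<bar>)" by (intro continuous_intros)
      fix c :: real assume c: "c \<in> \<rat>" "c \<in> ?J"
      show "0 \<le> R x * \<bar>c - \<theta>\<^sub>0\<bar> - \<bar>?l 2 x c - ?l 2 x \<theta>\<^sub>0\<bar>"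
      proof (cases "c = \<theta>\<^sub>0")
        case False
        then have cJ: "c \<in> JQ" using c by (simp add: JQ_def)
        define u where "u = \<bar>?l 2 x c - ?l 2 x \<theta>\<^sub>0\<bar> / \<bar>c - \<theta>\<^sub>0\<bar>"
        have u0: "0 \<le> u" by (simp add: u_def)
        have "ennreal (u ^ 3) \<le> Qs x"
          unfolding Qs_def using SUP_upper[OF cJ, of "\<lambda>a. ennreal (q a x)"] xS by (simp add: q_def u_def)
        also have "Qs x = ennreal (enn2real (Qs x))" using x by (simp add: A_def less_top)
        finally have "u ^ 3 \<le> enn2real (Qs x)" by (simp add: ennreal_le_iff)
        then have "root 3 (u ^ 3) \<le> root 3 (enn2real (Qs x))" by simp
        then have "u \<le> R x" using u0 x by (simp add: R_def real_root_power_cancel)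
        then show ?thesis using False by (simp add: u_def pos_divide_le_eq)
      qed simp
    qed
    then show ?thesis by simp
  qed
  have Y_expand: "\<bar>Y t x - Z x - t * U x\<bar> \<le> R x * t\<^sup>2" if t: "\<bar>t\<bar> \<le> \<delta>" for t x
  proof (cases "x \<in> A")
    case True
    then have xS: "x \<in> S" using AS by auto
    have Jt: "\<theta>\<^sub>0 + s \<in> ?J" if "s \<in> {- \<bar>t\<bar>..\<bar>t\<bar>}" for s using that t by (intro Jabs) auto
    \<comment> \<open>Mean value inequality for the first derivative minus its linear term: by
      \<open>lip\<close>, the derivative of this function is at most
      \<open>R x * \<bar>t\<bar>\<close> between -|t| and |t|.\<close>
    have "norm ((?l 1 x (\<theta>\<^sub>0 + t) - t * ?l 2 x \<theta>\<^sub>0) - (?l 1 x (\<theta>\<^sub>0 + 0) - 0 * ?l 2 x \<theta>\<^sub>0)) \<le> (R x * \<bar>t\<bar>) * norm (t - 0)"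
    proof (rule field_differentiable_bound[where f = "\<lambda>s. ?l 1 x (\<theta>\<^sub>0 + s) - s * ?l 2 x \<theta>\<^sub>0" and S = "{- \<bar>t\<bar>..\<bar>t\<bar>}"
        and f' = "\<lambda>s. ?l 2 x (\<theta>\<^sub>0 + s) - ?l 2 x \<theta>\<^sub>0"])
      show "convex {- \<bar>t\<bar>..\<bar>t\<bar>}" by simp
      fix s assume s: "s \<in> {- \<bar>t\<bar>..\<bar>t\<bar>}"
      have "((\<lambda>s. ?l 1 x (\<theta>\<^sub>0 + s)) has_real_derivative ?l 2 x (\<theta>\<^sub>0 + s) * 1) (at s)"
        by (rule DERIV_chain2[where f = "?l 1 x" and g = "\<lambda>s. \<theta>\<^sub>0 + s", OF ld(2)[OF xS Jt[OF s]]]) (auto intro!: derivative_eq_intros)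
      then have "((\<lambda>s. ?l 1 x (\<theta>\<^sub>0 + s) - s * ?l 2 x \<theta>\<^sub>0) has_real_derivative ?l 2 x (\<theta>\<^sub>0 + s) - ?l 2 x \<theta>\<^sub>0) (at s)"
        by (auto intro!: derivative_eq_intros)
      then show "((\<lambda>s. ?l 1 x (\<theta>\<^sub>0 + s) - s * ?l 2 x \<theta>\<^sub>0) has_field_derivative ?l 2 x (\<theta>\<^sub>0 + s) - ?l 2 x \<theta>\<^sub>0) (at s within {- \<bar>t\<bar>..\<bar>t\<bar>})"
        by (rule has_field_derivative_at_within)
      have "\<bar>?l 2 x (\<theta>\<^sub>0 + s) - ?l 2 x \<theta>\<^sub>0\<bar> \<le> R x * \<bar>s\<bar>" using lip[OF True Jt[OF s]] by simp
      also have "\<dots> \<le> R x * \<bar>t\<bar>" using s R0 by (intro mult_left_mono) auto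
      finally show "norm (?l 2 x (\<theta>\<^sub>0 + s) - ?l 2 x \<theta>\<^sub>0) \<le> R x * \<bar>t\<bar>" by simp
    qed auto
    then show ?thesis using True by (simp add: Y_def Z_def U_def power2_eq_square algebra_simps)
  qed (simp add: Y_def Z_def U_def R_def)
  have nnA: "(\<integral>\<^sup>+x. ennreal (f (indicator A x * g x)) \<partial>D) = (\<integral>\<^sup>+x. ennreal (f (g x)) \<partial>obs_law \<mu> p \<theta>\<^sub>0)"
    for f :: "real \<Rightarrow> real" and g :: "'x \<Rightarrow> real"
    unfolding O nn_integral_restrict_density[OF SD]
    using A_AE AS by (intro nn_integral_cong_AE) (auto elim!: eventually_mono)
  have bochner_A: "D.expectation (\<lambda>x. indicator A x * g x) = c"
    if hb: "has_bochner_integral (obs_law \<mu> p \<theta>\<^sub>0) g c" and gm: "(\<lambda>x. indicator A x * g x) \<in> borel_measurable D"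
      and gS: "(\<lambda>x. indicator S x * g x) \<in> borel_measurable D" for g :: "'x \<Rightarrow> real" and c
  proof -
    have "c = (\<integral>x. g x \<partial>obs_law \<mu> p \<theta>\<^sub>0)" using hb by (simp add: has_bochner_integral_iff)
    also have "\<dots> = (\<integral>x. indicator S x * g x \<partial>D)"
      unfolding O using SD by (subst integral_restrict_space) auto
    also have "\<dots> = (\<integral>x. indicator A x * g x \<partial>D)"
      using A_AE AS by (intro integral_cong_AE gm gS) (auto elim!: eventually_mono)
    finally show ?thesis by simp
  qed
  have III': "(\<integral>\<^sup>+x. ennreal (\<bar>?l 1 x \<theta>\<^sub>0\<bar> ^ 3) \<partial>obs_law \<mu> p \<theta>\<^sub>0) < \<infinity>" "(\<integral>\<^sup>+x. ennreal (\<bar>?l 2 x \<theta>\<^sub>0\<bar> ^ 3) \<partial>obs_law \<mu> p \<theta>\<^sub>0) < \<infinity>"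
    using III by auto
  have cubes: "integrable D (\<lambda>x. \<bar>Z x\<bar> ^ 3)" "integrable D (\<lambda>x. \<bar>U x\<bar> ^ 3)" "integrable D (\<lambda>x. \<bar>R x\<bar> ^ 3)"
  proof -
    have m: "(\<lambda>x. \<bar>f x\<bar> ^ 3) \<in> borel_measurable D" if "f \<in> borel_measurable D" for f :: "'x \<Rightarrow> real"
      using that by measurable
    show "integrable D (\<lambda>x. \<bar>Z x\<bar> ^ 3)"
      using III'(1) nnA[of "\<lambda>y. \<bar>y\<bar> ^ 3" "\<lambda>x. ?l 1 x \<theta>\<^sub>0"]
      by (intro integrableI_nonneg m Z_meas) (simp_all add: Z_def)
    show "integrable D (\<lambda>x. \<bar>U x\<bar> ^ 3)"
      using III'(2) nnA[of "\<lambda>y. \<bar>y\<bar> ^ 3" "\<lambda>x. ?l 2 x \<theta>\<^sub>0"] 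
      by (intro integrableI_nonneg m U_meas) (simp_all add: U_def)
    have "(\<integral>\<^sup>+x. ennreal (\<bar>R x\<bar> ^ 3) \<partial>D) \<le> (\<integral>\<^sup>+x. Qs x \<partial>D)"
    proof (rule nn_integral_mono)
      fix x
      show "ennreal (\<bar>R x\<bar> ^ 3) \<le> Qs x"
      proof (cases "x \<in> A")
        case True
        then have "\<bar>R x\<bar> ^ 3 = enn2real (Qs x)" by (simp add: R_def)
        then show ?thesis using True by (simp add: A_def less_top)
      qed (simp add: R_def)
    qed
    then show "integrable D (\<lambda>x. \<bar>R x\<bar> ^ 3)"
      using Qs_int by (intro integrableI_nonneg m R_meas) (auto intro: le_less_trans)
  qed
  have mean_Z: "D.expectation Z = 0"
    unfolding Z_def[abs_def]
    using Z_meas m1[OF J0] by (intro bochner_A[OF II_mean]) (simp_all add: meas_D Z_def[abs_def])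
  have mean_U: "D.expectation U = - I"
    unfolding U_def[abs_def]
    using U_meas m2[OF J0] by (intro bochner_A[OF II_hess[folded I_def]]) (simp_all add: meas_D U_def[abs_def])
  have var_Z: "D.expectation (\<lambda>x. (Z x)\<^sup>2) = I"
  proof -
    note [measurable] = Z_meas
    have "D.expectation (\<lambda>x. (Z x)\<^sup>2) = enn2real (\<integral>\<^sup>+x. ennreal ((Z x)\<^sup>2) \<partial>D)"
      by (rule integral_eq_nn_integral) auto
    also have "(\<integral>\<^sup>+x. ennreal ((Z x)\<^sup>2) \<partial>D) = fisher_info \<mu> \<Theta> p \<theta>\<^sub>0"
      using nnA[of "\<lambda>y. y\<^sup>2" "\<lambda>x. ?l 1 x \<theta>\<^sub>0"] II_var by (simp add: Z_def)
    finally show ?thesis by (simp add: I_def)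
  qed
  interpret mle_model N D X Z U R Y \<delta> I \<Theta> p \<theta>\<^sub>0 A "\<lambda>t x. ?l 2 x (\<theta>\<^sub>0 + t)"
  proof
    show "N.indep_vars (\<lambda>_. D) X UNIV" by (rule indep_D)
    show "distr N D (X i) = D" for i by (rule distr_D)
    show "0 < \<delta>" by (rule \<delta>(1))
    show "0 < I" by (rule I(1))
    show "Z \<in> borel_measurable D" "U \<in> borel_measurable D" "R \<in> borel_measurable D" by (rule Z_meas U_meas R_meas)+
    show "Y t \<in> borel_measurable D" if "\<bar>t\<bar> \<le> \<delta>" for t by (rule Y_meas[OF that])
    show "\<bar>Y t x - Z x - t * U x\<bar> \<le> R x * t\<^sup>2" if "\<bar>t\<bar> \<le> \<delta>" for t x by (rule Y_expand[OF that])
    show "integrable D (\<lambda>x. \<bar>Z x\<bar> ^ 3)" "integrable D (\<lambda>x. \<bar>U x\<bar> ^ 3)" "integrable D (\<lambda>x. \<bar>R x\<bar> ^ 3)" by (rule cubes)+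
    show "D.expectation Z = 0" "D.expectation (\<lambda>x. (Z x)\<^sup>2) = I" "D.expectation U = - I" by (rule mean_Z var_Z mean_U)+
    show "A \<in> sets D" by (rule A)
    show "AE x in D. x \<in> A" by (rule A_AE)
    show "0 \<le> p \<theta> x" if "\<theta> \<in> \<Theta>" "x \<in> space D" for \<theta> x using p_nonneg that by (simp add: space_D)
    show "?J \<subseteq> interior \<Theta>" by (rule \<delta>(2))
    fix x t assume xt: "x \<in> A" "\<bar>t\<bar> \<le> \<delta>"
    then have xS: "x \<in> S" using AS by auto
    show "0 < p (\<theta>\<^sub>0 + t) x" by (rule S_pos(1)[OF xS Jabs[OF xt(2)]])
    have "((\<lambda>t. ln (p (\<theta>\<^sub>0 + t) x)) has_real_derivative ?l 1 x (\<theta>\<^sub>0 + t) * 1) (at t)"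
      by (rule DERIV_chain2[where f = "\<lambda>t. ln (p t x)" and g = "\<lambda>s. \<theta>\<^sub>0 + s", OF ld(1)[OF xS Jabs[OF xt(2)]]]) (auto intro!: derivative_eq_intros)
    then show "((\<lambda>t. ln (p (\<theta>\<^sub>0 + t) x)) has_real_derivative Y t x) (at t)" using xt by (simp add: Y_def)
    have "((\<lambda>t. ?l 1 x (\<theta>\<^sub>0 + t)) has_real_derivative ?l 2 x (\<theta>\<^sub>0 + t) * 1) (at t)"
      by (rule DERIV_chain2[where f = "?l 1 x" and g = "\<lambda>s. \<theta>\<^sub>0 + s", OF ld(2)[OF xS Jabs[OF xt(2)]]]) (auto intro!: derivative_eq_intros)
    then show "((\<lambda>t. Y t x) has_real_derivative ?l 2 x (\<theta>\<^sub>0 + t)) (at t)" using xt by (simp add: Y_def)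
    show "?l 2 x (\<theta>\<^sub>0 + t) \<le> U x + \<bar>t\<bar> * R x"
      using lip[OF xt(1) Jabs[OF xt(2)]] xt by (simp add: U_def abs_le_iff mult.commute)
  qed
  define T where "T n w = \<theta>hat n (\<lambda>i\<in>{1..n}. X i w)" for n w
  have gm: "generalized_maximizer \<Theta> (likelihood p n (\<lambda>i. X i w)) (T n w)" if n: "1 \<le> n" and w: "w \<in> space N" for n w
  proof -
    have "(\<lambda>i\<in>{1..n}. X i w) \<in> {1..n} \<rightarrow>\<^sub>E space \<mu>"
      using measurable_space[OF meas_X] w space_N by auto
    then have "generalized_maximizer \<Theta> (likelihood p n (\<lambda>i\<in>{1..n}. X i w)) (T n w)"
      using MLE[OF n] unfolding is_MLE_def T_def by blast
    moreover have "likelihood p n (\<lambda>i\<in>{1..n}. X i w) = likelihood p n (\<lambda>i. X i w)"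
      unfolding likelihood_def by (intro ext prod.cong) auto
    ultimately show ?thesis by simp
  qed
  \<comment> \<open>The only place where the two alternatives are distinguished; all that follows
    uses their common conclusion.\<close>
  have far: "far_controlled d" if d: "0 < d" "d \<le> \<delta>" for d
    using alternatives
  proof
    assume "\<forall>x\<in>space \<mu>. ereal_concave_on \<Theta> (loglik p x)"
    then show ?thesis using d by (intro far_controlled_concave) (auto simp: space_D)
  next
    assume alt: "is_interval \<Theta> \<and> fisher_info_well_defined \<mu> \<Theta> p \<and>
        (\<exists>c\<^sub>1>0. \<exists>c\<^sub>2>0. \<exists>\<alpha>>0. \<forall>\<theta>\<in>\<Theta>.
           fisher_info \<mu> \<Theta> p \<theta> \<le> ennreal (c\<^sub>1 + c\<^sub>2 * \<bar>\<theta> - \<theta>\<^sub>0\<bar> powr \<alpha>)) \<and>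
        (\<forall>U. bounded U \<and> \<theta>\<^sub>0 \<in> interior U \<longrightarrow>
           (\<exists>c>0. \<forall>\<theta>\<in>U \<inter> \<Theta>. hellinger_sq \<mu> p \<theta> \<theta>\<^sub>0 \<ge> c * (\<theta> - \<theta>\<^sub>0)\<^sup>2)) \<and>
        (\<exists>\<gamma>>0. \<exists>V. bounded V \<and> \<theta>\<^sub>0 \<in> interior V \<and>
           (\<exists>C>0. \<forall>\<theta>\<in>\<Theta> - V.
              (\<integral>x. sqrt (p \<theta> x) * sqrt (p \<theta>\<^sub>0 x) \<partial>\<mu>) \<le> C * \<bar>\<theta> - \<theta>\<^sub>0\<bar> powr (- \<gamma>)))"
    note alt_int = alt[THEN conjunct1] and alt_wd = alt[THEN conjunct2, THEN conjunct1]
      and alt_B = alt[THEN conjunct2, THEN conjunct2, THEN conjunct1]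
      and alt_D0 = alt[THEN conjunct2, THEN conjunct2, THEN conjunct2, THEN conjunct1]
      and alt_D1 = alt[THEN conjunct2, THEN conjunct2, THEN conjunct2, THEN conjunct2]
    interpret hellinger_model N D X Z U R Y \<delta> I \<Theta> p \<theta>\<^sub>0 A "\<lambda>t x. ?l 2 x (\<theta>\<^sub>0 + t)" \<mu>
      by unfold_locales (fact D_def p_meas p_mass alt_int alt_wd)+
    obtain c1 c2 \<alpha> where c: "0 < c1" "0 < c2" "0 < \<alpha>"
      "\<And>\<theta>. \<theta> \<in> \<Theta> \<Longrightarrow> fisher_info \<mu> \<Theta> p \<theta> \<le> ennreal (c1 + c2 * \<bar>\<theta> - \<theta>\<^sub>0\<bar> powr \<alpha>)" using alt_B by blast
    obtain \<gamma> V C where D1: "0 < \<gamma>" "bounded V" "0 < C"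
      "\<And>\<theta>. \<theta> \<in> \<Theta> - V \<Longrightarrow> affinity \<theta> \<le> C * \<bar>\<theta> - \<theta>\<^sub>0\<bar> powr (- \<gamma>)"
      using alt_D1 unfolding affinity_def by blast
    have D0: "\<exists>c>0. \<forall>\<theta>\<in>U \<inter> \<Theta>. c * (\<theta> - \<theta>\<^sub>0)\<^sup>2 \<le> hellinger_sq \<mu> p \<theta> \<theta>\<^sub>0" if "bounded U" "\<theta>\<^sub>0 \<in> interior U" for U
      using alt_D0 that by blast
    show ?thesis by (rule far_controlled_hellinger[OF d(1) c D0 D1])
  qed
  have loc: "\<exists>d C. 0 < d \<and> d \<le> \<delta>1 \<and> localises T \<theta>\<^sub>0 d C" if \<delta>1: "0 < \<delta>1" "\<delta>1 \<le> \<delta>" for \<delta>1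
  proof -
    \<comment> \<open>Small enough for 4 d (r + 1) \<le> I, where r is the mean of \<open>R\<close>;
      this makes the summed second derivative negative on the whole interval of radius d.\<close>
    define d where "d = min \<delta>1 (I / (4 * (D.expectation R + 1)))"
    have r: "0 < D.expectation R + 1" using R_mean_nonneg by simp
    have d: "0 < d" "d \<le> \<delta>1" "d \<le> \<delta>" using \<delta>1 I(1) r by (auto simp: d_def)
    have "d * (D.expectation R + 1) \<le> I / (4 * (D.expectation R + 1)) * (D.expectation R + 1)"
      using r by (intro mult_right_mono) (auto simp: d_def)
    also have "\<dots> = I / 4" using r by (simp add: field_simps)
    finally have "4 * (d * (D.expectation R + 1)) \<le> I" by simp
    from localisesI[OF d(1,3) this far[OF d(1,3)], of T] gm show ?thesis using d by blast
  qed
  obtain C where C: "0 < C"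
    "\<And>Q n z. Q \<in> {outer_measure_of N, inner_measure_of N} \<Longrightarrow> 1 \<le> n \<Longrightarrow>
    \<bar>enn2real (Q {w \<in> space N. ereal (sqrt (real n * I)) * (T n w - ereal \<theta>\<^sub>0) \<le> ereal z})
      - cdf std_normal_distribution z\<bar> \<le> C / (sqrt (real n) * (1 + \<bar>z\<bar>) ^ 3) + C / (real n)\<^sup>2"
  proof (rule estimator_comparison)
    show "\<exists>d C. 0 < d \<and> d \<le> \<delta>1 \<and> localises T \<theta>\<^sub>0 d C" if "0 < \<delta>1" "\<delta>1 \<le> \<delta>" for \<delta>1
      by (rule loc[OF that])
  qed (rule that)
  have E: "{w \<in> space N. ereal (sqrt (real n * I)) * (T n w - ereal \<theta>\<^sub>0) \<le> ereal z} = E n z" for n z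
    by (simp add: E_def T_def I_def space_N)
  show ?thesis
    unfolding N_def[symmetric]
  proof (intro ballI conjI)
    fix Q :: "'w set \<Rightarrow> ennreal" assume Q: "Q \<in> {outer_measure_of N, inner_measure_of N}"
    note rates = combined_bound_imp_rates[OF C(1), of "\<lambda>n z. \<bar>enn2real (Q (E n z)) - cdf std_normal_distribution z\<bar>", OF C(2)[OF Q, unfolded E]]
    show "\<exists>C>0. \<forall>n\<ge>1. \<forall>z. \<bar>enn2real (Q (E n z)) - cdf std_normal_distribution z\<bar> \<le> C / sqrt (real n)"
      by (rule rates(1))
    show "\<forall>\<omega>>0. \<exists>C>0. \<forall>n\<ge>1. \<forall>z. 0 < z \<and> z \<le> \<omega> * sqrt (real n) \<longrightarrow>
         \<bar>enn2real (Q (E n z)) - cdf std_normal_distribution z\<bar> \<le> C / (z ^ 3 * sqrt (real n))"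
      by (rule rates(2))
  qed
qed

end
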